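(* Suppose that for each $\epsilon\in(0,1)$ the random variables $\{\xi^{(\epsilon)}(x)\colon x\in D_\epsilon\}$ are independent, that there is $K>\max\{1,d/2\}$ with $$\sup_{\epsilon\in(0,1)}\max_{x\in D_\epsilon}\mathbb E\bigl(|\xi^{(\epsilon)}(x)|^K\bigr)<\infty,$$ and that there is a bounded continuous function $U\colon D\to\mathbb R$ with $\mathbb E\,\xi^{(\epsilon)}(x)=U(\epsilon x)$ for all $x\in D_\epsilon$ and all $\epsilon$. Then for each $k\in\mathbb N$, $$\lambda^{(k)}_{D_\epsilon,\xi^{(\epsilon)}}\longrightarrow\lambda^{(k)}_D\quad\text{in probability as }\epsilon\downarrow0 .$$
   Context: Let $d\ge1$ and let $D\subset\mathbb R^d$ be a nonempty bounded open set whose boundary is $C^{1,\alpha}$ for some $\alpha>0$. For $\epsilon>0$ let $D_\epsilon:=\{x\in\mathbb Z^d\colon \mathrm{dist}_\infty(\epsilon x,\mathbb R^d\setminus D)>\epsilon\}$, where $\mathrm{dist}_\infty$ is the $\ell^\infty$-distance. For $\xi\colon D_\epsilon\to\mathbb R$, $H_{D_\epsilon,\xi}$ is the symmetric matrix acting on functions $f\colon\mathbb Z^d\to\mathbb R$ vanishing outside $D_\epsilon$ by $$(H_{D_\epsilon,\xi}f)(x)=-\epsilon^{-2}\sum_{y\in\mathbb Z^d\colon|x-y|=1}[f(y)-f(x)]+\xi(x)f(x),\qquad x\in D_\epsilon,$$ and $\lambda^{(1)}_{D_\epsilon,\xi}\le\lambda^{(2)}_{D_\epsilon,\xi}\le\cdots$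 are its eigenvalues counted with multiplicity. The random potentials $\xi^{(\epsilon)}$ are defined on a probability space $(\Omega,\mathcal F,\mathbb P)$ with expectation $\mathbb E$; their law may depend on $\epsilon$. $H_{D,U}:=-\Delta+U(x)$ is the self-adjoint operator on $L^2(D)$ with Dirichlet boundary conditions (form domain $H^1_0(D)$); it has compact resolvent, and $\lambda^{(k)}_D$ denotes its $k$-th smallest eigenvalue counted with multiplicity. *)

theory Defs
  imports "HOL-Probability.Probability" "HOL-Library.Extended_Nat"
begin

section \<open>Domains with Hoelder-differentiable boundary\<close>

text \<open>
  Near each boundary point, in suitable rotated coordinates, \<open>D\<close> is the part of a ball lying
  strictly above the graph of a \<open>C\<^sup>1\<close> function with \<open>\<alpha>\<close>-Hoelder gradient.
  Here \<open>n\<close> is the "vertical" unit vector, and the graph function is evaluated only on the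
  hyperplane orthogonal to \<open>n\<close>. That it is given, with a global Hoelder constant, on all of
  the space is no restriction, by a cut-off and by making it constant along \<open>n\<close>.
\<close>

definition C1_Holder_boundary :: "real \<Rightarrow> (real ^ 'd::finite) set \<Rightarrow> bool" where
  "C1_Holder_boundary \<alpha> D \<longleftrightarrow>
     (\<forall>p\<in>frontier D. \<exists>r>0. \<exists>n. norm n = 1 \<and>
        (\<exists>(\<gamma> :: real ^ 'd \<Rightarrow> real) g C.
           (\<forall>x. GDERIV \<gamma> x :> g x) \<and>
           (\<forall>x y. norm (g x - g y) \<le> C * norm (x - y) powr \<alpha>) \<and>
           D \<inter> ball p r = {x \<in> ball p r. \<gamma> (x - (x \<bullet> n) *\<^sub>R n) < x \<bullet> n}))"

section \<open>Eigenvalues counted with multiplicity\<close>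

text \<open>
  Dimension of the quotient of the linear space \<open>E\<close> by its intersection with the linear
  space \<open>N\<close>: the largest size of a finite family in \<open>E\<close> that is linearly independent modulo
  \<open>N\<close>. This avoids forming quotient types: \<open>N\<close> consists of the functions vanishing almost
  everywhere on the domain for \<open>L\<^sup>2\<close>, and only of the zero function for the lattice operator.
\<close>

definition dim_modulo :: "('a \<Rightarrow> real) set \<Rightarrow> ('a \<Rightarrow> real) set \<Rightarrow> enat" where
  "dim_modulo N E =
     Sup {enat n | n. \<exists>\<phi>. (\<forall>i<n. \<phi> i \<in> E) \<and>
        (\<forall>c::nat \<Rightarrow> real. (\<lambda>x. \<Sum>i<n. c i * \<phi> i x) \<in> N \<longrightarrow> (\<forall>i<n. c i = 0))}"

text \<open>
  \<open>m \<nu>\<close> is the multiplicity of \<open>\<nu>\<close> as an eigenvalue, zero if \<open>\<nu>\<close> is not an eigenvalue.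
\<close>

definition eigenvalue_count :: "(real \<Rightarrow> enat) \<Rightarrow> real \<Rightarrow> enat" where
  "eigenvalue_count m \<mu> = Sup {\<Sum>\<nu>\<in>F. m \<nu> | F. finite F \<and> F \<subseteq> {..\<mu>}}"

text \<open>The numbering of eigenvalues starts with \<open>k = 1\<close>.\<close>

definition kth_eigenvalue :: "(real \<Rightarrow> enat) \<Rightarrow> nat \<Rightarrow> real" where
  "kth_eigenvalue m k = (LEAST \<mu>. enat k \<le> eigenvalue_count m \<mu>)"

section \<open>The lattice operator\<close>

definition lattice_point :: "int ^ 'd \<Rightarrow> real ^ 'd::finite" where
  "lattice_point x = (\<chi> i. real_of_int (x $ i))"

definition dist_inf :: "real ^ 'd::finite \<Rightarrow> (real ^ 'd) set \<Rightarrow> real" where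
  "dist_inf x S = (INF y\<in>S. infnorm (x - y))"

definition lattice_domain :: "(real ^ 'd::finite) set \<Rightarrow> real \<Rightarrow> (int ^ 'd) set" where
  "lattice_domain D \<epsilon> = {x. dist_inf (\<epsilon> *\<^sub>R lattice_point x) (- D) > \<epsilon>}"

definition lattice_op ::
  "real \<Rightarrow> (int ^ 'd::finite \<Rightarrow> real) \<Rightarrow> (int ^ 'd \<Rightarrow> real) \<Rightarrow> int ^ 'd \<Rightarrow> real" where
  "lattice_op \<epsilon> \<xi> f x =
     - (1 / \<epsilon>\<^sup>2) * (\<Sum>y | norm (lattice_point x - lattice_point y) = 1. f y - f x) + \<xi> x * f x"

definition lattice_eigenspace ::
  "(real ^ 'd::finite) set \<Rightarrow> real \<Rightarrow> (int ^ 'd \<Rightarrow> real) \<Rightarrow> real \<Rightarrow> (int ^ 'd \<Rightarrow> real) set" where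
  "lattice_eigenspace D \<epsilon> \<xi> \<nu> =
     {f. (\<forall>x. x \<notin> lattice_domain D \<epsilon> \<longrightarrow> f x = 0) \<and>
         (\<forall>x\<in>lattice_domain D \<epsilon>. lattice_op \<epsilon> \<xi> f x = \<nu> * f x)}"

definition lattice_eigenvalue ::
  "(real ^ 'd::finite) set \<Rightarrow> real \<Rightarrow> (int ^ 'd \<Rightarrow> real) \<Rightarrow> nat \<Rightarrow> real" where
  "lattice_eigenvalue D \<epsilon> \<xi> k =
     kth_eigenvalue (\<lambda>\<nu>. dim_modulo {\<lambda>_. 0} (lattice_eigenspace D \<epsilon> \<xi> \<nu>)) k"

section \<open>Sobolev spaces and the Dirichlet operator\<close>

text \<open>
  Elements of function spaces over \<open>D\<close> are represented by functions on the whole space whose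
  values outside \<open>D\<close> are irrelevant.
\<close>

primrec Ck :: "nat \<Rightarrow> (real ^ 'd::finite \<Rightarrow> real) \<Rightarrow> bool" where
  "Ck 0 f \<longleftrightarrow> continuous_on UNIV f"
| "Ck (Suc n) f \<longleftrightarrow> (\<exists>g. (\<forall>x. GDERIV f x :> g x) \<and> (\<forall>i. Ck n (\<lambda>x. g x $ i)))"

definition test_function :: "(real ^ 'd::finite) set \<Rightarrow> (real ^ 'd \<Rightarrow> real) \<Rightarrow> bool" where
  "test_function D \<phi> \<longleftrightarrow> (\<forall>n. Ck n \<phi>) \<and>
     compact (closure {x. \<phi> x \<noteq> 0}) \<and> closure {x. \<phi> x \<noteq> 0} \<subseteq> D"

definition grad :: "(real ^ 'd::finite \<Rightarrow> real) \<Rightarrow> real ^ 'd \<Rightarrow> real ^ 'd" where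
  "grad f x = (THE g. GDERIV f x :> g)"

definition L2_on :: "(real ^ 'd::finite) set \<Rightarrow> (real ^ 'd \<Rightarrow> 'b::euclidean_space) \<Rightarrow> bool" where
  "L2_on D f \<longleftrightarrow> f \<in> borel_measurable (lebesgue_on D) \<and>
     integrable (lebesgue_on D) (\<lambda>x. (norm (f x))\<^sup>2)"

text \<open>\<open>u\<close> belongs to \<open>H\<^sup>1(D)\<close> and \<open>G\<close> is a version of its weak gradient.\<close>

definition H1_grad ::
  "(real ^ 'd::finite) set \<Rightarrow> (real ^ 'd \<Rightarrow> real) \<Rightarrow> (real ^ 'd \<Rightarrow> real ^ 'd) \<Rightarrow> bool" where
  "H1_grad D u G \<longleftrightarrow> L2_on D u \<and> L2_on D G \<and>
     (\<forall>\<phi>. test_function D \<phi> \<longrightarrow>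
        (\<integral>x. u x *\<^sub>R grad \<phi> x \<partial>lebesgue_on D) = - (\<integral>x. \<phi> x *\<^sub>R G x \<partial>lebesgue_on D))"

text \<open>
  The same for \<open>H\<^sup>1\<^sub>0(D)\<close>, the closure of the test functions in the norm of \<open>H\<^sup>1(D)\<close>.
\<close>

definition H10_grad ::
  "(real ^ 'd::finite) set \<Rightarrow> (real ^ 'd \<Rightarrow> real) \<Rightarrow> (real ^ 'd \<Rightarrow> real ^ 'd) \<Rightarrow> bool" where
  "H10_grad D u G \<longleftrightarrow> H1_grad D u G \<and>
     (\<exists>\<phi>. (\<forall>n. test_function D (\<phi> n)) \<and>
        (\<lambda>n. (\<integral>x. (\<phi> n x - u x)\<^sup>2 \<partial>lebesgue_on D) +
              (\<integral>x. (norm (grad (\<phi> n) x - G x))\<^sup>2 \<partial>lebesgue_on D)) \<longlonglongrightarrow> 0)"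

text \<open>
  The graph of the self-adjoint operator \<open>-\<Delta> + U\<close> on \<open>L\<^sup>2(D)\<close> associated with the quadratic
  form \<open>\<integral> |\<nabla>u|\<^sup>2 + U u\<^sup>2\<close> with form domain \<open>H\<^sup>1\<^sub>0(D)\<close>: \<open>u\<close> is in the operator domain and is
  mapped to \<open>f\<close> iff \<open>u\<close> is in the form domain and the form of \<open>u\<close> and \<open>v\<close> is the inner product
  of \<open>f\<close> and \<open>v\<close>, for each \<open>v\<close> in the form domain.
\<close>

definition dirichlet_op ::
  "(real ^ 'd::finite) set \<Rightarrow> (real ^ 'd \<Rightarrow> real) \<Rightarrow> (real ^ 'd \<Rightarrow> real) \<Rightarrow> (real ^ 'd \<Rightarrow> real) \<Rightarrow> bool"
  where
  "dirichlet_op D U u f \<longleftrightarrow> L2_on D f \<and>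
     (\<exists>G. H10_grad D u G \<and>
        (\<forall>v V. H10_grad D v V \<longrightarrow>
           (\<integral>x. G x \<bullet> V x + U x * u x * v x \<partial>lebesgue_on D) = (\<integral>x. f x * v x \<partial>lebesgue_on D)))"

definition dirichlet_eigenvalue ::
  "(real ^ 'd::finite) set \<Rightarrow> (real ^ 'd \<Rightarrow> real) \<Rightarrow> nat \<Rightarrow> real" where
  "dirichlet_eigenvalue D U k =
     kth_eigenvalue
       (\<lambda>\<nu>. dim_modulo {f. AE x in lebesgue_on D. f x = 0} {u. dirichlet_op D U u (\<lambda>x. \<nu> * u x)}) k"

section \<open>Convergence in probability\<close>

text \<open>
  Measurability is part of the notion, since \<^const>\<open>measure\<close> is zero on non-measurable sets.
\<close>

definition tendsto_in_prob ::
  "'w measure \<Rightarrow> ('i \<Rightarrow> 'w \<Rightarrow> real) \<Rightarrow> real \<Rightarrow> 'i filter \<Rightarrow> bool" where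
  "tendsto_in_prob M X l F \<longleftrightarrow>
     (\<forall>\<^sub>F i in F. X i \<in> borel_measurable M) \<and>
     (\<forall>\<delta>>0. ((\<lambda>i. measure M {\<omega> \<in> space M. \<bar>X i \<omega> - l\<bar> > \<delta>}) \<longlongrightarrow> 0) F)"

end

theory Submission
  imports Defs "HOL-Library.Diagonal_Subsequence"
begin

text \<open>
  Both operators are compared through their quadratic forms, and the \<open>k\<close>-th eigenvalues through
  the min-max principle.

  Averaging over dyadic cubes shows that a potential \<open>\<eta>\<close> with bounded \<open>K\<close>-th moments, where
  \<open>K > max 1 (d / 2)\<close>, whose mean over each cell of a fixed mesoscopic grid is small, satisfies
  \<open>\<bar>\<epsilon>\<^sup>d \<Sum> \<eta> f\<^sup>2\<bar> \<le> \<delta> (energy f + mass f)\<close> for all lattice functions \<open>f\<close>. By a truncated weak law of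
  large numbers on each of the finitely many cells, the fluctuation of \<open>\<xi>\<close> has this property with
  probability tending to one, so that \<open>\<xi>\<close> may be replaced by a local average of \<open>U\<close>.

  For the deterministic potential, test functions approximating the first \<open>k\<close> eigenfunctions of the
  Dirichlet operator are sampled on the lattice, which bounds the lattice eigenvalue from above.
  Conversely, lattice functions are interpolated by smooth kernels that reach only slightly farther
  than \<open>\<epsilon>\<close>. The strict inequality in the definition of the lattice domain leaves room to make the
  interpolant a test function on \<open>D\<close>, and by Jensen's inequality the interpolation does not increase
  the Dirichlet energy.
\<close>

section \<open>Compact quadratic forms and their eigenvalues\<close>

text \<open>The potentials are not bounded uniformly in the mesh, so only a bound relative to energy
  and mass is available. Its exponent comes from counting scales: at box side \<open>L\<close> a
  dyadic increment of \<open>f\<close> costs \<open>L^2\<close> times the Dirichlet sum, while a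
  \<open>K\<close>-th moment limits the box average of the weight to order \<open>L\<close> to the
  power \<open>- d / K\<close>. The product has exponent \<open>2 * \<theta>\<close> with
  \<open>\<theta> = 1 - d / (2 * K)\<close>, positive since \<open>K > d / 2\<close>; the sum over
  scales is then dominated by the coarsest one, where it can be made small. \<open>K > 1\<close>
  makes the truncation remainder vanish. \<open>U\<close> is averaged with the interpolation weights
  themselves: the lattice potential term is then the integral of \<open>U\<close> against the
  interpolated squares, which differs from that of the squared interpolant by a variance of order
  \<open>eps^2\<close> times the energy. Randomness enters only through \<open>form_close\<close>,
  whose threshold is deterministic. Both spectra are treated in one abstract locale, in which an
  element of the Sobolev space is a function paired with its weak gradient and the mass form may
  vanish on nonzero elements.\<close>

text \<open>Gaussian elimination on the last equation. This is the dimension count of the min-max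
  arguments: more trial vectors than constraints leave a nontrivial combination.\<close>

lemma homogeneous_system_solution:
 fixes A :: "nat => nat => real"
 assumes "n < k"
 shows "\<exists>c. (\<exists>j<k. c j ~= 0) \<and> (\<forall>i<n. (\<Sum>j<k. A i j * c j) = 0)"
 using assms
proof (induction n arbitrary: k A)
 case 0
 then show ?case by (intro exI[of _ "%_. 1"]) auto
next
 case (Suc n)
 show ?case
 proof (cases "\<forall>j<k. A n j = 0")
  case True
  obtain c where c: "\<exists>j<k. c j ~= 0" "\<forall>i<n. (\<Sum>j<k. A i j * c j) = 0"
   using Suc.IH[of k A] Suc.prems by auto
  have "(\<Sum>j<k. A n j * c j) = 0" using True by (intro sum.neutral) auto
  then show ?thesis using c by (intro exI[of _ c]) (auto simp: less_Suc_eq)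
 next
  case False
  then obtain p where p: "p < k" "A n p ~= 0" by auto
  \<comment> \<open>\<open>\<sigma>\<close> enumerates the unknowns other than the pivot
    \<open>p\<close>; \<open>A'\<close> below is the system reduced by row \<open>n\<close>.\<close>
  define \<sigma> where "\<sigma> j = (if j < p then j else Suc j)" for j
  have bij: "bij_betw \<sigma> {..<k-1} ({..<k} - {p})"
  proof (rule bij_betwI[where g="%j. if j < p then j else j - 1"])
   show "\<sigma> \<in> {..<k-1} \<rightarrow> {..<k} - {p}"
    by (auto simp: \<sigma>_def split: if_splits)
   show "(%j. if j < p then j else j - 1) \<in> {..<k} - {p} \<rightarrow> {..<k-1}" using p by (auto split: if_splits)
   show "(if \<sigma> j < p then \<sigma> j else \<sigma> j - 1) = j" for j by (simp add: \<sigma>_def)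
   show "\<sigma> (if j < p then j else j - 1) = j" if "j \<in> {..<k} - {p}" for j
    using that by (auto simp: \<sigma>_def)
  qed
  define A' where "A' i j = A i (\<sigma> j) - A i p * A n (\<sigma> j) / A n p" for i j
  obtain c where c: "\<exists>j<k-1. c j ~= 0" "\<forall>i<n. (\<Sum>j<k-1. A' i j * c j) = 0"
   using Suc.IH[of "k-1" A'] Suc.prems by (auto simp: less_diff_conv)
  define d0 where "d0 j = c (if j < p then j else j - 1)" for j
  have d0\<sigma>: "d0 (\<sigma> j) = c j" for j by (simp add: d0_def \<sigma>_def)
  have \<sigma>p: "\<sigma> j ~= p" for j by (simp add: \<sigma>_def)
  define s where "s = (\<Sum>j<k-1. A n (\<sigma> j) * c j)"
  \<comment> \<open>Back substitution: the pivot unknown is forced by equation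
    \<open>n\<close>.\<close>
  define d where "d j = (if j = p then - s / A n p else d0 j)" for j
  have sum: "(\<Sum>j<k. A i j * d j) = (\<Sum>j<k-1. A i (\<sigma> j) * c j) - A i p * s / A n p" for i
  proof -
   have "(\<Sum>j<k. A i j * d j) = A i p * d p + (\<Sum>j\<in>{..<k}-{p}. A i j * d j)"
    using p by (subst sum.remove[of _ p]) auto
   also have "(\<Sum>j\<in>{..<k}-{p}. A i j * d j) = (\<Sum>j<k-1. A i (\<sigma> j) * d (\<sigma> j))"
    by (rule sum.reindex_bij_betw[OF bij, symmetric])
   also have "... = (\<Sum>j<k-1. A i (\<sigma> j) * c j)"
    by (intro sum.cong refl) (simp add: d_def d0\<sigma> \<sigma>p)
   finally show ?thesis by (simp add: d_def)
  qed
  have "(\<Sum>j<k. A i j * d j) = 0" if "i < Suc n" for i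
  proof (cases "i = n")
   case True
   then show ?thesis using p by (simp add: sum s_def)
  next
   case False
   then have "(\<Sum>j<k-1. A' i j * c j) = 0" using that c by auto
   then have "(\<Sum>j<k-1. A i (\<sigma> j) * c j) - A i p * s / A n p = 0"
    by (simp add: A'_def s_def sum_distrib_left sum_subtractf left_diff_distrib
      sum_divide_distrib mult.assoc)
   then show ?thesis by (simp add: sum)
  qed
  moreover have "\<exists>j<k. d j ~= 0"
  proof -
   obtain j where j: "j < k-1" "c j ~= 0" using c by auto
   then have "\<sigma> j < k" "\<sigma> j ~= p" by (auto simp: \<sigma>_def)
   moreover have "d (\<sigma> j) ~= 0" using j \<open>\<sigma> j ~= p\<close> d0\<sigma> by (simp add: d_def)
   ultimately show ?thesis by blast
  qed
  ultimately show ?thesis by blast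
 qed
qed

text \<open>The case \<open>A = 0\<close> forces \<open>B = 0\<close>, which yields the
  Euler-Lagrange equation of a minimizer; the general case yields Cauchy-Schwarz for forms and for
  square-integrable functions.\<close>

lemma quadratic_psd_discriminant:
 fixes A B C :: real
 assumes "!!s t. 0 \<le> s\<^sup>2 * A + 2 * s * t * B + t\<^sup>2 * C"
 shows "B\<^sup>2 \<le> A * C"
proof (cases "C = 0")
 case True
 have "B = 0"
 proof (rule ccontr)
  assume "B ~= 0"
  \<comment> \<open>At this point the form takes the value \<open>A - (A + 1) = -1\<close>.\<close>
  then show False using assms[of 1 "- (A + 1) / (2 * B)"] True by (simp add: field_simps)
 qed
 then show ?thesis using True by simp
next
 case False
 then have C: "C > 0" using assms[of 0 1] by auto
 have "0 \<le> C * (C * A - B\<^sup>2)"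
  using assms[of C "- B"] by (simp add: power2_eq_square algebra_simps)
 then show ?thesis using C by (simp add: zero_le_mult_iff mult.commute)
qed

text \<open>Values lie in a vector space rather than in the reals because elements of the Sobolev
  space are represented as pairs of a function and its weak gradient.\<close>

locale linear_function_space =
 fixes W :: "('x => 'b::real_vector) set"
 assumes W_ne: "W ~= {}"
  and W_lin: "u \<in> W ==> v \<in> W ==> (%x. s *\<^sub>R u x + t *\<^sub>R v x) \<in> W"
begin

lemma zero_in: "(%x. 0) \<in> W"
proof -
 obtain u where "u \<in> W" using W_ne by auto
 from W_lin[OF this this, of 0 0] show ?thesis by simp
qed

lemma diff_in: "u \<in> W ==> v \<in> W ==> (%x. u x - v x) \<in> W"
 using W_lin[of u v 1 "-1"] by simp

lemma add_in: "u \<in> W ==> v \<in> W ==> (%x. u x + v x) \<in> W"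
 using W_lin[of u v 1 "1"] by simp

lemma scale_in: "u \<in> W ==> (%x. s *\<^sub>R u x) \<in> W"
 using W_lin[of u u s "0"] by simp

lemma sum_in: "(!!i. i < k ==> \<phi> i \<in> W) ==> (%x. \<Sum>i<k. c i *\<^sub>R \<phi> i x) \<in> W" for k :: nat
proof (induction k)
 case 0
 then show ?case by (simp add: zero_in)
next
 case (Suc k)
 then show ?case using W_lin[of "%x. \<Sum>i<k. c i *\<^sub>R \<phi> i x" "\<phi> k" 1 "c k"] by simp
qed

end

locale bilinear_form = linear_function_space W for W :: "('x => 'b::real_vector) set" +
 fixes a :: "('x => 'b) => ('x => 'b) => real"
 assumes a_sym: "u \<in> W ==> v \<in> W ==> a u v = a v u"
  and a_lin: "u \<in> W ==> v \<in> W ==> w \<in> W ==>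
   a (%x. s *\<^sub>R u x + t *\<^sub>R v x) w = s * a u w + t * a v w"
begin

lemma zero_left: "w \<in> W ==> a (%x. 0) w = 0"
 using a_lin[of w w w 0 0] by simp

lemma diff_left: "u \<in> W ==> v \<in> W ==> w \<in> W ==> a (%x. u x - v x) w = a u w - a v w"
 using a_lin[of u v w 1 "-1"] by simp

lemma add_left: "u \<in> W ==> v \<in> W ==> w \<in> W ==> a (%x. u x + v x) w = a u w + a v w"
 using a_lin[of u v w 1 "1"] by simp

lemma scale_left: "u \<in> W ==> w \<in> W ==> a (%x. s *\<^sub>R u x) w = s * a u w"
 using a_lin[of u u w s 0] by simp

lemma diff_right: "u \<in> W ==> v \<in> W ==> w \<in> W ==> a w (%x. u x - v x) = a w u - a w v"
 using diff_left[of u v w] a_sym[of w "(%x. u x - v x)"] a_sym[of u w] a_sym[of v w] diff_in[of u v] by simp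

lemma add_right: "u \<in> W ==> v \<in> W ==> w \<in> W ==> a w (%x. u x + v x) = a w u + a w v"
 using add_left[of u v w] a_sym[of w "(%x. u x + v x)"] a_sym[of u w] a_sym[of v w] add_in[of u v] by simp

lemma scale_right: "u \<in> W ==> w \<in> W ==> a w (%x. s *\<^sub>R u x) = s * a w u"
 using scale_left[of u w s] a_sym[of w "(%x. s *\<^sub>R u x)"] a_sym[of u w] scale_in[of u s] by simp

lemma diff_diff: "u \<in> W ==> v \<in> W ==>
  a (%x. u x - v x) (%x. u x - v x) = a u u - 2 * a u v + a v v"
 using diff_in[of u v] a_sym[of u v] by (simp add: diff_left diff_right)

lemma add_add: "u \<in> W ==> v \<in> W ==>
  a (%x. u x + v x) (%x. u x + v x) = a u u + 2 * a u v + a v v"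
 using add_in[of u v] a_sym[of u v] by (simp add: add_left add_right)

lemma lin_lin: "u \<in> W ==> v \<in> W ==>
  a (%x. s *\<^sub>R u x + t *\<^sub>R v x) (%x. s *\<^sub>R u x + t *\<^sub>R v x)
   = s\<^sup>2 * a u u + 2 * s * t * a u v + t\<^sup>2 * a v v"
 using W_lin[of u v s t] a_sym[of u v]
  a_sym[of u "(%x. s *\<^sub>R u x + t *\<^sub>R v x)"] a_sym[of v "(%x. s *\<^sub>R u x + t *\<^sub>R v x)"]
 by (simp add: a_lin power2_eq_square algebra_simps)

lemma sum_left: "(!!i. i < k ==> \<phi> i \<in> W) ==> w \<in> W ==>
  a (%x. \<Sum>i<k. c i *\<^sub>R \<phi> i x) w = (\<Sum>i<k. c i * a (\<phi> i) w)" for k :: nat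
proof (induction k)
 case 0
 then show ?case by (simp add: zero_left)
next
 case (Suc k)
 then have "a (%x. 1 *\<^sub>R (\<Sum>i<k. c i *\<^sub>R \<phi> i x) + c k *\<^sub>R \<phi> k x) w
   = 1 * a (%x. \<Sum>i<k. c i *\<^sub>R \<phi> i x) w + c k * a (\<phi> k) w"
  by (intro a_lin sum_in) auto
 then show ?case using Suc by simp
qed

lemma sum_sum:
 fixes k :: nat
 assumes "!!i. i < k ==> \<phi> i \<in> W"
 shows "a (%x. \<Sum>i<k. c i *\<^sub>R \<phi> i x) (%x. \<Sum>i<k. c i *\<^sub>R \<phi> i x)
  = (\<Sum>i<k. \<Sum>j<k. c i * c j * a (\<phi> i) (\<phi> j))"
proof -
 have "a (\<phi> i) (%x. \<Sum>j<k. c j *\<^sub>R \<phi> j x) = (\<Sum>j<k. c j * a (\<phi> i) (\<phi> j))" if "i < k" for i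
 proof -
  have "a (\<phi> i) (%x. \<Sum>j<k. c j *\<^sub>R \<phi> j x) = (\<Sum>j<k. c j * a (\<phi> j) (\<phi> i))"
   using a_sym[OF assms[OF that] sum_in[OF assms]] sum_left[OF assms assms[OF that]] by simp
  also have "... = (\<Sum>j<k. c j * a (\<phi> i) (\<phi> j))"
   using a_sym[OF assms assms[OF that]] by (intro sum.cong refl) simp
  finally show ?thesis .
 qed
 then show ?thesis
  using assms sum_in[of k \<phi> c] by (simp add: sum_left sum_distrib_left mult.assoc)
qed

end

locale psd_form = bilinear_form W a for W :: "('x => 'b::real_vector) set" and a +
 assumes a_pos: "u \<in> W ==> 0 \<le> a u u"
begin

lemma cauchy_schwarz: "u \<in> W ==> v \<in> W ==> (a u v)^2 \<le> a u u * a v v"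
 using a_pos[OF W_lin[of u v]] lin_lin[of u v] by (intro quadratic_psd_discriminant) simp

lemma null: "u \<in> W ==> v \<in> W ==> a u u = 0 ==> a u v = 0"
 using cauchy_schwarz[of u v] by simp

lemma tendsto_left:
 assumes "!!n. u n \<in> W" "w \<in> W" "v \<in> W"
  and lim: "(%n. a (%x. u n x - w x) (%x. u n x - w x)) \<longlonglongrightarrow> 0"
 shows "(%n. a (u n) v) \<longlonglongrightarrow> a w v"
proof -
 have "(%n. a (u n) v - a w v) \<longlonglongrightarrow> 0"
 proof (rule Lim_null_comparison)
  show "\<forall>\<^sub>F n in sequentially. norm (a (u n) v - a w v)
    \<le> sqrt (a (%x. u n x - w x) (%x. u n x - w x) * a v v)"
  proof (intro always_eventually allI)
   fix n
   have "(a (u n) v - a w v)^2 \<le> a (%x. u n x - w x) (%x. u n x - w x) * a v v"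
    using cauchy_schwarz[OF diff_in[OF assms(1,2)] assms(3)] diff_left[OF assms(1-3)] by simp
   from real_sqrt_le_mono[OF this]
   show "norm (a (u n) v - a w v) \<le> sqrt (a (%x. u n x - w x) (%x. u n x - w x) * a v v)"
    by simp
  qed
  have "(%n. sqrt (a (%x. u n x - w x) (%x. u n x - w x) * a v v)) \<longlonglongrightarrow> sqrt (0 * a v v)"
   by (intro tendsto_intros lim)
  then show "(%n. sqrt (a (%x. u n x - w x) (%x. u n x - w x) * a v v)) \<longlonglongrightarrow> 0" by simp
 qed
 then show ?thesis by (simp add: LIM_zero_iff)
qed

lemma tendsto_diag:
 assumes "!!n. u n \<in> W" "w \<in> W"
  and lim: "(%n. a (%x. u n x - w x) (%x. u n x - w x)) \<longlonglongrightarrow> 0"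
 shows "(%n. a (u n) (u n)) \<longlonglongrightarrow> a w w"
proof -
 have "a (u n) (u n) = a (%x. u n x - w x) (%x. u n x - w x) + 2 * a (u n) w - a w w" for n
  using assms by (simp add: diff_diff)
 moreover have "(%n. a (%x. u n x - w x) (%x. u n x - w x) + 2 * a (u n) w - a w w)
   \<longlonglongrightarrow> 0 + 2 * a w w - a w w"
  by (intro tendsto_intros lim tendsto_left assms)
 ultimately show ?thesis by simp
qed

end

text \<open>Axioms shared by the lattice and the Dirichlet operator: \<open>b\<close> is the mass
  form and \<open>q\<close> the energy form, bounded below relative to \<open>b\<close>.
  \<open>bounded_imp_cauchy\<close> is the compact embedding and \<open>form_complete\<close> the
  closedness of the form. \<open>b\<close> is only semidefinite, since functions equal almost
  everywhere are distinct elements of \<open>W\<close>.\<close>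

locale compact_form = linear_function_space W for W :: "('x => 'b::real_vector) set" +
 fixes b q :: "('x => 'b) => ('x => 'b) => real"
  and c0 :: real
 assumes b_sym: "u \<in> W ==> v \<in> W ==> b u v = b v u"
  and b_lin: "u \<in> W ==> v \<in> W ==> w \<in> W ==>
   b (%x. s *\<^sub>R u x + t *\<^sub>R v x) w = s * b u w + t * b v w"
  and b_pos: "u \<in> W ==> 0 \<le> b u u"
  and q_sym: "u \<in> W ==> v \<in> W ==> q u v = q v u"
  and q_lin: "u \<in> W ==> v \<in> W ==> w \<in> W ==>
   q (%x. s *\<^sub>R u x + t *\<^sub>R v x) w = s * q u w + t * q v w"
  and q_lower: "u \<in> W ==> - c0 * b u u \<le> q u u"
  and bounded_imp_cauchy: "!!u B. (!!n::nat. u n \<in> W) ==> (!!n. b (u n) (u n) \<le> B) ==>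
   (!!n. q (u n) (u n) \<le> B) ==>
   \<exists>r::nat => nat. strict_mono r \<and>
    (\<forall>e>0. \<exists>N. \<forall>m\<ge>N. \<forall>n\<ge>N. b (%x. u (r m) x - u (r n) x) (%x. u (r m) x - u (r n) x) < e)"
  and form_complete: "!!u. (!!n::nat. u n \<in> W) ==>
   \<forall>e>0. \<exists>N. \<forall>m\<ge>N. \<forall>n\<ge>N. b (%x. u m x - u n x) (%x. u m x - u n x) < e \<and>
     q (%x. u m x - u n x) (%x. u m x - u n x) < e ==>
   \<exists>w\<in>W. (%n. b (%x. u n x - w x) (%x. u n x - w x)) \<longlonglongrightarrow> 0 \<and>
    (%n. q (%x. u n x - w x) (%x. u n x - w x)) \<longlonglongrightarrow> 0"
begin

sublocale b: psd_form W b
 by unfold_locales (auto simp: b_sym b_lin b_pos)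

sublocale q: bilinear_form W q
 by unfold_locales (auto simp: q_sym q_lin)

text \<open>\<open>q\<close> itself may be negative; the shift by \<open>c0\<close> makes
  Cauchy-Schwarz available, and limits for \<open>q\<close> are recovered by subtracting those for
  \<open>b\<close>.\<close>

sublocale Q: psd_form W "%u v. q u v + c0 * b u v"
proof
 show "0 \<le> q u u + c0 * b u u" if "u \<in> W" for u using q_lower[OF that] by simp
qed (auto simp: b_sym b_lin q_sym q_lin algebra_simps)

text \<open>Direct method: a normalised minimizing sequence has a \<open>b\<close>-Cauchy
  subsequence by compactness, and near-minimality upgrades this to \<open>q\<close>-Cauchy, so a
  limit exists in \<open>W\<close> and attains the infimum.\<close>

lemma minimizer_exists:
 assumes e: "!!i::nat. i < n ==> e i \<in> W"
  and ex: "\<exists>u\<in>W. (\<forall>i<n. b u (e i) = 0) \<and> b u u > 0"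
 shows "\<exists>w\<in>W. (\<forall>i<n. b w (e i) = 0) \<and> b w w = 1 \<and>
  (\<forall>u\<in>W. (\<forall>i<n. b u (e i) = 0) --> q w w * b u u \<le> q u u)"
proof -
 define V where "V = {u \<in> W. \<forall>i<n. b u (e i) = 0}"
 have VW: "u \<in> W" if "u \<in> V" for u using that by (simp add: V_def)
 have V_lin: "(%x. s *\<^sub>R u x + t *\<^sub>R v x) \<in> V" if "u \<in> V" "v \<in> V" for u v s t
  using that e by (auto simp: V_def W_lin b_lin)
 define R where "R = {q u u | u. u \<in> V \<and> b u u = 1}"
 define l where "l = Inf R"
 have norm1: "\<exists>s. b (%x. s *\<^sub>R u x) (%x. s *\<^sub>R u x) = 1 \<and> (%x. s *\<^sub>R u x) \<in> V
   \<and> q (%x. s *\<^sub>R u x) (%x. s *\<^sub>R u x) = q u u / b u u" if u: "u \<in> V" "b u u > 0" for u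
 proof -
  define s where "s = 1 / sqrt (b u u)"
  have ss: "s * s = 1 / b u u" using u(2) by (simp add: s_def)
  have "b (%x. s *\<^sub>R u x) (%x. s *\<^sub>R u x) = (s * s) * b u u"
   using VW[OF u(1)] by (simp add: b.scale_left b.scale_right scale_in)
  moreover have "q (%x. s *\<^sub>R u x) (%x. s *\<^sub>R u x) = (s * s) * q u u"
   using VW[OF u(1)] by (simp add: q.scale_left q.scale_right scale_in)
  moreover have "(%x. s *\<^sub>R u x) \<in> V" using V_lin[OF u(1) u(1), of s 0] by simp
  ultimately show ?thesis using u(2) unfolding ss by (intro exI[of _ s]) simp
 qed
 have Rne: "R ~= {}"
 proof -
  obtain u where "u \<in> V" "b u u > 0" using ex by (auto simp: V_def)
  from norm1[OF this] show ?thesis unfolding R_def by blast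
 qed
 have bdd: "bdd_below R"
  by (rule bdd_belowI[of _ "-c0"]) (use q_lower VW in \<open>fastforce simp: R_def\<close>)
 have l_le: "l * b u u \<le> q u u" if u: "u \<in> V" for u
 proof (cases "b u u = 0")
  case True
  then show ?thesis using q_lower[OF VW[OF u]] by simp
 next
  case False
  then have pos: "b u u > 0" using b_pos[OF VW[OF u]] by simp
  from norm1[OF u this] obtain s where "q (%x. s *\<^sub>R u x) (%x. s *\<^sub>R u x) = q u u / b u u"
   "b (%x. s *\<^sub>R u x) (%x. s *\<^sub>R u x) = 1" "(%x. s *\<^sub>R u x) \<in> V" by blast
  then have "q u u / b u u \<in> R"
   unfolding R_def mem_Collect_eq by (intro exI[of _ "%x. s *\<^sub>R u x"]) simp
  then have "l \<le> q u u / b u u" unfolding l_def by (rule cInf_lower[OF _ bdd])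
  then show ?thesis using pos by (simp add: field_simps)
 qed
 have "\<exists>u. u \<in> V \<and> b u u = 1 \<and> q u u < l + inverse (Suc m)" for m
 proof -
  have "\<exists>r\<in>R. r < l + inverse (Suc m)"
   unfolding l_def by (rule cInf_lessD[OF Rne]) simp
  then show ?thesis by (auto simp: R_def)
 qed
 then obtain u where u: "!!m. u m \<in> V" "!!m. b (u m) (u m) = 1"
   "!!m. q (u m) (u m) < l + inverse (Suc m)" by metis
 have uW: "u m \<in> W" for m using u(1) VW by blast
 have "q (u m) (u m) \<le> \<bar>l\<bar> + 1" for m
 proof -
  have "inverse (Suc m) \<le> (1::real)" by (simp add: field_simps)
  then show ?thesis using u(3)[of m] by linarith
 qed
 then obtain r :: "nat => nat" where r: "strict_mono r" and cau: "!!e. e > 0 ==>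
   \<exists>N. \<forall>m\<ge>N. \<forall>n\<ge>N. b (%x. u (r m) x - u (r n) x) (%x. u (r m) x - u (r n) x) < e"
  using bounded_imp_cauchy[of u "\<bar>l\<bar> + 1", OF uW] u(2) by auto
 define v where "v m = u (r m)" for m
 have vW: "v m \<in> W" and vV: "v m \<in> V" and b1: "b (v m) (v m) = 1" for m
  using uW u by (auto simp: v_def)
 have qv: "q (v m) (v m) < l + inverse (Suc m)" for m
 proof -
  have "m \<le> r m" using r by (rule strict_mono_imp_increasing)
  then have "inverse (Suc (r m)) \<le> inverse (real (Suc m))" by (simp add: field_simps)
  then show ?thesis using u(3)[of "r m"] unfolding v_def by linarith
 qed
 \<comment> \<open>Parallelogram identity: the sum of two near-minimizers has energy at least
   \<open>l\<close> times its mass, so little energy is left for their difference.\<close>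
 have qd: "q (%x. v m x - v k x) (%x. v m x - v k x) \<le> 2 * inverse (Suc m) + 2 * inverse (Suc k)
   + l * b (%x. v m x - v k x) (%x. v m x - v k x)" for m k
 proof -
  have "(%x. v m x + v k x) \<in> V" using V_lin[OF vV[of m] vV[of k], of 1 1] by simp
  from l_le[OF this] have "l * b (%x. v m x + v k x) (%x. v m x + v k x)
   \<le> q (%x. v m x + v k x) (%x. v m x + v k x)" .
  then have "l * (2 + 2 * b (v m) (v k)) \<le> q (v m) (v m) + 2 * q (v m) (v k) + q (v k) (v k)"
   using vW by (simp add: b.add_add q.add_add b1)
  then show ?thesis using vW qv[of m] qv[of k]
   by (simp add: b.diff_diff q.diff_diff b1 algebra_simps)
 qed
 have "\<forall>e>0. \<exists>N. \<forall>m\<ge>N. \<forall>n\<ge>N. b (%x. v m x - v n x) (%x. v m x - v n x) < e \<and>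
     q (%x. v m x - v n x) (%x. v m x - v n x) < e"
 proof (intro allI impI)
  fix e :: real assume e: "e > 0"
  \<comment> \<open>With this choice the term \<open>l\<close> times the mass of the difference
    takes at most half of \<open>e\<close>, whatever the sign of \<open>l\<close>.\<close>
  define e' where "e' = e / (2 * (\<bar>l\<bar> + 1))"
  have e': "e' > 0" "e' \<le> e" using e by (auto simp: e'_def field_simps)
  obtain N where N: "!!m n. m \<ge> N ==> n \<ge> N ==> b (%x. v m x - v n x) (%x. v m x - v n x) < e'"
   using cau[OF e'(1)] by (auto simp: v_def)
  obtain N2 where N2: "inverse (Suc N2) < e / 8" using reals_Archimedean[of "e/8"] e by auto
  have "b (%x. v m x - v n x) (%x. v m x - v n x) < e \<and>
     q (%x. v m x - v n x) (%x. v m x - v n x) < e"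
   if mn: "m \<ge> max N N2" "n \<ge> max N N2" for m n
  proof -
   have b': "b (%x. v m x - v n x) (%x. v m x - v n x) < e'" using N mn by auto
   have "l * b (%x. v m x - v n x) (%x. v m x - v n x) \<le> \<bar>l\<bar> * e'"
    using b' b_pos[OF diff_in[OF vW vW, of m n]] e'(1)
    by (smt (verit) mult_left_mono mult_right_mono abs_ge_self abs_ge_zero)
   also have "... \<le> e / 2" using e by (simp add: e'_def field_simps)
   finally have 1: "l * b (%x. v m x - v n x) (%x. v m x - v n x) \<le> e / 2" .
   have "inverse (Suc m) \<le> inverse (real (Suc N2))" "inverse (Suc n) \<le> inverse (real (Suc N2))"
    using mn by (auto simp: field_simps)
   then have "2 * inverse (Suc m) + 2 * inverse (Suc n) < e / 2" using N2 by linarith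
   then show ?thesis using 1 qd[of m n] b' e' by linarith
  qed
  then show "\<exists>N. \<forall>m\<ge>N. \<forall>n\<ge>N. b (%x. v m x - v n x) (%x. v m x - v n x) < e \<and>
     q (%x. v m x - v n x) (%x. v m x - v n x) < e" by blast
 qed
 then obtain w where w: "w \<in> W" "(%n. b (%x. v n x - w x) (%x. v n x - w x)) \<longlonglongrightarrow> 0"
    "(%n. q (%x. v n x - w x) (%x. v n x - w x)) \<longlonglongrightarrow> 0"
  using form_complete[of v] vW by blast
 have Qlim: "(%n. q (%x. v n x - w x) (%x. v n x - w x)
   + c0 * b (%x. v n x - w x) (%x. v n x - w x)) \<longlonglongrightarrow> 0"
  using tendsto_add[OF w(3) tendsto_mult_left[OF w(2), of c0]] by simp
 have bw: "(%n. b (v n) (v n)) \<longlonglongrightarrow> b w w" by (rule b.tendsto_diag[OF vW w(1,2)])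
 then have bw1: "b w w = 1" by (simp add: b1 LIMSEQ_const_iff)
 have "(%n. q (v n) (v n) + c0 * b (v n) (v n)) \<longlonglongrightarrow> q w w + c0 * b w w"
  by (rule Q.tendsto_diag[of v w, OF vW w(1) Qlim])
 from tendsto_diff[OF this tendsto_mult_left[OF bw, of c0]]
 have qw: "(%n. q (v n) (v n)) \<longlonglongrightarrow> q w w" by simp
 have "(%n. l + inverse (real (Suc n))) \<longlonglongrightarrow> l + 0"
  using LIMSEQ_inverse_real_of_nat_add[of l] by simp
 then have "q w w \<le> l + 0"
  by (rule LIMSEQ_le[OF qw]) (use qv in \<open>auto intro: less_imp_le\<close>)
 moreover have orth: "b w (e i) = 0" if "i < n" for i
 proof -
  have "(%n. b (v n) (e i)) \<longlonglongrightarrow> b w (e i)"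
   by (rule b.tendsto_left[OF vW w(1) e[OF that] w(2)])
  moreover have "b (v m) (e i) = 0" for m using vV that by (auto simp: V_def)
  ultimately show ?thesis by (simp add: LIMSEQ_const_iff)
 qed
 moreover have "q w w * b u u \<le> q u u" if "u \<in> V" for u
  using mult_right_mono[of "q w w" l "b u u"] l_le[OF that] b_pos[OF VW[OF that]]
   \<open>q w w \<le> l + 0\<close> by simp
 ultimately show ?thesis using w(1) bw1 by (intro bexI[of _ w]) (auto simp: V_def)
qed

text \<open>The last clause is variational: \<open>l i\<close> is the minimum of the Rayleigh
  quotient on the \<open>b\<close>-complement of the earlier vectors. It replaces completeness of
  the eigenfunctions and makes the \<open>l i\<close> the lowest eigenvalues, not merely
  some.\<close>

definition eigenbasis :: "nat => (nat => 'x => 'b) => (nat => real) => bool" where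
 "eigenbasis n e l \<longleftrightarrow> (\<forall>i<n. e i \<in> W) \<and> (\<forall>i<n. \<forall>j<n. b (e i) (e j) = (if i = j then 1 else 0)) \<and>
   (\<forall>i<n. \<forall>v\<in>W. q (e i) v = l i * b (e i) v) \<and>
   (\<forall>i<n. \<forall>u\<in>W. (\<forall>j<i. b u (e j) = 0) --> l i * b u u \<le> q u u)"

lemma exists_orthogonal:
 fixes k :: nat
 assumes "!!i. i < n ==> e i \<in> W" "n < k" "!!i. i < k ==> \<phi> i \<in> W"
 shows "\<exists>c. (\<exists>j<k. c j ~= 0) \<and> (\<forall>i<n. b (%x. \<Sum>j<k. c j *\<^sub>R \<phi> j x) (e i) = 0)"
 using homogeneous_system_solution[OF assms(2), of "%i j. b (\<phi> j) (e i)"] assms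
 by (simp add: b.sum_left mult.commute)

text \<open>Successive minimization on the complement of the vectors found so far; \<open>k\<close>
  vectors independent modulo the null space of \<open>b\<close> ensure that this complement contains
  an element of positive mass.\<close>

lemma eigenbasis_exists:
 assumes \<phi>: "!!i. i < k ==> \<phi> i \<in> W"
  and ind: "!!c. b (%x. \<Sum>j<k. c j *\<^sub>R \<phi> j x) (%x. \<Sum>j<k. c j *\<^sub>R \<phi> j x) = 0 ==> \<forall>j<k. c j = 0"
  and "n \<le> k"
 shows "\<exists>e l. eigenbasis n e l"
 using \<open>n \<le> k\<close>
proof (induction n)
 case 0
 then show ?case by (auto simp: eigenbasis_def)
next
 case (Suc n)
 then obtain e l where el: "eigenbasis n e l" by auto
 then have eW: "!!i. i < n ==> e i \<in> W"
  and on: "!!i j. i < n ==> j < n ==> b (e i) (e j) = (if i = j then 1 else 0)"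
  and ev: "!!i v. i < n ==> v \<in> W ==> q (e i) v = l i * b (e i) v" by (auto simp: eigenbasis_def)
 obtain c where c: "\<exists>j<k. c j ~= 0" "\<forall>i<n. b (%x. \<Sum>j<k. c j *\<^sub>R \<phi> j x) (e i) = 0"
  using exists_orthogonal[of n e k \<phi>] eW \<phi> Suc.prems by auto
 define u where "u = (%x. \<Sum>j<k. c j *\<^sub>R \<phi> j x)"
 have "u \<in> W" using \<phi> by (auto simp: u_def intro: sum_in)
 moreover have "b u u ~= 0" using ind[of c] c(1) unfolding u_def[symmetric] by blast
 moreover note c(2)[folded u_def]
 ultimately have "\<exists>u\<in>W. (\<forall>i<n. b u (e i) = 0) \<and> b u u > 0"
  using b_pos[of u] by (intro bexI[of _ u]) auto
 from minimizer_exists[OF eW this] obtain w where w: "w \<in> W" "!!i. i < n ==> b w (e i) = 0"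
   "b w w = 1" and wmin: "!!u. u \<in> W ==> \<forall>i<n. b u (e i) = 0 ==> q w w * b u u \<le> q u u" by blast
 have sym0: "b (e i) w = 0" if "i < n" for i using w that eW b_sym[of "e i" w] by simp
 \<comment> \<open>The form \<open>q\<close> minus \<open>q w w\<close> times \<open>b\<close> is
   nonnegative on the complement and vanishes at \<open>w\<close>, so its discriminant inequality
   forces the mixed term to vanish.\<close>
 have EL0: "q w v = q w w * b w v" if v: "v \<in> W" "\<forall>i<n. b v (e i) = 0" for v
 proof -
  have "(q w v - q w w * b w v)^2 \<le> (q w w - q w w * b w w) * (q v v - q w w * b v v)"
  proof (rule quadratic_psd_discriminant)
   fix s t
   have "q w w * b (%x. s *\<^sub>R w x + t *\<^sub>R v x) (%x. s *\<^sub>R w x + t *\<^sub>R v x)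
     \<le> q (%x. s *\<^sub>R w x + t *\<^sub>R v x) (%x. s *\<^sub>R w x + t *\<^sub>R v x)"
    using w v eW by (intro wmin W_lin) (auto simp: b_lin)
   then show "0 \<le> s\<^sup>2 * (q w w - q w w * b w w) + 2 * s * t * (q w v - q w w * b w v)
     + t\<^sup>2 * (q v v - q w w * b v v)"
    using w v by (simp add: b.lin_lin q.lin_lin algebra_simps)
  qed
  then show ?thesis using w(3) by simp
 qed
 have EL: "q w v = q w w * b w v" if v: "v \<in> W" for v
 proof -
  \<comment> \<open>\<open>p\<close> projects \<open>v\<close> onto the earlier eigenvectors. It is
    orthogonal to \<open>w\<close> for both forms, hence only the complement part of
    \<open>v\<close> matters.\<close>
  define p where "p = (%x. \<Sum>i<n. b v (e i) *\<^sub>R e i x)"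
  have pW: "p \<in> W" using eW by (auto simp: p_def intro: sum_in)
  have bp: "b p (e j) = b v (e j)" if "j < n" for j
   using that eW by (simp add: p_def b.sum_left on if_distrib cong: if_cong)
  have qp: "q p w = 0" "b p w = 0"
   using eW w ev sym0 by (auto simp: p_def b.sum_left q.sum_left intro!: sum.neutral)
  have "q w (%x. v x - p x) = q w w * b w (%x. v x - p x)"
   using v pW eW bp by (intro EL0) (auto simp: diff_in b.diff_left)
  then show ?thesis using v pW w qp b_sym[of p w] q_sym[of p w] by (simp add: b.diff_right q.diff_right)
 qed
 have "eigenbasis (Suc n) (e(n := w)) (l(n := q w w))"
  unfolding eigenbasis_def
 proof (intro conjI allI impI ballI)
  fix i assume i: "i < Suc n"
  show "(e(n := w)) i \<in> W" using i w(1) eW by (auto simp: less_Suc_eq)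
  show "b ((e(n := w)) i) ((e(n := w)) j) = (if i = j then 1 else 0)" if "j < Suc n" for j
   using i that w on sym0 by (auto simp: less_Suc_eq)
  show "q ((e(n := w)) i) v = (l(n := q w w)) i * b ((e(n := w)) i) v" if "v \<in> W" for v
   using i that EL ev by (auto simp: less_Suc_eq)
  show "(l(n := q w w)) i * b u u \<le> q u u" if u: "u \<in> W" "\<forall>j<i. b u ((e(n := w)) j) = 0" for u
  proof (cases "i = n")
   case True
   then show ?thesis using wmin[OF u(1)] u(2) by auto
  next
   case False
   then have "\<forall>j<i. b u (e j) = 0" using u(2) i by auto
   then show ?thesis using False i u(1) el unfolding eigenbasis_def by auto
  qed
 qed
 then show ?case by blast
qed

lemma eigenbasis_mono:
 assumes "eigenbasis n e l" "i \<le> j" "j < n" shows "l i \<le> l j"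
proof -
 have "i < n" using assms by simp
 moreover have "\<forall>j'<i. b (e j) (e j') = 0" "e j \<in> W" using assms by (auto simp: eigenbasis_def)
 ultimately have "l i * b (e j) (e j) \<le> q (e j) (e j)"
  using assms(1) unfolding eigenbasis_def by blast
 moreover have "b (e j) (e j) = 1" "q (e j) (e j) = l j * b (e j) (e j)"
  using assms by (auto simp: eigenbasis_def)
 ultimately show ?thesis by simp
qed

lemma eigenbasis_b_sum:
 assumes "eigenbasis k e l"
 shows "b (%x. \<Sum>i<k. c i *\<^sub>R e i x) (%x. \<Sum>i<k. c i *\<^sub>R e i x) = (\<Sum>i<k. (c i)^2)"
proof -
 have "b (%x. \<Sum>i<k. c i *\<^sub>R e i x) (%x. \<Sum>i<k. c i *\<^sub>R e i x) = (\<Sum>i<k. \<Sum>j<k. c i * c j * b (e i) (e j))"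
  using assms by (intro b.sum_sum) (simp add: eigenbasis_def)
 also have "... = (\<Sum>i<k. \<Sum>j<k. if i = j then (c i)\<^sup>2 else 0)"
  using assms by (intro sum.cong refl) (simp add: eigenbasis_def power2_eq_square)
 finally show ?thesis by simp
qed

lemma eigenbasis_q_sum_le:
 assumes el: "eigenbasis k e l"
 shows "q (%x. \<Sum>i<k. c i *\<^sub>R e i x) (%x. \<Sum>i<k. c i *\<^sub>R e i x) \<le> l (k - 1) * (\<Sum>i<k. (c i)^2)"
proof -
 have "q (%x. \<Sum>i<k. c i *\<^sub>R e i x) (%x. \<Sum>i<k. c i *\<^sub>R e i x) = (\<Sum>i<k. \<Sum>j<k. c i * c j * q (e i) (e j))"
  using el by (intro q.sum_sum) (simp add: eigenbasis_def)
 also have "... = (\<Sum>i<k. \<Sum>j<k. if i = j then l i * (c i)^2 else 0)"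
  using el by (intro sum.cong refl) (simp add: eigenbasis_def power2_eq_square)
 also have "... = (\<Sum>i<k. l i * (c i)^2)" by simp
 also have "... \<le> (\<Sum>i<k. l (k - 1) * (c i)^2)"
  by (intro sum_mono mult_right_mono eigenbasis_mono[OF el]) auto
 finally show ?thesis by (simp add: sum_distrib_left)
qed

text \<open>A trial family of \<open>k\<close> members has a combination orthogonal to the first
  \<open>k - 1\<close> eigenvectors, where the variational clause applies. Strictness for every
  nonzero coefficient vector takes the place of linear independence.\<close>

lemma kth_le_test:
 assumes "eigenbasis k e l" "k \<ge> 1"
  and \<phi>: "!!i. i < k ==> \<phi> i \<in> W"
  and lt: "!!c. \<exists>j<k. c j ~= 0 ==> q (%x. \<Sum>j<k. c j *\<^sub>R \<phi> j x) (%x. \<Sum>j<k. c j *\<^sub>R \<phi> j x)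
    < \<mu> * b (%x. \<Sum>j<k. c j *\<^sub>R \<phi> j x) (%x. \<Sum>j<k. c j *\<^sub>R \<phi> j x)"
 shows "l (k - 1) < \<mu>"
proof -
 obtain c where c: "\<exists>j<k. c j ~= 0" "\<forall>i<k-1. b (%x. \<Sum>j<k. c j *\<^sub>R \<phi> j x) (e i) = 0"
  using exists_orthogonal[of "k-1" e k \<phi>] assms(1,2) \<phi> unfolding eigenbasis_def by auto
 define u where "u = (%x. \<Sum>j<k. c j *\<^sub>R \<phi> j x)"
 have u: "u \<in> W" using \<phi> by (auto simp: u_def intro: sum_in)
 have "l (k-1) * b u u \<le> q u u"
  using assms(1,2) c(2) u unfolding eigenbasis_def u_def[symmetric] by auto
 also have "... < \<mu> * b u u" using lt[OF c(1)] by (simp add: u_def)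
 finally have "l (k-1) * b u u < \<mu> * b u u" .
 then show ?thesis using b_pos[OF u] by (metis mult_right_mono not_le)
qed

section \<open>Multiplicities and the k-th eigenvalue\<close>

definition eigenspace :: "real => ('x => 'b) set" where
 "eigenspace \<nu> = {u \<in> W. \<forall>v\<in>W. q u v = \<nu> * b u v}"

text \<open>\<open>p\<close> extracts the function that the concrete eigenvalue problem speaks of:
  \<open>fst\<close> on pairs of function and gradient, the identity on lattice functions.
  \<open>N\<close> is the set of functions regarded as zero.\<close>

lemma dim_modulo_eigenspace_ge:
 assumes el: "eigenbasis k e l"
  and p: "linear p" and N: "!!u. u \<in> W ==> (%x. p (u x)) \<in> N \<longleftrightarrow> b u u = 0"
 shows "enat (card {i\<in>{..<k}. l i = \<nu>}) \<le> dim_modulo N ((%u x. p (u x)) ` eigenspace \<nu>)"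
proof -
 define J where "J = {i\<in>{..<k}. l i = \<nu>}"
 have fin: "finite J" by (simp add: J_def)
 obtain h where h: "bij_betw h {..<card J} J"
  using ex_bij_betw_nat_finite[OF fin] by (auto simp: atLeast0LessThan)
 then have hJ: "h i \<in> J" if "i < card J" for i using that by (auto simp: bij_betw_def)
 have hinj: "h i = h j \<longleftrightarrow> i = j" if "i < card J" "j < card J" for i j
  using h that by (auto simp: bij_betw_def inj_on_def)
 have eW: "e (h i) \<in> W" if "i < card J" for i using hJ[OF that] el by (auto simp: J_def eigenbasis_def)
 have "\<exists>\<phi>. (\<forall>i<card J. \<phi> i \<in> (%u x. p (u x)) ` eigenspace \<nu>) \<and>
    (\<forall>c::nat => real. (%x. \<Sum>i<card J. c i * \<phi> i x) \<in> N --> (\<forall>i<card J. c i = 0))"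
 proof (intro exI[of _ "%i x. p (e (h i) x)"] conjI allI impI)
  fix i assume "i < card J"
  from hJ[OF this] show "(%x. p (e (h i) x)) \<in> (%u x. p (u x)) ` eigenspace \<nu>"
   using el by (intro image_eqI[of _ _ "e (h i)"]) (auto simp: J_def eigenbasis_def eigenspace_def)
 next
  fix c i assume *: "(%x. \<Sum>i<card J. c i * p (e (h i) x)) \<in> N" and i: "i < card J"
  define u where "u = (%x. \<Sum>i<card J. c i *\<^sub>R e (h i) x)"
  have uW: "u \<in> W" using eW by (auto simp: u_def intro: sum_in)
  have "(%x. p (u x)) = (%x. \<Sum>i<card J. c i * p (e (h i) x))"
   using p by (simp add: u_def linear_sum linear_cmul)
  then have "b u u = 0" using N[OF uW] * by simp
  then have "b u (e (h i)) = 0" using b.null uW eW i by blast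
  moreover have "b u (e (h i)) = (\<Sum>j<card J. c j * (if j = i then 1 else 0))"
  proof -
   have "b (e (h j)) (e (h i)) = (if j = i then 1 else 0)" if "j < card J" for j
    using hJ[OF that] hJ[OF i] hinj[OF that i] el by (auto simp: eigenbasis_def J_def)
   then show ?thesis using eW i by (simp add: u_def b.sum_left)
  qed
  ultimately show "c i = 0" using i by (simp add: if_distrib cong: if_cong)
 qed
 then show ?thesis unfolding dim_modulo_def J_def[symmetric] by (intro Sup_upper) blast
qed

text \<open>A larger family would contain a nontrivial combination \<open>w\<close> orthogonal to
  all \<open>e i\<close> with \<open>l i = \<nu>\<close>. It is orthogonal to the other
  \<open>e i\<close> with \<open>i < k - 1\<close> because their eigenvalues differ from
  \<open>\<nu>\<close>; the variational clause at index \<open>k - 1\<close> then makes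
  \<open>w\<close> null.\<close>

lemma dim_modulo_eigenspace_le:
 assumes el: "eigenbasis k e l" and "k \<ge> 1" "\<nu> < l (k - 1)"
  and p: "linear p" and N: "!!u. u \<in> W ==> (%x. p (u x)) \<in> N \<longleftrightarrow> b u u = 0"
 shows "dim_modulo N ((%u x. p (u x)) ` eigenspace \<nu>) \<le> enat (card {i\<in>{..<k-1}. l i = \<nu>})"
proof -
 define J where "J = {i\<in>{..<k-1}. l i = \<nu>}"
 have fin: "finite J" by (simp add: J_def)
 obtain h where h: "bij_betw h {..<card J} J"
  using ex_bij_betw_nat_finite[OF fin] by (auto simp: atLeast0LessThan)
 have eW: "e i \<in> W" if "i < k - 1" for i using that el by (auto simp: eigenbasis_def)
 have "enat n \<le> enat (card J)" if ex: "\<exists>\<phi>. (\<forall>i<n. \<phi> i \<in> (%u x. p (u x)) ` eigenspace \<nu>) \<and>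
    (\<forall>c::nat => real. (%x. \<Sum>i<n. c i * \<phi> i x) \<in> N --> (\<forall>i<n. c i = 0))" for n
 proof (rule ccontr)
  assume "\<not> enat n \<le> enat (card J)"
  then have n: "card J < n" by simp
  obtain \<phi> where \<phi>: "!!i. i < n ==> \<phi> i \<in> (%u x. p (u x)) ` eigenspace \<nu>"
   and ind: "!!c. (%x. \<Sum>i<n. c i * \<phi> i x) \<in> N ==> (\<forall>i<n. c i = 0)" using ex by blast
  have "\<forall>i. \<exists>u. i < n --> u \<in> eigenspace \<nu> \<and> \<phi> i = (%x. p (u x))" using \<phi> by blast
  then obtain u where u: "!!i. i < n ==> u i \<in> eigenspace \<nu>" "!!i. i < n ==> \<phi> i = (%x. p (u i x))" by metis
  have uW: "u i \<in> W" if "i < n" for i using u(1)[OF that] by (simp add: eigenspace_def)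
  have "h i < k - 1" if "i < card J" for i using that h by (auto simp: bij_betw_def J_def)
  then obtain c where c: "\<exists>j<n. c j ~= 0" "\<forall>i<card J. b (%x. \<Sum>j<n. c j *\<^sub>R u j x) (e (h i)) = 0"
   using exists_orthogonal[of "card J" "e \<circ> h" n u] n eW uW by auto
  define w where "w = (%x. \<Sum>j<n. c j *\<^sub>R u j x)"
  have wW: "w \<in> W" using uW by (auto simp: w_def intro: sum_in)
  have we: "q w v = \<nu> * b w v" if "v \<in> W" for v
   using that uW u(1) by (simp add: w_def b.sum_left q.sum_left eigenspace_def sum_distrib_left mult.left_commute)
  have "b w (e i) = 0" if i: "i < k - 1" for i
  proof (cases "l i = \<nu>")
   case True
   then have "i \<in> J" using i by (simp add: J_def)
   then obtain j where "j < card J" "h j = i" using h by (metis bij_betw_def imageE lessThan_iff)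
   then show ?thesis using c by (auto simp: w_def)
  next
   case False
   have "l i * b (e i) w = q (e i) w" using el wW i by (auto simp: eigenbasis_def)
   also have "... = \<nu> * b (e i) w" using we[OF eW[OF i]] wW eW[OF i] b_sym[of w "e i"] q_sym[of w "e i"] by simp
   finally show ?thesis using False wW eW[OF i] b_sym[of w "e i"] by simp
  qed
  then have "l (k-1) * b w w \<le> q w w" using el wW \<open>k \<ge> 1\<close> by (auto simp: eigenbasis_def)
  then have "l (k-1) * b w w \<le> \<nu> * b w w" using we[OF wW] by simp
  then have "b w w = 0" using b_pos[OF wW] \<open>\<nu> < l (k-1)\<close>
   by (metis less_le_not_le mult_strict_right_mono order_less_le)
  then have "(%x. p (w x)) \<in> N" using N[OF wW] by simp
  moreover have "(%x. p (w x)) = (%x. \<Sum>i<n. c i * \<phi> i x)"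
   using p u by (simp add: w_def linear_sum linear_cmul)
  ultimately show False using ind[of c] c by auto
 qed
 then show ?thesis unfolding dim_modulo_def J_def[symmetric] by (intro Sup_least) blast
qed

text \<open>The count reaches \<open>k\<close> at \<open>l (k - 1)\<close> and stays at most
  \<open>k - 1\<close> below it. Lower bounds on multiplicities suffice for the first half, which
  matters because the top eigenvalue may have further eigenvectors outside the basis.\<close>

theorem kth_eigenvalue_eq:
 assumes el: "eigenbasis k e l" and k: "k \<ge> 1"
  and p: "linear p" and N: "!!u. u \<in> W ==> (%x. p (u x)) \<in> N \<longleftrightarrow> b u u = 0"
 shows "kth_eigenvalue (%\<nu>. dim_modulo N ((%u x. p (u x)) ` eigenspace \<nu>)) k = l (k - 1)"
 unfolding kth_eigenvalue_def
proof (rule Least_equality)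
 let ?m = "%\<nu>. dim_modulo N ((%u x. p (u x)) ` eigenspace \<nu>)"
 have "enat k = (\<Sum>\<nu>\<in>l ` {..<k}. enat (card {i\<in>{..<k}. l i = \<nu>}))"
 proof -
  have "k = card (\<Union>\<nu>\<in>l ` {..<k}. {i\<in>{..<k}. l i = \<nu>})"
  proof -
   have "(\<Union>\<nu>\<in>l ` {..<k}. {i\<in>{..<k}. l i = \<nu>}) = {..<k}" by auto
   then show ?thesis by simp
  qed
  also have "... = (\<Sum>\<nu>\<in>l ` {..<k}. card {i\<in>{..<k}. l i = \<nu>})"
   by (rule card_UN_disjoint) auto
  finally show ?thesis by (metis (no_types, lifting) of_nat_eq_enat of_nat_sum sum.cong)
 qed
 also have "... \<le> (\<Sum>\<nu>\<in>l ` {..<k}. ?m \<nu>)"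
  by (intro sum_mono dim_modulo_eigenspace_ge[OF el p N])
 also have "... \<le> eigenvalue_count ?m (l (k-1))"
  unfolding eigenvalue_count_def
  using eigenbasis_mono[OF el] k
  by (intro Sup_upper) (force intro!: exI[of _ "l ` {..<k}"])
 finally show "enat k \<le> eigenvalue_count ?m (l (k-1))" .
 fix \<mu> assume \<mu>: "enat k \<le> eigenvalue_count ?m \<mu>"
 show "l (k-1) \<le> \<mu>"
 proof (rule ccontr)
  assume "\<not> l (k-1) \<le> \<mu>"
  then have lt: "\<mu> < l (k-1)" by simp
  have "eigenvalue_count ?m \<mu> \<le> enat (k - 1)"
   unfolding eigenvalue_count_def
  proof (rule Sup_least, clarify)
   fix F assume F: "finite F" "F \<subseteq> {..\<mu>}"
   have "(\<Sum>\<nu>\<in>F. ?m \<nu>) \<le> (\<Sum>\<nu>\<in>F. enat (card {i\<in>{..<k-1}. l i = \<nu>}))"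
    using F lt by (intro sum_mono dim_modulo_eigenspace_le[OF el k _ p N]) auto
   also have "... = enat (\<Sum>\<nu>\<in>F. card {i\<in>{..<k-1}. l i = \<nu>})"
    by (metis (no_types, lifting) of_nat_eq_enat of_nat_sum sum.cong)
   also have "(\<Sum>\<nu>\<in>F. card {i\<in>{..<k-1}. l i = \<nu>}) = card (\<Union>\<nu>\<in>F. {i\<in>{..<k-1}. l i = \<nu>})"
    using F by (intro card_UN_disjoint[symmetric]) auto
   also have "... \<le> card {..<k-1}" by (intro card_mono) auto
   finally show "(\<Sum>\<nu>\<in>F. ?m \<nu>) \<le> enat (k - 1)" by simp
  qed
  then have "enat k \<le> enat (k - 1)" using \<mu> by (rule order_trans[rotated])
  then show False using k by simp
 qed
qed

end

section \<open>Lattice functions and the relative smallness of oscillating potentials\<close>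

definition fin_supp :: "('a => real) => bool" where
 "fin_supp f \<longleftrightarrow> finite {x. f x ~= 0}"

text \<open>Summing over the support gives a translation-invariant sum without a chosen index set;
  on an infinite support the value is the default \<open>0\<close>, so additivity is stated under
  \<open>fin_supp\<close>.\<close>

definition zsum :: "('a => real) => real" where
 "zsum f = sum f {x. f x ~= 0}"

lemma zsum_eq: "finite A ==> (!!x. x \<notin> A ==> f x = 0) ==> zsum f = sum f A"
 unfolding zsum_def by (rule sum.mono_neutral_left) auto

lemma fin_suppI: "finite A ==> (!!x. x \<notin> A ==> f x = 0) ==> fin_supp f"
 unfolding fin_supp_def by (erule finite_subset[rotated]) auto

lemma fin_supp_mult_left: "fin_supp f ==> fin_supp (%x. f x * g x)"
 and fin_supp_mult_right: "fin_supp f ==> fin_supp (%x. g x * f x)"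
 unfolding fin_supp_def by (auto elim: finite_subset[rotated])

lemma fin_supp_add: "fin_supp f ==> fin_supp g ==> fin_supp (%x. f x + g x)"
 and fin_supp_diff: "fin_supp f ==> fin_supp g ==> fin_supp (%x. f x - g x)"
 unfolding fin_supp_def by (auto intro: finite_subset[of _ "{x. f x ~= 0} \<union> {x. g x ~= 0}"])

lemma fin_supp_comp0: "fin_supp f ==> h 0 = 0 ==> fin_supp (%x. h (f x))"
 unfolding fin_supp_def by (auto elim: finite_subset[rotated])

lemma fin_supp_sum: "finite I ==> (!!i. i \<in> I ==> fin_supp (f i)) ==> fin_supp (%x. \<Sum>i\<in>I. f i x)"
proof (induction I rule: finite_induct)
 case empty
 then show ?case by (simp add: fin_supp_def)
next
 case (insert i I)
 then show ?case by (simp add: fin_supp_add)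
qed

lemma fin_supp_shift:
 fixes f :: "'a::ab_group_add => real"
 assumes "fin_supp f" shows "fin_supp (%x. f (x + z))"
 using finite_vimageI[of "{x. f x ~= 0}" "%x. x + z"] assms
 by (simp add: fin_supp_def vimage_def)

lemma fin_supp_shift2:
 fixes f :: "'a::ab_group_add => real"
 assumes "fin_supp f" shows "fin_supp (%x. f (x - z))"
 using fin_supp_shift[OF assms, of "-z"] by simp

lemmas fin_supp_intros = fin_supp_mult_left fin_supp_mult_right fin_supp_add fin_supp_diff fin_supp_sum
 fin_supp_shift fin_supp_shift2

lemma zsum_add: "fin_supp f ==> fin_supp g ==> zsum (%x. f x + g x) = zsum f + zsum g"
proof -
 assume "fin_supp f" "fin_supp g"
 then have "finite ({x. f x ~= 0} \<union> {x. g x ~= 0})" by (simp add: fin_supp_def)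
 note * = zsum_eq[OF this]
 have "zsum (%x. f x + g x) = (\<Sum>x\<in>{x. f x ~= 0} \<union> {x. g x ~= 0}. f x + g x)" by (rule *) auto
 moreover have "zsum f = sum f ({x. f x ~= 0} \<union> {x. g x ~= 0})" by (rule *) auto
 moreover have "zsum g = sum g ({x. f x ~= 0} \<union> {x. g x ~= 0})" by (rule *) auto
 ultimately show ?thesis by (simp only: sum.distrib)
qed

lemma zsum_diff: "fin_supp f ==> fin_supp g ==> zsum (%x. f x - g x) = zsum f - zsum g"
proof -
 assume "fin_supp f" "fin_supp g"
 then have "finite ({x. f x ~= 0} \<union> {x. g x ~= 0})" by (simp add: fin_supp_def)
 note * = zsum_eq[OF this]
 have "zsum (%x. f x - g x) = (\<Sum>x\<in>{x. f x ~= 0} \<union> {x. g x ~= 0}. f x - g x)" by (rule *) auto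
 moreover have "zsum f = sum f ({x. f x ~= 0} \<union> {x. g x ~= 0})" by (rule *) auto
 moreover have "zsum g = sum g ({x. f x ~= 0} \<union> {x. g x ~= 0})" by (rule *) auto
 ultimately show ?thesis by (simp only: sum_subtractf)
qed

lemma zsum_cmult: "zsum (%x. c * f x) = c * zsum f"
 by (cases "c = 0") (auto simp: zsum_def sum_distrib_left)

lemma zsum_mult_right: "zsum (%x. f x * c) = zsum f * c"
 using zsum_cmult[of c f] by (simp add: mult.commute)

lemma zsum_divide: "zsum (%x. f x / c) = zsum f / c"
 using zsum_cmult[of "1 / c" f] by simp

lemma zsum_nonneg: "(!!x. 0 \<le> f x) ==> 0 \<le> zsum f"
 unfolding zsum_def by (rule sum_nonneg) auto

lemma zsum_mono: "fin_supp f ==> fin_supp g ==> (!!x. f x \<le> g x) ==> zsum f \<le> zsum g"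
proof -
 assume "fin_supp f" "fin_supp g" and le: "!!x. f x \<le> g x"
 then have "finite ({x. f x ~= 0} \<union> {x. g x ~= 0})" by (simp add: fin_supp_def)
 note * = zsum_eq[OF this]
 have "zsum f = sum f ({x. f x ~= 0} \<union> {x. g x ~= 0})" by (rule *) auto
 moreover have "zsum g = sum g ({x. f x ~= 0} \<union> {x. g x ~= 0})" by (rule *) auto
 ultimately show ?thesis using le by (simp only: sum_mono)
qed

lemma zsum_abs: "fin_supp f ==> \<bar>zsum f\<bar> \<le> zsum (%x. \<bar>f x\<bar>)"
 unfolding zsum_def by simp

lemma zsum_zero [simp]: "zsum (%x. 0) = 0"
 by (simp add: zsum_def)

lemma zsum_sum: "finite I ==> (!!i. i \<in> I ==> fin_supp (f i)) ==>
  zsum (%x. \<Sum>i\<in>I. f i x) = (\<Sum>i\<in>I. zsum (f i))"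
 by (induction I rule: finite_induct) (auto simp: zsum_add fin_supp_sum)

lemma zsum_shift: "zsum (%x. f (x + z)) = zsum f" for f :: "'a::ab_group_add => real"
 unfolding zsum_def
 by (rule sum.reindex_bij_witness[of _ "%x. x - z" "%x. x + z"]) auto

lemma zsum_shift2: "zsum (%x. f (x - z)) = zsum f" for f :: "'a::ab_group_add => real"
 using zsum_shift[of f "-z"] by simp

lemma zsum_le_sum_sq:
 assumes "fin_supp f" "!!x. 0 \<le> f x" shows "f y \<le> zsum f"
proof (cases "f y = 0")
 case True
 then show ?thesis using zsum_nonneg[of f] assms by simp
next
 case False
 then show ?thesis unfolding zsum_def using assms
  by (intro member_le_sum) (auto simp: fin_supp_def)
qed

section \<open>Lattice L2 norms and translations\<close>

definition l2norm :: "('a => real) => real" where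
 "l2norm f = sqrt (zsum (%x. (f x)^2))"

lemma fin_supp_sq: "fin_supp f ==> fin_supp (%x. (f x)^2)"
 by (rule fin_supp_comp0) auto

lemma l2norm_nonneg [simp]: "0 \<le> l2norm f"
 by (simp add: l2norm_def zsum_nonneg)

lemma l2norm_sq: "(l2norm f)^2 = zsum (%x. (f x)^2)"
 by (simp add: l2norm_def zsum_nonneg)

lemma l2norm_triangle:
 assumes "fin_supp f" "fin_supp g"
 shows "l2norm (%x. f x + g x) \<le> l2norm f + l2norm g"
proof -
 let ?A = "{x. f x ~= 0} \<union> {x. g x ~= 0}"
 have "finite ?A" using assms by (simp add: fin_supp_def)
 then have "l2norm h = L2_set h ?A" if "!!x. x \<notin> ?A ==> h x = 0" for h
  unfolding l2norm_def L2_set_def using that by (subst zsum_eq[of ?A]) auto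
 from this[of f] this[of g] this[of "%x. f x + g x"] show ?thesis
  using L2_set_triangle_ineq[of f g ?A] by simp
qed

lemma l2norm_shift: "l2norm (%x. f (x + z)) = l2norm f" for f :: "'a::ab_group_add => real"
 unfolding l2norm_def using zsum_shift[of "%x. (f x)^2" z] by simp

definition fdiff :: "'d => (int ^ 'd::finite => real) => int ^ 'd => real" where
 "fdiff i f x = f (x + axis i 1) - f x"

definition dirichlet_sum :: "(int ^ 'd::finite => real) => real" where
 "dirichlet_sum f = (\<Sum>i\<in>UNIV. zsum (%x. (fdiff i f x)^2))"

lemma dirichlet_sum_nonneg [simp]: "0 \<le> dirichlet_sum f"
 unfolding dirichlet_sum_def by (intro sum_nonneg zsum_nonneg) auto

lemma l2norm_shift_add:
 fixes f :: "'a::ab_group_add => real"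
 assumes "fin_supp f"
 shows "l2norm (%x. f (x + (u + v)) - f x) \<le> l2norm (%x. f (x + u) - f x) + l2norm (%x. f (x + v) - f x)"
proof -
 have "l2norm (%x. (f ((x + u) + v) - f (x + u)) + (f (x + u) - f x))
  \<le> l2norm (%x. f ((x + u) + v) - f (x + u)) + l2norm (%x. f (x + u) - f x)"
  using assms fin_supp_shift[OF assms, of "u + v"]
  by (intro l2norm_triangle fin_supp_intros) (auto simp: add.assoc intro: fin_supp_intros)
 also have "l2norm (%x. f ((x + u) + v) - f (x + u)) = l2norm (%x. f (x + v) - f x)"
  using l2norm_shift[of "%x. f (x + v) - f x" u] by simp
 finally show ?thesis by (simp add: add.assoc)
qed

lemma l2norm_shift_uminus:
 fixes f :: "'a::ab_group_add => real"
 shows "l2norm (%x. f (x + - u) - f x) = l2norm (%x. f (x + u) - f x)"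
proof -
 have "l2norm (%x. f (x + - u) - f x) = l2norm (%x. f (x + u + - u) - f (x + u))"
  using l2norm_shift[of "%x. f (x + - u) - f x" u] by simp
 also have "... = l2norm (%x. f (x + u) - f x)"
  unfolding l2norm_def by (simp add: power2_commute)
 finally show ?thesis .
qed

lemma l2norm_shift_axis_nat:
 fixes f :: "int ^ 'd::finite => real"
 assumes "fin_supp f"
 shows "l2norm (%x. f (x + axis i (int n)) - f x) \<le> real n * l2norm (fdiff i f)"
proof (induction n)
 case 0
 have [simp]: "axis i (0::int) = 0" by (simp add: vec_eq_iff axis_def)
 show ?case by (simp add: l2norm_def)
next
 case (Suc n)
 have eq: "axis i (int (Suc n)) = axis i (int n) + (axis i 1 :: int ^ 'd)"
  by (simp add: vec_eq_iff axis_def)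
 have [simp]: "l2norm (%x. f (x + axis i 1) - f x) = l2norm (fdiff i f)"
  by (simp add: fdiff_def l2norm_def)
 show ?case using l2norm_shift_add[OF assms, of "axis i (int n)" "axis i 1"] Suc
  unfolding eq by (simp add: algebra_simps)
qed

lemma l2norm_shift_axis:
 fixes f :: "int ^ 'd::finite => real"
 assumes "fin_supp f"
 shows "l2norm (%x. f (x + axis i a) - f x) \<le> \<bar>real_of_int a\<bar> * l2norm (fdiff i f)"
proof (cases "a \<ge> 0")
 case True
 then show ?thesis using l2norm_shift_axis_nat[OF assms, of i "nat a"] by simp
next
 case False
 have eq: "axis i a = - (axis i (int (nat (- a))) :: int ^ 'd)"
  using False by (simp add: vec_eq_iff axis_def)
 have "l2norm (%x. f (x + axis i a) - f x) = l2norm (%x. f (x + axis i (int (nat (- a)))) - f x)"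
  unfolding eq by (rule l2norm_shift_uminus)
 then show ?thesis using l2norm_shift_axis_nat[OF assms, of i "nat (- a)"] False by simp
qed

text \<open>The translation by \<open>z\<close> is carried out one coordinate at a time, as a walk
  along the axes.\<close>

lemma l2norm_shift_le:
 fixes f :: "int ^ 'd::finite => real"
 assumes "fin_supp f"
 shows "l2norm (%x. f (x + z) - f x) \<le> (\<Sum>i\<in>UNIV. \<bar>real_of_int (z $ i)\<bar> * l2norm (fdiff i f))"
proof -
 have *: "l2norm (%x. f (x + (\<Sum>i\<in>I. axis i (z $ i))) - f x)
   \<le> (\<Sum>i\<in>I. \<bar>real_of_int (z $ i)\<bar> * l2norm (fdiff i f))" if "finite I" for I
  using that
 proof (induction I rule: finite_induct)
  case empty
  then show ?case by (simp add: l2norm_def)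
 next
  case (insert i I)
  then show ?case
   using l2norm_shift_add[OF assms, of "axis i (z $ i)" "\<Sum>i\<in>I. axis i (z $ i)"]
    l2norm_shift_axis[OF assms, of i "z $ i"] by simp
 qed
 have "z = (\<Sum>i\<in>UNIV. axis i (z $ i))"
  by (simp add: vec_eq_iff axis_def if_distrib cong: if_cong)
 with *[of UNIV] show ?thesis by simp
qed

text \<open>Discrete counterpart of bounding the L2 modulus of continuity by the gradient; the
  factor \<open>CARD('d)\<close> is the price of Cauchy-Schwarz over the coordinates.\<close>

lemma zsum_shift_le:
 fixes f :: "int ^ 'd::finite => real"
 assumes "fin_supp f" and z: "!!i. \<bar>real_of_int (z $ i)\<bar> \<le> L"
 shows "zsum (%x. (f (x + z) - f x)^2) \<le> L\<^sup>2 * real CARD('d) * dirichlet_sum f"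
proof -
 have L: "L \<ge> 0" using z[of undefined] by linarith
 have "l2norm (%x. f (x + z) - f x) \<le> (\<Sum>i\<in>UNIV. \<bar>real_of_int (z $ i)\<bar> * l2norm (fdiff i f))"
  by (rule l2norm_shift_le[OF assms(1)])
 also have "... \<le> (\<Sum>i\<in>UNIV. L * l2norm (fdiff i f))"
  by (intro sum_mono mult_right_mono z) auto
 also have "... = L * (\<Sum>i\<in>UNIV. l2norm (fdiff i f))" by (simp add: sum_distrib_left)
 finally have "(l2norm (%x. f (x + z) - f x))^2 \<le> (L * (\<Sum>i\<in>UNIV. l2norm (fdiff i f)))^2"
  by (intro power_mono) auto
 also have "... = L\<^sup>2 * (\<Sum>i\<in>UNIV. l2norm (fdiff i f))^2" by (simp add: power_mult_distrib)
 also have "... \<le> L\<^sup>2 * ((\<Sum>i\<in>UNIV. (l2norm (fdiff i f))^2) * card (UNIV :: 'd set))"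
  by (intro mult_left_mono sum_squared_le_sum_of_squares) auto
 finally show ?thesis by (simp add: l2norm_sq dirichlet_sum_def mult_ac)
qed

section \<open>Box averages against a weight\<close>

definition zbox :: "nat => (int ^ 'd::finite) set" where
 "zbox L = {z. \<forall>i. 0 \<le> z $ i \<and> z $ i < int L}"

lemma zbox_eq_image: "zbox L = (%g. \<chi> i. g i) ` (PiE UNIV (%_. {0..<int L}))"
proof (intro set_eqI iffI)
 fix z :: "int ^ 'd" assume "z \<in> zbox L"
 then show "z \<in> (%g. \<chi> i. g i) ` (PiE UNIV (%_. {0..<int L}))"
  by (intro image_eqI[of _ _ "%i. z $ i"]) (auto simp: zbox_def vec_eq_iff)
qed (auto simp: zbox_def PiE_def Pi_def)

lemma finite_zbox [simp]: "finite (zbox L)"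
 unfolding zbox_eq_image by (intro finite_imageI finite_PiE) auto

lemma card_zbox: "card (zbox L :: (int ^ 'd::finite) set) = L ^ CARD('d)"
proof -
 have "card (zbox L :: (int ^ 'd) set) = card (PiE (UNIV :: 'd set) (%_. {0..<int L}))"
  unfolding zbox_eq_image by (rule card_image) (auto simp: inj_on_def vec_eq_iff)
 then show ?thesis by (simp add: card_PiE)
qed

definition bavg :: "nat => (int ^ 'd::finite => real) => int ^ 'd => real" where
 "bavg L f x = (\<Sum>z\<in>zbox L. f (x + z)) / real (L ^ CARD('d))"

lemma bavg_1 [simp]: "bavg (Suc 0) f = f"
proof -
 have *: "0 \<le> a \<and> a < 1 \<longleftrightarrow> a = 0" for a :: int by linarith
 have "zbox (Suc 0) = {0 :: int ^ 'a}" by (simp add: zbox_def vec_eq_iff * set_eq_iff)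
 then show ?thesis by (simp add: bavg_def fun_eq_iff)
qed

lemma bavg_sq_le:
 fixes f :: "int ^ 'd::finite => real"
 shows "(bavg L f x)^2 \<le> (\<Sum>z\<in>zbox L. (f (x + z))^2) / real (L ^ CARD('d))"
proof (cases "L = 0")
 case True
 then show ?thesis by (simp add: bavg_def zero_power)
next
 case False
 let ?N = "real (L ^ CARD('d))"
 have N: "?N > 0" using False by simp
 have "(\<Sum>z\<in>zbox L. f (x + z))^2 \<le> (\<Sum>z\<in>zbox L. (f (x + z))^2) * ?N"
  using sum_squared_le_sum_of_squares[of "%z. f (x + z)" "zbox L"] by (simp add: card_zbox)
 then have "(\<Sum>z\<in>zbox L. f (x + z))^2 / ?N\<^sup>2 \<le> (\<Sum>z\<in>zbox L. (f (x + z))^2) * ?N / ?N\<^sup>2"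
  by (rule divide_right_mono) simp
 then show ?thesis using N by (simp add: bavg_def power_divide power2_eq_square)
qed

text \<open>Jensen on the box, then extension of the sum to the whole lattice: averaging turns an L2
  bound into a uniform one.\<close>

lemma bavg_sq_le_zsum:
 fixes f :: "int ^ 'd::finite => real"
 assumes "fin_supp f"
 shows "(bavg L f x)^2 \<le> zsum (%x. (f x)^2) / real (L ^ CARD('d))"
proof -
 have "(\<Sum>z\<in>zbox L. (f (x + z))^2) = (\<Sum>y\<in>(%z. x + z) ` zbox L. (f y)^2)"
  by (subst sum.reindex) auto
 also have "... \<le> (\<Sum>y\<in>(%z. x + z) ` zbox L \<union> {y. f y ~= 0}. (f y)^2)"
  using assms by (intro sum_mono2) (auto simp: fin_supp_def)
 also have "... = zsum (%x. (f x)^2)"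
  using assms by (intro zsum_eq[symmetric]) (auto simp: fin_supp_def)
 finally show ?thesis using bavg_sq_le[of L f x]
  by (meson divide_right_mono of_nat_0_le_iff order_trans)
qed

text \<open>Jensen replaces the squared average by the average of squares; reordering the sums moves
  the averaging from \<open>h\<close> onto the weight, so only box sums of \<open>V\<close> enter,
  however large \<open>V\<close> is at single points.\<close>

lemma zsum_weight_bavg_le:
 fixes h V :: "int ^ 'd::finite => real"
 assumes V: "!!x. 0 \<le> V x" "fin_supp V" and h: "fin_supp h" and "L > 0"
  and S: "!!y. (\<Sum>z\<in>zbox L. V (y - z)) \<le> S * real (L ^ CARD('d))"
 shows "zsum (%x. V x * (bavg L h x)^2) \<le> S * zsum (%x. (h x)^2)"
proof -
 let ?N = "real (L ^ CARD('d))"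
 have N: "?N > 0" using \<open>L > 0\<close> by simp
 have "zsum (%x. V x * (bavg L h x)^2) \<le> zsum (%x. V x * ((\<Sum>z\<in>zbox L. (h (x + z))^2) / ?N))"
  using V by (intro zsum_mono fin_supp_intros mult_left_mono bavg_sq_le) auto
 also have "... = zsum (%x. \<Sum>z\<in>zbox L. V x * (h (x + z))^2 / ?N)"
  by (simp add: sum_distrib_left sum_divide_distrib)
 also have "... = (\<Sum>z\<in>zbox L. zsum (%x. V x * (h (x + z))^2 / ?N))"
  using V unfolding times_divide_eq_right[symmetric] by (intro zsum_sum fin_supp_intros) auto
 also have "... = (\<Sum>z\<in>zbox L. zsum (%y. V (y - z) * (h y)^2 / ?N))"
 proof (rule sum.cong[OF refl])
  fix z show "zsum (%x. V x * (h (x + z))^2 / ?N) = zsum (%y. V (y - z) * (h y)^2 / ?N)"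
   using zsum_shift[of "%y. V (y - z) * (h y)^2 / ?N" z] by simp
 qed
 also have "... = zsum (%y. \<Sum>z\<in>zbox L. V (y - z) * (h y)^2 / ?N)"
  unfolding times_divide_eq_right[symmetric]
  by (intro zsum_sum[symmetric] fin_supp_mult_left fin_supp_shift2 V finite_zbox)
 also have "... = zsum (%y. (\<Sum>z\<in>zbox L. V (y - z)) / ?N * (h y)^2)"
  by (simp add: sum_divide_distrib sum_distrib_right)
 also have "... \<le> zsum (%y. S * (h y)^2)"
  using h S N by (intro zsum_mono fin_supp_mult_right fin_supp_sq mult_right_mono) (auto simp: field_simps)
 finally show ?thesis by (simp add: zsum_cmult)
qed

text \<open>Power mean inequality, obtained by summing Young's inequality for \<open>V x / t\<close>
  over the set.\<close>

lemma sum_le_powr_mean: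
 fixes V :: "'a => real"
 assumes "finite A" "A ~= {}" "!!x. x \<in> A ==> 0 \<le> V x" "K > 1" "(\<Sum>x\<in>A. V x powr K) \<le> M"
 shows "(\<Sum>x\<in>A. V x) \<le> (M / card A) powr (1 / K) * card A"
proof -
 let ?n = "real (card A)"
 have n: "?n > 0" using assms by (simp add: card_gt_0_iff)
 show ?thesis
 proof (cases "M > 0")
  case False
  then have "(\<Sum>x\<in>A. V x powr K) = 0" using assms(5) sum_nonneg[of A "%x. V x powr K"] by simp
  then have "!!x. x \<in> A ==> V x = 0" using assms(1) by (simp add: sum_nonneg_eq_0_iff)
  then show ?thesis by simp
 next
  case True
  \<comment> \<open>\<open>t\<close> is the claimed bound on the mean; with
    \<open>t powr K = M / ?n\<close> the two parts of Young's inequality add up to at most the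
    number of points.\<close>
  define t where "t = (M / ?n) powr (1 / K)"
  have t: "t > 0" using True n by (simp add: t_def)
  have tK: "t powr K = M / ?n" using True n assms(4) by (simp add: t_def powr_powr)
  have "V x / t \<le> (1 / K) * (V x powr K / t powr K) + (1 - 1 / K)" if "x \<in> A" for x
  proof (cases "V x = 0")
   case True
   then show ?thesis using assms(4) by simp
  next
   case False
   then have "V x > 0" using assms(3)[OF that] by simp
   then have "((V x / t) powr K) powr (1 / K) * 1 powr (1 - 1 / K) \<le> (1 / K) * (V x / t) powr K + (1 - 1 / K) * 1"
    using t assms(4) by (intro Youngs_inequality_0) auto
   then show ?thesis using t assms(4) \<open>V x > 0\<close> by (simp add: powr_powr powr_divide)
  qed
  then have "(\<Sum>x\<in>A. V x / t) \<le> (\<Sum>x\<in>A. (1 / K) * (V x powr K / t powr K) + (1 - 1 / K))"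
   by (rule sum_mono)
  also have "... = (1 / K) * ((\<Sum>x\<in>A. V x powr K) / t powr K) + ?n * (1 - 1 / K)"
   by (simp add: sum.distrib sum_divide_distrib[symmetric] sum_distrib_left[symmetric])
  also have "... \<le> (1 / K) * (M / t powr K) + ?n * (1 - 1 / K)"
   using assms(4,5) by (intro add_right_mono mult_left_mono divide_right_mono) auto
  also have "... = ?n" using True n assms(4) unfolding tK by (simp add: field_simps)
  finally have "(\<Sum>x\<in>A. V x) / t \<le> ?n" by (simp add: sum_divide_distrib)
  then show ?thesis using t unfolding t_def[symmetric] by (simp add: field_simps)
 qed
qed

lemma box_sum_le:
 fixes V :: "int ^ 'd::finite => real"
 assumes V: "!!x. 0 \<le> V x" "fin_supp V" and "K > 1" "L > 0" "zsum (%x. V x powr K) \<le> M"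
 shows "(\<Sum>z\<in>zbox L. V (y - z)) \<le> (M / real (L ^ CARD('d))) powr (1 / K) * real (L ^ CARD('d))"
proof -
 have "(\<Sum>z\<in>zbox L. V (y - z) powr K) = (\<Sum>x\<in>(%z. y - z) ` zbox L. V x powr K)"
  by (subst sum.reindex) (auto simp: inj_on_def)
 also have "... \<le> (\<Sum>x\<in>(%z. y - z) ` zbox L \<union> {x. V x ~= 0}. V x powr K)"
  using V by (intro sum_mono2) (auto simp: fin_supp_def)
 also have "... = zsum (%x. V x powr K)"
  using V by (intro zsum_eq[symmetric]) (auto simp: fin_supp_def)
 finally have le: "(\<Sum>z\<in>zbox L. V (y - z) powr K) \<le> M" using assms(5) by simp
 have "0 \<in> (zbox L :: (int ^ 'd) set)" using \<open>L > 0\<close> by (simp add: zbox_def)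
 then show ?thesis
  using sum_le_powr_mean[of "zbox L" "%z. V (y - z)" K M] V \<open>K > 1\<close> le
  by (auto simp: card_zbox)
qed

section \<open>Telescoping over dyadic scales\<close>

definition dyadic_increment :: "nat => (int ^ 'd::finite => real) => int ^ 'd => real" where
 "dyadic_increment L f x = (\<Sum>s\<in>zbox 2. f (x + int L *s s) - f x) / 2 ^ CARD('d)"

text \<open>A box of side \<open>2 * L\<close> splits into \<open>2 ^ CARD('d)\<close> boxes of side
  \<open>L\<close>, with remainder and quotient modulo \<open>L\<close> as coordinates. Passing to
  the next scale therefore averages an increment that the Dirichlet sum controls.\<close>

lemma bavg_double:
 fixes f :: "int ^ 'd::finite => real"
 assumes "L > 0"
 shows "bavg (2 * L) f x - bavg L f x = bavg L (dyadic_increment L f) x"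
proof -
 let ?d = "CARD('d)"
 have "(\<Sum>z\<in>zbox (2 * L). f (x + z)) = (\<Sum>(u, s)\<in>zbox L \<times> zbox 2. f (x + (u + int L *s s)))"
 proof (rule sum.reindex_bij_witness[of _ "%(u, s). u + int L *s s"
    "%z. (\<chi> i. z $ i mod int L, \<chi> i. z $ i div int L)"], goal_cases)
  case (1 z)
  then show ?case by (simp add: vec_eq_iff)
 next
  case (2 z)
  have "0 \<le> a div int L \<and> a div int L < 2" if "0 \<le> a" "a < 2 * int L" for a
  proof
   show "0 \<le> a div int L" using that assms by (simp add: pos_imp_zdiv_nonneg_iff)
   show "a div int L < 2"
   proof (rule ccontr)
    assume "\<not> a div int L < 2"
    then have "2 * int L \<le> (a div int L) * int L" by (intro mult_right_mono) auto
    also have "... \<le> a" using assms by (simp add: minus_mod_eq_div_mult[symmetric])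
    finally show False using that by simp
   qed
  qed
  then show ?case using 2 assms by (simp add: zbox_def)
 next
  case (3 p)
  obtain u s where p: "p = (u, s)" by fastforce
  show ?case using 3 assms by (simp add: p zbox_def vec_eq_iff)
 next
  case (4 p)
  obtain u s where p: "p = (u, s)" by fastforce
  have "0 \<le> u $ i + int L * s $ i \<and> u $ i + int L * s $ i < 2 * int L" for i
  proof -
   have *: "0 \<le> u $ i" "u $ i < int L" "0 \<le> s $ i" "s $ i < 2" using 4 by (auto simp: p zbox_def)
   then have "s $ i = 0 \<or> s $ i = 1" by linarith
   then show ?thesis using * by auto
  qed
  then show ?case by (simp add: p zbox_def)
 next
  case (5 z)
  have "(\<chi> i. z $ i mod int L) + int L *s (\<chi> i. z $ i div int L) = z" by (simp add: vec_eq_iff)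
  then show ?case by simp
 qed
 then have "(\<Sum>z\<in>zbox (2 * L). f (x + z)) = (\<Sum>u\<in>zbox L. \<Sum>s\<in>zbox 2. f (x + u + int L *s s))"
  by (simp add: sum.cartesian_product add.assoc)
 then have "bavg (2 * L) f x = (\<Sum>u\<in>zbox L. \<Sum>s\<in>zbox 2. f (x + u + int L *s s)) / (2 ^ ?d * real (L ^ ?d))"
  by (simp add: bavg_def power_mult_distrib)
 moreover have "bavg L (dyadic_increment L f) x = (\<Sum>u\<in>zbox L. (\<Sum>s\<in>zbox 2. f (x + u + int L *s s)) / 2 ^ ?d - f (x + u)) / real (L ^ ?d)"
  by (simp add: bavg_def dyadic_increment_def sum_subtractf card_zbox diff_divide_distrib)
 ultimately show ?thesis
  by (simp add: sum_subtractf diff_divide_distrib bavg_def sum_divide_distrib)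
qed

lemma fin_supp_dyadic_increment: "fin_supp f ==> fin_supp (dyadic_increment L f)"
 unfolding dyadic_increment_def divide_inverse by (intro fin_supp_intros) auto

lemma dyadic_increment_le:
 fixes f :: "int ^ 'd::finite => real"
 assumes f: "fin_supp f"
 shows "zsum (%x. (dyadic_increment L f x)^2) \<le> (real L)^2 * real CARD('d) * dirichlet_sum f"
proof -
 let ?N = "2 ^ CARD('d) :: real" and ?B = "(real L)^2 * real CARD('d) * dirichlet_sum f"
 have "(dyadic_increment L f x)^2 \<le> (\<Sum>s\<in>zbox 2. (f (x + int L *s s) - f x)^2) / ?N" for x
 proof -
  have "(\<Sum>s\<in>zbox 2. f (x + int L *s s) - f x)^2 \<le> (\<Sum>s\<in>zbox 2. (f (x + int L *s s) - f x)^2) * ?N"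
   using sum_squared_le_sum_of_squares[of "%s. f (x + int L *s s) - f x" "zbox 2"] by (simp add: card_zbox)
  then have "(\<Sum>s\<in>zbox 2. f (x + int L *s s) - f x)^2 / ?N\<^sup>2
    \<le> (\<Sum>s\<in>zbox 2. (f (x + int L *s s) - f x)^2) * ?N / ?N\<^sup>2"
   by (rule divide_right_mono) simp
  then show ?thesis by (simp add: dyadic_increment_def power_divide power2_eq_square)
 qed
 then have "zsum (%x. (dyadic_increment L f x)^2) \<le> zsum (%x. (\<Sum>s\<in>zbox 2. (f (x + int L *s s) - f x)^2) / ?N)"
  using f unfolding divide_inverse
  by (intro zsum_mono fin_supp_sq fin_supp_dyadic_increment fin_supp_mult_left fin_supp_sum fin_supp_diff fin_supp_shift) auto
 also have "... = (\<Sum>s\<in>zbox 2. zsum (%x. (f (x + int L *s s) - f x)^2)) / ?N"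
  using f by (subst zsum_divide, subst zsum_sum) (auto intro!: fin_supp_sq fin_supp_diff fin_supp_shift)
 also have "... \<le> (\<Sum>s\<in>(zbox 2 :: (int ^ 'd) set). ?B) / ?N"
 proof (intro divide_right_mono sum_mono zsum_shift_le f)
  fix s :: "int ^ 'd" and i assume "s \<in> zbox 2"
  then have "0 \<le> s $ i \<and> s $ i < 2" by (auto simp: zbox_def)
  then have "s $ i = 0 \<or> s $ i = 1" by linarith
  then show "\<bar>real_of_int ((int L *s s) $ i)\<bar> \<le> real L" by auto
 qed auto
 also have "... = ?B" by (simp add: card_zbox)
 finally show ?thesis .
qed

lemma weighted_l2norm:
 assumes "!!x. 0 \<le> V x"
 shows "zsum (%x. V x * (g x)^2) = (l2norm (%x. sqrt (V x) * g x))^2"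
 using assms by (simp add: l2norm_sq power_mult_distrib)

text \<open>Telescoping of \<open>f - bavg (2 ^ J) f\<close>. At scale \<open>2 ^ j\<close> the
  increment contributes \<open>(2 ^ j)^2\<close> through \<open>dyadic_increment_le\<close> and the
  weight contributes \<open>2 ^ j\<close> to the power \<open>- d / K\<close> through
  \<open>box_sum_le\<close>, together \<open>(2 ^ j) powr (2 * \<theta>)\<close>. As
  \<open>\<theta> > 0\<close>, the geometric sum of the norms is comparable to its last
  term.\<close>

lemma weighted_diff_bavg_le:
 fixes f V :: "int ^ 'd::finite => real"
 assumes V: "!!x. 0 \<le> V x" "fin_supp V" and f: "fin_supp f"
  and K: "K > 1" "2 * K > real CARD('d)" and M: "zsum (%x. V x powr K) \<le> M"
 defines "\<theta> \<equiv> 1 - real CARD('d) / (2 * K)"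
 shows "zsum (%x. V x * (f x - bavg (2 ^ J) f x)^2)
   \<le> M powr (1 / K) * real CARD('d) * dirichlet_sum f * ((2 ^ J) powr \<theta> / (2 powr \<theta> - 1))^2"
proof -
 let ?d = "real CARD('d)"
 have \<theta>: "\<theta> > 0" using K by (simp add: \<theta>_def field_simps)
 define B where "B = sqrt (M powr (1 / K) * ?d * dirichlet_sum f)"
 define w where "w x = sqrt (V x)" for x
 have w: "fin_supp w" using V(2) unfolding w_def by (rule fin_supp_comp0) simp
 have M0: "M \<ge> 0" using zsum_nonneg[of "%x. V x powr K"] M by simp
 have B2: "B\<^sup>2 = M powr (1 / K) * ?d * dirichlet_sum f" by (simp add: B_def)
 have step: "l2norm (%x. w x * (bavg (2 ^ j) f x - bavg (2 ^ Suc j) f x)) \<le> B * (2 ^ j) powr \<theta>" for j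
 proof -
  let ?L = "2 ^ j :: nat"
  have "zsum (%x. V x * (bavg ?L (dyadic_increment ?L f) x)^2)
    \<le> (M / real (?L ^ CARD('d))) powr (1 / K) * zsum (%x. (dyadic_increment ?L f x)^2)"
   by (intro zsum_weight_bavg_le V fin_supp_dyadic_increment f box_sum_le K M) auto
  also have "... \<le> (M / real (?L ^ CARD('d))) powr (1 / K) * ((real ?L)^2 * ?d * dirichlet_sum f)"
   by (intro mult_left_mono dyadic_increment_le f) auto
  also have "... = B\<^sup>2 * ((2 ^ j) powr \<theta>)^2"
  proof -
   have 1: "(M / real (?L ^ CARD('d))) powr (1 / K) = M powr (1 / K) / (2 ^ j) powr (?d / K)"
    using M0 by (simp add: powr_divide powr_realpow[symmetric] powr_powr)
   have 2: "((2 ^ j) powr \<theta>)^2 = (2 ^ j :: real)^2 / (2 ^ j) powr (?d / K)"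
   proof -
    have "((2 ^ j) powr \<theta>)^2 = (2 ^ j) powr (2 - ?d / K)"
     using K by (simp add: \<theta>_def power2_eq_square powr_add[symmetric])
    also have "... = (2 ^ j) powr 2 / (2 ^ j) powr (?d / K)" by (rule powr_diff)
    also have "(2 ^ j) powr 2 = (2 ^ j :: real)^2" by (rule powr_numeral) simp
    finally show ?thesis .
   qed
   show ?thesis unfolding 1 2 B2 by simp
  qed
  finally have "(l2norm (%x. w x * bavg ?L (dyadic_increment ?L f) x))^2 \<le> (B * (2 ^ j) powr \<theta>)^2"
   using V(1) by (simp add: weighted_l2norm w_def power_mult_distrib)
  then have "l2norm (%x. w x * bavg ?L (dyadic_increment ?L f) x) \<le> B * (2 ^ j) powr \<theta>"
   by (rule power2_le_imp_le) (simp add: B_def M0)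
  moreover have "l2norm (%x. w x * (bavg (2 ^ j) f x - bavg (2 ^ Suc j) f x))
    = l2norm (%x. w x * bavg ?L (dyadic_increment ?L f) x)"
  proof -
   have "bavg (2 ^ j) f x - bavg (2 ^ Suc j) f x = - bavg ?L (dyadic_increment ?L f) x" for x
    using bavg_double[of ?L f x] by simp
   then show ?thesis by (simp add: l2norm_def)
  qed
  ultimately show ?thesis by simp
 qed
 have B0: "B \<ge> 0" by (simp add: B_def M0)
 have q: "2 powr \<theta> > 1" using \<theta> by simp
 have "l2norm (%x. w x * (f x - bavg (2 ^ J) f x)) \<le> B * ((2 ^ J) powr \<theta> / (2 powr \<theta> - 1))"
 proof (induction J)
  case 0
  then show ?case using B0 q by (simp add: l2norm_def)
 next
  case (Suc J)
  have "l2norm (%x. w x * (f x - bavg (2 ^ Suc J) f x))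
   = l2norm (%x. w x * (f x - bavg (2 ^ J) f x) + w x * (bavg (2 ^ J) f x - bavg (2 ^ Suc J) f x))"
   by (simp add: algebra_simps)
  also have "... \<le> l2norm (%x. w x * (f x - bavg (2 ^ J) f x)) + l2norm (%x. w x * (bavg (2 ^ J) f x - bavg (2 ^ Suc J) f x))"
   by (intro l2norm_triangle fin_supp_mult_left w)
  also have "... \<le> B * ((2 ^ J) powr \<theta> / (2 powr \<theta> - 1)) + B * (2 ^ J) powr \<theta>"
   by (intro add_mono Suc step)
  also have "... = B * ((2 ^ J) powr \<theta> * 2 powr \<theta> / (2 powr \<theta> - 1))"
  proof -
   have "p / (s - 1) + p = p * s / (s - 1)" if "s > 1" for p s :: real
    using that by (simp add: divide_simps) (simp add: algebra_simps)
   from this[OF q] show ?thesis by (simp only: distrib_left[symmetric])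
  qed
  also have "(2 ^ J) powr \<theta> * 2 powr \<theta> = (2 ^ Suc J) powr \<theta>"
   by (simp add: powr_mult)
  finally show ?case .
 qed
 then have "(l2norm (%x. w x * (f x - bavg (2 ^ J) f x)))^2 \<le> (B * ((2 ^ J) powr \<theta> / (2 powr \<theta> - 1)))^2"
  by (intro power_mono) auto
 then show ?thesis using V(1) by (simp add: weighted_l2norm w_def power_mult_distrib power_divide B2)
qed

section \<open>Scaling by the mesh, and mesoscopic cells\<close>

definition mass :: "real => (int ^ 'd::finite => real) => real" where
 "mass eps f = eps ^ CARD('d) * zsum (%x. (f x)^2)"

definition energy :: "real => (int ^ 'd::finite => real) => real" where
 "energy eps f = eps ^ CARD('d) / eps\<^sup>2 * dirichlet_sum f"

text \<open>\<open>\<rho>\<close> is a length fixed before the mesh tends to zero, so that a bounded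
  region meets a number of cells that is bounded independently of \<open>eps\<close>.\<close>

definition cell :: "real => real => int ^ 'd::finite => int ^ 'd" where
 "cell \<rho> eps x = (\<chi> i. \<lfloor>eps * real_of_int (x $ i) / \<rho>\<rfloor>)"

lemma mass_nonneg: "eps \<ge> 0 ==> 0 \<le> mass eps f"
 unfolding mass_def by (intro mult_nonneg_nonneg zsum_nonneg) auto

lemma energy_nonneg: "eps \<ge> 0 ==> 0 \<le> energy eps f"
 unfolding energy_def by (intro mult_nonneg_nonneg divide_nonneg_nonneg) auto

lemma dirichlet_sum_energy: "eps > 0 ==> dirichlet_sum f = energy eps f * eps\<^sup>2 / eps ^ CARD('d)"
 for f :: "int ^ 'd::finite => real"
 by (simp add: energy_def)

text \<open>Dyadic boxes realise only the lengths \<open>2 ^ J * eps\<close>; every length above the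
  mesh is matched up to a factor two.\<close>

lemma dyadic_scale:
 fixes eps r :: real
 assumes "0 < eps" "eps \<le> r"
 obtains J where "2 ^ J * eps \<le> r" "r / 2 < 2 ^ J * eps"
proof -
 obtain n where n: "r / eps < 2 ^ n" using real_arch_pow[of 2 "r / eps"] by auto
 define m where "m = (LEAST n. r / eps < 2 ^ n)"
 have m: "r / eps < 2 ^ m" unfolding m_def using n by (rule LeastI)
 have m0: "m ~= 0" using m assms by (intro notI) (simp add: field_simps)
 then have "\<not> r / eps < 2 ^ (m - 1)" using not_less_Least[of "m - 1" "%n. r / eps < 2 ^ n"] unfolding m_def by simp
 then have "2 ^ (m - 1) * eps \<le> r" using assms by (simp add: field_simps)
 moreover have "r / 2 < 2 ^ (m - 1) * eps"
 proof -
  have "(2::real) ^ m = 2 * 2 ^ (m - 1)" using m0 by (simp add: power_eq_if)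
  then show ?thesis using m assms by (simp add: field_simps)
 qed
 ultimately show ?thesis by (rule that)
qed

text \<open>All powers of \<open>eps\<close> combine with \<open>2 ^ J\<close> into the physical
  side length \<open>2 ^ J * eps\<close>, raised to \<open>2 * \<theta>\<close>; the bound is
  therefore uniform in the mesh and small with \<open>r\<close>.\<close>

lemma weighted_diff_bavg_scaled:
 fixes f V :: "int ^ 'd::finite => real"
 assumes V: "!!x. 0 \<le> V x" "fin_supp V" and f: "fin_supp f"
  and K: "K > 1" "2 * K > real CARD('d)" and M: "eps ^ CARD('d) * zsum (%x. V x powr K) \<le> M"
  and eps: "0 < eps" "2 ^ J * eps \<le> r"
 defines "\<theta> \<equiv> 1 - real CARD('d) / (2 * K)"
 shows "eps ^ CARD('d) * zsum (%x. V x * (f x - bavg (2 ^ J) f x)^2)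
   \<le> M powr (1 / K) * real CARD('d) / (2 powr \<theta> - 1)^2 * r powr (2 * \<theta>) * energy eps f"
proof -
 let ?d = "real CARD('d)"
 let ?p = "eps ^ CARD('d)"
 have \<theta>: "\<theta> > 0" using K by (simp add: \<theta>_def field_simps)
 have p: "?p > 0" using eps by simp
 have M0: "M \<ge> 0" using zsum_nonneg[of "%x. V x powr K"] p M
  by (meson mult_nonneg_nonneg order_trans powr_ge_zero less_imp_le)
 have "zsum (%x. V x powr K) \<le> M / ?p" using M p by (simp add: field_simps)
 from weighted_diff_bavg_le[OF V f K this, of J]
 have "?p * zsum (%x. V x * (f x - bavg (2 ^ J) f x)^2)
  \<le> ?p * ((M / ?p) powr (1 / K) * ?d * dirichlet_sum f * ((2 ^ J) powr \<theta> / (2 powr \<theta> - 1))^2)"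
  using p unfolding \<theta>_def by (intro mult_left_mono) auto
 also have "... = M powr (1 / K) * ?d / (2 powr \<theta> - 1)^2 * (eps\<^sup>2 / ?p powr (1 / K) * ((2 ^ J) powr \<theta>)^2) * energy eps f"
  using p eps M0 by (simp add: dirichlet_sum_energy[of eps] powr_divide power_divide ac_simps)
 also have "eps\<^sup>2 / ?p powr (1 / K) * ((2 ^ J) powr \<theta>)^2 = (2 ^ J * eps) powr (2 * \<theta>)"
 proof -
  have "eps powr (2 * \<theta>) = eps powr (2 - ?d / K)" using K by (simp add: \<theta>_def)
  also have "... = eps powr 2 / eps powr (?d / K)" by (rule powr_diff)
  also have "eps powr 2 = eps\<^sup>2" using eps by simp
  also have "eps powr (?d / K) = ?p powr (1 / K)" using eps by (simp add: powr_realpow[symmetric] powr_powr)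
  finally have "eps\<^sup>2 / ?p powr (1 / K) = eps powr (2 * \<theta>)" ..
  moreover have "((2 ^ J) powr \<theta>)^2 = (2 ^ J) powr (2 * \<theta>)"
   by (simp add: power2_eq_square powr_add[symmetric])
  ultimately show ?thesis using eps by (simp add: powr_mult mult.commute)
 qed
 also have "M powr (1 / K) * ?d / (2 powr \<theta> - 1)^2 * (2 ^ J * eps) powr (2 * \<theta>) * energy eps f
   \<le> M powr (1 / K) * ?d / (2 powr \<theta> - 1)^2 * r powr (2 * \<theta>) * energy eps f"
  using eps \<theta> energy_nonneg[of eps f]
  by (intro mult_right_mono mult_left_mono powr_mono2) auto
 finally show ?thesis .
qed

lemma bavg_sq_le_mass:
 fixes f :: "int ^ 'd::finite => real"
 assumes "fin_supp f" "0 < eps" "0 < s" "s \<le> real L * eps"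
 shows "(bavg L f x)^2 \<le> mass eps f / s ^ CARD('d)"
proof -
 have L: "L > 0" using assms by (cases L) auto
 have "(bavg L f x)^2 \<le> zsum (%x. (f x)^2) / real (L ^ CARD('d))"
  by (rule bavg_sq_le_zsum[OF assms(1)])
 also have "... = mass eps f / (real L * eps) ^ CARD('d)"
  using assms by (simp add: mass_def power_mult_distrib)
 also have "... \<le> mass eps f / s ^ CARD('d)"
  using assms L by (intro divide_left_mono power_mono mass_nonneg mult_pos_pos zero_less_power) auto
 finally show ?thesis .
qed

text \<open>Young's inequality for \<open>2 * \<bar>a\<bar> * \<bar>a - b\<bar>\<close> with weight
  \<open>\<kappa>\<close>: the difference may carry a large factor, because the high-frequency part
  will be made small, while only a small share of \<open>a\<^sup>2\<close> is spent.\<close>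

lemma sq_diff_le:
 fixes a b :: real
 assumes "\<kappa> > 0"
 shows "\<bar>a\<^sup>2 - b\<^sup>2\<bar> \<le> (1 + 1 / \<kappa>) * (a - b)^2 + \<kappa> * a\<^sup>2"
proof -
 have "2 * \<bar>a\<bar> * \<bar>a - b\<bar> \<le> (1 / \<kappa>) * (a - b)^2 + \<kappa> * a\<^sup>2"
 proof -
  have "0 \<le> (\<bar>a - b\<bar> / sqrt \<kappa> - sqrt \<kappa> * \<bar>a\<bar>)^2" by simp
  also have "... = (1 / \<kappa>) * (a - b)^2 + \<kappa> * a\<^sup>2 - 2 * \<bar>a\<bar> * \<bar>a - b\<bar>"
   using assms by (simp add: power2_diff power_divide power_mult_distrib)
  finally show ?thesis by simp
 qed
 moreover have "a\<^sup>2 - b\<^sup>2 = 2 * a * (a - b) - (a - b)^2" by (simp add: power2_eq_square algebra_simps)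
 then have "\<bar>a\<^sup>2 - b\<^sup>2\<bar> \<le> \<bar>2 * a * (a - b)\<bar> + (a - b)^2"
  using abs_triangle_ineq4[of "2 * a * (a - b)" "(a - b)^2"] by simp
 moreover have "\<bar>2 * a * (a - b)\<bar> = 2 * \<bar>a\<bar> * \<bar>a - b\<bar>" by (simp add: abs_mult)
 moreover have "(1 + 1 / \<kappa>) * (a - b)^2 = (a - b)^2 + (1 / \<kappa>) * (a - b)^2" by (simp add: distrib_right)
 ultimately show ?thesis by linarith
qed

text \<open>Young's inequality for \<open>\<bar>a - b\<bar> * \<bar>a + b\<bar>\<close>, weighted by
  the scale \<open>\<rho>\<close> on which \<open>a - b\<close> is small.\<close>

lemma sq_diff_le2:
 fixes a b :: real
 assumes "\<rho> > 0" "(a - b)^2 \<le> \<rho>\<^sup>2 * P" "a\<^sup>2 \<le> Q" "b\<^sup>2 \<le> Q"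
 shows "\<bar>a\<^sup>2 - b\<^sup>2\<bar> \<le> \<rho> * (P + Q)"
proof -
 have "0 \<le> (\<bar>a - b\<bar> / \<rho> - \<bar>a + b\<bar> / 2)^2" by simp
 also have "... = (a - b)^2 / \<rho>\<^sup>2 + (a + b)^2 / 4 - \<bar>a - b\<bar> * \<bar>a + b\<bar> / \<rho>"
  using assms(1) by (simp add: power2_diff power_divide)
 finally have 1: "\<bar>a - b\<bar> * \<bar>a + b\<bar> / \<rho> \<le> (a - b)^2 / \<rho>\<^sup>2 + (a + b)^2 / 4" by simp
 have "0 \<le> (a - b)^2" by simp
 then have "(a + b)^2 \<le> 2 * a\<^sup>2 + 2 * b\<^sup>2" by (simp add: power2_eq_square algebra_simps)
 then have 2: "(a + b)^2 / 4 \<le> Q" using assms(3,4) by simp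
 have "(a - b)^2 / \<rho>\<^sup>2 \<le> P" using assms(1,2) by (simp add: field_simps)
 then have "\<bar>a - b\<bar> * \<bar>a + b\<bar> / \<rho> \<le> P + Q" using 1 2 by linarith
 moreover have "\<bar>a\<^sup>2 - b\<^sup>2\<bar> = \<bar>a - b\<bar> * \<bar>a + b\<bar>"
  by (simp add: abs_mult[symmetric] power2_eq_square algebra_simps)
 ultimately show ?thesis using assms(1) by (simp add: field_simps)
qed

text \<open>A form bound whose constant need not be small, from averages over boxes of physical side
  between one half and one. It pays for the term weighted by \<open>\<kappa>\<close> in the sharp
  estimate.\<close>

lemma weighted_mass_le:
 fixes f V :: "int ^ 'd::finite => real"
 assumes V: "!!x. 0 \<le> V x" "fin_supp V" and f: "fin_supp f"
  and K: "K > 1" "2 * K > real CARD('d)" and M: "eps ^ CARD('d) * zsum (%x. V x powr K) \<le> M"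
   "eps ^ CARD('d) * zsum V \<le> M"
  and eps: "0 < eps" "eps \<le> 1"
 defines "\<theta> \<equiv> 1 - real CARD('d) / (2 * K)"
 shows "eps ^ CARD('d) * zsum (%x. V x * (f x)^2)
   \<le> 2 * (M powr (1 / K) * real CARD('d) / (2 powr \<theta> - 1)^2 + M * 2 ^ CARD('d)) * (energy eps f + mass eps f)"
proof -
 let ?p = "eps ^ CARD('d)"
 have p: "?p > 0" using eps by simp
 have M0: "M \<ge> 0" using zsum_nonneg[of V] V(1) p M(2)
  by (meson mult_nonneg_nonneg order_trans less_imp_le)
 obtain J where J: "2 ^ J * eps \<le> 1" "1 / 2 < 2 ^ J * eps" using dyadic_scale[OF eps] by blast
 let ?g = "bavg (2 ^ J) f"
 let ?C = "M powr (1 / K) * real CARD('d) / (2 powr \<theta> - 1)^2"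
 have "(f x)^2 \<le> 2 * (f x - ?g x)^2 + 2 * (?g x)^2" for x
 proof -
  have "0 \<le> (f x - 2 * ?g x)^2" by simp
  then show ?thesis by (simp add: power2_eq_square algebra_simps)
 qed
 moreover have "(?g x)^2 \<le> 2 ^ CARD('d) * mass eps f" for x
  using bavg_sq_le_mass[OF f eps(1), of "1/2" "2 ^ J" x] J by (simp add: power_one_over field_simps)
 ultimately have le: "(f x)^2 \<le> 2 * (f x - ?g x)^2 + 2 * (2 ^ CARD('d) * mass eps f)" for x
  by (smt (verit))
 have "zsum (%x. V x * (f x)^2) \<le> zsum (%x. 2 * (V x * (f x - ?g x)^2) + V x * (2 * (2 ^ CARD('d) * mass eps f)))"
 proof (rule zsum_mono)
  show "fin_supp (%x. V x * (f x)^2)" using V(2) by (rule fin_supp_mult_left)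
  have "fin_supp (%x. V x * (f x - ?g x)^2)" using V(2) by (rule fin_supp_mult_left)
  then show "fin_supp (%x. 2 * (V x * (f x - ?g x)^2) + V x * (2 * (2 ^ CARD('d) * mass eps f)))"
   by (intro fin_supp_add fin_supp_mult_right fin_supp_mult_left[OF V(2)])
  show "V x * (f x)^2 \<le> 2 * (V x * (f x - ?g x)^2) + V x * (2 * (2 ^ CARD('d) * mass eps f))" for x
   using mult_left_mono[OF le V(1), of x x] by (simp add: algebra_simps)
 qed
 also have "... = 2 * zsum (%x. V x * (f x - ?g x)^2) + zsum V * (2 * (2 ^ CARD('d) * mass eps f))"
 proof -
  have f1: "fin_supp (%x. 2 * (V x * (f x - ?g x)^2))"
   by (intro fin_supp_mult_right[of "%x. V x * (f x - ?g x)^2"] fin_supp_mult_left[OF V(2)])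
  have f2: "fin_supp (%x. V x * (2 * (2 ^ CARD('d) * mass eps f)))" by (rule fin_supp_mult_left[OF V(2)])
  show ?thesis by (simp only: zsum_add[OF f1 f2] zsum_cmult zsum_mult_right)
 qed
 finally have "?p * zsum (%x. V x * (f x)^2) \<le> ?p * (2 * zsum (%x. V x * (f x - ?g x)^2) + zsum V * (2 * (2 ^ CARD('d) * mass eps f)))"
  using p by (intro mult_left_mono) auto
 also have "... = 2 * (?p * zsum (%x. V x * (f x - ?g x)^2)) + (?p * zsum V) * (2 * (2 ^ CARD('d) * mass eps f))"
  by (simp add: algebra_simps)
 also have "... \<le> 2 * (?C * 1 powr (2 * \<theta>) * energy eps f) + M * (2 * (2 ^ CARD('d) * mass eps f))"
  unfolding \<theta>_def using mass_nonneg[of eps f] eps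
  by (intro add_mono mult_left_mono mult_right_mono weighted_diff_bavg_scaled V f K M J) auto
 also have "... = 2 * (?C * energy eps f + M * 2 ^ CARD('d) * mass eps f)" by (simp add: algebra_simps)
 also have "... \<le> 2 * ((?C + M * 2 ^ CARD('d)) * (energy eps f + mass eps f))"
 proof -
  have "A * x + B * y \<le> (A + B) * (x + y)" if "A \<ge> 0" "B \<ge> 0" "x \<ge> 0" "y \<ge> 0" for A B x y :: real
   using that mult_nonneg_nonneg[of A y] mult_nonneg_nonneg[of B x] by (simp add: algebra_simps)
  from this[of ?C "M * 2 ^ CARD('d)" "energy eps f" "mass eps f"]
  show ?thesis using M0 mass_nonneg[of eps f] energy_nonneg[of eps f] eps by (intro mult_left_mono) auto
 qed
 finally show ?thesis by (simp only: mult.assoc)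
qed

lemma zsum_cell_le:
 fixes \<eta> w :: "int ^ 'd::finite => real"
 assumes \<eta>: "fin_supp \<eta>" and w: "!!x y. cell \<rho> eps x = cell \<rho> eps y ==> \<bar>w x - w y\<bar> \<le> \<Lambda>" "!!x. \<bar>w x\<bar> \<le> B"
  and c: "\<bar>zsum (%x. if cell \<rho> eps x = c then \<eta> x else 0)\<bar> \<le> \<delta>"
 shows "\<bar>zsum (%x. if cell \<rho> eps x = c then \<eta> x * w x else 0)\<bar>
   \<le> B * \<delta> + \<Lambda> * zsum (%x. if cell \<rho> eps x = c then \<bar>\<eta> x\<bar> else 0)"
proof (cases "\<exists>y. cell \<rho> eps y = c")
 case True
 then obtain y where y: "cell \<rho> eps y = c" by blast
 let ?\<eta> = "%x. if cell \<rho> eps x = c then \<eta> x else 0"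
 have fs: "fin_supp ?\<eta>" using \<eta> unfolding fin_supp_def by (rule finite_subset[rotated]) auto
 then have fsa: "fin_supp (%x. \<bar>?\<eta> x\<bar>)" by (rule fin_supp_comp0) simp
 have "zsum (%x. if cell \<rho> eps x = c then \<eta> x * w x else 0) = zsum (%x. ?\<eta> x * w y + ?\<eta> x * (w x - w y))"
  by (rule arg_cong[where f=zsum]) (auto simp: algebra_simps)
 also have "... = zsum ?\<eta> * w y + zsum (%x. ?\<eta> x * (w x - w y))"
  using fs by (subst zsum_add) (auto intro!: fin_supp_mult_left simp: zsum_mult_right)
 finally have "\<bar>zsum (%x. if cell \<rho> eps x = c then \<eta> x * w x else 0)\<bar> \<le> \<bar>zsum ?\<eta> * w y\<bar> + \<bar>zsum (%x. ?\<eta> x * (w x - w y))\<bar>"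
  by (simp only: abs_triangle_ineq)
 also have "\<bar>zsum ?\<eta> * w y\<bar> \<le> \<delta> * B"
  unfolding abs_mult using c w(2) by (intro mult_mono) auto
 also have "\<bar>zsum (%x. ?\<eta> x * (w x - w y))\<bar> \<le> zsum (%x. \<bar>?\<eta> x * (w x - w y)\<bar>)"
  using fs by (intro zsum_abs fin_supp_mult_left)
 also have "... \<le> zsum (%x. \<Lambda> * \<bar>?\<eta> x\<bar>)"
 proof (intro zsum_mono fin_supp_mult_right fsa)
  show "fin_supp (%x. \<bar>?\<eta> x * (w x - w y)\<bar>)" unfolding abs_mult using fsa by (rule fin_supp_mult_left)
  show "\<bar>?\<eta> x * (w x - w y)\<bar> \<le> \<Lambda> * \<bar>?\<eta> x\<bar>" for x
   using mult_left_mono[OF w(1)[of x y], of "\<bar>\<eta> x\<bar>"] y by (auto simp: abs_mult mult.commute)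
 qed
 also have "... = \<Lambda> * zsum (%x. if cell \<rho> eps x = c then \<bar>\<eta> x\<bar> else 0)"
  unfolding zsum_cmult by (rule arg_cong[where f="%z. \<Lambda> * zsum z"]) auto
 finally show ?thesis by (simp add: mult.commute)
next
 case False
 then have "zsum (%x. if cell \<rho> eps x = c then g x else 0) = 0" for g :: "_ => real" by simp
 moreover have "B \<ge> 0" using w(2)[of undefined] by linarith
 moreover have "\<delta> \<ge> 0" using c by linarith
 ultimately show ?thesis by simp
qed

lemma zsum_by_cells:
 fixes \<eta> :: "int ^ 'd::finite => real"
 assumes "fin_supp \<eta>" "finite A" "!!x. \<eta> x ~= 0 ==> cell \<rho> eps x \<in> A"
 shows "zsum \<eta> = (\<Sum>c\<in>A. zsum (%x. if cell \<rho> eps x = c then \<eta> x else 0))"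
proof -
 have fs: "fin_supp (%x. if cell \<rho> eps x = c then \<eta> x else 0)" for c
  using assms(1) unfolding fin_supp_def by (rule finite_subset[rotated]) auto
 have "zsum \<eta> = zsum (%x. \<Sum>c\<in>A. if cell \<rho> eps x = c then \<eta> x else 0)"
  using assms(2,3) by (intro arg_cong[where f=zsum]) (auto simp: fun_eq_iff)
 then show ?thesis using zsum_sum[OF assms(2), of "%c x. if cell \<rho> eps x = c then \<eta> x else 0"] fs by simp
qed

lemma cell_same_close:
 assumes "cell \<rho> eps x = cell \<rho> eps y" "\<rho> > 0" "eps > 0"
 shows "\<bar>real_of_int (x $ i) - real_of_int (y $ i)\<bar> \<le> \<rho> / eps"
proof -
 have "\<lfloor>eps * real_of_int (x $ i) / \<rho>\<rfloor> = \<lfloor>eps * real_of_int (y $ i) / \<rho>\<rfloor>"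
  using assms(1) by (simp add: cell_def vec_eq_iff)
 then have "\<bar>eps * real_of_int (x $ i) / \<rho> - eps * real_of_int (y $ i) / \<rho>\<bar> \<le> 1" by linarith
 also have "eps * real_of_int (x $ i) / \<rho> - eps * real_of_int (y $ i) / \<rho> = (eps / \<rho>) * (real_of_int (x $ i) - real_of_int (y $ i))"
  by (simp add: diff_divide_distrib[symmetric] right_diff_distrib)
 finally have "(eps / \<rho>) * \<bar>real_of_int (x $ i) - real_of_int (y $ i)\<bar> \<le> 1"
  using assms(2,3) by (simp add: abs_mult)
 moreover have "t \<le> \<rho> / eps" if "(eps / \<rho>) * t \<le> 1" for t using that assms(2,3) by (simp add: field_simps)
 ultimately show ?thesis by blast
qed

text \<open>The difference of two averages is the average of a translation difference, and points of
  one cell are at most \<open>\<rho> / eps\<close> lattice steps apart in each coordinate.\<close>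

lemma bavg_cell_diff:
 fixes f :: "int ^ 'd::finite => real"
 assumes f: "fin_supp f" and eps: "0 < eps" and \<rho>: "0 < \<rho>" and s: "0 < s" "s \<le> real L * eps"
  and xy: "cell \<rho> eps x = cell \<rho> eps y"
 shows "\<bar>(bavg L f x)\<^sup>2 - (bavg L f y)^2\<bar> \<le> \<rho> * (real CARD('d) * (energy eps f + mass eps f) / s ^ CARD('d))"
proof -
 have L: "L > 0" using s eps by (cases L) auto
 define z where "z = x - y"
 have "(bavg L f x - bavg L f y) = bavg L (%u. f (u + z) - f u) y"
  by (simp add: bavg_def sum_subtractf diff_divide_distrib z_def algebra_simps)
 then have "(bavg L f x - bavg L f y)^2 \<le> zsum (%u. (f (u + z) - f u)^2) / real (L ^ CARD('d))"
  using bavg_sq_le_zsum[of "%u. f (u + z) - f u" L y] f by (simp add: fin_supp_diff fin_supp_shift)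
 also have "... \<le> ((\<rho> / eps)^2 * real CARD('d) * dirichlet_sum f) / real (L ^ CARD('d))"
  using cell_same_close[OF xy \<rho> eps] by (intro divide_right_mono zsum_shift_le f) (auto simp: z_def)
 also have "... = \<rho>\<^sup>2 * (real CARD('d) * energy eps f / (real L * eps) ^ CARD('d))"
  using eps by (simp add: energy_def power_mult_distrib power_divide)
 also have "... \<le> \<rho>\<^sup>2 * (real CARD('d) * energy eps f / s ^ CARD('d))"
  using s eps L by (intro mult_left_mono divide_left_mono power_mono mult_nonneg_nonneg energy_nonneg mult_pos_pos zero_less_power) auto
 finally have 1: "(bavg L f x - bavg L f y)^2 \<le> \<rho>\<^sup>2 * (real CARD('d) * energy eps f / s ^ CARD('d))" .
 have 2: "(bavg L f u)^2 \<le> real CARD('d) * mass eps f / s ^ CARD('d)" for u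
 proof -
  have "1 \<le> CARD('d)" using zero_less_card_finite[where 'a='d] by linarith
  then have "1 \<le> real CARD('d)" by linarith
  then have "1 * mass eps f \<le> real CARD('d) * mass eps f"
   using mass_nonneg[of eps f] eps by (intro mult_right_mono) auto
  then have "1 * mass eps f / s ^ CARD('d) \<le> real CARD('d) * mass eps f / s ^ CARD('d)"
   using s by (intro divide_right_mono) auto
  then show ?thesis using bavg_sq_le_mass[OF f eps s, of u] by linarith
 qed
 from sq_diff_le2[OF \<rho> 1 2 2] show ?thesis by (simp add: distrib_left add_divide_distrib)
qed

text \<open>High frequencies of \<open>f\<close> are controlled by telescoping over dyadic averages; the remaining average
 is slowly varying, so that on it \<open>\<eta>\<close> acts through its cell sums only.\<close>

lemma potential_form_small:
 fixes K M R \<delta> :: real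
 assumes K: "K > 1" "2 * K > real CARD('d::finite)" and \<delta>: "\<delta> > 0" and R: "R \<ge> 0" and M: "M > 0"
 shows "\<exists>\<rho>>0. \<exists>\<delta>1>0. \<exists>eps0>0. \<forall>eps (\<eta> :: int ^ 'd => real) f. 0 < eps --> eps < eps0 --> fin_supp \<eta> -->
   (\<forall>x i. \<eta> x ~= 0 --> \<bar>eps * real_of_int (x $ i)\<bar> \<le> R) -->
   eps ^ CARD('d) * zsum (%x. \<bar>\<eta> x\<bar> powr K) \<le> M --> eps ^ CARD('d) * zsum (%x. \<bar>\<eta> x\<bar>) \<le> M -->
   (\<forall>c. \<bar>eps ^ CARD('d) * zsum (%x. if cell \<rho> eps x = c then \<eta> x else 0)\<bar> \<le> \<delta>1) --> fin_supp f -->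
   \<bar>eps ^ CARD('d) * zsum (%x. \<eta> x * (f x)^2)\<bar> \<le> \<delta> * (energy eps f + mass eps f)"
proof -
 let ?d = "CARD('d)"
 define \<theta> where "\<theta> = 1 - real CARD('d) / (2 * K)"
 have \<theta>: "\<theta> > 0" using K by (simp add: \<theta>_def field_simps)
 define C1 where "C1 = M powr (1 / K) * real CARD('d) / (2 powr \<theta> - 1)^2"
 define C0 where "C0 = 2 * (C1 + M * 2 ^ ?d)"
 have C: "C1 \<ge> 0" "C0 > 0" using M by (auto simp: C1_def C0_def intro!: add_nonneg_pos divide_nonneg_nonneg)
 \<comment> \<open>\<open>\<kappa>\<close> lets the crude bound with constant \<open>C0\<close> take
   a quarter of \<open>\<delta>\<close>.\<close>
 define \<kappa> where "\<kappa> = \<delta> / (4 * C0)"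
 have \<kappa>: "\<kappa> > 0" "\<kappa> * C0 = \<delta> / 4" using C \<delta> by (auto simp: \<kappa>_def)
 \<comment> \<open>The averaging length depends on \<open>\<kappa>\<close>, since the high-frequency
   part carries the factor \<open>1 + 1 / \<kappa>\<close>; the added \<open>1\<close> only keeps
   the denominator positive.\<close>
 define r where "r = min 1 ((\<delta> / (4 * ((1 + 1 / \<kappa>) * C1 + 1))) powr (1 / (2 * \<theta>)))"
 have D: "(1 + 1 / \<kappa>) * C1 + 1 > 0" using C \<kappa> by (intro add_nonneg_pos mult_nonneg_nonneg) auto
 have r: "0 < r" "r \<le> 1" using \<delta> D by (auto simp: r_def)
 have rC: "(1 + 1 / \<kappa>) * (C1 * r powr (2 * \<theta>)) \<le> \<delta> / 4"
 proof -
  have "r powr (2 * \<theta>) \<le> ((\<delta> / (4 * ((1 + 1 / \<kappa>) * C1 + 1))) powr (1 / (2 * \<theta>))) powr (2 * \<theta>)"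
   using r \<theta> by (intro powr_mono2) (auto simp: r_def)
  also have "... = \<delta> / (4 * ((1 + 1 / \<kappa>) * C1 + 1))" using \<theta> \<delta> D by (simp add: powr_powr)
  moreover have "c * R \<le> \<delta> / 4" if "R \<le> \<delta> / (4 * c)" "c > 0" for c R :: real
   using that by (simp add: field_simps)
  ultimately have "((1 + 1 / \<kappa>) * C1 + 1) * r powr (2 * \<theta>) \<le> \<delta> / 4" using D by auto
  moreover have "(1 + 1 / \<kappa>) * (C1 * r powr (2 * \<theta>)) \<le> ((1 + 1 / \<kappa>) * C1 + 1) * r powr (2 * \<theta>)"
   by (simp add: algebra_simps)
  ultimately show ?thesis by linarith
 qed
 define s where "s = (r / 2) ^ ?d"
 have s: "s > 0" using r by (simp add: s_def)
 \<comment> \<open>The cells are chosen fine after \<open>r\<close>, so that the oscillation of the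
   squared average inside a cell costs a quarter of \<open>\<delta>\<close>.\<close>
 define \<rho> where "\<rho> = \<delta> * s / (4 * M * real ?d)"
 have \<rho>: "\<rho> > 0" using \<delta> s M by (simp add: \<rho>_def)
 define A where "A = {c :: int ^ 'd. \<forall>i. c $ i \<in> {- \<lceil>R / \<rho>\<rceil> - 1 .. \<lceil>R / \<rho>\<rceil> + 1}}"
 have finA: "finite A"
 proof -
  have "A \<subseteq> (%g. \<chi> i. g i) ` (PiE UNIV (%_. {- \<lceil>R / \<rho>\<rceil> - 1 .. \<lceil>R / \<rho>\<rceil> + 1}))"
  proof
   fix c assume "c \<in> A"
   then show "c \<in> (%g. \<chi> i. g i) ` (PiE UNIV (%_. {- \<lceil>R / \<rho>\<rceil> - 1 .. \<lceil>R / \<rho>\<rceil> + 1}))"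
    by (intro image_eqI[of _ _ "%i. c $ i"]) (auto simp: A_def vec_eq_iff)
  qed
  then show ?thesis by (rule finite_subset) (intro finite_imageI finite_PiE, auto)
 qed
 \<comment> \<open>The admissible cell sum comes last: it is paid once for each of the finitely many
   cells in \<open>A\<close>.\<close>
 define \<delta>1 where "\<delta>1 = \<delta> * s / (4 * (real (card A) + 1))"
 have \<delta>1: "\<delta>1 > 0" using \<delta> s by (simp add: \<delta>1_def)
 have "\<bar>eps ^ ?d * zsum (%x. \<eta> x * (f x)^2)\<bar> \<le> \<delta> * (energy eps f + mass eps f)"
  if eps: "0 < eps" "eps < r" and \<eta>: "fin_supp \<eta>" and \<eta>R: "!!x i. \<eta> x ~= 0 ==> \<bar>eps * real_of_int (x $ i)\<bar> \<le> R"
   and MK: "eps ^ ?d * zsum (%x. \<bar>\<eta> x\<bar> powr K) \<le> M" and M1: "eps ^ ?d * zsum (%x. \<bar>\<eta> x\<bar>) \<le> M"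
   and cells: "!!c. \<bar>eps ^ ?d * zsum (%x. if cell \<rho> eps x = c then \<eta> x else 0)\<bar> \<le> \<delta>1"
   and f: "fin_supp f" for eps \<eta> and f :: "int ^ 'd => real"
 proof -
  let ?p = "eps ^ ?d"
  define T where "T = energy eps f + mass eps f"
  have T: "T \<ge> 0" "energy eps f \<le> T" "mass eps f \<le> T"
   using eps energy_nonneg[of eps f] mass_nonneg[of eps f] by (auto simp: T_def)
  have p: "?p > 0" using eps by simp
  have fa: "fin_supp (%x. \<bar>\<eta> x\<bar>)" using \<eta> by (rule fin_supp_comp0) simp
  obtain J where J: "2 ^ J * eps \<le> r" "r / 2 < 2 ^ J * eps" using dyadic_scale[of eps r] eps by auto
  let ?g = "bavg (2 ^ J) f"
  have high: "?p * zsum (%x. \<bar>\<eta> x\<bar> * (f x - ?g x)^2) \<le> C1 * r powr (2 * \<theta>) * energy eps f"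
   unfolding C1_def \<theta>_def by (rule weighted_diff_bavg_scaled[OF _ fa f K MK eps(1) J(1)]) simp
  have tot: "?p * zsum (%x. \<bar>\<eta> x\<bar> * (f x)^2) \<le> C0 * T"
   unfolding C0_def C1_def \<theta>_def T_def using eps r
   by (intro weighted_mass_le fa f K MK M1) auto
  have "\<bar>zsum (%x. \<eta> x * (f x)^2) - zsum (%x. \<eta> x * (?g x)^2)\<bar> = \<bar>zsum (%x. \<eta> x * ((f x)^2 - (?g x)^2))\<bar>"
   using \<eta> by (simp add: zsum_diff[symmetric] fin_supp_mult_left right_diff_distrib)
  also have "... \<le> zsum (%x. \<bar>\<eta> x * ((f x)^2 - (?g x)^2)\<bar>)"
   using \<eta> by (intro zsum_abs fin_supp_mult_left)
  also have "... \<le> zsum (%x. (1 + 1 / \<kappa>) * (\<bar>\<eta> x\<bar> * (f x - ?g x)^2) + \<kappa> * (\<bar>\<eta> x\<bar> * (f x)^2))"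
  proof (intro zsum_mono fin_supp_add)
   show "fin_supp (%x. \<bar>\<eta> x * ((f x)^2 - (?g x)^2)\<bar>)" unfolding abs_mult using fa by (rule fin_supp_mult_left)
   show "fin_supp (%x. (1 + 1 / \<kappa>) * (\<bar>\<eta> x\<bar> * (f x - ?g x)^2))" "fin_supp (%x. \<kappa> * (\<bar>\<eta> x\<bar> * (f x)^2))"
    using fa by (auto intro!: fin_supp_mult_left fin_supp_mult_right[of "%x. \<bar>\<eta> x\<bar> * _ x"])
   fix x
   have "\<bar>\<eta> x\<bar> * \<bar>(f x)\<^sup>2 - (?g x)^2\<bar> \<le> \<bar>\<eta> x\<bar> * ((1 + 1 / \<kappa>) * (f x - ?g x)^2 + \<kappa> * (f x)^2)"
    by (intro mult_left_mono sq_diff_le \<kappa>) auto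
   then show "\<bar>\<eta> x * ((f x)^2 - (?g x)^2)\<bar> \<le> (1 + 1 / \<kappa>) * (\<bar>\<eta> x\<bar> * (f x - ?g x)^2) + \<kappa> * (\<bar>\<eta> x\<bar> * (f x)^2)"
    unfolding abs_mult by (simp add: algebra_simps)
  qed
  also have "... = (1 + 1 / \<kappa>) * zsum (%x. \<bar>\<eta> x\<bar> * (f x - ?g x)^2) + \<kappa> * zsum (%x. \<bar>\<eta> x\<bar> * (f x)^2)"
  proof -
   have "fin_supp (%x. (1 + 1 / \<kappa>) * (\<bar>\<eta> x\<bar> * (f x - ?g x)^2))" "fin_supp (%x. \<kappa> * (\<bar>\<eta> x\<bar> * (f x)^2))"
    using fa by (auto intro!: fin_supp_mult_left fin_supp_mult_right[of "%x. \<bar>\<eta> x\<bar> * _ x"])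
   then show ?thesis by (simp only: zsum_add zsum_cmult)
  qed
  finally have "?p * \<bar>zsum (%x. \<eta> x * (f x)^2) - zsum (%x. \<eta> x * (?g x)^2)\<bar> \<le>
    ?p * ((1 + 1 / \<kappa>) * zsum (%x. \<bar>\<eta> x\<bar> * (f x - ?g x)^2) + \<kappa> * zsum (%x. \<bar>\<eta> x\<bar> * (f x)^2))"
   using p by (intro mult_left_mono) auto
  also have "... = (1 + 1 / \<kappa>) * (?p * zsum (%x. \<bar>\<eta> x\<bar> * (f x - ?g x)^2)) + \<kappa> * (?p * zsum (%x. \<bar>\<eta> x\<bar> * (f x)^2))"
   by (simp only: distrib_left mult.left_commute)
  also have "... \<le> (1 + 1 / \<kappa>) * (C1 * r powr (2 * \<theta>) * energy eps f) + \<kappa> * (C0 * T)"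
   using \<kappa> by (intro add_mono mult_left_mono high tot) auto
  also have "... = ((1 + 1 / \<kappa>) * (C1 * r powr (2 * \<theta>))) * energy eps f + (\<kappa> * C0) * T" by (simp only: mult.assoc)
  also have "... \<le> \<delta> / 4 * T + \<delta> / 4 * T"
   unfolding \<kappa>(2) using rC T \<delta> energy_nonneg[of eps f] eps by (intro add_mono mult_mono) auto
  finally have diff: "\<bar>?p * zsum (%x. \<eta> x * (f x)^2) - ?p * zsum (%x. \<eta> x * (?g x)^2)\<bar> \<le> \<delta> / 2 * T"
   using p by (simp add: abs_mult right_diff_distrib[symmetric] mult.commute[of \<delta>])
  let ?\<Lambda> = "\<rho> * (real ?d * T / s)"
  have L: "0 < r / 2" "r / 2 \<le> real (2 ^ J) * eps" using r J by auto
  have var: "\<bar>(?g x)\<^sup>2 - (?g y)^2\<bar> \<le> ?\<Lambda>" if "cell \<rho> eps x = cell \<rho> eps y" for x y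
   unfolding s_def T_def by (rule bavg_cell_diff[OF f eps(1) \<rho> L that])
  have bd: "\<bar>(?g x)\<^sup>2\<bar> \<le> T / s" for x
  proof -
   have "(?g x)^2 \<le> mass eps f / s" unfolding s_def by (rule bavg_sq_le_mass[OF f eps(1) L])
   also have "... \<le> T / s" using T s by (intro divide_right_mono) auto
   finally show ?thesis by simp
  qed
  have cellA: "cell \<rho> eps x \<in> A" if "\<eta> x ~= 0" for x
  proof -
   have "- \<lceil>R / \<rho>\<rceil> - 1 \<le> \<lfloor>eps * real_of_int (x $ i) / \<rho>\<rfloor> \<and> \<lfloor>eps * real_of_int (x $ i) / \<rho>\<rfloor> \<le> \<lceil>R / \<rho>\<rceil> + 1" for i
   proof -
    have "\<bar>eps * real_of_int (x $ i) / \<rho>\<bar> \<le> R / \<rho>" using \<eta>R[OF that, of i] \<rho> by (simp add: divide_right_mono)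
    then show ?thesis by linarith
   qed
   then show ?thesis by (simp add: A_def cell_def)
  qed
  have fg: "fin_supp (%x. \<eta> x * (?g x)^2)" using \<eta> by (rule fin_supp_mult_left)
  have "zsum (%x. \<eta> x * (?g x)^2) = (\<Sum>c\<in>A. zsum (%x. if cell \<rho> eps x = c then \<eta> x * (?g x)^2 else 0))"
   by (rule zsum_by_cells[OF fg finA]) (use cellA in auto)
  also have "\<bar>...\<bar> \<le> (\<Sum>c\<in>A. T / s * (\<delta>1 / ?p) + ?\<Lambda> * zsum (%x. if cell \<rho> eps x = c then \<bar>\<eta> x\<bar> else 0))"
  proof (rule order_trans[OF sum_abs sum_mono])
   fix c
   have "\<bar>zsum (%x. if cell \<rho> eps x = c then \<eta> x else 0)\<bar> \<le> \<delta>1 / ?p"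
    using cells[of c] p by (simp add: abs_mult field_simps)
   then show "\<bar>zsum (%x. if cell \<rho> eps x = c then \<eta> x * (?g x)^2 else 0)\<bar>
     \<le> T / s * (\<delta>1 / ?p) + ?\<Lambda> * zsum (%x. if cell \<rho> eps x = c then \<bar>\<eta> x\<bar> else 0)"
    by (intro zsum_cell_le[OF \<eta> var bd])
  qed
  also have "... = real (card A) * (T / s * (\<delta>1 / ?p)) + ?\<Lambda> * zsum (%x. \<bar>\<eta> x\<bar>)"
  proof -
   have "zsum (%x. \<bar>\<eta> x\<bar>) = (\<Sum>c\<in>A. zsum (%x. if cell \<rho> eps x = c then \<bar>\<eta> x\<bar> else 0))"
    by (rule zsum_by_cells[OF fa finA]) (use cellA in auto)
   then show ?thesis by (simp add: sum.distrib sum_distrib_left)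
  qed
  finally have "?p * \<bar>zsum (%x. \<eta> x * (?g x)^2)\<bar> \<le> ?p * (real (card A) * (T / s * (\<delta>1 / ?p)) + ?\<Lambda> * zsum (%x. \<bar>\<eta> x\<bar>))"
   using p by (intro mult_left_mono) auto
  also have "... = real (card A) * (T / s * \<delta>1) + ?\<Lambda> * (?p * zsum (%x. \<bar>\<eta> x\<bar>))"
   using p eps(1) by (simp add: distrib_left)
  also have "... \<le> \<delta> / 4 * T + ?\<Lambda> * M"
  proof (intro add_mono mult_left_mono M1)
   have "real (card A) * (T / s * \<delta>1) = (\<delta> / 4 * T) * (real (card A) / (real (card A) + 1))"
    using s by (simp add: \<delta>1_def)
   also have "... \<le> (\<delta> / 4 * T) * 1" using T \<delta> by (intro mult_left_mono) auto
   finally show "real (card A) * (T / s * \<delta>1) \<le> \<delta> / 4 * T" by simp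
   show "0 \<le> ?\<Lambda>" using \<rho> T s by (intro mult_nonneg_nonneg divide_nonneg_nonneg) auto
  qed
  also have "?\<Lambda> * M = \<delta> / 4 * T" using s M by (simp add: \<rho>_def)
  finally have "\<bar>?p * zsum (%x. \<eta> x * (?g x)^2)\<bar> \<le> \<delta> / 2 * T"
   using p by (simp add: abs_mult mult.commute[of \<delta>])
  then have "\<bar>?p * zsum (%x. \<eta> x * (f x)^2)\<bar> \<le> \<delta> * T" using diff by linarith
  then show ?thesis by (simp add: T_def)
 qed
 then show ?thesis using \<rho> \<delta>1 r(1) by blast
qed

section \<open>Smooth interpolation kernels\<close>

primrec Dk :: "nat => (real => real) => bool" where
 "Dk 0 f \<longleftrightarrow> continuous_on UNIV f"
| "Dk (Suc n) f \<longleftrightarrow> (\<exists>g. (\<forall>t. DERIV f t :> g t) \<and> Dk n g)"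

lemma Dk_SucI: "(!!t. DERIV f t :> g t) ==> Dk n g ==> Dk (Suc n) f"
 by auto

lemma Dk_Suc_imp: "Dk (Suc n) f ==> Dk n f"
proof (induction n arbitrary: f)
 case 0
 then obtain g where "!!t. DERIV f t :> g t" by auto
 then show ?case by (auto intro: DERIV_isCont continuous_at_imp_continuous_on)
next
 case (Suc n)
 then obtain g where g: "!!t. DERIV f t :> g t" "Dk (Suc n) g" by auto
 show ?case by (rule Dk_SucI[OF g(1) Suc.IH[OF g(2)]])
qed

lemma Dk_const: "Dk n (%t. c)"
proof (induction n arbitrary: c)
 case 0
 show ?case by simp
next
 case (Suc n)
 show ?case by (rule Dk_SucI[OF _ Suc[of 0]]) simp
qed

lemma Dk_add: "Dk n f ==> Dk n g ==> Dk n (%t. f t + g t)"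
proof (induction n arbitrary: f g)
 case 0
 then show ?case by (simp add: continuous_on_add)
next
 case (Suc n)
 then obtain f' g' where *: "!!t. DERIV f t :> f' t" "Dk n f'" "!!t. DERIV g t :> g' t" "Dk n g'" by auto
 show ?case by (rule Dk_SucI[OF DERIV_add[OF *(1,3)] Suc.IH[OF *(2,4)]])
qed

lemma Dk_mult: "Dk n f ==> Dk n g ==> Dk n (%t. f t * g t)"
proof (induction n arbitrary: f g)
 case 0
 then show ?case by (simp add: continuous_on_mult)
next
 case (Suc n)
 then obtain f' g' where *: "!!t. DERIV f t :> f' t" "Dk n f'" "!!t. DERIV g t :> g' t" "Dk n g'" by auto
 have "Dk n f" "Dk n g" using Suc.prems Dk_Suc_imp by blast+
 then show ?case
  by (intro Dk_SucI[OF DERIV_mult[OF *(1,3)]] Dk_add Suc.IH *)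
qed

lemma Dk_cmult: "Dk n f ==> Dk n (%t. c * f t)"
 by (intro Dk_mult Dk_const)

lemma Dk_inverse: "Dk n f ==> (!!t. f t ~= 0) ==> Dk n (%t. inverse (f t))"
proof (induction n arbitrary: f)
 case 0
 then show ?case by (auto intro: continuous_on_inverse)
next
 case (Suc n)
 then obtain f' where *: "!!t. DERIV f t :> f' t" "Dk n f'" by auto
 have "Dk n f" using Suc.prems Dk_Suc_imp by blast
 then have "Dk n (%t. inverse (f t))" using Suc.IH Suc.prems(2) by blast
 then have "Dk n (%t. -1 * (inverse (f t) * f' t * inverse (f t)))"
  by (intro Dk_cmult Dk_mult *)
 moreover have "DERIV (%t. inverse (f t)) t :> -1 * (inverse (f t) * f' t * inverse (f t))" for t
  using DERIV_inverse'[OF *(1) Suc.prems(2)] by simp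
 ultimately show ?case by (intro Dk_SucI)
qed

lemma Dk_affine: "Dk n f ==> Dk n (%t. f (a * t + b))"
proof (induction n arbitrary: f)
 case 0
 then show ?case by (auto intro!: continuous_on_compose2[of UNIV f] continuous_intros)
next
 case (Suc n)
 then obtain f' where *: "!!t. DERIV f t :> f' t" "Dk n f'" by auto
 have "DERIV (%t. f (a * t + b)) t :> a * f' (a * t + b)" for t
 proof -
  have "DERIV (%t. a * t + b) t :> a" by (auto intro!: derivative_eq_intros)
  from DERIV_chain2[OF *(1) this] show ?thesis by (simp add: mult.commute)
 qed
 then show ?case by (intro Dk_SucI[OF _ Dk_cmult[OF Suc.IH[OF *(2)]]])
qed

lemma poly_div_exp_tendsto_0: "((%s. poly p s / exp s) \<longlongrightarrow> (0::real)) at_top"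
proof -
 have "((%s. \<Sum>i\<le>degree p. coeff p i * (s ^ i / exp s)) \<longlongrightarrow> (\<Sum>i\<le>degree p. coeff p i * 0)) at_top"
  by (intro tendsto_sum tendsto_mult tendsto_const tendsto_power_div_exp_0)
 then show ?thesis by (simp add: poly_altdef sum_divide_distrib)
qed

text \<open>This family is closed under differentiation, which turns smoothness of the flat function
  \<open>exp (- 1 / t)\<close> at \<open>0\<close> into an induction over the order with arbitrary
  \<open>p\<close>.\<close>

definition poly_exp_inv :: "real poly => real => real" where
 "poly_exp_inv p t = (if t > 0 then poly p (1 / t) * exp (- 1 / t) else 0)"

lemma poly_exp_inv_tendsto_0: "(poly_exp_inv p \<longlongrightarrow> 0) (at_right 0)"
proof -
 have "((%t. poly p (inverse t) / exp (inverse t)) \<longlongrightarrow> 0) (at_right 0)"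
  by (rule filterlim_compose[OF poly_div_exp_tendsto_0 filterlim_inverse_at_top_right])
 moreover have "\<forall>\<^sub>F t in at_right 0. poly p (inverse t) / exp (inverse t) = poly_exp_inv p t"
  by (auto simp: eventually_at_filter poly_exp_inv_def exp_minus field_simps)
 ultimately show ?thesis by (rule Lim_transform_eventually)
qed

lemma poly_exp_inv_deriv:
 "DERIV (poly_exp_inv p) t :> poly_exp_inv ([:0, 0, 1:] * (p - pderiv p)) t"
proof -
 consider "t > 0" | "t < 0" | "t = 0" by linarith
 then show ?thesis
 proof cases
  case 1
  have "DERIV (%t. poly p (1 / t) * exp (- 1 / t)) t :> poly_exp_inv ([:0, 0, 1:] * (p - pderiv p)) t"
   using 1 by (auto intro!: derivative_eq_intros simp: poly_exp_inv_def power2_eq_square field_simps)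
  then show ?thesis
   by (rule has_field_derivative_transform_within[of _ _ _ _ t]) (use 1 in \<open>auto simp: poly_exp_inv_def dist_real_def\<close>)
 next
  case 2
  have "DERIV (%t. 0) t :> poly_exp_inv ([:0, 0, 1:] * (p - pderiv p)) t"
   using 2 by (simp add: poly_exp_inv_def)
  then show ?thesis
   by (rule has_field_derivative_transform_within[of _ _ _ _ "-t"]) (use 2 in \<open>auto simp: poly_exp_inv_def dist_real_def\<close>)
 next
  case 3
  \<comment> \<open>To the right of \<open>0\<close> the difference quotient is again a member of
    the family, with \<open>p\<close> multiplied by the variable.\<close>
  have R: "((%y. poly_exp_inv p y / y) \<longlongrightarrow> 0) (at_right 0)"
  proof (rule Lim_transform_eventually[OF poly_exp_inv_tendsto_0[of "[:0, 1:] * p"]])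
   show "\<forall>\<^sub>F y in at_right 0. poly_exp_inv ([:0, 1:] * p) y = poly_exp_inv p y / y"
    by (auto simp: eventually_at_filter poly_exp_inv_def)
  qed
  have L: "((%y. poly_exp_inv p y / y) \<longlongrightarrow> 0) (at_left 0)"
  proof (rule Lim_transform_eventually[OF tendsto_const])
   show "\<forall>\<^sub>F y in at_left 0. 0 = poly_exp_inv p y / y"
    by (auto simp: eventually_at_filter poly_exp_inv_def)
  qed
  have "((%y. poly_exp_inv p y / y) \<longlongrightarrow> 0) (at 0)"
   using L R by (simp add: filterlim_at_split)
  then show ?thesis using 3 by (simp add: has_field_derivative_iff poly_exp_inv_def)
 qed
qed

lemma Dk_poly_exp_inv: "Dk n (poly_exp_inv p)"
proof (induction n arbitrary: p)
 case 0
 show ?case using poly_exp_inv_deriv by (auto intro: DERIV_isCont continuous_at_imp_continuous_on)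
next
 case (Suc n)
 show ?case by (rule Dk_SucI[OF poly_exp_inv_deriv Suc])
qed

text \<open>A quotient of flat functions; its denominator \<open>N\<close> is positive because
  \<open>\<delta> + t\<close> and \<open>\<delta> - t\<close> are never both nonpositive.\<close>

lemma smooth_step_exists:
 assumes "\<delta> > 0"
 shows "\<exists>S. (\<forall>n. Dk n S) \<and> mono S \<and> (\<forall>t\<le>-\<delta>. S t = 0) \<and> (\<forall>t\<ge>\<delta>. S t = 1)"
proof -
 define B where "B = poly_exp_inv 1"
 have B0: "B t = 0" if "t \<le> 0" for t using that by (simp add: B_def poly_exp_inv_def)
 have Bpos: "B t > 0" if "t > 0" for t using that by (simp add: B_def poly_exp_inv_def)
 have Bnn: "B t \<ge> 0" for t by (simp add: B_def poly_exp_inv_def)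
 have Bmono: "B s \<le> B t" if "s \<le> t" for s t
  using that by (auto simp: B_def poly_exp_inv_def field_simps)
 define N where "N t = B (\<delta> + t) + B (\<delta> - t)" for t
 have N: "N t > 0" for t
 proof (cases "\<delta> + t > 0")
  case True
  then show ?thesis using Bpos[OF True] Bnn[of "\<delta> - t"] by (simp add: N_def)
 next
  case False
  then have "\<delta> - t > 0" using assms by linarith
  then show ?thesis using Bpos[of "\<delta> - t"] Bnn[of "\<delta> + t"] by (simp add: N_def)
 qed
 define S where "S t = B (\<delta> + t) * inverse (N t)" for t
 have D1: "Dk n (%t. B (\<delta> + t))" for n
  using Dk_affine[OF Dk_poly_exp_inv, of n 1 1 \<delta>] by (simp add: B_def add.commute)
 have D2: "Dk n (%t. B (\<delta> - t))" for n
  using Dk_affine[OF Dk_poly_exp_inv, of n 1 "-1" \<delta>] by (simp add: B_def)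
 have "Dk n S" for n
  unfolding S_def N_def by (intro Dk_mult Dk_inverse Dk_add D1 D2) (use N in \<open>auto simp: N_def less_imp_neq[THEN not_sym]\<close>)
 moreover have "mono S"
 proof
  fix s t :: real assume st: "s \<le> t"
  have "B (\<delta> + s) * N t \<le> B (\<delta> + t) * N s"
  proof -
   have "B (\<delta> + s) * B (\<delta> - t) \<le> B (\<delta> + t) * B (\<delta> - s)"
    using st by (intro mult_mono Bmono Bnn) auto
   then show ?thesis by (simp add: N_def algebra_simps)
  qed
  then show "S s \<le> S t" using N[of s] N[of t] by (simp add: S_def field_simps)
 qed
 moreover have "S t = 0" if "t \<le> - \<delta>" for t using that by (simp add: S_def B0)
 moreover have "S t = 1" if "t \<ge> \<delta>" for t using that N[of t] by (simp add: S_def N_def B0)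
 ultimately show ?thesis by blast
qed

text \<open>\<open>h\<close> is a mollified hat function and \<open>k\<close> a mollified indicator of an interval.\<close>

lemma smooth_hat_exists:
 assumes \<delta>: "0 < \<delta>" "\<delta> < 1"
 obtains h k :: "real => real" where "!!n. Dk n h" "continuous_on UNIV k"
  "!!t. DERIV h t :> k t - k (t - 1)" "!!t. 0 \<le> h t" "!!t. 0 \<le> k t"
  "!!t. 1 + \<delta> \<le> \<bar>t\<bar> ==> h t = 0" "!!t. 1 + \<delta> \<le> \<bar>t\<bar> ==> k t = 0"
  "!!t a b. real_of_int a \<le> t - 2 ==> t + 2 \<le> real_of_int b ==> (\<Sum>n\<in>{a..b}. h (t - real_of_int n)) = 1"
  "!!t a b. real_of_int a \<le> t - 2 ==> t + 2 \<le> real_of_int b ==> (\<Sum>n\<in>{a..b}. k (t - real_of_int n)) = 1"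
proof -
 obtain S where S: "!!n. Dk n S" "mono S" "!!t. t \<le> -\<delta> ==> S t = 0" "!!t. t \<ge> \<delta> ==> S t = 1"
  using smooth_step_exists[OF \<delta>(1)] by blast
 have Sc: "continuous_on UNIV S" using S(1)[of 0] by simp
 \<comment> \<open>The antiderivative may start at \<open>-1\<close> because \<open>S\<close>
   vanishes to the left of \<open>- \<delta>\<close>, which exceeds \<open>-1\<close>.\<close>
 define T where "T t = integral {-1..t} S" for t
 have T: "DERIV T t :> S t" for t
 proof (cases "t > -1")
  case True
  have "(T has_real_derivative S t) (at t within {-1..t+1})"
   unfolding T_def using True
   by (intro integral_has_real_derivative continuous_on_subset[OF Sc]) auto
  moreover have "at t within {-1..t+1} = at t"
   using True by (intro at_within_interior) auto
  ultimately show ?thesis by simp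
 next
  case False
  have "T s = 0" if "s < - \<delta>" for s
  proof (cases "s \<ge> -1")
   case True
   have "integral {-1..s} S = integral {-1..s} (%x. 0)"
    using that S(3) by (intro integral_cong) auto
   then show ?thesis by (simp add: T_def)
  qed (simp add: T_def)
  moreover have "t < - \<delta>" "S t = 0" using False \<delta> S(3) by auto
  ultimately show ?thesis
   by (intro has_field_derivative_transform_within[of "%_. 0" "S t" t UNIV "-\<delta> - t" T]) (auto simp: dist_real_def)
 qed
 have TD: "Dk n T" for n
  by (rule Dk_Suc_imp) (rule Dk_SucI[OF T S(1)])
 \<comment> \<open>\<open>k\<close> and \<open>u\<close> are unit differences of \<open>S\<close>
   and \<open>T\<close>, and \<open>h\<close> is a unit difference of \<open>u\<close>. Hence the
   derivative of \<open>h\<close> is a difference of two translates of \<open>k\<close>, and the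
   integer translates of either kernel telescope to \<open>1\<close>.\<close>
 define k where "k t = S (t + 1) - S t" for t
 define u where "u t = T (t + 1) - T t" for t
 define h where "h t = u t - u (t - 1)" for t
 have u_mvt: "\<exists>z. t < z \<and> z < t + 1 \<and> u t = S z" for t
  using MVT2[of t "t + 1" T S] T by (auto simp: u_def)
 have u1: "u t = 1" if "t \<ge> \<delta>" for t using u_mvt[of t] S(4) that by force
 have u0: "u t = 0" if "t \<le> -1 - \<delta>" for t using u_mvt[of t] S(3) that by force
 have k_eq: "k t = S (t + 1) - S t" for t by (simp add: k_def)
 show ?thesis
 proof
  show "Dk n h" for n
  proof -
   have "Dk n (%t. T (1 * t + 1) + (-2) * T t + T (1 * t + (-1)))"
    by (intro Dk_add Dk_cmult Dk_affine TD)
   moreover have "h = (%t. T (1 * t + 1) + (-2) * T t + T (1 * t + (-1)))"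
    by (simp add: h_def u_def fun_eq_iff)
   ultimately show ?thesis by simp
  qed
  show "continuous_on UNIV k" unfolding k_def
   by (intro continuous_intros continuous_on_compose2[OF Sc]) auto
  show "DERIV h t :> k t - k (t - 1)" for t
  proof -
   have "DERIV (%t. T (t + 1) - T t - (T (t - 1 + 1) - T (t - 1))) t
     :> S (t + 1) * 1 - S t - (S (t - 1 + 1) * 1 - S (t - 1) * 1)"
    by (intro DERIV_diff T DERIV_chain2[OF T]) (auto intro!: derivative_eq_intros)
   moreover have "h = (%t. T (t + 1) - T t - (T (t - 1 + 1) - T (t - 1)))"
    by (simp add: h_def u_def fun_eq_iff)
   ultimately show ?thesis by (simp add: k_def)
  qed
  show "0 \<le> k t" for t using monoD[OF S(2), of t "t + 1"] by (simp add: k_def)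
  show "0 \<le> h t" for t
  proof -
   obtain z where z: "t < z" "u t = S z" using u_mvt by blast
   obtain z' where z': "z' < t - 1 + 1" "u (t - 1) = S z'" using u_mvt[of "t - 1"] by auto
   show ?thesis using monoD[OF S(2), of z' z] z z' by (simp add: h_def)
  qed
  show "h t = 0" if "1 + \<delta> \<le> \<bar>t\<bar>" for t
  proof (cases "t \<ge> 0")
   case True
   then show ?thesis using that u1[of t] u1[of "t - 1"] \<delta> by (simp add: h_def)
  next
   case False
   then show ?thesis using that u0[of t] u0[of "t - 1"] \<delta> by (simp add: h_def)
  qed
  show "k t = 0" if "1 + \<delta> \<le> \<bar>t\<bar>" for t
  proof (cases "t \<ge> 0")
   case True
   then show ?thesis using that S(4)[of t] S(4)[of "t + 1"] \<delta> by (simp add: k_def)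
  next
   case False
   then show ?thesis using that S(3)[of t] S(3)[of "t + 1"] \<delta> by (simp add: k_def)
  qed
  have tele: "(\<Sum>n\<in>{a..b}. g (t - real_of_int n) - g (t - real_of_int n - 1)) = g (t - real_of_int a) - g (t - real_of_int b - 1)"
   if "a \<le> b" for g :: "real => real" and t a b
   using that
  proof (induction b rule: int_ge_induct)
   case base
   then show ?case by simp
  next
   case (step b)
   have "{a..b+1} = insert (b + 1) {a..b}" using step by auto
   then show ?case using step by (simp add: algebra_simps)
  qed
  show "(\<Sum>n\<in>{a..b}. h (t - real_of_int n)) = 1" if "real_of_int a \<le> t - 2" "t + 2 \<le> real_of_int b" for t a b
  proof -
   have "a \<le> b" using that by linarith
   from tele[OF this, of u t] show ?thesis using that \<delta> u1[of "t - real_of_int a"] u0[of "t - real_of_int b - 1"]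
    by (simp add: h_def)
  qed
  show "(\<Sum>n\<in>{a..b}. k (t - real_of_int n)) = 1" if "real_of_int a \<le> t - 2" "t + 2 \<le> real_of_int b" for t a b
  proof -
   have "a \<le> b" using that by linarith
   from tele[OF this, of "%s. S (s + 1)" t] show ?thesis using that \<delta> S(4)[of "t - real_of_int a + 1"] S(3)[of "t - real_of_int b"]
    by (simp add: k_def)
  qed
 qed
qed

section \<open>Gradients and smooth functions of several variables\<close>

lemma GDERIV_unique: "GDERIV f x :> a ==> GDERIV f x :> b ==> a = b"
proof -
 assume "GDERIV f x :> a" "GDERIV f x :> b"
 then have "(%h. h \<bullet> a) = (%h. h \<bullet> b)" unfolding gderiv_def by (rule has_derivative_unique)
 then have "!!h. h \<bullet> (a - b) = 0" by (metis inner_diff_right right_minus_eq)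
 from this[of "a - b"] show ?thesis by simp
qed

lemma grad_eq: "GDERIV f x :> g ==> grad f x = g" for f :: "real ^ 'd::finite => real"
 unfolding grad_def using GDERIV_unique by (intro the_equality) blast+

lemma Ck_SucI: "(!!x. GDERIV f x :> g x) ==> (!!i. Ck n (%x. g x $ i)) ==> Ck (Suc n) f"
 by auto

lemma Ck_Suc_imp: "Ck (Suc n) f ==> Ck n f"
proof (induction n arbitrary: f)
 case 0
 then obtain g where "!!t. GDERIV f t :> g t" by auto
 then show ?case
  by (auto simp: gderiv_def intro!: continuous_at_imp_continuous_on has_derivative_continuous)
next
 case (Suc n)
 then obtain g where g: "!!t. GDERIV f t :> g t" "!!i. Ck (Suc n) (%x. g x $ i)" by auto
 show ?case by (rule Ck_SucI[OF g(1) Suc.IH[OF g(2)]])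
qed

lemma Ck_const: "Ck n (%t. c)"
proof (induction n arbitrary: c)
 case 0
 show ?case by simp
next
 case (Suc n)
 show ?case by (rule Ck_SucI[OF GDERIV_const]) (simp add: Suc)
qed

lemma Ck_add: "Ck n f ==> Ck n g ==> Ck n (%t. f t + g t)"
proof (induction n arbitrary: f g)
 case 0
 then show ?case by (simp add: continuous_on_add)
next
 case (Suc n)
 then obtain f' g' where *: "!!t. GDERIV f t :> f' t" "!!i. Ck n (%x. f' x $ i)"
  "!!t. GDERIV g t :> g' t" "!!i. Ck n (%x. g' x $ i)" by auto
 show ?case by (rule Ck_SucI[OF GDERIV_add[OF *(1,3)]]) (simp add: Suc.IH *)
qed

lemma Ck_mult: "Ck n f ==> Ck n g ==> Ck n (%t. f t * g t)"
proof (induction n arbitrary: f g)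
 case 0
 then show ?case by (simp add: continuous_on_mult)
next
 case (Suc n)
 then obtain f' g' where *: "!!t. GDERIV f t :> f' t" "!!i. Ck n (%x. f' x $ i)"
  "!!t. GDERIV g t :> g' t" "!!i. Ck n (%x. g' x $ i)" by auto
 have "Ck n f" "Ck n g" using Suc.prems Ck_Suc_imp by blast+
 then show ?case by (intro Ck_SucI[OF GDERIV_mult[OF *(1,3)]]) (simp add: Ck_add Suc.IH *)
qed

lemma Ck_sum: "finite I ==> (!!i. i \<in> I ==> Ck n (f i)) ==> Ck n (%x. \<Sum>i\<in>I. f i x)"
 by (induction I rule: finite_induct) (auto intro: Ck_add Ck_const)

lemma Ck_prod: "finite I ==> (!!i. i \<in> I ==> Ck n (f i)) ==> Ck n (%x. \<Prod>i\<in>I. f i x)"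
 by (induction I rule: finite_induct) (auto intro: Ck_mult Ck_const)

lemma GDERIV_nth: "GDERIV (%x::real ^ 'd::finite. x $ i) x :> axis i 1"
 unfolding gderiv_def inner_axis by (auto intro!: bounded_linear_imp_has_derivative bounded_linear_vec_nth)

lemma GDERIV_affine_coordinate:
 assumes "!!t. DERIV p t :> p' t"
 shows "GDERIV (%x::real ^ 'd::finite. p (a * x $ i + b)) x :> (a * p' (a * x $ i + b)) *\<^sub>R axis i 1"
proof -
 have "DERIV (%t. p (a * t + b)) (x $ i) :> p' (a * x $ i + b) * a"
 proof (rule DERIV_chain2[OF assms])
  show "DERIV (%t. a * t + b) (x $ i) :> a" by (auto intro!: derivative_eq_intros)
 qed
 from GDERIV_DERIV_compose[OF GDERIV_nth this] show ?thesis by (simp add: mult.commute)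
qed

lemma Ck_affine_coordinate: "Dk n p ==> Ck n (%x::real ^ 'd::finite. p (a * x $ i + b))"
proof (induction n arbitrary: p)
 case 0
 then show ?case by (auto intro!: continuous_on_compose2[of UNIV p] continuous_intros)
next
 case (Suc n)
 then obtain p' where p': "!!t. DERIV p t :> p' t" "Dk n p'" by auto
 show ?case
 proof (rule Ck_SucI[OF GDERIV_affine_coordinate[OF p'(1)]])
  fix j
  have "Ck n (%x::real ^ 'd. (if i = j then a else 0) * p' (a * x $ i + b))"
   by (intro Ck_mult Ck_const Suc.IH p')
  then show "Ck n (%x::real ^ 'd. ((a * p' (a * x $ i + b)) *\<^sub>R axis i 1) $ j)"
   by (cases "i = j") (simp_all add: axis_def)
 qed
qed

section \<open>Riemann sums over the lattice\<close>

definition qfloor :: "real => real ^ 'd::finite => int ^ 'd" where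
 "qfloor eps x = (\<chi> i. \<lfloor>x $ i / eps\<rfloor>)"

lemma qfloor_eq_iff:
 assumes "eps > 0"
 shows "qfloor eps x = y \<longleftrightarrow> (\<forall>i. eps * real_of_int (y $ i) \<le> x $ i \<and> x $ i < eps * real_of_int (y $ i) + eps)"
proof -
 have "\<lfloor>x $ i / eps\<rfloor> = y $ i \<longleftrightarrow> eps * real_of_int (y $ i) \<le> x $ i \<and> x $ i < eps * real_of_int (y $ i) + eps" for i
  using assms by (simp add: floor_eq_iff field_simps)
 then show ?thesis by (simp add: qfloor_def vec_eq_iff)
qed

lemma qfloor_bounds:
 assumes "eps > 0"
 shows "eps * real_of_int (qfloor eps x $ i) \<le> x $ i" "x $ i < eps * real_of_int (qfloor eps x $ i) + eps"
 using qfloor_eq_iff[OF assms, of x "qfloor eps x"] by auto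

lemma sets_qfloor [measurable]:
 assumes "eps > 0" shows "{x :: real ^ 'd::finite. qfloor eps x = y} \<in> sets borel"
proof -
 have "{x :: real ^ 'd. qfloor eps x = y} =
   (\<Inter>i. {x. eps * real_of_int (y $ i) \<le> x $ i} \<inter> {x. x $ i < eps * real_of_int (y $ i) + eps})"
  using qfloor_eq_iff[OF assms] by auto
 also have "... \<in> sets borel"
  by (intro sets.countable_INT'' sets.Int borel_closed borel_open closed_Collect_le open_Collect_less continuous_intros) auto
 finally show ?thesis .
qed

text \<open>The half-open cube lies between an open and a closed box of equal volume.\<close>

lemma measure_qfloor:
 assumes "eps > 0"
 shows "emeasure lborel {x :: real ^ 'd::finite. qfloor eps x = y} = ennreal (eps ^ CARD('d))"
proof -
 define a where "a = (\<chi> i. eps * real_of_int (y $ i))"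
 define b where "b = (\<chi> i. eps * real_of_int (y $ i) + eps)"
 have ab: "a \<bullet> u \<le> b \<bullet> u \<and> (b - a) \<bullet> u = eps" if u: "u \<in> Basis" for u
 proof -
  obtain i where "u = axis i 1" using u by (auto simp: Basis_vec_def)
  then show ?thesis using assms by (simp add: a_def b_def inner_axis)
 qed
 have "(\<Prod>u\<in>Basis. (b - a) \<bullet> u) = eps ^ CARD('d)" using ab by (simp cong: prod.cong)
 then have m: "emeasure lborel (box a b) = ennreal (eps ^ CARD('d))" "emeasure lborel (cbox a b) = ennreal (eps ^ CARD('d))"
  using ab by simp_all
 have "box a b \<subseteq> {x. qfloor eps x = y}" "{x. qfloor eps x = y} \<subseteq> cbox a b"
  by (auto simp: qfloor_eq_iff[OF assms] mem_box_cart a_def b_def less_imp_le)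
 then have "emeasure lborel (box a b) \<le> emeasure lborel {x. qfloor eps x = y}"
   "emeasure lborel {x. qfloor eps x = y} \<le> emeasure lborel (cbox a b)"
  by (auto intro!: emeasure_mono simp: sets_qfloor[OF assms])
 then show ?thesis unfolding m by (rule antisym[rotated])
qed

lemma step_function_eq:
 assumes "fin_supp c"
 shows "c (qfloor eps x) = (\<Sum>y | c y ~= 0. c y * indicator {x. qfloor eps x = y} x)"
proof -
 have "(\<Sum>y | c y ~= 0. c y * indicator {x. qfloor eps x = y} x) = (\<Sum>y | c y ~= 0. if y = qfloor eps x then c y else 0)"
  by (intro sum.cong) (auto simp: indicator_def)
 then show ?thesis using assms by (simp add: fin_supp_def)
qed

lemma integrable_step:
 fixes c :: "int ^ 'd::finite => real"
 assumes "fin_supp c" "eps > 0"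
 shows "integrable lborel (%x. c (qfloor eps x))"
 unfolding step_function_eq[OF assms(1)]
 by (intro Bochner_Integration.integrable_sum integrable_mult_right integrable_real_indicator)
  (auto simp: measure_qfloor[OF assms(2)] sets_qfloor[OF assms(2)])

lemma integral_step:
 fixes c :: "int ^ 'd::finite => real"
 assumes "fin_supp c" "eps > 0"
 shows "(LBINT x. c (qfloor eps x)) = eps ^ CARD('d) * zsum c"
proof -
 have m: "measure lborel {x :: real ^ 'd. qfloor eps x = y} = eps ^ CARD('d)" for y
  using measure_qfloor[OF assms(2)] assms(2) by (simp add: measure_def)
 have "(LBINT x. c (qfloor eps x)) = (\<Sum>y | c y ~= 0. \<integral>x. c y * indicator {x. qfloor eps x = y} x \<partial>lborel)"
  unfolding step_function_eq[OF assms(1)]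
  by (intro Bochner_Integration.integral_sum integrable_mult_right integrable_real_indicator)
   (auto simp: measure_qfloor[OF assms(2)] sets_qfloor[OF assms(2)])
 also have "... = (\<Sum>y | c y ~= 0. c y * eps ^ CARD('d))" by (simp add: m)
 finally show ?thesis by (simp add: zsum_def sum_distrib_left mult.commute)
qed

lemma finite_bounded_lattice:
 assumes "eps > 0"
 shows "finite {y :: int ^ 'd::finite. \<forall>i. \<bar>eps * real_of_int (y $ i)\<bar> \<le> R}"
proof -
 let ?B = "{- \<lceil>R / eps\<rceil> .. \<lceil>R / eps\<rceil>}"
 have "{y :: int ^ 'd. \<forall>i. \<bar>eps * real_of_int (y $ i)\<bar> \<le> R} \<subseteq> (%g. \<chi> i. g i) ` (PiE UNIV (%_. ?B))"
 proof
  fix y :: "int ^ 'd" assume y: "y \<in> {y. \<forall>i. \<bar>eps * real_of_int (y $ i)\<bar> \<le> R}"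
  have "y $ i \<in> ?B" for i
  proof -
   have "\<bar>eps * real_of_int (y $ i)\<bar> \<le> R" using y by simp
   then have "\<bar>real_of_int (y $ i)\<bar> \<le> R / eps" using assms by (simp add: abs_mult field_simps)
   then show ?thesis by (simp add: abs_le_iff) linarith
  qed
  then show "y \<in> (%g. \<chi> i. g i) ` (PiE UNIV (%_. ?B))"
   by (intro image_eqI[of _ _ "%i. y $ i"]) (auto simp: vec_eq_iff)
 qed
 then show ?thesis by (rule finite_subset) (intro finite_imageI finite_PiE, auto)
qed

lemma qfloor_tendsto:
 fixes x :: "real ^ 'd::finite"
 assumes "!!n. eps n > 0" "eps \<longlonglongrightarrow> 0"
 shows "(%n. eps n *\<^sub>R lattice_point (qfloor (eps n) x + z)) \<longlonglongrightarrow> x"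
proof (rule vec_tendstoI)
 fix i
 have "(%n. eps n * real_of_int (qfloor (eps n) x $ i)) \<longlonglongrightarrow> x $ i"
 proof (rule tendsto_sandwich[of "%n. x $ i - eps n" _ _ "%n. x $ i"])
  show "\<forall>\<^sub>F n in sequentially. x $ i - eps n \<le> eps n * real_of_int (qfloor (eps n) x $ i)"
   using qfloor_bounds(2)[OF assms(1), of x i] by (intro always_eventually allI) (smt (verit))
  show "\<forall>\<^sub>F n in sequentially. eps n * real_of_int (qfloor (eps n) x $ i) \<le> x $ i"
   using qfloor_bounds(1)[OF assms(1)] by (intro always_eventually allI) auto
  show "(%n. x $ i - eps n) \<longlonglongrightarrow> x $ i" using tendsto_diff[OF tendsto_const assms(2), of "x $ i"] by simp
 qed simp
 then have "(%n. eps n * real_of_int (qfloor (eps n) x $ i) + eps n * real_of_int (z $ i)) \<longlonglongrightarrow> x $ i + 0 * real_of_int (z $ i)"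
  by (intro tendsto_intros assms)
 then show "(%n. (eps n *\<^sub>R lattice_point (qfloor (eps n) x + z)) $ i) \<longlonglongrightarrow> x $ i"
  by (simp add: lattice_point_def distrib_left)
qed

text \<open>The sum is the integral of a step function that is constant on lattice cubes, so
  dominated convergence applies to uniformly bounded summands in a common bounded region; it also
  gives integrability of the limit.\<close>

lemma lattice_riemann_sum:
 fixes G :: "real ^ 'd::finite => real" and g :: "nat => int ^ 'd => real"
 assumes eps: "!!n. 0 < eps n" "!!n. eps n \<le> 1" and G: "G \<in> borel_measurable borel"
  and supp: "!!n y i. g n y ~= 0 ==> \<bar>eps n * real_of_int (y $ i)\<bar> \<le> R" and bd: "!!n y. \<bar>g n y\<bar> \<le> B"
  and lim: "AE x in lborel. (%n. g n (qfloor (eps n) x)) \<longlonglongrightarrow> G x"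
 shows "integrable lborel G" "(%n. eps n ^ CARD('d) * zsum (g n)) \<longlonglongrightarrow> (LBINT x. G x)"
proof -
 have fs: "fin_supp (g n)" for n
  by (rule fin_suppI[OF finite_bounded_lattice[OF eps(1)[of n], of R]]) (use supp in auto)
 \<comment> \<open>The region grows by at most one mesh, hence by at most \<open>1\<close>, when a
   lattice point stands for its cube.\<close>
 let ?C = "cbox (\<chi> i. - (R + 1)) (\<chi> i. R + 1) :: (real ^ 'd) set"
 have "emeasure lborel ?C < \<infinity>" by (rule emeasure_lborel_cbox_finite)
 then have w: "integrable lborel (%x. B * indicator ?C x)"
  by (intro integrable_mult_right integrable_real_indicator) auto
 have dom: "norm (g n (qfloor (eps n) x)) \<le> B * indicator ?C x" for n x
 proof (cases "g n (qfloor (eps n) x) = 0")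
  case True
  have "B \<ge> 0" using bd[of 0 0] by linarith
  then show ?thesis using True by simp
 next
  case False
  have "- (R + 1) \<le> x $ i \<and> x $ i \<le> R + 1" for i
   using supp[OF False, of i] qfloor_bounds[OF eps(1)[of n], of x i] eps(2)[of n] by linarith
  then have "x \<in> ?C" by (simp add: mem_box_cart)
  then show ?thesis using bd by simp
 qed
 have meas: "(%x. g n (qfloor (eps n) x)) \<in> borel_measurable lborel" for n
  using integrable_step[OF fs eps(1)] by (rule borel_measurable_integrable)
 have G': "G \<in> borel_measurable lborel" using G by simp
 show "integrable lborel G"
  by (rule integrable_dominated_convergence[OF G' meas w lim]) (use dom in auto)
 have "(%n. \<integral>x. g n (qfloor (eps n) x) \<partial>lborel) \<longlonglongrightarrow> (LBINT x. G x)"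
  by (rule integral_dominated_convergence[OF G' meas w lim]) (use dom in auto)
 then show "(%n. eps n ^ CARD('d) * zsum (g n)) \<longlonglongrightarrow> (LBINT x. G x)"
  by (simp add: integral_step[OF fs eps(1)])
qed

lemma tendsto_at_right_0_iff_seq:
 fixes F :: "real => 'a::topological_space"
 assumes "!!X. (!!n. 0 < X n) ==> (!!n. X n \<le> 1) ==> X \<longlonglongrightarrow> 0 ==> (%n. F (X n)) \<longlonglongrightarrow> L"
 shows "(F \<longlongrightarrow> L) (at_right 0)"
proof -
 have "at (0::real) within {0<..} = at 0 within {0<..1}"
  by (rule at_within_nhd[of _ "{..<1}"]) auto
 moreover have "(F \<longlongrightarrow> L) (at 0 within {0<..1})"
  unfolding tendsto_at_iff_sequentially comp_def using assms by auto
 ultimately show ?thesis by simp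
qed

lemma integrable_bounded_support:
 fixes f :: "real ^ 'd::finite => 'b::{banach, second_countable_topology}"
 assumes "f \<in> borel_measurable borel" "!!x. norm (f x) \<le> B" "!!x i. f x ~= 0 ==> \<bar>x $ i\<bar> \<le> R"
 shows "integrable lborel f"
proof -
 let ?C = "cbox (\<chi> i. - R) (\<chi> i. R) :: (real ^ 'd) set"
 have "emeasure lborel ?C < \<infinity>" by (rule emeasure_lborel_cbox_finite)
 then have w: "integrable lborel (%x. B * indicator ?C x)"
  by (intro integrable_mult_right integrable_real_indicator) auto
 have "norm (f x) \<le> norm (B * indicator ?C x)" for x
 proof (cases "f x = 0")
  case False
  then have "x \<in> ?C" using assms(3)[OF False] by (auto simp: mem_box_cart abs_le_iff minus_le_iff)
  then show ?thesis using assms(2)[of x] norm_ge_zero[of "f x"] by simp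
 qed simp
 then show ?thesis using assms(1) by (intro Bochner_Integration.integrable_bound[OF w]) auto
qed

lemma integral_translate:
 fixes g :: "'a::euclidean_space => real"
 assumes "g \<in> borel_measurable borel"
 shows "(LBINT x. g (c + x)) = (LBINT x. g x)"
proof -
 have "(LBINT x. g x) = (\<integral>x. g x \<partial>distr lborel borel ((+) c))" by (simp add: lborel_distr_plus)
 also have "... = (LBINT x. g (c + x))" using assms by (subst integral_distr) auto
 finally show ?thesis ..
qed

text \<open>A continuous partition of unity by integer translates, stated with finite windows
  \<open>{a..b}\<close> that reach beyond the support on both sides.\<close>

definition unit_kernel :: "(real => real) => bool" where
 "unit_kernel p \<longleftrightarrow> continuous_on UNIV p \<and> (\<forall>t. 0 \<le> p t) \<and> (\<forall>t. 2 \<le> \<bar>t\<bar> --> p t = 0) \<and>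
   (\<forall>t a b. real_of_int a \<le> t - 2 --> t + 2 \<le> real_of_int b --> (\<Sum>n\<in>{a..b}. p (t - real_of_int n)) = 1)"

text \<open>The factor may depend on the coordinate because a partial derivative changes the
  one-dimensional kernel in one direction only.\<close>

definition tens :: "('d::finite => real => real) => real => int ^ 'd => real ^ 'd => real" where
 "tens p eps y x = (\<Prod>i\<in>UNIV. p i (x $ i / eps - real_of_int (y $ i)))"

text \<open>Every index whose kernel is nonzero at \<open>x\<close> lies in this set, and the window
  in each direction is wide enough for \<open>unit_kernel\<close>; the asymmetric \<open>- 2\<close>
  and \<open>+ 3\<close> compensate for rounding down.\<close>

definition nbr :: "real => real ^ 'd::finite => (int ^ 'd) set" where
 "nbr eps x = {y. \<forall>i. y $ i \<in> {\<lfloor>x $ i / eps\<rfloor> - 2 .. \<lfloor>x $ i / eps\<rfloor> + 3}}"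

lemma nbr_eq_image: "nbr eps x = (%g. \<chi> i. g i) ` (PiE UNIV (%i. {\<lfloor>x $ i / eps\<rfloor> - 2 .. \<lfloor>x $ i / eps\<rfloor> + 3}))"
proof (intro set_eqI iffI)
 fix z assume "z \<in> nbr eps x"
 then show "z \<in> (%g. \<chi> i. g i) ` (PiE UNIV (%i. {\<lfloor>x $ i / eps\<rfloor> - 2 .. \<lfloor>x $ i / eps\<rfloor> + 3}))"
  by (intro image_eqI[of _ _ "%i. z $ i"]) (auto simp: nbr_def vec_eq_iff)
qed (auto simp: nbr_def PiE_def Pi_def)

lemma finite_nbr [simp]: "finite (nbr eps x)"
 unfolding nbr_eq_image by (intro finite_imageI finite_PiE) auto

text \<open>Kernels that meet at a point have indices less than \<open>4\<close> apart in each
  coordinate, so offsets up to \<open>5\<close> suffice; the second factor comes from the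
  translation estimate for such offsets. The factor \<open>1\<close> inside the set matches
  \<open>finite_bounded_lattice\<close> with mesh \<open>1\<close>.\<close>

definition interp_const :: "'d::finite itself => real" where
 "interp_const _ = real (card {z :: int ^ 'd. \<forall>i. \<bar>1 * real_of_int (z $ i)\<bar> \<le> 5}) * (5\<^sup>2 * real CARD('d))"

context
 fixes p :: "'d::finite => real => real"
 assumes p: "!!i. unit_kernel (p i)"
begin

lemma tens_nonneg: "0 \<le> tens p eps y x"
 unfolding tens_def using p by (intro prod_nonneg) (auto simp: unit_kernel_def)

lemma tens_continuous: "continuous_on UNIV (tens p eps y)"
proof -
 have "continuous_on UNIV (p i)" for i using p by (simp add: unit_kernel_def)
 then have "continuous_on UNIV (%x::real ^ 'd. p i (x $ i / eps - real_of_int (y $ i)))" for i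
  unfolding divide_inverse by (rule continuous_on_compose2) (auto intro!: continuous_intros)
 then show ?thesis unfolding tens_def[abs_def] by (intro continuous_on_prod) auto
qed

lemma tens_measurable [measurable]: "tens p eps y \<in> borel_measurable borel"
 by (rule borel_measurable_continuous_onI[OF tens_continuous])

lemma tens_shift: "eps ~= 0 ==> tens p eps (y - z) x = tens p eps y (eps *\<^sub>R lattice_point z + x)"
 by (simp add: tens_def lattice_point_def add_divide_distrib algebra_simps)

lemma tens_nz:
 assumes "tens p eps y x ~= 0"
 shows "\<bar>x $ i / eps - real_of_int (y $ i)\<bar> < 2"
proof -
 have "p i (x $ i / eps - real_of_int (y $ i)) ~= 0" using assms by (simp add: tens_def)
 then show ?thesis using p[of i] unfolding unit_kernel_def by (meson not_le)
qed

lemma tens_nz_nbr: "tens p eps y x ~= 0 ==> y \<in> nbr eps x"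
proof -
 assume "tens p eps y x ~= 0"
 then have *: "\<bar>x $ i / eps - real_of_int (y $ i)\<bar> < 2" for i by (rule tens_nz)
 have "\<lfloor>x $ i / eps\<rfloor> - 2 \<le> y $ i \<and> y $ i \<le> \<lfloor>x $ i / eps\<rfloor> + 3" for i
  using *[of i]
  by (simp add: abs_less_iff) linarith
 then show ?thesis by (simp add: nbr_def)
qed

lemma tens_sum_nbr: "(\<Sum>y\<in>nbr eps x. tens p eps y x) = 1"
proof -
 let ?I = "%i. {\<lfloor>x $ i / eps\<rfloor> - 2 .. \<lfloor>x $ i / eps\<rfloor> + 3}"
 have "(\<Sum>y\<in>nbr eps x. tens p eps y x) = (\<Sum>g\<in>PiE UNIV ?I. tens p eps (\<chi> i. g i) x)"
  unfolding nbr_eq_image by (subst sum.reindex) (auto simp: inj_on_def vec_eq_iff)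
 also have "... = (\<Prod>i\<in>UNIV. \<Sum>n\<in>?I i. p i (x $ i / eps - real_of_int n))"
  by (subst prod_sum_PiE) (auto simp: tens_def)
 also have "... = 1"
 proof (rule prod.neutral, intro ballI)
  fix i
  have "real_of_int (\<lfloor>x $ i / eps\<rfloor> - 2) \<le> x $ i / eps - 2" "x $ i / eps + 2 \<le> real_of_int (\<lfloor>x $ i / eps\<rfloor> + 3)"
   by simp linarith
  then show "(\<Sum>n\<in>?I i. p i (x $ i / eps - real_of_int n)) = 1"
   using p[of i] unfolding unit_kernel_def by blast
 qed
 finally show ?thesis .
qed

lemma tens_sum_le: "finite A ==> (\<Sum>y\<in>A. tens p eps y x) \<le> 1"
proof -
 assume A: "finite A"
 have "(\<Sum>y\<in>A. tens p eps y x) = (\<Sum>y\<in>A \<inter> nbr eps x. tens p eps y x)"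
  using A tens_nz_nbr by (intro sum.mono_neutral_right) auto
 also have "... \<le> (\<Sum>y\<in>nbr eps x. tens p eps y x)"
  by (intro sum_mono2) (auto simp: tens_nonneg)
 finally show ?thesis by (simp add: tens_sum_nbr)
qed

lemma tens_sum_eq: "finite A ==> nbr eps x \<subseteq> A ==> (\<Sum>y\<in>A. tens p eps y x) = 1"
proof -
 assume A: "finite A" "nbr eps x \<subseteq> A"
 have "(\<Sum>y\<in>A. tens p eps y x) = (\<Sum>y\<in>nbr eps x. tens p eps y x)"
  using A tens_nz_nbr by (intro sum.mono_neutral_right) auto
 then show ?thesis by (simp add: tens_sum_nbr)
qed

lemma tens_le_1: "tens p eps y x \<le> 1"
 using tens_sum_le[of "{y}"] by simp

lemma tens_support:
 assumes "tens p eps y x ~= 0" "eps > 0"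
 shows "\<bar>x $ i\<bar> \<le> eps * (\<bar>real_of_int (y $ i)\<bar> + 2)"
proof -
 have "\<bar>x $ i / eps\<bar> \<le> \<bar>real_of_int (y $ i)\<bar> + 2" using tens_nz[OF assms(1), of i] by linarith
 then show ?thesis using assms(2) by (simp add: field_simps)
qed

lemma tens_integrable_mult:
 assumes eps: "eps > 0" and u: "u \<in> borel_measurable borel" "!!x. \<bar>u x\<bar> \<le> C"
 shows "integrable lborel (%x. u x * tens p eps y x)"
proof (rule integrable_bounded_support[of _ C "Max (range (%i. eps * (\<bar>real_of_int (y $ i)\<bar> + 2)))"])
 show "norm (u x * tens p eps y x) \<le> C" for x
  using mult_mono[OF u(2)[of x] tens_le_1[of eps y x]] u(2)[of x] tens_nonneg[of eps y x] by (simp add: abs_mult)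
 show "\<bar>x $ i\<bar> \<le> Max (range (%i. eps * (\<bar>real_of_int (y $ i)\<bar> + 2)))" if "u x * tens p eps y x ~= 0" for x i
  using tens_support[of eps y x i] that eps by (intro Max.coboundedI[THEN order_trans[rotated]]) auto
qed (use u in measurable)

lemma tens_integrable: "eps > 0 ==> integrable lborel (tens p eps y)"
 using tens_integrable_mult[of eps "%_. 1" 1 y] by simp

text \<open>Cutting the integral along lattice cubes and translating every piece to the cube of
  index \<open>0\<close> collects all translates of the kernel there, where they form a partition of
  unity.\<close>

lemma tens_integral:
 assumes eps: "eps > 0"
 shows "(LBINT x. tens p eps y x) = eps ^ CARD('d)"
proof -
 \<comment> \<open>\<open>F\<close> contains the cubes that the support of the kernel can meet, and
   the indices \<open>y - z\<close> with \<open>z\<close> in \<open>F\<close> cover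
   \<open>nbr\<close> at the points of the cube of index \<open>0\<close>.\<close>
 define F where "F = (%u. y - u) ` {u :: int ^ 'd. \<forall>i. \<bar>1 * real_of_int (u $ i)\<bar> \<le> 3}"
 have F: "finite F" unfolding F_def by (intro finite_imageI finite_bounded_lattice) simp
 have Fmem: "qfloor eps x \<in> F" if "tens p eps y x ~= 0" for x
 proof -
  have "\<bar>real_of_int (y $ i - qfloor eps x $ i)\<bar> \<le> 3" for i
   using tens_nz[OF that, of i] unfolding qfloor_def by simp linarith
  then show ?thesis unfolding F_def by (intro image_eqI[of _ _ "y - qfloor eps x"]) auto
 qed
 let ?c = "%z x. indicator {x. qfloor eps x = z} x :: real"
 have ic: "integrable lborel (%x. ?c z x * tens p eps w x)" for z w
 proof (rule tens_integrable_mult[OF eps])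
  show "?c z \<in> borel_measurable borel" by (rule borel_measurable_indicator) (rule sets_qfloor[OF eps])
  show "\<bar>?c z x\<bar> \<le> 1" for x by (simp add: indicator_def)
 qed
 have meas: "(%x. ?c z x * tens p eps w x) \<in> borel_measurable borel" for z w
  using borel_measurable_integrable[OF ic] by simp
 have "(LBINT x. tens p eps y x) = (LBINT x. (\<Sum>z\<in>F. ?c z x * tens p eps y x))"
 proof (intro Bochner_Integration.integral_cong refl)
  fix x
  have "(\<Sum>z\<in>F. ?c z x * tens p eps y x) = (\<Sum>z\<in>F. if z = qfloor eps x then tens p eps y x else 0)"
   by (intro sum.cong) (auto simp: indicator_def)
  then show "tens p eps y x = (\<Sum>z\<in>F. ?c z x * tens p eps y x)" using F Fmem by auto
 qed
 also have "... = (\<Sum>z\<in>F. \<integral>x. ?c z x * tens p eps y x \<partial>lborel)"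
  by (rule Bochner_Integration.integral_sum) (rule ic)
 also have "... = (\<Sum>z\<in>F. \<integral>x. ?c 0 x * tens p eps (y - z) x \<partial>lborel)"
 proof (rule sum.cong[OF refl])
  fix z
  have "(LBINT x. ?c z x * tens p eps y x) = (LBINT x. ?c z (eps *\<^sub>R lattice_point z + x) * tens p eps y (eps *\<^sub>R lattice_point z + x))"
   by (rule integral_translate[symmetric, OF meas])
  also have "... = (LBINT x. ?c 0 x * tens p eps (y - z) x)"
  proof -
   have "qfloor eps (eps *\<^sub>R lattice_point z + x) = z \<longleftrightarrow> qfloor eps x = 0" for x
    by (simp add: qfloor_eq_iff[OF eps] lattice_point_def algebra_simps)
   then show ?thesis using eps by (simp add: tens_shift indicator_def)
  qed
  finally show "(LBINT x. ?c z x * tens p eps y x) = (LBINT x. ?c 0 x * tens p eps (y - z) x)" .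
 qed
 also have "... = (LBINT x. (\<Sum>z\<in>F. ?c 0 x * tens p eps (y - z) x))"
  by (rule Bochner_Integration.integral_sum[symmetric]) (rule ic)
 also have "(%x. \<Sum>z\<in>F. ?c 0 x * tens p eps (y - z) x) = ?c (0 :: int ^ 'd)"
 proof
  fix x
  show "(\<Sum>z\<in>F. ?c 0 x * tens p eps (y - z) x) = ?c 0 x"
  proof (cases "qfloor eps x = 0")
   case True
   have sub: "nbr eps x \<subseteq> (%z. y - z) ` F"
   proof
    fix u assume u: "u \<in> nbr eps x"
    have "\<lfloor>x $ i / eps\<rfloor> = 0" for i using True by (simp add: qfloor_def vec_eq_iff)
    then have "\<bar>1 * real_of_int (u $ i)\<bar> \<le> 3" for i using u by (auto simp: nbr_def abs_le_iff dest!: spec[of _ i])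
    then have "y - u \<in> F" by (auto simp: F_def)
    then show "u \<in> (%z. y - z) ` F" by (intro image_eqI[of _ _ "y - u"]) auto
   qed
   have "(\<Sum>z\<in>F. tens p eps (y - z) x) = (\<Sum>u\<in>(%z. y - z) ` F. tens p eps u x)"
    by (subst sum.reindex) (auto simp: inj_on_def)
   also have "... = 1" using F sub by (intro tens_sum_eq) auto
   finally show ?thesis using True by simp
  qed simp
 qed
 also have "(LBINT x. ?c (0 :: int ^ 'd) x) = eps ^ CARD('d)"
 proof -
  have "measure lborel {x :: real ^ 'd. qfloor eps x = 0} = eps ^ CARD('d)"
   using eps by (simp add: measure_def measure_qfloor[OF eps])
  then show ?thesis by simp
 qed
 finally show ?thesis .
qed

lemma tens_jensen:
 assumes "fin_supp a"
 shows "(zsum (%y. a y * tens p eps y x))^2 \<le> zsum (%y. (a y)^2 * tens p eps y x)"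
proof -
 define A where "A = {y. a y ~= 0}"
 have A: "finite A" using assms by (simp add: A_def fin_supp_def)
 let ?t = "%y. tens p eps y x"
 have "zsum (%y. a y * ?t y) = (\<Sum>y\<in>A. (a y * sqrt (?t y)) * sqrt (?t y))"
  using A tens_nonneg by (subst zsum_eq[of A]) (auto simp: A_def mult.assoc)
 also have "...\<^sup>2 \<le> (\<Sum>y\<in>A. (a y * sqrt (?t y))^2) * (\<Sum>y\<in>A. (sqrt (?t y))^2)"
  by (rule Cauchy_Schwarz_ineq_sum)
 also have "... \<le> (\<Sum>y\<in>A. (a y * sqrt (?t y))^2) * 1"
  using tens_sum_le[OF A] tens_nonneg by (intro mult_left_mono sum_nonneg) auto
 also have "... = zsum (%y. (a y)^2 * ?t y)"
  using A tens_nonneg by (subst zsum_eq[of A]) (auto simp: A_def power_mult_distrib)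
 finally show ?thesis .
qed

lemma tens_zsum_integral:
 assumes "fin_supp a" and eps: "eps > 0" and u: "u \<in> borel_measurable borel" "!!x. \<bar>u x\<bar> \<le> C"
 shows "integrable lborel (%x. u x * zsum (%y. a y * tens p eps y x))"
  "(LBINT x. u x * zsum (%y. a y * tens p eps y x)) = zsum (%y. a y * (LBINT x. u x * tens p eps y x))"
proof -
 define A where "A = {y. a y ~= 0}"
 have A: "finite A" using assms by (simp add: A_def fin_supp_def)
 have eq: "u x * zsum (%y. a y * tens p eps y x) = (\<Sum>y\<in>A. a y * (u x * tens p eps y x))" for x
  using A by (subst zsum_eq[of A]) (auto simp: A_def sum_distrib_left mult_ac)
 show "integrable lborel (%x. u x * zsum (%y. a y * tens p eps y x))"
  unfolding eq by (intro Bochner_Integration.integrable_sum integrable_mult_right tens_integrable_mult[OF eps u])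
 have "(LBINT x. u x * zsum (%y. a y * tens p eps y x)) = (\<Sum>y\<in>A. \<integral>x. a y * (u x * tens p eps y x) \<partial>lborel)"
  unfolding eq by (intro Bochner_Integration.integral_sum integrable_mult_right tens_integrable_mult[OF eps u])
 also have "... = zsum (%y. a y * (LBINT x. u x * tens p eps y x))"
  using A by (subst zsum_eq[of A]) (auto simp: A_def)
 finally show "(LBINT x. u x * zsum (%y. a y * tens p eps y x)) = zsum (%y. a y * (LBINT x. u x * tens p eps y x))" .
qed

text \<open>At fixed \<open>x\<close> the kernels are probability weights, and this difference is
  the variance of \<open>f\<close> under them, half of a double sum of squared differences. Bounding
  one of the two weights by \<open>1\<close> leaves translation differences over bounded
  offsets.\<close>

lemma tens_variance:
 assumes f: "fin_supp f" and eps: "eps > 0"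
 shows "0 \<le> zsum (%y. (f y)^2 * tens p eps y x) - (zsum (%y. f y * tens p eps y x))^2"
  and "zsum (%y. (f y)^2 * tens p eps y x) - (zsum (%y. f y * tens p eps y x))^2
   \<le> (\<Sum>z\<in>{z :: int ^ 'd. \<forall>i. \<bar>1 * real_of_int (z $ i)\<bar> \<le> 5}. zsum (%y. (f (y + z) - f y)^2 * tens p eps y x))"
proof -
 let ?t = "%y. tens p eps y x" and ?Z = "{z :: int ^ 'd. \<forall>i. \<bar>1 * real_of_int (z $ i)\<bar> \<le> 5}"
 show "0 \<le> zsum (%y. (f y)^2 * ?t y) - (zsum (%y. f y * ?t y))^2"
  using tens_jensen[OF f, of eps x] by simp
 define A where "A = {y. f y ~= 0} \<union> nbr eps x"
 have A: "finite A" using f by (simp add: A_def fin_supp_def)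
 have Z: "finite ?Z" by (rule finite_bounded_lattice) simp
 define S where "S = (\<Sum>y\<in>A. f y * ?t y)"
 have 1: "(\<Sum>y\<in>A. ?t y) = 1" using A by (intro tens_sum_eq) (auto simp: A_def)
 have 2: "zsum (%y. (f y)^2 * ?t y) = (\<Sum>y\<in>A. (f y)^2 * ?t y)" "zsum (%y. f y * ?t y) = S"
  unfolding S_def using A by (auto simp: A_def intro!: zsum_eq)
 define X where "X = (\<Sum>u\<in>A. (f u)^2 * ?t u)"
 have inner: "(\<Sum>y'\<in>A. (f y' - f y)^2 * (?t y * ?t y')) = ?t y * X - 2 * (f y * ?t y) * S + (f y)^2 * ?t y" for y
 proof -
  have "(\<Sum>y'\<in>A. (f y' - f y)^2 * (?t y * ?t y'))
    = (\<Sum>y'\<in>A. ?t y * ((f y')^2 * ?t y') - 2 * (f y * ?t y) * (f y' * ?t y') + (f y)^2 * ?t y * ?t y')"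
   by (intro sum.cong refl) (simp add: power2_eq_square algebra_simps)
  also have "... = ?t y * X - 2 * (f y * ?t y) * S + (f y)^2 * ?t y * (\<Sum>u\<in>A. ?t u)"
   by (simp add: sum.distrib sum_subtractf S_def X_def sum_distrib_left)
  finally show ?thesis by (simp add: 1)
 qed
 have "(\<Sum>y\<in>A. \<Sum>y'\<in>A. (f y' - f y)^2 * (?t y * ?t y')) = 2 * ((\<Sum>y\<in>A. (f y)^2 * ?t y) - S\<^sup>2)"
 proof -
  have "(\<Sum>y\<in>A. \<Sum>y'\<in>A. (f y' - f y)^2 * (?t y * ?t y')) = (\<Sum>y\<in>A. ?t y) * X - 2 * (\<Sum>y\<in>A. f y * ?t y) * S + (\<Sum>y\<in>A. (f y)^2 * ?t y)"
   unfolding inner by (simp add: sum.distrib sum_subtractf sum_distrib_right sum_distrib_left mult.assoc)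
  then show ?thesis unfolding 1 S_def[symmetric] X_def by (simp add: power2_eq_square)
 qed
 then have "(\<Sum>y\<in>A. (f y)^2 * ?t y) - S\<^sup>2 \<le> (\<Sum>y\<in>A. \<Sum>y'\<in>A. (f y' - f y)^2 * (?t y * ?t y'))"
  using sum_nonneg[of A "%y. \<Sum>y'\<in>A. (f y' - f y)^2 * (?t y * ?t y')"]
  by (simp add: sum_nonneg tens_nonneg)
 also have "... \<le> (\<Sum>y\<in>A. \<Sum>z\<in>?Z. (f (y + z) - f y)^2 * ?t y)"
 proof (rule sum_mono)
  fix y assume "y \<in> A"
  have "(\<Sum>y'\<in>A. (f y' - f y)^2 * (?t y * ?t y')) \<le> (\<Sum>y'\<in>A \<inter> (%z. y + z) ` ?Z. (f y' - f y)^2 * ?t y)"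
  proof -
   have zero: "(f y' - f y)^2 * (?t y * ?t y') = 0" if "y' \<notin> (%z. y + z) ` ?Z" for y'
   proof (rule ccontr)
    assume "\<not> ?thesis"
    then have "?t y ~= 0" "?t y' ~= 0" by auto
    then have "\<bar>1 * real_of_int ((y' - y) $ i)\<bar> \<le> 5" for i
     using tens_nz[of eps y x i] tens_nz[of eps y' x i] by simp
    then have "y' - y \<in> ?Z" by simp
    then show False using that by (metis (no_types, lifting) image_eqI add_diff_cancel_left' diff_add_cancel add.commute)
   qed
   have "(\<Sum>y'\<in>A. (f y' - f y)^2 * (?t y * ?t y')) = (\<Sum>y'\<in>A \<inter> (%z. y + z) ` ?Z. (f y' - f y)^2 * (?t y * ?t y'))"
    using A zero by (intro sum.mono_neutral_right) auto
   also have "... \<le> (\<Sum>y'\<in>A \<inter> (%z. y + z) ` ?Z. (f y' - f y)^2 * (?t y * 1))"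
    by (intro sum_mono mult_left_mono tens_le_1 tens_nonneg) auto
   finally show ?thesis by simp
  qed
  also have "... \<le> (\<Sum>y'\<in>(%z. y + z) ` ?Z. (f y' - f y)^2 * ?t y)"
   using Z by (intro sum_mono2) (auto simp: tens_nonneg)
  also have "... = (\<Sum>z\<in>?Z. (f (y + z) - f y)^2 * ?t y)"
   by (subst sum.reindex) auto
  finally show "(\<Sum>y'\<in>A. (f y' - f y)^2 * (?t y * ?t y')) \<le> (\<Sum>z\<in>?Z. (f (y + z) - f y)^2 * ?t y)" .
 qed
 also have "... = (\<Sum>z\<in>?Z. \<Sum>y\<in>A. (f (y + z) - f y)^2 * ?t y)" by (rule sum.swap)
 also have "... = (\<Sum>z\<in>?Z. zsum (%y. (f (y + z) - f y)^2 * ?t y))"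
  using A tens_nz_nbr by (intro sum.cong refl zsum_eq[symmetric]) (auto simp: A_def)
 finally show "zsum (%y. (f y)^2 * ?t y) - (zsum (%y. f y * ?t y))^2 \<le> (\<Sum>z\<in>?Z. zsum (%y. (f (y + z) - f y)^2 * ?t y))"
  by (simp add: 2)
qed

text \<open>The error is the integral of \<open>u\<close> against a pointwise variance, hence of
  order \<open>eps\<^sup>2\<close> times the energy. Constant \<open>u\<close> serves to compare
  masses, the continuum potential to compare potential terms.\<close>

lemma tens_weighted_mass:
 assumes f: "fin_supp f" and eps: "eps > 0" and u: "u \<in> borel_measurable borel" "!!x. \<bar>u x\<bar> \<le> C"
 shows "integrable lborel (%x. u x * (zsum (%y. f y * tens p eps y x))^2)"
  "\<bar>zsum (%y. (f y)^2 * (LBINT x. u x * tens p eps y x)) - (LBINT x. u x * (zsum (%y. f y * tens p eps y x))^2)\<bar>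
   \<le> C * interp_const TYPE('d) * eps\<^sup>2 * energy eps f"
proof -
 let ?Z = "{z :: int ^ 'd. \<forall>i. \<bar>1 * real_of_int (z $ i)\<bar> \<le> 5}"
 let ?F = "%x. zsum (%y. f y * tens p eps y x)" and ?G = "%x. zsum (%y. (f y)^2 * tens p eps y x)"
 let ?H = "%z x. zsum (%y. (f (y + z) - f y)^2 * tens p eps y x)"
 have C: "C \<ge> 0" using u(2)[of 0] by linarith
 have Z: "finite ?Z" by (rule finite_bounded_lattice) simp
 have f2: "fin_supp (%y. (f y)^2)" using f by (rule fin_supp_sq)
 have fz: "fin_supp (%y. (f (y + z) - f y)^2)" for z using f by (intro fin_supp_sq fin_supp_diff fin_supp_shift)
 have G1: "integrable lborel ?G" "integrable lborel (%x. u x * ?G x)"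
  using tens_zsum_integral(1)[OF f2 eps, of "%_. 1" 1] tens_zsum_integral(1)[OF f2 eps u] by simp_all
 have H1: "integrable lborel (?H z)" and H2: "(LBINT x. ?H z x) = eps ^ CARD('d) * zsum (%y. (f (y + z) - f y)^2)" for z
  using tens_zsum_integral[OF fz eps, of "%_. 1" 1 z] by (simp_all add: tens_integral[OF eps] zsum_mult_right)
 have Fm: "?F \<in> borel_measurable borel"
  using borel_measurable_integrable[OF tens_zsum_integral(1)[OF f eps, of "%_. 1" 1]] by simp
 have var0: "0 \<le> ?G x - (?F x)^2" and var: "?G x - (?F x)^2 \<le> (\<Sum>z\<in>?Z. ?H z x)" for x
  using tens_variance[OF f eps, of x] by simp_all
 have bd: "norm (u x * (?F x)^2) \<le> norm (C * ?G x)" for x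
 proof -
  have "\<bar>u x\<bar> * (?F x)^2 \<le> C * ?G x" using u(2)[of x] var0[of x] C by (intro mult_mono) auto
  moreover have "norm (u x * (?F x)^2) = \<bar>u x\<bar> * (?F x)^2" by (simp add: abs_mult)
  ultimately show ?thesis using abs_ge_self[of "C * ?G x"] unfolding real_norm_def by linarith
 qed
 show int: "integrable lborel (%x. u x * (?F x)^2)"
  by (rule Bochner_Integration.integrable_bound[OF integrable_mult_right[OF G1(1), of C]])
   (use Fm u bd in auto)
 have "zsum (%y. (f y)^2 * (LBINT x. u x * tens p eps y x)) - (LBINT x. u x * (?F x)^2)
   = (LBINT x. u x * ?G x - u x * (?F x)^2)"
  using int G1 tens_zsum_integral(2)[OF f2 eps u] by simp
 also have "\<bar>...\<bar> \<le> (LBINT x. C * (\<Sum>z\<in>?Z. ?H z x))"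
 proof -
  have "norm (LBINT x. u x * ?G x - u x * (?F x)^2) \<le> (LBINT x. C * (\<Sum>z\<in>?Z. ?H z x))"
  proof (rule Bochner_Integration.integral_norm_bound_integral)
   show "integrable lborel (%x. u x * ?G x - u x * (?F x)^2)" using int G1 by simp
   show "integrable lborel (%x. C * (\<Sum>z\<in>?Z. ?H z x))" using H1 by simp
   show "norm (u x * ?G x - u x * (?F x)^2) \<le> C * (\<Sum>z\<in>?Z. ?H z x)" for x
   proof -
    have "\<bar>u x\<bar> * (?G x - (?F x)^2) \<le> C * (\<Sum>z\<in>?Z. ?H z x)"
     using u(2)[of x] var0[of x] var[of x] C by (intro mult_mono) auto
    then show ?thesis using var0[of x] by (simp add: abs_mult right_diff_distrib[symmetric])
   qed
  qed
  then show ?thesis by simp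
 qed
 also have "... = C * (\<Sum>z\<in>?Z. eps ^ CARD('d) * zsum (%y. (f (y + z) - f y)^2))"
  unfolding integral_mult_right_zero Bochner_Integration.integral_sum[OF H1] H2 ..
 also have "... \<le> C * (\<Sum>z\<in>?Z. eps ^ CARD('d) * (5\<^sup>2 * real CARD('d) * dirichlet_sum f))"
  using C eps by (intro mult_left_mono sum_mono zsum_shift_le f) auto
 also have "... = C * interp_const TYPE('d) * eps\<^sup>2 * energy eps f"
  using eps by (simp add: interp_const_def energy_def)
 finally show "\<bar>zsum (%y. (f y)^2 * (LBINT x. u x * tens p eps y x)) - (LBINT x. u x * (?F x)^2)\<bar>
   \<le> C * interp_const TYPE('d) * eps\<^sup>2 * energy eps f" .
qed

end

section \<open>Interpolation of lattice functions\<close>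

lemma GDERIV_sum:
 "finite I ==> (!!i. i \<in> I ==> GDERIV (f i) x :> g i) ==> GDERIV (%x. \<Sum>i\<in>I. f i x) x :> (\<Sum>i\<in>I. g i)"
 by (induction I rule: finite_induct) (auto intro: GDERIV_add GDERIV_const)

lemma GDERIV_cmult: "GDERIV f x :> g ==> GDERIV (%x. c * f x) x :> c *\<^sub>R g"
 using GDERIV_mult[OF GDERIV_const, of f x g c] by simp

lemma compact_closure_subset:
 fixes S K :: "'a::t2_space set"
 assumes "closure S \<subseteq> K" "compact K"
 shows "compact (closure S)"
proof -
 have "K \<inter> closure S = closure S" using assms(1) by auto
 then show ?thesis using compact_Int_closed[OF assms(2) closed_closure[of S]] by simp
qed

lemma dist_inf_cube:
 fixes D :: "(real ^ 'd::finite) set"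
 assumes "dist_inf z (- D) > c" "!!i. \<bar>x $ i - z $ i\<bar> \<le> c"
 shows "x \<in> D"
proof (rule ccontr)
 assume "x \<notin> D"
 then have "dist_inf z (- D) \<le> infnorm (z - x)"
  unfolding dist_inf_def by (intro cINF_lower bdd_belowI[of _ 0]) (auto simp: infnorm_pos_le)
 also have "infnorm (z - x) \<le> c"
  unfolding infnorm_cart using assms(2) by (intro cSup_least) (auto simp: abs_minus_commute)
 finally show False using assms(1) by simp
qed

locale smooth_hat =
 fixes h k :: "real => real" and \<delta> :: real
 assumes \<delta>: "0 < \<delta>" "\<delta> < 1" and Dk_h: "!!n. Dk n h"
  and h: "unit_kernel h" and k: "unit_kernel k"
  and h_deriv: "!!t. DERIV h t :> k t - k (t - 1)"
  and h_supp: "!!t. 1 + \<delta> \<le> \<bar>t\<bar> ==> h t = 0"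
begin

abbreviation "w \<equiv> tens (%_. h)"
definition "kk i = (%j. if j = i then k else h)"

lemma kk: "unit_kernel (kk i j)"
 by (simp add: kk_def h k)

lemma w_gderiv:
 fixes y :: "int ^ 'd::finite"
 assumes "eps > 0"
 shows "GDERIV (w eps y) x :> (\<chi> i. (tens (kk i) eps y x - tens (kk i) eps (y + axis i 1) x) / eps)"
proof -
 let ?s = "%i. x $ i / eps - real_of_int (y $ i)"
 let ?G = "\<chi> i. (tens (kk i) eps y x - tens (kk i) eps (y + axis i 1) x) / eps"
 have d: "((%x::real ^ 'd. h (x $ i / eps - real_of_int (y $ i))) has_derivative
   (%v. v $ i * ((k (?s i) - k (?s i - 1)) / eps))) (at x)" for i
 proof -
  have "((%x::real ^ 'd. x $ i / eps - real_of_int (y $ i)) has_derivative (%v. v $ i / eps)) (at x)"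
   using assms by (auto intro!: derivative_eq_intros bounded_linear_imp_has_derivative bounded_linear_vec_nth)
  from DERIV_compose_FDERIV[OF h_deriv this] show ?thesis by (simp add: mult_ac)
 qed
 have "((%x. \<Prod>i\<in>UNIV. h (x $ i / eps - real_of_int (y $ i))) has_derivative
   (%v. \<Sum>i\<in>UNIV. v $ i * ((k (?s i) - k (?s i - 1)) / eps) * (\<Prod>j\<in>UNIV - {i}. h (?s j)))) (at x)"
  by (rule has_derivative_prod) (rule d)
 moreover have "(\<Sum>i\<in>UNIV. v $ i * ((k (?s i) - k (?s i - 1)) / eps) * (\<Prod>j\<in>UNIV - {i}. h (?s j))) = v \<bullet> ?G" for v :: "real ^ 'd"
 proof -
  have 1: "tens (kk i) eps y x = k (?s i) * (\<Prod>j\<in>UNIV - {i}. h (?s j))" for i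
   unfolding tens_def by (subst prod.remove[of _ i]) (auto simp: kk_def)
  have 2: "tens (kk i) eps (y + axis i 1) x = k (?s i - 1) * (\<Prod>j\<in>UNIV - {i}. h (?s j))" for i
   unfolding tens_def by (subst prod.remove[of _ i]) (auto simp: kk_def axis_def algebra_simps intro!: prod.cong)
  show ?thesis unfolding inner_vec_def by (intro sum.cong refl) (simp add: 1 2 algebra_simps diff_divide_distrib)
 qed
 ultimately show ?thesis unfolding gderiv_def tens_def[abs_def] by simp
qed

definition interp :: "real => (int ^ 'd::finite => real) => real ^ 'd => real" where
 "interp eps f x = zsum (%y. f y * w eps y x)"

lemma interp_eq_sum: "fin_supp f ==> interp eps f x = (\<Sum>y | f y ~= 0. f y * w eps y x)"
 unfolding interp_def by (rule zsum_eq) (auto simp: fin_supp_def)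

lemma interp_eq_sum_fun: "fin_supp f ==> interp eps f = (%x. \<Sum>y | f y ~= 0. f y * w eps y x)"
 by (rule ext) (rule interp_eq_sum)

text \<open>Summation by parts: the derivative of a hat is a difference of two kernels, and shifting
  the index moves the difference onto \<open>f\<close>. The gradient is thus a kernel average of
  difference quotients.\<close>

lemma interp_gderiv:
 fixes f :: "int ^ 'd::finite => real"
 assumes f: "fin_supp f" and eps: "eps > 0"
 shows "GDERIV (interp eps f) x :> (\<chi> i. zsum (%y. fdiff i f (y - axis i 1) * tens (kk i) eps y x) / eps)"
proof -
 let ?g = "%y. (\<chi> i. (tens (kk i) eps y x - tens (kk i) eps (y + axis i 1) x) / eps)"
 have "GDERIV (%x. \<Sum>y | f y ~= 0. f y * w eps y x) x :> (\<Sum>y | f y ~= 0. f y *\<^sub>R ?g y)"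
  using f eps by (intro GDERIV_sum GDERIV_cmult w_gderiv) (auto simp: fin_supp_def)
 moreover have "(\<Sum>y | f y ~= 0. f y *\<^sub>R ?g y) = (\<chi> i. zsum (%y. fdiff i f (y - axis i 1) * tens (kk i) eps y x) / eps)"
 proof -
  have "(\<Sum>y | f y ~= 0. f y *\<^sub>R ?g y) $ i = zsum (%y. fdiff i f (y - axis i 1) * tens (kk i) eps y x) / eps" for i
  proof -
   let ?e = "axis i 1 :: int ^ 'd"
   have "(\<Sum>y | f y ~= 0. f y *\<^sub>R ?g y) $ i
     = (\<Sum>y | f y ~= 0. f y * tens (kk i) eps y x - f y * tens (kk i) eps (y + ?e) x) / eps"
    by (simp add: sum_divide_distrib algebra_simps diff_divide_distrib)
   also have "(\<Sum>y | f y ~= 0. f y * tens (kk i) eps y x - f y * tens (kk i) eps (y + ?e) x)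
     = zsum (%y. f y * tens (kk i) eps y x - f y * tens (kk i) eps (y + ?e) x)"
    using f by (intro zsum_eq[symmetric]) (auto simp: fin_supp_def)
   also have "... = zsum (%y. f y * tens (kk i) eps y x) - zsum (%y. f y * tens (kk i) eps (y + ?e) x)"
    using f by (intro zsum_diff fin_supp_mult_left)
   also have "zsum (%y. f y * tens (kk i) eps (y + ?e) x) = zsum (%y. f (y - ?e) * tens (kk i) eps y x)"
    using zsum_shift[of "%y. f (y - ?e) * tens (kk i) eps y x" ?e] by simp
   also have "zsum (%y. f y * tens (kk i) eps y x) - ... = zsum (%y. f y * tens (kk i) eps y x - f (y - ?e) * tens (kk i) eps y x)"
    using f by (intro zsum_diff[symmetric] fin_supp_mult_left fin_supp_shift2)
   finally show ?thesis by (simp add: fdiff_def left_diff_distrib)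
  qed
  then show ?thesis by (simp add: vec_eq_iff)
 qed
 ultimately show ?thesis using f by (simp add: interp_eq_sum_fun)
qed

lemma fin_supp_fdiff: "fin_supp f ==> fin_supp (fdiff i f)"
 unfolding fdiff_def by (intro fin_supp_diff fin_supp_shift)

text \<open>The constant one in front of the energy is what the lower eigenvalue bound requires; it
  comes from Jensen at each point and from the exact total weight \<open>eps ^ CARD('d)\<close> of
  every kernel built from \<open>kk i\<close>.\<close>

lemma interp_energy:
 fixes f :: "int ^ 'd::finite => real"
 assumes f: "fin_supp f" and eps: "eps > 0"
 shows "integrable lborel (%x. (norm (grad (interp eps f) x))^2)"
  "(LBINT x. (norm (grad (interp eps f) x))^2) \<le> energy eps f"
proof -
 let ?a = "%i y. fdiff i f (y - axis i 1)"
 let ?A = "%i x. zsum (%y. ?a i y * tens (kk i) eps y x)"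
 have a: "fin_supp (?a i)" for i by (intro fin_supp_shift2 fin_supp_fdiff f)
 have a2: "fin_supp (%y. (?a i y)^2)" for i using a by (rule fin_supp_sq)
 have int2: "integrable lborel (%x. zsum (%y. (?a i y)^2 * tens (kk i) eps y x))"
   "(LBINT x. zsum (%y. (?a i y)^2 * tens (kk i) eps y x)) = eps ^ CARD('d) * zsum (%x. (fdiff i f x)^2)" for i
  using tens_zsum_integral[OF kk[of i] a2[of i] eps, of "%_. 1" 1] zsum_shift2[of "%x. (fdiff i f x)^2" "axis i 1"]
  by (simp_all add: tens_integral[OF kk eps] zsum_mult_right)
 have Am: "?A i \<in> borel_measurable borel" for i
  using borel_measurable_integrable[OF tens_zsum_integral(1)[OF kk[of i] a[of i] eps, of "%_. 1" 1]] by simp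
 have le: "(?A i x)^2 \<le> zsum (%y. (?a i y)^2 * tens (kk i) eps y x)" for i x by (rule tens_jensen[OF kk a])
 have intA: "integrable lborel (%x. (?A i x)^2)" for i
  by (rule Bochner_Integration.integrable_bound[OF int2(1)[of i]])
   (use Am le[THEN order_trans[OF _ abs_ge_self]] in auto)
 have leA: "(LBINT x. (?A i x)^2) \<le> eps ^ CARD('d) * zsum (%x. (fdiff i f x)^2)" for i
  unfolding int2(2)[symmetric] by (intro integral_mono intA int2 le)
 have eq: "(norm (grad (interp eps f) x))^2 = (\<Sum>i\<in>UNIV. (?A i x)^2 / eps\<^sup>2)" for x
  unfolding grad_eq[OF interp_gderiv[OF f eps]] power2_norm_eq_inner inner_vec_def
  by (simp add: power2_eq_square)
 show "integrable lborel (%x. (norm (grad (interp eps f) x))^2)"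
  unfolding eq by (intro Bochner_Integration.integrable_sum integrable_divide_zero intA)
 have "(LBINT x. (norm (grad (interp eps f) x))^2) = (\<Sum>i\<in>UNIV. (LBINT x. (?A i x)^2) / eps\<^sup>2)"
  unfolding eq using intA by (subst Bochner_Integration.integral_sum) auto
 also have "... \<le> (\<Sum>i\<in>UNIV. eps ^ CARD('d) * zsum (%x. (fdiff i f x)^2) / eps\<^sup>2)"
  by (intro sum_mono divide_right_mono leA) auto
 also have "... = energy eps f" by (simp add: energy_def dirichlet_sum_def sum_distrib_left sum_divide_distrib)
 finally show "(LBINT x. (norm (grad (interp eps f) x))^2) \<le> energy eps f" .
qed

lemma w_Ck: "Ck n (w eps y)"
proof -
 have "Ck n (%x. h (1 / eps * x $ i + (- real_of_int (y $ i))))" for i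
  by (rule Ck_affine_coordinate[OF Dk_h])
 then have "Ck n (%x. h (x $ i / eps - real_of_int (y $ i)))" for i by simp
 then show ?thesis unfolding tens_def[abs_def] by (intro Ck_prod) auto
qed

lemma interp_Ck: "fin_supp f ==> Ck n (interp eps f)"
 by (subst interp_eq_sum_fun, assumption, intro Ck_sum Ck_mult Ck_const w_Ck) (auto simp: fin_supp_def)

lemma w_supp:
 assumes "w eps y x ~= 0" "eps > 0"
 shows "\<bar>x $ i - eps * real_of_int (y $ i)\<bar> \<le> eps * (1 + \<delta>)"
proof -
 have "h (x $ i / eps - real_of_int (y $ i)) ~= 0" using assms by (simp add: tens_def)
 then have "\<bar>x $ i / eps - real_of_int (y $ i)\<bar> \<le> 1 + \<delta>"
  using h_supp[of "x $ i / eps - real_of_int (y $ i)"] by (cases "1 + \<delta> \<le> \<bar>x $ i / eps - real_of_int (y $ i)\<bar>") auto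
 moreover have "x $ i - eps * real_of_int (y $ i) = eps * (x $ i / eps - real_of_int (y $ i))"
  using assms by (simp add: algebra_simps)
 ultimately show ?thesis using assms(2) by (simp add: abs_mult)
qed

text \<open>Each kernel lives in a cube of half side \<open>eps * (1 + \<delta>)\<close> about its
  lattice point, and the slack keeps these finitely many cubes inside \<open>D\<close>.\<close>

lemma interp_test_function:
 fixes f :: "int ^ 'd::finite => real"
 assumes f: "fin_supp f" and eps: "eps > 0"
  and slack: "!!y. f y ~= 0 ==> dist_inf (eps *\<^sub>R lattice_point y) (- D) > eps * (1 + \<delta>)"
 shows "test_function D (interp eps f)"
proof -
 define Q where "Q y = cbox (\<chi> i. eps * real_of_int (y $ i) - eps * (1 + \<delta>)) (\<chi> i. eps * real_of_int (y $ i) + eps * (1 + \<delta>))" for y :: "int ^ 'd"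
 define K where "K = (\<Union>y\<in>{y. f y ~= 0}. Q y)"
 have K: "compact K" unfolding K_def Q_def using f by (intro compact_UN) (auto simp: fin_supp_def)
 have "{x. interp eps f x ~= 0} \<subseteq> K"
 proof
  fix x assume "x \<in> {x. interp eps f x ~= 0}"
  then have "(\<Sum>y | f y ~= 0. f y * w eps y x) ~= 0" using interp_eq_sum[OF f] by simp
  then obtain y where y: "f y ~= 0" "f y * w eps y x ~= 0" by (auto elim: sum.not_neutral_contains_not_neutral)
  then have "x \<in> Q y" using w_supp[OF _ eps, of y x] by (auto simp: Q_def mem_box_cart abs_le_iff algebra_simps)
  then show "x \<in> K" using y by (auto simp: K_def)
 qed
 then have sub: "closure {x. interp eps f x ~= 0} \<subseteq> K"
  using K by (simp add: closure_minimal compact_imp_closed)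
 have "K \<subseteq> D"
 proof
  fix x assume "x \<in> K"
  then obtain y where y: "f y ~= 0" "x \<in> Q y" by (auto simp: K_def)
  then show "x \<in> D"
   by (intro dist_inf_cube[OF slack[OF y(1)]]) (auto simp: Q_def mem_box_cart abs_le_iff lattice_point_def algebra_simps)
 qed
 then show ?thesis unfolding test_function_def
  using interp_Ck[OF f] sub compact_closure_subset[OF sub K] by blast
qed

end

text \<open>An interface that hides the kernel and its mesh-dependent parameter
  \<open>\<delta>\<close>: normalisation and support, admissibility on \<open>D\<close>, the energy
  inequality and the variance bound.\<close>

definition interpolation_weights :: "(real ^ 'd::finite) set => real => (int ^ 'd => real ^ 'd => real) => bool" where
 "interpolation_weights D eps w \<longleftrightarrow>
  (\<forall>y. w y \<in> borel_measurable borel \<and> integrable lborel (w y) \<and> (LBINT x. w y x) = eps ^ CARD('d) \<and>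
   (\<forall>x. 0 \<le> w y x) \<and> (\<forall>x i. w y x ~= 0 --> \<bar>x $ i - eps * real_of_int (y $ i)\<bar> \<le> 2 * eps)) \<and>
  (\<forall>f. fin_supp f --> (\<forall>y. y \<notin> lattice_domain D eps --> f y = 0) -->
   test_function D (%x. zsum (%y. f y * w y x))) \<and>
  (\<forall>f. fin_supp f --> integrable lborel (%x. (norm (grad (%x. zsum (%y. f y * w y x)) x))^2) \<and>
   (LBINT x. (norm (grad (%x. zsum (%y. f y * w y x)) x))^2) \<le> energy eps f) \<and>
  (\<forall>f u C. fin_supp f --> u \<in> borel_measurable borel --> (\<forall>x. \<bar>u x\<bar> \<le> C) -->
   integrable lborel (%x. u x * (zsum (%y. f y * w y x))^2) \<and>
   \<bar>zsum (%y. (f y)^2 * (LBINT x. u x * w y x)) - (LBINT x. u x * (zsum (%y. f y * w y x))^2)\<bar>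
    \<le> C * interp_const TYPE('d) * eps\<^sup>2 * energy eps f)"

lemma lattice_domain_bounded:
 fixes D :: "(real ^ 'd::finite) set"
 assumes "!!x i. x \<in> D ==> \<bar>x $ i\<bar> \<le> R" "eps > 0" "y \<in> lattice_domain D eps"
 shows "eps *\<^sub>R lattice_point y \<in> D" "\<bar>eps * real_of_int (y $ i)\<bar> \<le> R"
proof -
 show D: "eps *\<^sub>R lattice_point y \<in> D"
  using assms by (intro dist_inf_cube) (auto simp: lattice_domain_def)
 show "\<bar>eps * real_of_int (y $ i)\<bar> \<le> R" using assms(1)[OF D, of i] by (simp add: lattice_point_def)
qed

lemma finite_lattice_domain:
 fixes D :: "(real ^ 'd::finite) set"
 assumes "bounded D" "eps > 0"
 shows "finite (lattice_domain D eps)"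
proof -
 obtain R where "!!x. x \<in> D ==> norm x \<le> R" using assms(1) by (auto simp: bounded_iff)
 then have R: "\<bar>x $ i\<bar> \<le> R" if "x \<in> D" for x i using component_le_norm_cart[of x i] that by (meson order_trans)
 show ?thesis
  by (rule finite_subset[OF _ finite_bounded_lattice[OF assms(2), of R]])
   (use lattice_domain_bounded(2)[of D R, OF R assms(2)] in auto)
qed

lemma interpolation_weights_exist:
 fixes D :: "(real ^ 'd::finite) set"
 assumes "bounded D" "eps > 0"
 shows "\<exists>w. interpolation_weights D eps w"
proof -
 have fin: "finite (lattice_domain D eps)" by (rule finite_lattice_domain[OF assms])
 have "\<exists>\<delta>>0. \<delta> < 1 \<and> (\<forall>y\<in>lattice_domain D eps. dist_inf (eps *\<^sub>R lattice_point y) (- D) > eps * (1 + \<delta>))"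
 proof (cases "lattice_domain D eps = {}")
  case True
  then show ?thesis by (intro exI[of _ "1/2"]) auto
 next
  case False
  \<comment> \<open>There are finitely many lattice points, so the strict inequality in
    \<open>lattice_domain\<close> holds with a positive margin, of which \<open>\<delta>\<close>
    uses at most half.\<close>
  define m where "m = Min ((%y. dist_inf (eps *\<^sub>R lattice_point y) (- D)) ` lattice_domain D eps)"
  have "m > eps" unfolding m_def using fin False by (subst Min_gr_iff) (auto simp: lattice_domain_def)
  define \<delta> where "\<delta> = min (1/2) ((m / eps - 1) / 2)"
  have me: "m / eps > 1" using \<open>m > eps\<close> assms by simp
  then have \<delta>: "\<delta> > 0" "\<delta> < 1" by (auto simp: \<delta>_def)
  have "1 + min (1/2) ((q - 1) / 2) < q" if "q > 1" for q :: real
  proof -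
   have "(q - 1) / 2 < q - 1" using that by simp
   then show ?thesis by linarith
  qed
  from this[OF me] have "1 + \<delta> < m / eps" by (simp add: \<delta>_def)
  then have "eps * (1 + \<delta>) < m" using assms by (simp add: field_simps)
  moreover have "m \<le> dist_inf (eps *\<^sub>R lattice_point y) (- D)" if "y \<in> lattice_domain D eps" for y
   unfolding m_def using fin that by (intro Min_le) auto
  ultimately show ?thesis using \<delta> by (meson order_less_le_trans)
 qed
 then obtain \<delta> where \<delta>: "\<delta> > 0" "\<delta> < 1" and slack: "!!y. y \<in> lattice_domain D eps ==> dist_inf (eps *\<^sub>R lattice_point y) (- D) > eps * (1 + \<delta>)"
  by blast
 obtain h k where hk: "!!n. Dk n h" "continuous_on UNIV k"
  "!!t. DERIV h t :> k t - k (t - 1)" "!!t. 0 \<le> h t" "!!t. 0 \<le> k t"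
  "!!t. 1 + \<delta> \<le> \<bar>t\<bar> ==> h t = 0" "!!t. 1 + \<delta> \<le> \<bar>t\<bar> ==> k t = 0"
  "!!t a b. real_of_int a \<le> t - 2 ==> t + 2 \<le> real_of_int b ==> (\<Sum>n\<in>{a..b}. h (t - real_of_int n)) = 1"
  "!!t a b. real_of_int a \<le> t - 2 ==> t + 2 \<le> real_of_int b ==> (\<Sum>n\<in>{a..b}. k (t - real_of_int n)) = 1"
  by (rule smooth_hat_exists[OF \<delta>]) (rule that; assumption)
 have uh: "unit_kernel h" and uk: "unit_kernel k"
  using hk(1)[of 0] hk(2-) \<delta> unfolding unit_kernel_def by auto
 interpret smooth_hat h k \<delta>
  by unfold_locales (use \<delta> hk uh uk in auto)
 have ie: "(%x. zsum (%y. f y * w eps y x)) = interp eps f" for f :: "int ^ 'd => real" by (simp add: interp_def fun_eq_iff)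
 have "interpolation_weights D eps (w eps)"
  unfolding interpolation_weights_def ie
 proof (intro conjI allI impI)
  fix y :: "int ^ 'd"
  show "w eps y \<in> borel_measurable borel" by (rule tens_measurable[OF uh])
  show "integrable lborel (w eps y)" "(LBINT x. w eps y x) = eps ^ CARD('d)"
   by (rule tens_integrable[OF uh assms(2)], rule tens_integral[OF uh assms(2)])
  show "0 \<le> w eps y x" for x by (rule tens_nonneg[OF uh])
  show "\<bar>x $ i - eps * real_of_int (y $ i)\<bar> \<le> 2 * eps" if "w eps y x ~= 0" for x i
  proof -
   have "\<bar>x $ i - eps * real_of_int (y $ i)\<bar> \<le> eps * (1 + \<delta>)" by (rule w_supp[OF that assms(2)])
   also have "... \<le> eps * 2" using assms(2) \<delta> by (intro mult_left_mono) auto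
   finally show ?thesis by simp
  qed
 next
  fix f :: "int ^ 'd => real"
  assume f: "fin_supp f"
  show "test_function D (interp eps f)" if "\<forall>y. y \<notin> lattice_domain D eps --> f y = 0"
   by (rule interp_test_function[OF f assms(2)]) (use that slack in blast)
  show "integrable lborel (%x. (norm (grad (interp eps f) x))^2)" "(LBINT x. (norm (grad (interp eps f) x))^2) \<le> energy eps f"
   by (rule interp_energy[OF f assms(2)])+
  fix u :: "real ^ 'd => real" and C assume u: "u \<in> borel_measurable borel" "\<forall>x. \<bar>u x\<bar> \<le> C"
  note tw = tens_weighted_mass[OF uh f assms(2) u(1) u(2)[rule_format]]
  show "integrable lborel (%x. u x * (zsum (%y. f y * w eps y x))^2)" by (rule tw(1))
  show "\<bar>zsum (%y. (f y)^2 * (LBINT x. u x * w eps y x)) - (LBINT x. u x * (zsum (%y. f y * w eps y x))^2)\<bar>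
    \<le> C * interp_const TYPE('d) * eps\<^sup>2 * energy eps f" by (rule tw(2))
 qed
 then show ?thesis by blast
qed

section \<open>Sampling of test functions\<close>

lemma zsum_fdiff: "fin_supp f ==> zsum (fdiff i f) = 0"
 unfolding fdiff_def[abs_def] by (subst zsum_diff) (auto intro: fin_supp_shift simp: zsum_shift)

definition sample :: "real => (real ^ 'd::finite => real) => int ^ 'd => real" where
 "sample eps \<phi> y = \<phi> (eps *\<^sub>R lattice_point y)"

lemma lattice_point_add: "lattice_point (x + y) = lattice_point x + lattice_point y"
 by (simp add: lattice_point_def vec_eq_iff)

lemma lattice_point_axis: "lattice_point (axis i 1) = axis i 1"
 by (simp add: lattice_point_def vec_eq_iff axis_def)

locale test_fun =
 fixes D :: "(real ^ 'd::finite) set" and \<phi> :: "real ^ 'd => real" and R :: real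
 assumes test: "test_function D \<phi>" and D_bound: "!!x i. x \<in> D ==> \<bar>x $ i\<bar> \<le> R"
begin

lemma gderiv: "GDERIV \<phi> x :> grad \<phi> x"
proof -
 have "Ck (Suc 0) \<phi>" using test unfolding test_function_def by blast
 then obtain g where "!!x. GDERIV \<phi> x :> g x" by auto
 then show ?thesis using grad_eq by metis
qed

lemma cont: "continuous_on UNIV \<phi>"
proof -
 have "Ck 0 \<phi>" using test unfolding test_function_def by blast
 then show ?thesis by simp
qed

lemma cont_grad: "continuous_on UNIV (%x. grad \<phi> x $ i)"
proof -
 have "Ck (Suc 0) \<phi>" using test unfolding test_function_def by blast
 then obtain g where g: "!!x. GDERIV \<phi> x :> g x" "!!i. continuous_on UNIV (%x. g x $ i)" by auto
 then have "grad \<phi> = g" using grad_eq by blast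
 then show ?thesis by (simp only: g(2))
qed

lemma cont_grad': "continuous_on UNIV (grad \<phi>)"
proof -
 have "continuous_on UNIV (%x. \<chi> i. grad \<phi> x $ i)" by (rule continuous_on_vec_lambda) (rule cont_grad)
 then show ?thesis unfolding vec_nth_inverse .
qed

lemma measurable_phi: "\<phi> \<in> borel_measurable borel"
 by (rule borel_measurable_continuous_onI[OF cont])

lemma measurable_grad: "grad \<phi> \<in> borel_measurable borel"
 by (rule borel_measurable_continuous_onI[OF cont_grad'])

lemma measurable_grad_nth: "(%x. grad \<phi> x $ i) \<in> borel_measurable borel"
 by (rule borel_measurable_continuous_onI[OF cont_grad])

lemma outside:
 assumes "x \<notin> closure {x. \<phi> x ~= 0}" shows "\<phi> x = 0" "grad \<phi> x = 0"
proof -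
 let ?S = "- closure {x. \<phi> x ~= 0}"
 have z: "\<phi> y = 0" if "y \<in> ?S" for y using that closure_subset[of "{x. \<phi> x ~= 0}"] by blast
 show "\<phi> x = 0" by (rule z) (use assms in blast)
 have "((%_. 0) has_derivative (%h. h \<bullet> (0::real ^ 'd))) (at x)"
  unfolding inner_zero_right by (rule has_derivative_const)
 then have "(\<phi> has_derivative (%h. h \<bullet> (0::real ^ 'd))) (at x)"
 proof (rule has_derivative_transform_within_open)
  show "open ?S" by (intro open_Compl closed_closure)
  show "x \<in> ?S" using assms by (rule ComplI[OF notE])
  show "0 = \<phi> y" if "y \<in> ?S" for y using z[OF that] by (rule sym)
 qed
 then have "GDERIV \<phi> x :> 0" unfolding gderiv_def .
 then show "grad \<phi> x = 0" by (rule grad_eq)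
qed

lemma outside_D:
 assumes "x \<notin> D" shows "\<phi> x = 0" "grad \<phi> x = 0"
 using outside[of x] test assms unfolding test_function_def by auto

lemma bounded_exists: "\<exists>B\<ge>0. \<forall>x. \<bar>\<phi> x\<bar> \<le> B \<and> norm (grad \<phi> x) \<le> B"
proof -
 let ?K = "closure {x. \<phi> x ~= 0}"
 have K: "compact ?K" using test unfolding test_function_def by blast
 have "bounded (\<phi> ` ?K)" "bounded (grad \<phi> ` ?K)"
  by (intro compact_imp_bounded compact_continuous_image K continuous_on_subset[OF cont] continuous_on_subset[OF cont_grad'] subset_UNIV)+
 then obtain B1 B2 where B: "!!x. x \<in> ?K ==> \<bar>\<phi> x\<bar> \<le> B1" "!!x. x \<in> ?K ==> norm (grad \<phi> x) \<le> B2"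
  unfolding bounded_iff by auto
 have "\<bar>\<phi> x\<bar> \<le> max 0 (max B1 B2) \<and> norm (grad \<phi> x) \<le> max 0 (max B1 B2)" for x
  using B[of x] outside[of x] by (cases "x \<in> ?K") auto
 then show ?thesis by (intro exI[of _ "max 0 (max B1 B2)"]) auto
qed

lemma sample_supp: "sample eps \<phi> y ~= 0 ==> \<bar>eps * real_of_int (y $ i)\<bar> \<le> R"
 using outside_D(1)[of "eps *\<^sub>R lattice_point y"] D_bound[of "eps *\<^sub>R lattice_point y" i]
 by (auto simp: sample_def lattice_point_def)

lemma fin_supp_sample: "eps > 0 ==> fin_supp (sample eps \<phi>)"
 by (rule fin_suppI[OF finite_bounded_lattice[of eps R]]) (use sample_supp in auto)

lemma sample_fdiff_supp:
 assumes "fdiff j (sample eps \<phi>) y ~= 0" "0 < eps" "eps \<le> 1"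
 shows "\<bar>eps * real_of_int (y $ i)\<bar> \<le> R + 1"
proof -
 have "sample eps \<phi> y ~= 0 \<or> sample eps \<phi> (y + axis j 1) ~= 0" using assms(1) unfolding fdiff_def by linarith
 then consider "sample eps \<phi> y ~= 0" | "sample eps \<phi> (y + axis j 1) ~= 0" by blast
 then show ?thesis
 proof cases
  case 1
  from sample_supp[OF this, of i] show ?thesis by simp
 next
  case 2
  have "\<bar>eps * real_of_int ((y + axis j 1) $ i)\<bar> \<le> R" by (rule sample_supp[OF 2])
  moreover have "\<bar>eps * real_of_int ((y + axis j 1) $ i) - eps * real_of_int (y $ i)\<bar> \<le> 1"
   using assms by (simp add: axis_def distrib_left)
  ultimately show ?thesis by linarith
 qed
qed

lemma fdiff_mvt:
 assumes "eps > 0"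
 shows "\<exists>t. 0 < t \<and> t < eps \<and> fdiff i (sample eps \<phi>) y / eps = grad \<phi> (eps *\<^sub>R lattice_point y + t *\<^sub>R axis i 1) $ i"
proof -
 let ?a = "eps *\<^sub>R lattice_point y"
 let ?g = "%t. \<phi> (?a + t *\<^sub>R axis i 1)"
 have d: "DERIV ?g t :> grad \<phi> (?a + t *\<^sub>R axis i 1) $ i" for t
 proof -
  have "((%t. ?a + t *\<^sub>R axis i 1) has_derivative (%s. s *\<^sub>R axis i 1)) (at t)"
   by (auto intro!: derivative_eq_intros)
  moreover have "(\<phi> has_derivative (%h. h \<bullet> grad \<phi> (?a + t *\<^sub>R axis i 1))) (at (?a + t *\<^sub>R axis i 1))"
   using gderiv unfolding gderiv_def .
  ultimately have "(?g has_derivative (%s. (s *\<^sub>R axis i 1) \<bullet> grad \<phi> (?a + t *\<^sub>R axis i 1))) (at t)"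
   by (rule has_derivative_compose)
  then show ?thesis unfolding has_field_derivative_def
   by (simp add: inner_commute[of "axis i 1"] inner_axis mult_commute_abs)
 qed
 have "\<exists>t. 0 < t \<and> t < eps \<and> ?g eps - ?g 0 = (eps - 0) * grad \<phi> (?a + t *\<^sub>R axis i 1) $ i"
  by (rule MVT2[OF assms]) (rule d)
 moreover have "?g eps - ?g 0 = fdiff i (sample eps \<phi>) y"
  by (simp add: fdiff_def sample_def lattice_point_add lattice_point_axis scaleR_add_right)
 ultimately show ?thesis using assms by auto
qed

lemma fdiff_tendsto:
 assumes "!!n. eps n > 0" "eps \<longlonglongrightarrow> 0"
 shows "(%n. fdiff i (sample (eps n) \<phi>) (qfloor (eps n) x) / eps n) \<longlonglongrightarrow> grad \<phi> x $ i"
proof -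
 have "\<exists>t. \<forall>n. 0 < t n \<and> t n < eps n \<and> fdiff i (sample (eps n) \<phi>) (qfloor (eps n) x) / eps n
   = grad \<phi> (eps n *\<^sub>R lattice_point (qfloor (eps n) x) + t n *\<^sub>R axis i 1) $ i"
  by (intro choice allI fdiff_mvt assms)
 then obtain t where t: "!!n. 0 < t n" "!!n. t n < eps n"
  and eq: "!!n. fdiff i (sample (eps n) \<phi>) (qfloor (eps n) x) / eps n
   = grad \<phi> (eps n *\<^sub>R lattice_point (qfloor (eps n) x) + t n *\<^sub>R axis i 1) $ i" by blast
 have t0: "t \<longlonglongrightarrow> 0"
  by (rule tendsto_sandwich[OF _ _ tendsto_const assms(2)]) (use t in \<open>auto intro: less_imp_le always_eventually\<close>)
 have "(%n. eps n *\<^sub>R lattice_point (qfloor (eps n) x) + t n *\<^sub>R axis i 1) \<longlonglongrightarrow> x + 0 *\<^sub>R axis i 1"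
  using qfloor_tendsto[OF assms, of x 0] by (intro tendsto_add tendsto_scaleR tendsto_const t0) simp
 then have l: "(%n. eps n *\<^sub>R lattice_point (qfloor (eps n) x) + t n *\<^sub>R axis i 1) \<longlonglongrightarrow> x" by simp
 show ?thesis unfolding eq
  using continuous_on_tendsto_compose[OF cont_grad l] by simp
qed

lemma sample_tendsto:
 assumes "!!n. eps n > 0" "eps \<longlonglongrightarrow> 0"
 shows "(%n. sample (eps n) \<phi> (qfloor (eps n) x)) \<longlonglongrightarrow> \<phi> x"
 using continuous_on_tendsto_compose[OF cont qfloor_tendsto[OF assms, of x 0]] by (simp add: sample_def)

lemma fdiff_bound:
 assumes "eps > 0" "!!x. norm (grad \<phi> x) \<le> B"
 shows "\<bar>fdiff i (sample eps \<phi>) y / eps\<bar> \<le> B"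
proof -
 obtain t where "fdiff i (sample eps \<phi>) y / eps = grad \<phi> (eps *\<^sub>R lattice_point y + t *\<^sub>R axis i 1) $ i"
  using fdiff_mvt[OF assms(1)] by blast
 then show ?thesis using component_le_norm_cart[of "grad \<phi> (eps *\<^sub>R lattice_point y + t *\<^sub>R axis i 1)" i] assms(2)
  by (metis order_trans)
qed

text \<open>Lattice sums of difference quotients vanish by translation invariance, and they are
  Riemann sums for this integral.\<close>

lemma integral_grad_zero: "(LBINT x. grad \<phi> x $ i) = 0"
proof -
 obtain B where B: "!!x. norm (grad \<phi> x) \<le> B" using bounded_exists by blast
 define eps where "eps n = inverse (real (Suc n))" for n
 have eps: "!!n. 0 < eps n" "!!n. eps n \<le> 1" "eps \<longlonglongrightarrow> 0"
  unfolding eps_def using LIMSEQ_inverse_real_of_nat by (auto simp: field_simps)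
 have "(%n. eps n ^ CARD('d) * zsum (%y. fdiff i (sample (eps n) \<phi>) y / eps n)) \<longlonglongrightarrow> (LBINT x. grad \<phi> x $ i)"
  by (rule lattice_riemann_sum(2)[OF eps(1,2) measurable_grad_nth, where R = "R + 1" and B = B])
   (use fdiff_tendsto[OF eps(1,3)] fdiff_bound[OF eps(1) B] sample_fdiff_supp[OF _ eps(1,2)] in auto)
 then have "(%n. 0) \<longlonglongrightarrow> (LBINT x. grad \<phi> x $ i)"
  by (simp add: zsum_divide zsum_fdiff fin_supp_sample eps)
 then show ?thesis by (simp add: LIMSEQ_const_iff)
qed

end

section \<open>Integration by parts and limits of sampled forms\<close>

lemma test_function_lin:
 assumes "test_function D \<phi>" "test_function D \<psi>"
 shows "test_function D (%x. a * \<phi> x + b * \<psi> x)"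
proof -
 have sub: "closure {x. a * \<phi> x + b * \<psi> x ~= 0} \<subseteq> closure {x. \<phi> x ~= 0} \<union> closure {x. \<psi> x ~= 0}"
  unfolding closure_Un[symmetric] by (intro closure_mono) auto
 have c: "compact (closure {x. \<phi> x ~= 0} \<union> closure {x. \<psi> x ~= 0})"
  using assms unfolding test_function_def by (intro compact_Un) auto
 have "Ck n (%x. a * \<phi> x + b * \<psi> x)" for n
  using assms unfolding test_function_def by (intro Ck_add Ck_mult Ck_const) auto
 moreover have "compact (closure {x. a * \<phi> x + b * \<psi> x ~= 0})"
  by (rule compact_closure_subset[OF sub c])
 ultimately show ?thesis using assms sub unfolding test_function_def by blast
qed

lemma test_function_mult:
 assumes "test_function D \<phi>" "test_function D \<psi>"
 shows "test_function D (%x. \<phi> x * \<psi> x)"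
proof -
 have sub: "closure {x. \<phi> x * \<psi> x ~= 0} \<subseteq> closure {x. \<phi> x ~= 0}"
  by (intro closure_mono) auto
 have c: "compact (closure {x. \<phi> x ~= 0})"
  using assms unfolding test_function_def by auto
 have "Ck n (%x. \<phi> x * \<psi> x)" for n
  using assms unfolding test_function_def by (intro Ck_mult) auto
 moreover have "compact (closure {x. \<phi> x * \<psi> x ~= 0})"
  by (rule compact_closure_subset[OF sub c])
 ultimately show ?thesis using assms sub unfolding test_function_def by blast
qed

lemma test_fun_integrable:
 fixes D :: "(real ^ 'd::finite) set"
 assumes "test_fun D \<phi> R" "test_fun D \<psi> R"
 shows "integrable lborel (%x. \<phi> x * \<psi> x)" "integrable lborel (%x. grad \<phi> x $ i * grad \<psi> x $ i)"
  "integrable lborel (%x. \<phi> x * grad \<psi> x $ i)"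
proof -
 interpret f: test_fun D \<phi> R by fact
 interpret g: test_fun D \<psi> R by fact
 obtain B where B: "B \<ge> 0" "!!x. \<bar>\<phi> x\<bar> \<le> B" "!!x. norm (grad \<phi> x) \<le> B" using f.bounded_exists by blast
 obtain B' where B': "B' \<ge> 0" "!!x. \<bar>\<psi> x\<bar> \<le> B'" "!!x. norm (grad \<psi> x) \<le> B'" using g.bounded_exists by blast
 have c: "\<bar>grad \<phi> x $ i\<bar> \<le> B" "\<bar>grad \<psi> x $ i\<bar> \<le> B'" for x
  using component_le_norm_cart[of "grad \<phi> x" i] component_le_norm_cart[of "grad \<psi> x" i] B(3)[of x] B'(3)[of x] by linarith+
 note [measurable] = f.measurable_phi g.measurable_phi f.measurable_grad_nth g.measurable_grad_nth
 have R: "\<bar>x $ j\<bar> \<le> R" if "\<phi> x ~= 0 \<or> grad \<phi> x $ i ~= 0" for x j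
  using that f.outside_D[of x] f.D_bound[of x j] by (cases "x \<in> D") auto
 show "integrable lborel (%x. \<phi> x * \<psi> x)"
  using B B' R by (intro integrable_bounded_support[of _ "B * B'" R]) (auto simp: abs_mult intro!: mult_mono)
 show "integrable lborel (%x. grad \<phi> x $ i * grad \<psi> x $ i)"
  using B c R by (intro integrable_bounded_support[of _ "B * B'" R]) (auto simp: abs_mult intro!: mult_mono)
 show "integrable lborel (%x. \<phi> x * grad \<psi> x $ i)"
  using B c R by (intro integrable_bounded_support[of _ "B * B'" R]) (auto simp: abs_mult intro!: mult_mono)
qed

text \<open>The product is again a test function, and its gradient integrates to zero.\<close>

lemma test_fun_ibp:
 fixes D :: "(real ^ 'd::finite) set"
 assumes "test_fun D \<phi> R" "test_fun D \<psi> R"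
 shows "(LBINT x. \<phi> x * grad \<psi> x $ i) = - (LBINT x. \<psi> x * grad \<phi> x $ i)"
proof -
 interpret f: test_fun D \<phi> R by fact
 interpret g: test_fun D \<psi> R by fact
 interpret fg: test_fun D "%x. \<phi> x * \<psi> x" R
  by unfold_locales (auto intro: test_function_mult f.test g.test f.D_bound)
 have "grad (%x. \<phi> x * \<psi> x) x = \<phi> x *\<^sub>R grad \<psi> x + \<psi> x *\<^sub>R grad \<phi> x" for x
  by (rule grad_eq[OF GDERIV_mult[OF f.gderiv g.gderiv]])
 then have "(LBINT x. \<phi> x * grad \<psi> x $ i + \<psi> x * grad \<phi> x $ i) = 0"
  using fg.integral_grad_zero[of i] by simp
 then show ?thesis
  using test_fun_integrable(3)[OF assms, of i] test_fun_integrable(3)[OF assms(2,1), of i] by simp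
qed

lemma sample_limits:
 fixes D :: "(real ^ 'd::finite) set"
 assumes "test_fun D \<phi> R" "test_fun D \<psi> R" and eps: "!!n. 0 < eps n" "!!n. eps n \<le> 1" "eps \<longlonglongrightarrow> 0"
 shows "(%n. eps n ^ CARD('d) * zsum (%y. sample (eps n) \<phi> y * sample (eps n) \<psi> y)) \<longlonglongrightarrow> (LBINT x. \<phi> x * \<psi> x)"
  "(%n. eps n ^ CARD('d) / (eps n)^2 * zsum (%y. fdiff i (sample (eps n) \<phi>) y * fdiff i (sample (eps n) \<psi>) y)) \<longlonglongrightarrow> (LBINT x. grad \<phi> x $ i * grad \<psi> x $ i)"
proof -
 interpret f: test_fun D \<phi> R by fact
 interpret g: test_fun D \<psi> R by fact
 obtain B where B: "B \<ge> 0" "!!x. \<bar>\<phi> x\<bar> \<le> B" "!!x. norm (grad \<phi> x) \<le> B" using f.bounded_exists by blast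
 obtain B' where B': "B' \<ge> 0" "!!x. \<bar>\<psi> x\<bar> \<le> B'" "!!x. norm (grad \<psi> x) \<le> B'" using g.bounded_exists by blast
 note [measurable] = f.measurable_phi g.measurable_phi f.measurable_grad_nth g.measurable_grad_nth
 show "(%n. eps n ^ CARD('d) * zsum (%y. sample (eps n) \<phi> y * sample (eps n) \<psi> y)) \<longlonglongrightarrow> (LBINT x. \<phi> x * \<psi> x)"
 proof (rule lattice_riemann_sum(2)[OF eps(1,2), where R = R and B = "B * B'"])
  show "\<bar>sample (eps n) \<phi> y * sample (eps n) \<psi> y\<bar> \<le> B * B'" for n y
   using B B' by (auto simp: abs_mult sample_def intro!: mult_mono)
  show "AE x in lborel. (%n. sample (eps n) \<phi> (qfloor (eps n) x) * sample (eps n) \<psi> (qfloor (eps n) x)) \<longlonglongrightarrow> \<phi> x * \<psi> x"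
   by (intro AE_I2 tendsto_mult f.sample_tendsto g.sample_tendsto eps)
 qed (use f.sample_supp in auto)
 have "(%n. eps n ^ CARD('d) * zsum (%y. (fdiff i (sample (eps n) \<phi>) y / eps n) * (fdiff i (sample (eps n) \<psi>) y / eps n))) \<longlonglongrightarrow> (LBINT x. grad \<phi> x $ i * grad \<psi> x $ i)"
 proof (rule lattice_riemann_sum(2)[OF eps(1,2), where R = "R + 1" and B = "B * B'"])
  show "\<bar>(fdiff i (sample (eps n) \<phi>) y / eps n) * (fdiff i (sample (eps n) \<psi>) y / eps n)\<bar> \<le> B * B'" for n y
   unfolding abs_mult using B B' by (intro mult_mono f.fdiff_bound g.fdiff_bound eps) auto
  show "AE x in lborel. (%n. (fdiff i (sample (eps n) \<phi>) (qfloor (eps n) x) / eps n) * (fdiff i (sample (eps n) \<psi>) (qfloor (eps n) x) / eps n)) \<longlonglongrightarrow> grad \<phi> x $ i * grad \<psi> x $ i"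
   by (intro AE_I2 tendsto_mult f.fdiff_tendsto g.fdiff_tendsto eps)
  show "\<bar>eps n * real_of_int (y $ j)\<bar> \<le> R + 1" if "(fdiff i (sample (eps n) \<phi>) y / eps n) * (fdiff i (sample (eps n) \<psi>) y / eps n) ~= 0" for n y j
   using f.sample_fdiff_supp[OF _ eps(1,2), of i n y j] that by auto
 qed measurable
 moreover have "zsum (%y. (fdiff i (sample (eps n) \<phi>) y / eps n) * (fdiff i (sample (eps n) \<psi>) y / eps n))
   = zsum (%y. fdiff i (sample (eps n) \<phi>) y * fdiff i (sample (eps n) \<psi>) y) / (eps n)^2" for n
  by (simp add: zsum_divide[symmetric] power2_eq_square)
 ultimately show "(%n. eps n ^ CARD('d) / (eps n)^2 * zsum (%y. fdiff i (sample (eps n) \<phi>) y * fdiff i (sample (eps n) \<psi>) y)) \<longlonglongrightarrow> (LBINT x. grad \<phi> x $ i * grad \<psi> x $ i)"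
  by simp
qed

lemma energy_sample_tendsto:
 fixes D :: "(real ^ 'd::finite) set"
 assumes "test_fun D \<phi> R" and eps: "!!n. 0 < eps n" "!!n. eps n \<le> 1" "eps \<longlonglongrightarrow> 0"
 shows "(%n. energy (eps n) (sample (eps n) \<phi>)) \<longlonglongrightarrow> (LBINT x. (norm (grad \<phi> x))^2)"
proof -
 have "(LBINT x. (norm (grad \<phi> x))^2) = (\<Sum>i\<in>UNIV. \<integral>x. grad \<phi> x $ i * grad \<phi> x $ i \<partial>lborel)"
  unfolding power2_norm_eq_inner inner_vec_def using test_fun_integrable(2)[OF assms(1,1)]
  by (subst Bochner_Integration.integral_sum) auto
 moreover have "energy (eps n) (sample (eps n) \<phi>) = (\<Sum>i\<in>UNIV. eps n ^ CARD('d) / (eps n)^2 * zsum (%y. fdiff i (sample (eps n) \<phi>) y * fdiff i (sample (eps n) \<phi>) y))" for n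
  by (simp add: energy_def dirichlet_sum_def sum_distrib_left power2_eq_square)
 ultimately show ?thesis
  by (simp only:) (intro tendsto_sum sample_limits(2)[OF assms(1,1) eps])
qed

section \<open>A cell-wise Poincare inequality\<close>

definition zdiv :: "nat => int ^ 'd::finite => int ^ 'd" where
 "zdiv L x = (\<chi> i. x $ i div int L)"

lemma zdiv_box: "u \<in> zbox L ==> zdiv L (int L *s c + u) = c"
proof -
 assume u: "u \<in> zbox L"
 have "(int L * c $ i + u $ i) div int L = c $ i" for i
 proof -
  have "0 \<le> u $ i \<and> u $ i < int L" using u by (simp add: zbox_def)
  then show ?thesis by (simp add: div_pos_pos_trivial)
 qed
 then show ?thesis by (simp add: zdiv_def vec_eq_iff)
qed

lemma zsum_split_boxes:
 fixes f :: "int ^ 'd::finite => real"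
 assumes f: "fin_supp f" and L: "L > 0"
 shows "zsum f = zsum (%c. \<Sum>u\<in>zbox L. f (int L *s c + u))"
  "fin_supp (%c. \<Sum>u\<in>zbox L. f (int L *s c + u))"
proof -
 define S where "S = {x. f x ~= 0}"
 define C where "C = zdiv L ` S"
 have S: "finite S" using f by (simp add: S_def fin_supp_def)
 then have C: "finite C" by (simp add: C_def)
 have zero: "(\<Sum>u\<in>zbox L. f (int L *s c + u)) = 0" if "c \<notin> C" for c
 proof (rule sum.neutral, intro ballI, rule ccontr)
  fix u :: "int ^ 'd" assume u: "u \<in> zbox L" "f (int L *s c + u) ~= 0"
  then have "c \<in> C" unfolding C_def S_def by (intro image_eqI[of _ _ "int L *s c + u"]) (auto simp: zdiv_box)
  then show False using that by simp
 qed
 show "fin_supp (%c. \<Sum>u\<in>zbox L. f (int L *s c + u))"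
  by (rule fin_suppI[OF C zero])
 let ?T = "(%(c, u). int L *s c + u) ` (C \<times> zbox L)"
 have inj: "inj_on (%(c, u). int L *s c + u) (C \<times> (zbox L :: (int ^ 'd) set))"
 proof (rule inj_onI, clarify)
  fix c u c' u' :: "int ^ 'd"
  assume *: "u \<in> zbox L" "u' \<in> zbox L" "int L *s c + u = int L *s c' + u'"
  then have "c = c'" using zdiv_box[of u L c] zdiv_box[of u' L c'] by simp
  then show "c = c' \<and> u = u'" using * by simp
 qed
 have "f x = 0" if "x \<notin> ?T" for x
 proof (rule ccontr)
  assume "f x ~= 0"
  then have "zdiv L x \<in> C" by (simp add: C_def S_def)
  moreover have "(\<chi> i. x $ i mod int L) \<in> zbox L" using L by (simp add: zbox_def)
  moreover have "x = int L *s zdiv L x + (\<chi> i. x $ i mod int L)" by (simp add: zdiv_def vec_eq_iff)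
  ultimately have "x \<in> ?T" by (metis (no_types, lifting) SigmaI case_prod_conv image_eqI)
  then show False using that by simp
 qed
 then have "zsum f = sum f ?T" using C by (intro zsum_eq) auto
 also have "... = (\<Sum>(c, u)\<in>C \<times> zbox L. f (int L *s c + u))"
  by (subst sum.reindex[OF inj]) (simp add: case_prod_unfold)
 also have "... = (\<Sum>c\<in>C. \<Sum>u\<in>zbox L. f (int L *s c + u))"
  by (simp add: sum.cartesian_product)
 also have "... = zsum (%c. \<Sum>u\<in>zbox L. f (int L *s c + u))"
  using zero by (intro zsum_eq[symmetric] C)
 finally show "zsum f = zsum (%c. \<Sum>u\<in>zbox L. f (int L *s c + u))" .
qed

text \<open>In the exact variance identity the double sum carries a further factor one half.\<close>

lemma sum_sq_variance_le:
 fixes f :: "'a => real"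
 assumes "finite A" "A ~= {}"
 shows "(\<Sum>u\<in>A. (f u)^2) \<le> (\<Sum>u\<in>A. f u)^2 / real (card A) + (\<Sum>u\<in>A. \<Sum>v\<in>A. (f v - f u)^2) / real (card A)"
proof -
 let ?N = "real (card A)" and ?S = "\<Sum>u\<in>A. f u" and ?Q = "\<Sum>u\<in>A. (f u)^2"
 have N: "?N > 0" using assms by (simp add: card_gt_0_iff)
 have inner: "(\<Sum>v\<in>A. (f v - f u)^2) = ?Q - 2 * f u * ?S + ?N * (f u)^2" for u
 proof -
  have "(\<Sum>v\<in>A. (f v - f u)^2) = (\<Sum>v\<in>A. (f v)^2 - 2 * f u * f v + (f u)^2)"
   by (intro sum.cong refl) (simp add: power2_diff)
  then show ?thesis by (simp only: sum.distrib sum_subtractf sum_distrib_left[symmetric] sum_constant)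
 qed
 define Q where "Q = ?Q"
 define S where "S = ?S"
 have "(\<Sum>u\<in>A. \<Sum>v\<in>A. (f v - f u)^2) = ?N * Q - 2 * S * S + ?N * Q"
  unfolding inner Q_def[symmetric] S_def[symmetric]
  by (simp add: sum.distrib sum_subtractf sum_distrib_left[symmetric] sum_distrib_right[symmetric] Q_def[symmetric] S_def[symmetric])
 moreover have "0 \<le> (\<Sum>u\<in>A. \<Sum>v\<in>A. (f v - f u)^2)" by (intro sum_nonneg) auto
 ultimately have "?N * Q \<le> S\<^sup>2 + (\<Sum>u\<in>A. \<Sum>v\<in>A. (f v - f u)^2)" by (simp add: power2_eq_square)
 then have "Q \<le> (S\<^sup>2 + (\<Sum>u\<in>A. \<Sum>v\<in>A. (f v - f u)^2)) / ?N" using N by (simp add: field_simps)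
 then show ?thesis by (simp add: Q_def S_def add_divide_distrib)
qed

text \<open>In each box the variance is a double sum of differences whose offsets have coordinates
  at most \<open>L\<close> in absolute value. There are at most
  \<open>3 ^ CARD('d) * L ^ CARD('d)\<close> such offsets, and summed over all boxes each is
  controlled by the Dirichlet sum.\<close>

lemma cell_poincare_discrete:
 fixes f :: "int ^ 'd::finite => real"
 assumes f: "fin_supp f" and L: "L > 0"
 shows "zsum (%x. (f x)^2) \<le> 3 ^ CARD('d) * real CARD('d) * (real L)^2 * dirichlet_sum f
   + zsum (%c. (\<Sum>u\<in>zbox L. f (int L *s c + u))^2 / real (L ^ CARD('d)))"
  "fin_supp (%c. (\<Sum>u\<in>zbox L. f (int L *s c + u))^2 / real (L ^ CARD('d)))"
proof -
 let ?N = "real (L ^ CARD('d))"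
 have N: "?N > 0" using L by simp
 define Z where "Z = (%z. z - (\<chi> i. int L)) ` (zbox (2 * L + 1) :: (int ^ 'd) set)"
 have Z: "finite Z" by (simp add: Z_def)
 have Zmem: "z \<in> Z \<longleftrightarrow> (\<forall>i. \<bar>z $ i\<bar> \<le> int L)" for z :: "int ^ 'd"
 proof
  assume "z \<in> Z"
  then obtain x where x: "z = x - (\<chi> i. int L)" "x \<in> zbox (2 * L + 1)" by (auto simp: Z_def)
  show "\<forall>i. \<bar>z $ i\<bar> \<le> int L"
  proof
   fix i have "0 \<le> x $ i \<and> x $ i < int (2 * L + 1)" using x(2) by (simp add: zbox_def)
   then have "\<bar>x $ i - int L\<bar> \<le> int L" by linarith
   then show "\<bar>z $ i\<bar> \<le> int L" using x(1) by simp
  qed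
 next
  assume *: "\<forall>i. \<bar>z $ i\<bar> \<le> int L"
  have "0 \<le> z $ i + int L \<and> z $ i + int L < int (2 * L + 1)" for i
   using *[rule_format, of i] by auto
  then show "z \<in> Z" unfolding Z_def by (intro image_eqI[of _ _ "z + (\<chi> i. int L)"]) (auto simp: zbox_def)
 qed
 have cardZ: "real (card Z) \<le> 3 ^ CARD('d) * ?N"
 proof -
  have "card Z = (2 * L + 1) ^ CARD('d)" unfolding Z_def by (subst card_image) (auto simp: card_zbox inj_on_def)
  also have "... \<le> (3 * L) ^ CARD('d)" using L by (intro power_mono) auto
  finally show ?thesis by (simp add: power_mult_distrib flip: of_nat_le_iff[where 'a=real])
 qed
 let ?g = "%x. \<Sum>z\<in>Z. (f (x + z) - f x)^2"
 have g: "fin_supp ?g" using Z f by (intro fin_supp_sum fin_supp_sq fin_supp_diff fin_supp_shift)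
 have f2: "fin_supp (%x. (f x)^2)" using f by (rule fin_supp_sq)
 have fs1: "fin_supp (%c. \<Sum>u\<in>zbox L. f (int L *s c + u))" by (rule zsum_split_boxes(2)[OF f L])
 show fs2: "fin_supp (%c. (\<Sum>u\<in>zbox L. f (int L *s c + u))^2 / ?N)"
  unfolding divide_inverse by (intro fin_supp_mult_left fin_supp_sq fs1)
 have fs3: "fin_supp (%c. (\<Sum>u\<in>zbox L. ?g (int L *s c + u)) / ?N)"
  unfolding divide_inverse by (intro fin_supp_mult_left zsum_split_boxes(2)[OF g L])
 have "zsum (%x. (f x)^2) = zsum (%c. \<Sum>u\<in>zbox L. (f (int L *s c + u))^2)"
  by (rule zsum_split_boxes(1)[OF f2 L])
 also have "... \<le> zsum (%c. (\<Sum>u\<in>zbox L. f (int L *s c + u))^2 / ?N + (\<Sum>u\<in>zbox L. ?g (int L *s c + u)) / ?N)"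
 proof (intro zsum_mono fin_supp_add fs2 fs3 zsum_split_boxes(2)[OF f2 L])
  fix c :: "int ^ 'd"
  have "0 \<in> (zbox L :: (int ^ 'd) set)" using L by (simp add: zbox_def)
  then have "(\<Sum>u\<in>zbox L. (f (int L *s c + u))^2) \<le> (\<Sum>u\<in>zbox L. f (int L *s c + u))^2 / ?N
    + (\<Sum>u\<in>zbox L. \<Sum>v\<in>zbox L. (f (int L *s c + v) - f (int L *s c + u))^2) / ?N"
   using sum_sq_variance_le[of "zbox L" "%u. f (int L *s c + u)"] by (auto simp: card_zbox)
  also have "(\<Sum>u\<in>zbox L. \<Sum>v\<in>zbox L. (f (int L *s c + v) - f (int L *s c + u))^2) \<le> (\<Sum>u\<in>zbox L. ?g (int L *s c + u))"
  proof (rule sum_mono)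
   fix u :: "int ^ 'd" assume u: "u \<in> zbox L"
   have "(\<Sum>v\<in>zbox L. (f (int L *s c + v) - f (int L *s c + u))^2)
     = (\<Sum>z\<in>(%v. v - u) ` zbox L. (f (int L *s c + u + z) - f (int L *s c + u))^2)"
    by (subst sum.reindex) (auto simp: inj_on_def add.assoc)
   also have "... \<le> ?g (int L *s c + u)"
   proof (intro sum_mono2 Z)
    show "(%v. v - u) ` zbox L \<subseteq> Z"
    proof
     fix z assume "z \<in> (%v. v - u) ` zbox L"
     then obtain v where v: "v \<in> zbox L" "z = v - u" by blast
     have "\<bar>v $ i - u $ i\<bar> \<le> int L" for i
     proof -
      have "0 \<le> v $ i \<and> v $ i < int L" "0 \<le> u $ i \<and> u $ i < int L" using u v by (auto simp: zbox_def)
      then show ?thesis by linarith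
     qed
     then show "z \<in> Z" by (simp add: Zmem v)
    qed
   qed auto
   finally show "(\<Sum>v\<in>zbox L. (f (int L *s c + v) - f (int L *s c + u))^2) \<le> ?g (int L *s c + u)" .
  qed
  finally show "(\<Sum>u\<in>zbox L. (f (int L *s c + u))^2) \<le> (\<Sum>u\<in>zbox L. f (int L *s c + u))^2 / ?N + (\<Sum>u\<in>zbox L. ?g (int L *s c + u)) / ?N"
   using N by (simp add: divide_right_mono)
 qed
 also have "... = zsum (%c. (\<Sum>u\<in>zbox L. f (int L *s c + u))^2 / ?N) + zsum ?g / ?N"
  by (subst zsum_add[OF fs2 fs3], subst (2) zsum_divide, subst zsum_split_boxes(1)[OF g L]) simp
 also have "zsum ?g / ?N \<le> 3 ^ CARD('d) * real CARD('d) * (real L)^2 * dirichlet_sum f"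
 proof -
  have "zsum ?g = (\<Sum>z\<in>Z. zsum (%x. (f (x + z) - f x)^2))"
   using f by (intro zsum_sum Z fin_supp_sq fin_supp_diff fin_supp_shift)
  also have "... \<le> (\<Sum>z\<in>Z. (real L)^2 * real CARD('d) * dirichlet_sum f)"
  proof (intro sum_mono zsum_shift_le f)
   fix z i assume "z \<in> Z"
   then have "\<bar>z $ i\<bar> \<le> int L" by (simp add: Zmem)
   then show "\<bar>real_of_int (z $ i)\<bar> \<le> real L" by linarith
  qed
  also have "... = real (card Z) * ((real L)^2 * real CARD('d) * dirichlet_sum f)" by simp
  also have "... \<le> (3 ^ CARD('d) * ?N) * ((real L)^2 * real CARD('d) * dirichlet_sum f)"
   by (intro mult_right_mono cardZ) auto
  finally have "zsum ?g / ?N \<le> (3 ^ CARD('d) * ?N) * ((real L)^2 * real CARD('d) * dirichlet_sum f) / ?N"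
   using N by (intro divide_right_mono) auto
  also have "... = 3 ^ CARD('d) * real CARD('d) * (real L)^2 * dirichlet_sum f" using L by (simp add: mult_ac)
  finally show ?thesis .
 qed
 finally show "zsum (%x. (f x)^2) \<le> 3 ^ CARD('d) * real CARD('d) * (real L)^2 * dirichlet_sum f
   + zsum (%c. (\<Sum>u\<in>zbox L. f (int L *s c + u))^2 / ?N)" by simp
qed

context test_fun
begin

definition "near_cells r = {c :: int ^ 'd. \<forall>i. \<bar>r * real_of_int (c $ i)\<bar> \<le> R + r}"

text \<open>Finitely many cell integrals determine a test function in L2 up to an error proportional
  to \<open>r\<close> times its gradient norm; this is the quantitative core of Rellich compactness.
  It is obtained as the limit of the discrete inequality for sampled functions.\<close>

lemma cell_poincare:
 assumes r: "r > 0"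
 shows "(LBINT x. (\<phi> x)^2) \<le> 3 ^ CARD('d) * real CARD('d) * r\<^sup>2 * (LBINT x. (norm (grad \<phi> x))^2)
   + (\<Sum>c\<in>near_cells r. (LBINT x. (indicator {x. qfloor r x = c} x * \<phi> x))^2 / r ^ CARD('d))"
proof -
 obtain B where B: "B \<ge> 0" "!!x. \<bar>\<phi> x\<bar> \<le> B" using bounded_exists by blast
 have tf: "test_fun D \<phi> R" by unfold_locales
 have fin: "finite (near_cells r)" unfolding near_cells_def by (rule finite_bounded_lattice[OF r])
 \<comment> \<open>Boxes of side \<open>L n\<close> in lattice steps at mesh \<open>eps n\<close>
   are exactly the cells of side \<open>r\<close>; adding \<open>nat \<lceil>r\<rceil>\<close> keeps
   the mesh at most \<open>1\<close>.\<close>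
 define L where "L n = n + nat \<lceil>r\<rceil> + 1" for n
 define eps where "eps n = r / real (L n)" for n
 have L: "L n > 0" for n by (simp add: L_def)
 have epsL: "eps n * real (L n) = r" for n using L[of n] by (simp add: eps_def)
 have eps: "!!n. 0 < eps n" "!!n. eps n \<le> 1"
 proof -
  fix n show "0 < eps n" using r L[of n] by (simp add: eps_def)
  have "r \<le> real (L n)" unfolding L_def using r by (simp add: real_nat_ceiling_ge add_increasing)
  then show "eps n \<le> 1" using L[of n] by (simp add: eps_def)
 qed
 have eps0: "eps \<longlonglongrightarrow> 0"
 proof -
  have "filterlim L sequentially sequentially" unfolding L_def
   by (rule filterlim_at_top_mono[OF filterlim_ident]) (auto intro!: always_eventually)
  then have "filterlim (%n. real (L n)) at_top sequentially"
   by (rule filterlim_compose[OF filterlim_real_sequentially])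
  then show ?thesis unfolding eps_def by (intro tendsto_divide_0[OF tendsto_const] filterlim_at_top_imp_at_infinity)
 qed
 define s where "s n c = eps n ^ CARD('d) * (\<Sum>u\<in>zbox (L n). sample (eps n) \<phi> (int (L n) *s c + u))" for n c
 have s_lim: "(%n. s n c) \<longlonglongrightarrow> (LBINT x. (indicator {x. qfloor r x = c} x * \<phi> x))" for c
 proof -
  let ?g = "%n y. if zdiv (L n) y = c then sample (eps n) \<phi> y else 0"
  have fdiv: "zdiv (L n) (qfloor (eps n) x) = qfloor r x" for n x
  proof -
   have "\<lfloor>x $ i / eps n\<rfloor> div int (L n) = \<lfloor>x $ i / r\<rfloor>" for i
   proof -
    have "x $ i / r = (x $ i / eps n) / real_of_int (int (L n))" using epsL[of n] by (simp add: mult.commute)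
    then show ?thesis by (simp only: floor_divide_real_eq_div of_nat_0_le_iff)
   qed
   then show ?thesis by (simp add: zdiv_def qfloor_def vec_eq_iff)
  qed
  have fs: "fin_supp (?g n)" for n
   by (rule fin_suppI[OF finite_bounded_lattice[OF eps(1)[of n], of R]]) (use sample_supp in auto)
  have "(%n. eps n ^ CARD('d) * zsum (?g n)) \<longlonglongrightarrow> (LBINT x. (indicator {x. qfloor r x = c} x * \<phi> x))"
  proof (rule lattice_riemann_sum(2)[OF eps, where R = R and B = B])
   show "(%x. indicator {x. qfloor r x = c} x * \<phi> x) \<in> borel_measurable borel"
    using sets_qfloor[OF r] measurable_phi by (intro borel_measurable_times borel_measurable_indicator) auto
   show "\<bar>eps n * real_of_int (y $ i)\<bar> \<le> R" if "?g n y ~= 0" for n y i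
    using that sample_supp[of "eps n" y i] by (auto split: if_splits)
   show "\<bar>?g n y\<bar> \<le> B" for n y using B by (simp add: sample_def)
   show "AE x in lborel. (%n. ?g n (qfloor (eps n) x)) \<longlonglongrightarrow> indicator {x. qfloor r x = c} x * \<phi> x"
    using sample_tendsto[OF eps(1) eps0] by (intro AE_I2) (simp add: fdiv indicator_def)
  qed
  moreover have "zsum (?g n) = (\<Sum>u\<in>zbox (L n). sample (eps n) \<phi> (int (L n) *s c + u))" for n
  proof -
   have "zsum (?g n) = zsum (%c'. \<Sum>u\<in>zbox (L n). ?g n (int (L n) *s c' + u))"
    by (rule zsum_split_boxes(1)[OF fs L])
   also have "... = zsum (%c'. if c' = c then (\<Sum>u\<in>zbox (L n). sample (eps n) \<phi> (int (L n) *s c + u)) else 0)"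
    by (intro arg_cong[where f=zsum] ext) (auto simp: zdiv_box intro!: sum.neutral sum.cong)
   also have "... = (\<Sum>c'\<in>{c}. if c' = c then (\<Sum>u\<in>zbox (L n). sample (eps n) \<phi> (int (L n) *s c + u)) else 0)"
    by (rule zsum_eq) auto
   finally show ?thesis by simp
  qed
  ultimately show ?thesis by (simp add: s_def)
 qed
 have le: "eps n ^ CARD('d) * zsum (%y. sample (eps n) \<phi> y * sample (eps n) \<phi> y)
   \<le> 3 ^ CARD('d) * real CARD('d) * r\<^sup>2 * energy (eps n) (sample (eps n) \<phi>) + (\<Sum>c\<in>near_cells r. (s n c)^2 / r ^ CARD('d))" for n
 proof -
  let ?f = "sample (eps n) \<phi>" and ?p = "eps n ^ CARD('d)" and ?N = "real (L n ^ CARD('d))"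
  have p: "?p > 0" using eps(1)[of n] by simp
  have pN: "?p * ?N = r ^ CARD('d)" using epsL[of n] by (simp add: power_mult_distrib[symmetric])
  have "?p * zsum (%y. (?f y)^2) \<le> ?p * (3 ^ CARD('d) * real CARD('d) * (real (L n))^2 * dirichlet_sum ?f
   + zsum (%c. (\<Sum>u\<in>zbox (L n). ?f (int (L n) *s c + u))^2 / ?N))"
   using p by (intro mult_left_mono cell_poincare_discrete fin_supp_sample eps L) auto
  also have "... = 3 ^ CARD('d) * real CARD('d) * (eps n * real (L n))^2 * energy (eps n) ?f
   + zsum (%c. (s n c)^2 / r ^ CARD('d))"
  proof -
   have "?p * zsum (%c. (\<Sum>u\<in>zbox (L n). ?f (int (L n) *s c + u))^2 / ?N) = zsum (%c. (s n c)^2 / r ^ CARD('d))"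
    unfolding zsum_cmult[symmetric] pN[symmetric] s_def using p L[of n] eps(1)[of n]
    by (intro arg_cong[where f=zsum] ext) (simp add: power_mult_distrib power2_eq_square)
   moreover have "?p * (3 ^ CARD('d) * real CARD('d) * (real (L n))^2 * dirichlet_sum ?f)
     = 3 ^ CARD('d) * real CARD('d) * (eps n * real (L n))^2 * energy (eps n) ?f"
    using eps(1)[of n] by (simp add: energy_def power_mult_distrib)
   ultimately show ?thesis by (simp add: distrib_left)
  qed
  also have "zsum (%c. (s n c)^2 / r ^ CARD('d)) = (\<Sum>c\<in>near_cells r. (s n c)^2 / r ^ CARD('d))"
  proof (rule zsum_eq[OF fin])
   fix c assume c: "c \<notin> near_cells r"
   have "?f (int (L n) *s c + u) = 0" if u: "u \<in> zbox (L n)" for u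
   proof (rule ccontr)
    assume nz: "?f (int (L n) *s c + u) ~= 0"
    have "\<bar>r * real_of_int (c $ i)\<bar> \<le> R + r" for i
    proof -
     have 1: "\<bar>eps n * real_of_int ((int (L n) *s c + u) $ i)\<bar> \<le> R" by (rule sample_supp[OF nz])
     have 2: "eps n * real_of_int ((int (L n) *s c + u) $ i) = r * real_of_int (c $ i) + eps n * real_of_int (u $ i)"
      using epsL[of n] by (simp add: distrib_left mult.assoc[symmetric])
     have "0 \<le> u $ i \<and> u $ i < int (L n)" using u by (auto simp: zbox_def)
     then have "0 \<le> real_of_int (u $ i) \<and> real_of_int (u $ i) \<le> real (L n)" by linarith
     then have "0 \<le> eps n * real_of_int (u $ i)" "eps n * real_of_int (u $ i) \<le> eps n * real (L n)"
      using eps(1)[of n] by (auto intro: mult_left_mono)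
     then show ?thesis using 1 unfolding 2 epsL by linarith
    qed
    then show False using c by (simp add: near_cells_def)
   qed
   then show "(s n c)^2 / r ^ CARD('d) = 0" by (simp add: s_def)
  qed
  finally show ?thesis unfolding epsL by (simp add: power2_eq_square)
 qed
 have "(%n. eps n ^ CARD('d) * zsum (%y. sample (eps n) \<phi> y * sample (eps n) \<phi> y)) \<longlonglongrightarrow> (LBINT x. \<phi> x * \<phi> x)"
  by (rule sample_limits(1)[OF tf tf eps eps0])
 moreover have "(%n. 3 ^ CARD('d) * real CARD('d) * r\<^sup>2 * energy (eps n) (sample (eps n) \<phi>) + (\<Sum>c\<in>near_cells r. (s n c)^2 / r ^ CARD('d)))
   \<longlonglongrightarrow> 3 ^ CARD('d) * real CARD('d) * r\<^sup>2 * (LBINT x. (norm (grad \<phi> x))^2)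
   + (\<Sum>c\<in>near_cells r. (LBINT x. (indicator {x. qfloor r x = c} x * \<phi> x))^2 / r ^ CARD('d))"
  using r by (intro tendsto_intros energy_sample_tendsto[OF tf eps eps0] s_lim) auto
 ultimately show ?thesis using le by (simp add: power2_eq_square) (rule LIMSEQ_le, assumption+, auto)
qed

end

section \<open>Square-integrable functions\<close>

definition sq_int :: "'a measure => ('a => 'b::euclidean_space) => bool" where
 "sq_int M f \<longleftrightarrow> f \<in> borel_measurable M \<and> integrable M (%x. (norm (f x))^2)"

lemma sq_int_meas: "sq_int M f ==> f \<in> borel_measurable M"
 by (simp add: sq_int_def)

lemma sq_int_inner:
 assumes "sq_int M f" "sq_int M g" shows "integrable M (%x. f x \<bullet> g x)"
proof (rule Bochner_Integration.integrable_bound)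
 show "integrable M (%x. (norm (f x))^2 + (norm (g x))^2)" using assms by (simp add: sq_int_def)
 show "(%x. f x \<bullet> g x) \<in> borel_measurable M" using assms by (auto simp: sq_int_def)
 have "norm (a \<bullet> b) \<le> norm ((norm a)^2 + (norm b)^2)" for a b :: 'b
 proof -
  have "0 \<le> (norm a - norm b)^2 + (norm a)^2 + (norm b)^2" by simp
  then have "norm a * norm b \<le> (norm a)^2 + (norm b)^2" by (simp add: power2_diff)
  then show ?thesis using Cauchy_Schwarz_ineq2[of a b] by simp
 qed
 then show "AE x in M. norm (f x \<bullet> g x) \<le> norm ((norm (f x))^2 + (norm (g x))^2)" by simp
qed

lemma sq_int_lin:
 assumes "sq_int M f" "sq_int M g" shows "sq_int M (%x. s *\<^sub>R f x + t *\<^sub>R g x)"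
proof -
 have eq: "(norm (s *\<^sub>R f x + t *\<^sub>R g x))^2 = s\<^sup>2 * (f x \<bullet> f x) + 2 * s * t * (f x \<bullet> g x) + t\<^sup>2 * (g x \<bullet> g x)" for x
  unfolding power2_norm_eq_inner
  by (simp add: inner_add_left inner_add_right inner_commute power2_eq_square algebra_simps)
 show ?thesis unfolding sq_int_def eq
  using assms sq_int_inner[OF assms] sq_int_inner[OF assms(1,1)] sq_int_inner[OF assms(2,2)]
  by (auto simp: sq_int_def)
qed

lemma sq_int_diff: "sq_int M f ==> sq_int M g ==> sq_int M (%x. f x - g x)"
 using sq_int_lin[of M f g 1 "-1"] by simp

lemma sq_int_scaleR_bounded:
 assumes "sq_int M f" "u \<in> borel_measurable M" "!!x. x \<in> space M ==> \<bar>u x\<bar> \<le> C"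
 shows "sq_int M (%x. u x *\<^sub>R f x)"
 unfolding sq_int_def
proof
 show m: "(%x. u x *\<^sub>R f x) \<in> borel_measurable M" using assms by (auto simp: sq_int_def)
 show "integrable M (%x. (norm (u x *\<^sub>R f x))^2)"
 proof (rule Bochner_Integration.integrable_bound)
  show "integrable M (%x. C\<^sup>2 * (norm (f x))^2)" using assms by (simp add: sq_int_def)
  show "(%x. (norm (u x *\<^sub>R f x))^2) \<in> borel_measurable M" using m by measurable
  show "AE x in M. norm ((norm (u x *\<^sub>R f x))^2) \<le> norm (C\<^sup>2 * (norm (f x))^2)"
  proof (rule AE_I2)
   fix x assume "x \<in> space M"
   then have "(u x)^2 \<le> C\<^sup>2" using assms(3)[of x] by (intro power2_le_iff_abs_le[THEN iffD2]) auto
   then show "norm ((norm (u x *\<^sub>R f x))^2) \<le> norm (C\<^sup>2 * (norm (f x))^2)"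
    by (simp add: power_mult_distrib mult_right_mono)
  qed
 qed
qed

definition sqn :: "'a measure => ('a => 'b::euclidean_space) => real" where
 "sqn M f = (\<integral>x. (norm (f x))^2 \<partial>M)"

lemma sqn_nonneg: "0 \<le> sqn M f"
 unfolding sqn_def by (rule integral_nonneg_AE) simp

lemma sqn_inner: "sqn M f = (\<integral>x. f x \<bullet> f x \<partial>M)"
 by (simp add: sqn_def power2_norm_eq_inner)

lemma sqn_lin:
 assumes "sq_int M f" "sq_int M g"
 shows "sqn M (%x. s *\<^sub>R f x + t *\<^sub>R g x) = s\<^sup>2 * sqn M f + 2 * s * t * (\<integral>x. f x \<bullet> g x \<partial>M) + t\<^sup>2 * sqn M g"
proof -
 have eq: "(s *\<^sub>R f x + t *\<^sub>R g x) \<bullet> (s *\<^sub>R f x + t *\<^sub>R g x) = s\<^sup>2 * (f x \<bullet> f x) + 2 * s * t * (f x \<bullet> g x) + t\<^sup>2 * (g x \<bullet> g x)" for x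
  by (simp add: inner_add_left inner_add_right inner_commute power2_eq_square algebra_simps)
 show ?thesis unfolding sqn_inner eq
  using sq_int_inner[OF assms] sq_int_inner[OF assms(1,1)] sq_int_inner[OF assms(2,2)] by simp
qed

lemma sq_int_cauchy_schwarz:
 assumes "sq_int M f" "sq_int M g"
 shows "(\<integral>x. f x \<bullet> g x \<partial>M)^2 \<le> sqn M f * sqn M g"
proof (rule quadratic_psd_discriminant)
 fix s t
 have "0 \<le> sqn M (%x. s *\<^sub>R f x + t *\<^sub>R g x)" by (rule sqn_nonneg)
 then show "0 \<le> s\<^sup>2 * sqn M f + 2 * s * t * (\<integral>x. f x \<bullet> g x \<partial>M) + t\<^sup>2 * sqn M g"
  unfolding sqn_lin[OF assms] .
qed

lemma sqn_triangle:
 assumes "sq_int M f" "sq_int M g"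
 shows "sqn M (%x. f x - g x) \<le> 2 * sqn M f + 2 * sqn M g"
proof -
 have "sqn M (%x. f x - g x) = sqn M f - 2 * (\<integral>x. f x \<bullet> g x \<partial>M) + sqn M g"
  using sqn_lin[OF assms, of 1 "-1"] by simp
 moreover have "0 \<le> sqn M (%x. f x + g x)" by (rule sqn_nonneg)
 moreover have "sqn M (%x. f x + g x) = sqn M f + 2 * (\<integral>x. f x \<bullet> g x \<partial>M) + sqn M g"
  using sqn_lin[OF assms, of 1 1] by simp
 ultimately show ?thesis by simp
qed

lemma sqn_triangle3:
 assumes "sq_int M f" "sq_int M g" "sq_int M h"
 shows "sqn M (%x. f x - g x) \<le> 2 * sqn M (%x. f x - h x) + 2 * sqn M (%x. g x - h x)"
 using sqn_triangle[OF sq_int_diff[OF assms(1,3)] sq_int_diff[OF assms(2,3)]] by simp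

lemma sqn_tendsto_inner:
 assumes f: "!!n. sq_int M (f n)" "sq_int M g" "sq_int M h"
  and lim: "(%n. sqn M (%x. f n x - g x)) \<longlonglongrightarrow> 0"
 shows "(%n. \<integral>x. f n x \<bullet> h x \<partial>M) \<longlonglongrightarrow> (\<integral>x. g x \<bullet> h x \<partial>M)"
proof -
 have "(%n. (\<integral>x. f n x \<bullet> h x \<partial>M) - (\<integral>x. g x \<bullet> h x \<partial>M)) \<longlonglongrightarrow> 0"
 proof (rule Lim_null_comparison)
  have "norm ((\<integral>x. f n x \<bullet> h x \<partial>M) - (\<integral>x. g x \<bullet> h x \<partial>M)) \<le> sqrt (sqn M (%x. f n x - g x) * sqn M h)" for n
  proof -
   have "(\<integral>x. (f n x - g x) \<bullet> h x \<partial>M) = (\<integral>x. f n x \<bullet> h x \<partial>M) - (\<integral>x. g x \<bullet> h x \<partial>M)"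
    using sq_int_inner[OF f(1,3)] sq_int_inner[OF f(2,3)] by (simp add: inner_diff_left)
   then have "((\<integral>x. f n x \<bullet> h x \<partial>M) - (\<integral>x. g x \<bullet> h x \<partial>M))^2 \<le> sqn M (%x. f n x - g x) * sqn M h"
    using sq_int_cauchy_schwarz[OF sq_int_diff[OF f(1)[of n] f(2)] f(3)] by simp
   from real_sqrt_le_mono[OF this] show ?thesis by simp
  qed
  then show "\<forall>\<^sub>F n in sequentially. norm ((\<integral>x. f n x \<bullet> h x \<partial>M) - (\<integral>x. g x \<bullet> h x \<partial>M)) \<le> sqrt (sqn M (%x. f n x - g x) * sqn M h)"
   by simp
  have "(%n. sqrt (sqn M (%x. f n x - g x) * sqn M h)) \<longlonglongrightarrow> sqrt (0 * sqn M h)"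
   by (intro tendsto_intros lim)
  then show "(%n. sqrt (sqn M (%x. f n x - g x) * sqn M h)) \<longlonglongrightarrow> 0" by simp
 qed
 then show ?thesis by (simp add: LIM_zero_iff)
qed

lemma fast_cauchy_subsequence:
 fixes d :: "nat => nat => real"
 assumes "!!e. e > 0 ==> \<exists>N. \<forall>m\<ge>N. \<forall>n\<ge>N. d m n < e" "!!k. \<delta> k > 0"
 shows "\<exists>r::nat => nat. strict_mono r \<and> (\<forall>k. d (r (Suc k)) (r k) < \<delta> k)"
proof -
 have "\<forall>k. \<exists>N. \<forall>m\<ge>N. \<forall>n\<ge>N. d m n < \<delta> k" using assms by blast
 then obtain N where N: "!!k m n. m \<ge> N k ==> n \<ge> N k ==> d m n < \<delta> k" by metis
 define r where "r k = (\<Sum>i\<le>k. N i) + k" for k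
 have "strict_mono r" by (intro strict_monoI_Suc) (simp add: r_def)
 moreover have "N k \<le> r k" for k unfolding r_def using member_le_sum[of k "{..k}" N] by simp
 moreover have "r k \<le> r (Suc k)" for k by (simp add: r_def)
 ultimately show ?thesis using N by (intro exI[of _ r]) (meson order_trans)
qed

text \<open>Riesz-Fischer: along a fast subsequence the increments are summable almost everywhere,
  since on a finite measure space Cauchy-Schwarz bounds their L1 norms by a geometric series.
  Fatou's lemma then gives convergence in the square norm.\<close>

lemma sq_int_complete:
 fixes f :: "nat => 'a => 'b::euclidean_space"
 assumes fin: "finite_measure M" and f: "!!n. sq_int M (f n)"
  and cau: "!!e. e > 0 ==> \<exists>N. \<forall>m\<ge>N. \<forall>n\<ge>N. sqn M (%x. f m x - f n x) < e"
 shows "\<exists>g. sq_int M g \<and> (%n. sqn M (%x. f n x - g x)) \<longlonglongrightarrow> 0"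
proof -
 interpret finite_measure M by fact
 obtain r where r: "strict_mono r" "!!k. sqn M (%x. f (r (Suc k)) x - f (r k) x) < (1 / 4) ^ k"
  using fast_cauchy_subsequence[OF cau, of "%k. (1 / 4) ^ k"] by auto
 define d where "d k x = norm (f (r (Suc k)) x - f (r k) x)" for k x
 have fm [measurable]: "f n \<in> borel_measurable M" for n using f by (simp add: sq_int_def)
 have dm [measurable]: "d k \<in> borel_measurable M" for k unfolding d_def[abs_def] by measurable
 have d_sq: "sq_int M (d k)" for k
  using sq_int_diff[OF f f, of "r (Suc k)" "r k"] by (simp add: sq_int_def d_def[abs_def])
 have one: "sq_int M (%x. 1 :: real)" by (simp add: sq_int_def)
 have d_int: "integrable M (d k)" for k using sq_int_inner[OF d_sq one, of k] by simp
 define m where "m = measure M (space M)"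
 have dle: "(\<integral>x. d k x \<partial>M) \<le> sqrt m * (1 / 2) ^ k" for k
 proof -
  have "(\<integral>x. d k x \<partial>M)^2 \<le> sqn M (d k) * sqn M (%x. 1 :: real)"
   using sq_int_cauchy_schwarz[OF d_sq one, of k] unfolding inner_real_def mult_1_right .
  also have "... \<le> (1 / 4) ^ k * m"
  proof (rule mult_mono)
   show "sqn M (d k) \<le> (1 / 4) ^ k" using r(2)[of k] by (simp add: sqn_def d_def)
   show "sqn M (%x. 1 :: real) \<le> m" by (simp add: sqn_def m_def)
  qed (auto simp: sqn_nonneg)
  also have "... = (sqrt m * (1 / 2) ^ k)^2"
  proof -
   have "((1 / 2) ^ k)^2 = (1 / 4 :: real) ^ k" unfolding power2_eq_square power_mult_distrib[symmetric] by simp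
   then show ?thesis by (simp add: power_mult_distrib m_def)
  qed
  finally show ?thesis by (rule power2_le_imp_le) (intro mult_nonneg_nonneg real_sqrt_ge_zero, simp_all add: m_def)
 qed
 have "(\<integral>\<^sup>+x. (\<Sum>k. ennreal (d k x)) \<partial>M) = (\<Sum>k. \<integral>\<^sup>+x. ennreal (d k x) \<partial>M)"
  by (rule nn_integral_suminf) measurable
 also have "... = (\<Sum>k. ennreal (\<integral>x. d k x \<partial>M))"
  by (intro suminf_cong nn_integral_eq_integral d_int) (simp add: d_def)
 also have "... \<le> (\<Sum>k. ennreal (sqrt m * (1 / 2) ^ k))"
  using dle by (intro suminf_le) (auto simp: ennreal_leI)
 also have "... < \<infinity>"
 proof -
  have "summable (%k. sqrt m * (1 / 2 :: real) ^ k)" by (intro summable_mult summable_geometric) simp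
  then have "(\<Sum>k. ennreal (sqrt m * (1 / 2) ^ k)) = ennreal (\<Sum>k. sqrt m * (1 / 2) ^ k)"
   by (intro suminf_ennreal2) (auto simp: m_def)
  then show ?thesis by simp
 qed
 finally have "(\<integral>\<^sup>+x. (\<Sum>k. ennreal (d k x)) \<partial>M) ~= \<infinity>" by simp
 then have "AE x in M. (\<Sum>k. ennreal (d k x)) ~= \<infinity>"
  by (intro nn_integral_PInf_AE) measurable
 then have conv: "AE x in M. convergent (%k. f (r k) x)"
 proof eventually_elim
  case (elim x)
  then have "summable (%k. d k x)" by (intro summable_suminf_not_top) (auto simp: d_def)
  then have "summable (%k. f (r (Suc k)) x - f (r k) x)" unfolding d_def by (rule summable_norm_cancel)
  then have "convergent (%n. \<Sum>k<n. f (r (Suc k)) x - f (r k) x)" by (simp add: summable_iff_convergent)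
  then obtain l where "(%n. f (r n) x - f (r 0) x) \<longlonglongrightarrow> l"
   unfolding convergent_def using sum_lessThan_telescope[of "%k. f (r k) x"] by auto
  from tendsto_add[OF this tendsto_const[of "f (r 0) x"]]
  show ?case by (intro convergentI[of _ "l + f (r 0) x"]) simp
 qed
 define g where "g x = lim (%k. f (r k) x)" for x
 have gm [measurable]: "g \<in> borel_measurable M" unfolding g_def[abs_def] by measurable
 have lim: "AE x in M. (%k. f (r k) x) \<longlonglongrightarrow> g x" using conv by eventually_elim (simp add: g_def convergent_LIMSEQ_iff)
 have fatou: "(\<integral>\<^sup>+x. ennreal ((norm (f n x - g x))^2) \<partial>M) \<le> ennreal e"
  if "!!m. m \<ge> N ==> sqn M (%x. f n x - f m x) \<le> e" for n e N
 proof -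
  have "(\<integral>\<^sup>+x. ennreal ((norm (f n x - g x))^2) \<partial>M) = (\<integral>\<^sup>+x. liminf (%k. ennreal ((norm (f n x - f (r k) x))^2)) \<partial>M)"
  proof (rule nn_integral_cong_AE, use lim in eventually_elim)
   case (elim x)
   then have "(%k. ennreal ((norm (f n x - f (r k) x))^2)) \<longlonglongrightarrow> ennreal ((norm (f n x - g x))^2)"
    by (intro tendsto_intros)
   from lim_imp_Liminf[OF sequentially_bot this] show ?case by (rule sym)
  qed
  also have "... \<le> liminf (%k. \<integral>\<^sup>+x. ennreal ((norm (f n x - f (r k) x))^2) \<partial>M)"
   by (rule nn_integral_liminf) measurable
  also have "... \<le> ennreal e"
  proof (rule Liminf_le)
   show "\<forall>\<^sub>F k in sequentially. (\<integral>\<^sup>+x. ennreal ((norm (f n x - f (r k) x))^2) \<partial>M) \<le> ennreal e"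
    using eventually_ge_at_top[of N]
   proof eventually_elim
    case (elim k)
    have "r k \<ge> N" using strict_mono_imp_increasing[OF r(1), of k] elim by linarith
    then have "sqn M (%x. f n x - f (r k) x) \<le> e" by (rule that)
    moreover have "(\<integral>\<^sup>+x. ennreal ((norm (f n x - f (r k) x))^2) \<partial>M) = ennreal (sqn M (%x. f n x - f (r k) x))"
     unfolding sqn_def using sq_int_diff[OF f f, of n "r k"] by (intro nn_integral_eq_integral) (auto simp: sq_int_def)
    ultimately show ?case by (simp add: ennreal_leI)
   qed
  qed simp
  finally show ?thesis .
 qed
 have diff_sq: "sq_int M (%x. f n x - g x)" if "!!m. m \<ge> N ==> sqn M (%x. f n x - f m x) \<le> e" for n e N
  unfolding sq_int_def
 proof
  have "(\<integral>\<^sup>+x. ennreal (norm ((norm (f n x - g x))^2)) \<partial>M) < \<infinity>"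
   using le_less_trans[OF fatou[of N n e, OF that] ennreal_less_top] by simp
  then show "integrable M (%x. (norm (f n x - g x))^2)" by (intro integrableI_bounded) measurable
 qed measurable
 obtain N where N: "!!m n. m \<ge> N ==> n \<ge> N ==> sqn M (%x. f m x - f n x) < 1" using cau[of 1] by auto
 have "sq_int M (%x. f N x - g x)" by (rule diff_sq[of N _ 1]) (use N in \<open>auto intro: less_imp_le\<close>)
 then have g: "sq_int M g" using sq_int_diff[OF f[of N], of "%x. f N x - g x"] by simp
 moreover have "(%n. sqn M (%x. f n x - g x)) \<longlonglongrightarrow> 0"
 proof (rule LIMSEQ_I)
  fix e :: real assume e: "e > 0"
  obtain N where N: "!!m n. m \<ge> N ==> n \<ge> N ==> sqn M (%x. f m x - f n x) < e / 2" using cau[of "e/2"] e by auto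
  have "sqn M (%x. f n x - g x) < e" if n: "n \<ge> N" for n
  proof -
   have *: "(\<integral>\<^sup>+x. ennreal ((norm (f n x - g x))^2) \<partial>M) \<le> ennreal (e / 2)"
    by (rule fatou[of N]) (use N n in \<open>auto intro: less_imp_le\<close>)
   have "ennreal (sqn M (%x. f n x - g x)) = (\<integral>\<^sup>+x. ennreal ((norm (f n x - g x))^2) \<partial>M)"
    unfolding sqn_def using sq_int_diff[OF f g, of n] by (intro nn_integral_eq_integral[symmetric]) (auto simp: sq_int_def)
   then have "ennreal (sqn M (%x. f n x - g x)) \<le> ennreal (e / 2)" using * by simp
   then have "sqn M (%x. f n x - g x) \<le> e / 2" using e by (subst (asm) ennreal_le_iff) auto
   then show ?thesis using e by simp
  qed
  then show "\<exists>no. \<forall>n\<ge>no. norm (sqn M (%x. f n x - g x) - 0) < e"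
   by (intro exI[of _ N]) (simp add: abs_of_nonneg[OF sqn_nonneg])
 qed
 ultimately show ?thesis by blast
qed

lemma diagonal_convergent_subseq:
 fixes s :: "nat => nat => real"
 assumes bd: "!!j. \<exists>B. \<forall>n. \<bar>s j n\<bar> \<le> B"
 shows "\<exists>r::nat => nat. strict_mono r \<and> (\<forall>j. convergent (%n. s j (r n)))"
proof -
 interpret subseqs "%j r. convergent (%n. s j (r n))"
 proof
  fix j and q :: "nat => nat" assume "strict_mono q"
  obtain B where "\<forall>n. \<bar>s j n\<bar> \<le> B" using bd by blast
  then have "bounded (range (%n. s j (q n)))" by (auto simp: bounded_iff)
  then obtain l r where "strict_mono (r :: nat => nat)" "((%n. s j (q n)) \<circ> r) \<longlonglongrightarrow> l"
   using bounded_imp_convergent_subsequence by metis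
  then show "\<exists>r'. strict_mono r' \<and> convergent (%n. s j ((q \<circ> r') n))"
   by (intro exI[of _ r]) (auto simp: convergent_def o_def)
 qed
 have "convergent (%n. s j (diagseq (n + Suc j)))" for j
 proof -
  have "convergent (%n. s j ((diagseq \<circ> ((+) (Suc j))) n))"
  proof (rule diagseq_holds)
   fix r t :: "nat => nat" and n assume "strict_mono r" "convergent (%m. s n (t m))"
   then show "convergent (%m. s n ((t \<circ> r) m))"
    using convergent_subseq_convergent[of "%m. s n (t m)" r] by (simp add: o_def)
  qed
  then show ?thesis by (simp add: add.commute)
 qed
 then have "convergent (%n. s j (diagseq n))" for j
  using convergent_ignore_initial_segment[of "%n. s j (diagseq n)" "Suc j"] by simp
 then show ?thesis using subseq_diagseq by blast
qed

section \<open>The Dirichlet form\<close>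

lemma sq_int_fst_snd:
 fixes w :: "'a => 'b::euclidean_space \<times> 'c::euclidean_space"
 shows "sq_int M w \<longleftrightarrow> sq_int M (%x. fst (w x)) \<and> sq_int M (%x. snd (w x))"
proof
 assume w: "sq_int M w"
 have *: "sq_int M (%x. g (w x))" if g: "!!x. norm (g x) \<le> norm x" "g \<in> borel_measurable borel" for g :: "'b \<times> 'c => 'e::euclidean_space"
  unfolding sq_int_def
 proof
  show m: "(%x. g (w x)) \<in> borel_measurable M" using measurable_compose[OF sq_int_meas[OF w] g(2)] .
  show "integrable M (%x. (norm (g (w x)))^2)"
   by (rule Bochner_Integration.integrable_bound[of M "%x. (norm (w x))^2"])
    (use w m g(1) in \<open>auto simp: sq_int_def intro!: power_mono\<close>)
 qed
 show "sq_int M (%x. fst (w x)) \<and> sq_int M (%x. snd (w x))"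
 proof
  have "norm (fst x) \<le> norm x" for x :: "'b \<times> 'c" using norm_fst_le[of "fst x" "snd x"] by simp
  then show "sq_int M (%x. fst (w x))" by (rule *) (intro borel_measurable_continuous_onI continuous_intros)
  have "norm (snd x) \<le> norm x" for x :: "'b \<times> 'c" using norm_snd_le[of "snd x" "fst x"] by simp
  then show "sq_int M (%x. snd (w x))" by (rule *) (intro borel_measurable_continuous_onI continuous_intros)
 qed
next
 assume a: "sq_int M (%x. fst (w x)) \<and> sq_int M (%x. snd (w x))"
 have eq: "(norm (w x))^2 = (norm (fst (w x)))^2 + (norm (snd (w x)))^2" for x
  by (simp add: norm_prod_def)
 have "(%x. (fst (w x), snd (w x))) \<in> borel_measurable M"
  using a by (intro borel_measurable_Pair) (auto simp: sq_int_def)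
 then show "sq_int M w" unfolding sq_int_def eq using a by (auto simp: sq_int_def)
qed

lemma sqn_fst_snd:
 fixes w :: "'a => 'b::euclidean_space \<times> 'c::euclidean_space"
 assumes "sq_int M w"
 shows "sqn M w = sqn M (%x. fst (w x)) + sqn M (%x. snd (w x))"
proof -
 have eq: "(norm (w x))^2 = (norm (fst (w x)))^2 + (norm (snd (w x)))^2" for x
  by (simp add: norm_prod_def)
 show ?thesis unfolding sqn_def eq using assms unfolding sq_int_fst_snd by (simp add: sq_int_def)
qed

lemma sqn_null_comparison:
 assumes "!!n. sqn M (f n) \<le> c n" "c \<longlonglongrightarrow> 0"
 shows "(%n. sqn M (f n)) \<longlonglongrightarrow> 0"
 by (rule Lim_null_comparison[OF _ assms(2)]) (simp add: abs_of_nonneg[OF sqn_nonneg] assms(1))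

lemma lebesgue_on_lborel:
 fixes f :: "real ^ 'd::finite => 'b::{banach, second_countable_topology}"
 assumes "open D" "f \<in> borel_measurable borel" "!!x. x \<notin> D ==> f x = 0"
 shows "integrable (lebesgue_on D) f \<longleftrightarrow> integrable lborel f"
  "integral\<^sup>L (lebesgue_on D) f = integral\<^sup>L lborel f"
proof -
 have D: "D \<inter> space lebesgue \<in> sets lebesgue" using assms(1) by (simp add: lebesgue_openin borel_open)
 have eq: "(%x. indicator D x *\<^sub>R f x) = f" using assms(3) by (auto simp: indicator_def)
 have m: "f \<in> lborel \<rightarrow>\<^sub>M borel" using assms(2) by simp
 show "integrable (lebesgue_on D) f \<longleftrightarrow> integrable lborel f"
  unfolding integrable_restrict_space[OF D] eq by (rule integrable_completion[OF m])
 show "integral\<^sup>L (lebesgue_on D) f = integral\<^sup>L lborel f"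
  unfolding integral_restrict_space[OF D] eq by (rule integral_completion[OF m])
qed

lemma measurable_lebesgue_on: "f \<in> borel_measurable borel ==> f \<in> borel_measurable (lebesgue_on D)"
 for f :: "real ^ 'd::finite => 'b::topological_space"
 by (intro measurable_restrict_space1 measurable_completion) simp

locale dirichlet_domain =
 fixes D :: "(real ^ 'd::finite) set" and U :: "real ^ 'd => real" and R CU :: real
 assumes open_D: "open D" and D_bound: "!!x i. x \<in> D ==> \<bar>x $ i\<bar> \<le> R"
  and U_cont: "continuous_on D U" and U_bound: "!!x. x \<in> D ==> \<bar>U x\<bar> \<le> CU" and CU: "CU \<ge> 0"
begin

abbreviation "L \<equiv> lebesgue_on D"

lemma finite_L: "finite_measure L"
proof
 have "x \<in> cbox (\<chi> i. - R) (\<chi> i. R)" if "x \<in> D" for x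
  using D_bound[OF that] by (simp add: mem_box_cart abs_le_iff minus_le_iff)
 then have "D \<subseteq> cbox (\<chi> i. - R) (\<chi> i. R)" by blast
 moreover have "D \<in> sets borel" using open_D by simp
 ultimately have "emeasure lborel D \<le> emeasure lborel (cbox (\<chi> i. - R) (\<chi> i. R) :: (real ^ 'd) set)"
  by (intro emeasure_mono) auto
 also have "... < \<infinity>" by (rule emeasure_lborel_cbox_finite)
 finally have "emeasure lborel D < \<infinity>" .
 then show "emeasure L (space L) ~= \<infinity>"
  using open_D by (simp add: emeasure_restrict_space lebesgue_openin)
qed

lemma U_meas: "U \<in> borel_measurable L"
 using U_cont open_D by (intro continuous_imp_measurable_on_sets_lebesgue) auto

lemma test_fun: "test_function D \<phi> ==> test_fun D \<phi> R"
 by unfold_locales (auto intro: D_bound)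

definition pair :: "(real ^ 'd => real) => real ^ 'd => real \<times> (real ^ 'd)" where
 "pair \<phi> x = (\<phi> x, grad \<phi> x)"

lemma test_sq_int:
 assumes "test_function D \<phi>"
 shows "sq_int L \<phi>" "sq_int L (grad \<phi>)" "sq_int L (%x. grad \<phi> x $ i)" "sq_int L (pair \<phi>)"
proof -
 interpret test_fun D \<phi> R by (rule test_fun[OF assms])
 have bm: "(%x. (norm (\<phi> x))^2) \<in> borel_measurable borel" "(%x. (grad \<phi> x $ i)^2) \<in> borel_measurable borel" for i
  using measurable_phi measurable_grad_nth by measurable
 have "integrable lborel (%x. (norm (\<phi> x))^2)"
  using test_fun_integrable(1)[OF test_fun test_fun, OF assms assms] by (simp add: power2_eq_square)
 then show 1: "sq_int L \<phi>" unfolding sq_int_def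
  using lebesgue_on_lborel(1)[OF open_D bm(1)] outside_D by (auto intro: measurable_lebesgue_on measurable_phi)
 have i2: "integrable lborel (%x. (grad \<phi> x $ i)^2)" for i
  using test_fun_integrable(2)[OF test_fun test_fun, OF assms assms] by (simp add: power2_eq_square)
 then have i3: "integrable L (%x. (grad \<phi> x $ i)^2)" for i
  using lebesgue_on_lborel(1)[OF open_D bm(2)[of i]] outside_D(2) by simp
 then show "sq_int L (%x. grad \<phi> x $ i)" unfolding sq_int_def
  by (auto intro: measurable_lebesgue_on measurable_grad_nth)
 have "(norm (grad \<phi> x))^2 = (\<Sum>i\<in>UNIV. (grad \<phi> x $ i)^2)" for x
  unfolding power2_norm_eq_inner inner_vec_def by (simp add: power2_eq_square)
 then show 2: "sq_int L (grad \<phi>)" unfolding sq_int_def using i3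
  by (auto intro!: measurable_lebesgue_on measurable_grad)
 show "sq_int L (pair \<phi>)" unfolding sq_int_fst_snd using 1 2 by (simp add: pair_def)
qed

text \<open>Elements of \<open>H\<^sup>1\<^sub>0(D)\<close> are paired with their weak gradient.\<close>

definition W :: "(real ^ 'd => real \<times> (real ^ 'd)) set" where
 "W = {w. H10_grad D (%x. fst (w x)) (%x. snd (w x))}"

definition b :: "(real ^ 'd => real \<times> (real ^ 'd)) => (real ^ 'd => real \<times> (real ^ 'd)) => real" where
 "b w v = (LINT x|L. fst (w x) * fst (v x))"

definition q :: "(real ^ 'd => real \<times> (real ^ 'd)) => (real ^ 'd => real \<times> (real ^ 'd)) => real" where
 "q w v = (LINT x|L. snd (w x) \<bullet> snd (v x) + U x * fst (w x) * fst (v x))"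

lemma L2_on_eq: "L2_on D f \<longleftrightarrow> sq_int L f"
 by (simp add: L2_on_def sq_int_def)

text \<open>The weak-gradient identity survives limits of test functions, so membership in the form
  domain reduces to approximation in the square norm by pairs of a test function and its
  gradient.\<close>

lemma W_iff: "w \<in> W \<longleftrightarrow> sq_int L w \<and> (\<exists>\<phi>. (\<forall>n. test_function D (\<phi> n)) \<and> (%n. sqn L (%x. pair (\<phi> n) x - w x)) \<longlonglongrightarrow> 0)"
proof -
 have eq: "(LINT x|L. (\<phi> x - fst (w x))^2) + (LINT x|L. (norm (grad \<phi> x - snd (w x)))^2) = sqn L (%x. pair \<phi> x - w x)"
  if "sq_int L w" "test_function D \<phi>" for \<phi>
  using sqn_fst_snd[OF sq_int_diff[OF test_sq_int(4)[OF that(2)] that(1)]] by (simp add: pair_def sqn_def)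
 show ?thesis
 proof
  assume "w \<in> W"
  then have H: "H10_grad D (%x. fst (w x)) (%x. snd (w x))" by (simp add: W_def)
  then have w: "sq_int L w" unfolding H10_grad_def H1_grad_def L2_on_eq sq_int_fst_snd[of L w] by blast
  obtain \<phi> where "!!n. test_function D (\<phi> n)"
   "(%n. (LINT x|L. (\<phi> n x - fst (w x))^2) + (LINT x|L. (norm (grad (\<phi> n) x - snd (w x)))^2)) \<longlonglongrightarrow> 0"
   using H unfolding H10_grad_def by blast
  then show "sq_int L w \<and> (\<exists>\<phi>. (\<forall>n. test_function D (\<phi> n)) \<and> (%n. sqn L (%x. pair (\<phi> n) x - w x)) \<longlonglongrightarrow> 0)"
   using w eq[OF w] by auto
 next
  assume "sq_int L w \<and> (\<exists>\<phi>. (\<forall>n. test_function D (\<phi> n)) \<and> (%n. sqn L (%x. pair (\<phi> n) x - w x)) \<longlonglongrightarrow> 0)"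
  then obtain \<phi> where w: "sq_int L w" and \<phi>: "!!n. test_function D (\<phi> n)"
   and lim: "(%n. sqn L (%x. pair (\<phi> n) x - w x)) \<longlonglongrightarrow> 0" by blast
  have w': "sq_int L (%x. fst (w x))" "sq_int L (%x. snd (w x))" using w unfolding sq_int_fst_snd[of L w] by blast+
  have ibp: "(LINT x|L. fst (w x) *\<^sub>R grad \<psi> x) = - (LINT x|L. \<psi> x *\<^sub>R snd (w x))" if \<psi>: "test_function D \<psi>" for \<psi>
  proof -
   interpret p: test_fun D \<psi> R by (rule test_fun[OF \<psi>])
   obtain C where C: "!!x. \<bar>\<psi> x\<bar> \<le> C" using p.bounded_exists by blast
   have mp: "\<psi> \<in> borel_measurable L" by (rule measurable_lebesgue_on[OF p.measurable_phi])
   have "(LINT x|L. fst (w x) *\<^sub>R grad \<psi> x) \<bullet> axis i 1 = (- (LINT x|L. \<psi> x *\<^sub>R snd (w x))) \<bullet> axis i 1" for i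
   proof -
    \<comment> \<open>Pairing with \<open>g\<close> collects both sides of the \<open>i\<close>-th
      integration by parts in one inner product, which is continuous under the convergence at hand
      and zero for test functions.\<close>
    define g where "g x = (grad \<psi> x $ i, \<psi> x *\<^sub>R axis i (1::real))" for x
    have "sq_int L (%x. \<psi> x *\<^sub>R axis i (1::real))"
    proof -
     have "sq_int L (%x. axis i (1::real))" unfolding sq_int_def using finite_measure.integrable_const[OF finite_L, of "1 :: real"] by simp
     then show ?thesis by (rule sq_int_scaleR_bounded[OF _ mp C])
    qed
    then have g: "sq_int L g" unfolding sq_int_fst_snd g_def using test_sq_int(3)[OF \<psi>] by simp
    have zero: "(LINT x|L. pair (\<phi> n) x \<bullet> g x) = 0" for n
    proof -
     interpret f: test_fun D "\<phi> n" R by (rule test_fun[OF \<phi>])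
     have "(LINT x|L. pair (\<phi> n) x \<bullet> g x) = (LINT x|L. \<phi> n x * grad \<psi> x $ i + \<psi> x * grad (\<phi> n) x $ i)"
      by (intro Bochner_Integration.integral_cong refl) (simp add: pair_def g_def inner_axis)
     also have "... = (LBINT x. \<phi> n x * grad \<psi> x $ i + \<psi> x * grad (\<phi> n) x $ i)"
      using f.measurable_phi p.measurable_phi f.measurable_grad_nth p.measurable_grad_nth
      by (intro lebesgue_on_lborel(2) open_D) (auto simp: f.outside_D p.outside_D)
     also have "... = 0"
      using test_fun_integrable(3)[OF test_fun[OF \<phi>[of n]] test_fun[OF \<psi>], of i] test_fun_integrable(3)[OF test_fun[OF \<psi>] test_fun[OF \<phi>[of n]], of i]
       test_fun_ibp[OF test_fun[OF \<phi>[of n]] test_fun[OF \<psi>], of i] by simp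
     finally show ?thesis .
    qed
    have "(%n. \<integral>x. pair (\<phi> n) x \<bullet> g x \<partial>L) \<longlonglongrightarrow> (LINT x|L. w x \<bullet> g x)"
     by (rule sqn_tendsto_inner[OF test_sq_int(4)[OF \<phi>] w g lim])
    then have 0: "(LINT x|L. w x \<bullet> g x) = 0" unfolding zero by (simp add: LIMSEQ_const_iff)
    have i1: "integrable L (%x. fst (w x) * grad \<psi> x $ i)"
     using sq_int_inner[OF w'(1) test_sq_int(3)[OF \<psi>, of i]] by simp
    have s2: "sq_int L (%x. \<psi> x *\<^sub>R snd (w x))" by (rule sq_int_scaleR_bounded[OF w'(2) mp C])
    have one: "sq_int L (%x. axis j (1::real) :: real ^ 'd)" for j unfolding sq_int_def using finite_measure.integrable_const[OF finite_L, of "1 :: real"] by simp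
    have i2: "integrable L (%x. \<psi> x * snd (w x) $ i)"
     using sq_int_inner[OF s2 one[of i]] by (simp add: inner_axis)
    have v1: "integrable L (%x. fst (w x) *\<^sub>R grad \<psi> x)"
    proof -
     have "integrable L (%x. \<Sum>j\<in>UNIV. (fst (w x) * grad \<psi> x $ j) *\<^sub>R axis j (1::real))"
      using sq_int_inner[OF w'(1) test_sq_int(3)[OF \<psi>]] by (intro Bochner_Integration.integrable_sum integrable_scaleR_left) simp
     moreover have "(\<Sum>j\<in>UNIV. (fst (w x) * grad \<psi> x $ j) *\<^sub>R axis j (1::real)) = fst (w x) *\<^sub>R grad \<psi> x" for x
      by (simp add: vec_eq_iff axis_def if_distrib cong: if_cong)
     ultimately show ?thesis by simp
    qed
    have v2: "integrable L (%x. \<psi> x *\<^sub>R snd (w x))"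
    proof -
     have "integrable L (%x. \<Sum>j\<in>UNIV. (\<psi> x * snd (w x) $ j) *\<^sub>R axis j (1::real))"
      using sq_int_inner[OF s2 one] by (intro Bochner_Integration.integrable_sum integrable_scaleR_left) (simp add: inner_axis)
     moreover have "(\<Sum>j\<in>UNIV. (\<psi> x * snd (w x) $ j) *\<^sub>R axis j (1::real)) = \<psi> x *\<^sub>R snd (w x)" for x
      by (simp add: vec_eq_iff axis_def if_distrib cong: if_cong)
     ultimately show ?thesis by simp
    qed
    have "(LINT x|L. w x \<bullet> g x) = (LINT x|L. fst (w x) * grad \<psi> x $ i + \<psi> x * snd (w x) $ i)"
     by (intro Bochner_Integration.integral_cong refl) (simp add: g_def inner_prod_def inner_axis)
    also have "... = (LINT x|L. (fst (w x) *\<^sub>R grad \<psi> x) \<bullet> axis i 1) + (LINT x|L. (\<psi> x *\<^sub>R snd (w x)) \<bullet> axis i 1)"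
     using i1 i2 by (simp add: inner_axis)
    also have "... = (LINT x|L. fst (w x) *\<^sub>R grad \<psi> x) \<bullet> axis i 1 + (LINT x|L. \<psi> x *\<^sub>R snd (w x)) \<bullet> axis i 1"
     by (simp only: integral_inner_left[OF v1] integral_inner_left[OF v2])
    finally show ?thesis using 0 by simp
   qed
   then show ?thesis by (simp add: vec_eq_iff inner_axis)
  qed
  have "(%n. (LINT x|L. (\<phi> n x - fst (w x))^2) + (LINT x|L. (norm (grad (\<phi> n) x - snd (w x)))^2)) \<longlonglongrightarrow> 0"
   using lim by (simp only: eq[OF w \<phi>])
  then have "H10_grad D (%x. fst (w x)) (%x. snd (w x))"
   unfolding H10_grad_def H1_grad_def L2_on_eq using w' ibp \<phi> by blast
  then show "w \<in> W" by (simp add: W_def)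
 qed
qed

lemma W_sq: "w \<in> W ==> sq_int L w"
 by (simp add: W_iff)

lemma W_sq_fst: "w \<in> W ==> sq_int L (%x. fst (w x))" and W_sq_snd: "w \<in> W ==> sq_int L (%x. snd (w x))"
 using W_sq[of w] unfolding sq_int_fst_snd[of L w] by blast+

lemma pair_in_W: "test_function D \<phi> ==> pair \<phi> \<in> W"
 unfolding W_iff using test_sq_int(4) by (intro conjI exI[of _ "%_. \<phi>"]) (auto simp: sqn_def)

lemma W_approx:
 assumes "w \<in> W" "e > 0"
 shows "\<exists>\<phi>. test_function D \<phi> \<and> sqn L (%x. pair \<phi> x - w x) < e"
proof -
 obtain \<phi> where \<phi>: "!!n. test_function D (\<phi> n)" "(%n. sqn L (%x. pair (\<phi> n) x - w x)) \<longlonglongrightarrow> 0"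
  using assms(1) unfolding W_iff by blast
 have "\<forall>\<^sub>F n in sequentially. sqn L (%x. pair (\<phi> n) x - w x) < e"
  using order_tendstoD(2)[OF \<phi>(2) assms(2)] .
 then obtain n where "sqn L (%x. pair (\<phi> n) x - w x) < e" by (auto simp: eventually_sequentially)
 then show ?thesis using \<phi>(1) by blast
qed

lemma W_closed:
 assumes w: "sq_int L w" and ap: "!!e. e > 0 ==> \<exists>v\<in>W. sqn L (%x. v x - w x) < e"
 shows "w \<in> W"
proof -
 have "\<exists>\<phi>. test_function D \<phi> \<and> sqn L (%x. pair \<phi> x - w x) < inverse (real (Suc n))" for n
 proof -
  define e where "e = inverse (real (Suc n)) / 4"
  have e: "e > 0" by (simp add: e_def)
  obtain v where v: "v \<in> W" "sqn L (%x. v x - w x) < e" using ap[OF e] by blast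
  obtain \<phi> where \<phi>: "test_function D \<phi>" "sqn L (%x. pair \<phi> x - v x) < e" using W_approx[OF v(1) e] by blast
  have "sqn L (%x. w x - v x) = sqn L (%x. v x - w x)" by (simp add: sqn_def norm_minus_commute)
  then have "sqn L (%x. pair \<phi> x - w x) < 2 * e + 2 * e"
   using sqn_triangle3[OF test_sq_int(4)[OF \<phi>(1)] w W_sq[OF v(1)]] \<phi>(2) v(2) by linarith
  then show ?thesis using \<phi>(1) by (auto simp: e_def)
 qed
 then obtain \<phi> where \<phi>: "!!n. test_function D (\<phi> n)" "!!n. sqn L (%x. pair (\<phi> n) x - w x) < inverse (real (Suc n))" by metis
 have "(%n. sqn L (%x. pair (\<phi> n) x - w x)) \<longlonglongrightarrow> 0"
  by (rule sqn_null_comparison[OF less_imp_le[OF \<phi>(2)] LIMSEQ_inverse_real_of_nat])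
 then show ?thesis unfolding W_iff using w \<phi>(1) by blast
qed

lemma W_lin: "w \<in> W ==> v \<in> W ==> (%x. s *\<^sub>R w x + t *\<^sub>R v x) \<in> W"
proof -
 assume w: "w \<in> W" "v \<in> W"
 obtain \<phi> where \<phi>: "!!n. test_function D (\<phi> n)" "(%n. sqn L (%x. pair (\<phi> n) x - w x)) \<longlonglongrightarrow> 0"
  using w(1) unfolding W_iff by blast
 obtain \<psi> where \<psi>: "!!n. test_function D (\<psi> n)" "(%n. sqn L (%x. pair (\<psi> n) x - v x)) \<longlonglongrightarrow> 0"
  using w(2) unfolding W_iff by blast
 have p: "pair (%x. s * \<phi> n x + t * \<psi> n x) x = s *\<^sub>R pair (\<phi> n) x + t *\<^sub>R pair (\<psi> n) x" for n x
 proof -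
  interpret f: test_fun D "\<phi> n" R by (rule test_fun[OF \<phi>(1)])
  interpret g: test_fun D "\<psi> n" R by (rule test_fun[OF \<psi>(1)])
  have "GDERIV (%x. s * \<phi> n x + t * \<psi> n x) x :> s *\<^sub>R grad (\<phi> n) x + t *\<^sub>R grad (\<psi> n) x"
   by (intro GDERIV_add GDERIV_cmult f.gderiv g.gderiv)
  from grad_eq[OF this] show ?thesis by (simp add: pair_def)
 qed
 have "sqn L (%x. pair (%x. s * \<phi> n x + t * \<psi> n x) x - (s *\<^sub>R w x + t *\<^sub>R v x))
   \<le> 2 * (s\<^sup>2 * sqn L (%x. pair (\<phi> n) x - w x)) + 2 * (t\<^sup>2 * sqn L (%x. pair (\<psi> n) x - v x))" for n
 proof -
  have d: "sq_int L (%x. pair (\<phi> n) x - w x)" "sq_int L (%x. pair (\<psi> n) x - v x)"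
   by (intro sq_int_diff test_sq_int(4) \<phi> \<psi> W_sq w)+
  have s: "sq_int L (%x. s *\<^sub>R (pair (\<phi> n) x - w x))" "sq_int L (%x. (- t) *\<^sub>R (pair (\<psi> n) x - v x))"
   using sq_int_lin[OF d(1) d(1), of s 0] sq_int_lin[OF d(2) d(2), of "- t" 0] by simp_all
  have "sqn L (%x. s *\<^sub>R (pair (\<phi> n) x - w x) - (- t) *\<^sub>R (pair (\<psi> n) x - v x))
    \<le> 2 * sqn L (%x. s *\<^sub>R (pair (\<phi> n) x - w x)) + 2 * sqn L (%x. (- t) *\<^sub>R (pair (\<psi> n) x - v x))"
   by (rule sqn_triangle[OF s])
  moreover have "sqn L (%x. s *\<^sub>R (pair (\<phi> n) x - w x)) = s\<^sup>2 * sqn L (%x. pair (\<phi> n) x - w x)"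
   "sqn L (%x. (- t) *\<^sub>R (pair (\<psi> n) x - v x)) = t\<^sup>2 * sqn L (%x. pair (\<psi> n) x - v x)"
   by (simp_all add: sqn_def power_mult_distrib)
  moreover have "s *\<^sub>R (pair (\<phi> n) x - w x) - (- t) *\<^sub>R (pair (\<psi> n) x - v x) = pair (%x. s * \<phi> n x + t * \<psi> n x) x - (s *\<^sub>R w x + t *\<^sub>R v x)" for x
   unfolding p by (simp add: algebra_simps)
  ultimately show ?thesis by simp
 qed
 moreover have "(%n. 2 * (s\<^sup>2 * sqn L (%x. pair (\<phi> n) x - w x)) + 2 * (t\<^sup>2 * sqn L (%x. pair (\<psi> n) x - v x))) \<longlonglongrightarrow> 2 * (s\<^sup>2 * 0) + 2 * (t\<^sup>2 * 0)"
  by (intro tendsto_intros \<phi> \<psi>)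
 ultimately have "(%n. sqn L (%x. pair (%x. s * \<phi> n x + t * \<psi> n x) x - (s *\<^sub>R w x + t *\<^sub>R v x))) \<longlonglongrightarrow> 0"
  by (intro sqn_null_comparison) auto
 then show "(%x. s *\<^sub>R w x + t *\<^sub>R v x) \<in> W"
  unfolding W_iff using sq_int_lin[OF W_sq[OF w(1)] W_sq[OF w(2)]] test_function_lin[OF \<phi>(1) \<psi>(1)]
  by (intro conjI exI[of _ "%n x. s * \<phi> n x + t * \<psi> n x"]) auto
qed

lemma Uf_sq: "w \<in> W ==> sq_int L (%x. U x * fst (w x))"
 using sq_int_scaleR_bounded[OF W_sq_fst U_meas, of w CU] U_bound by simp

lemma b_integrable: "w \<in> W ==> v \<in> W ==> integrable L (%x. fst (w x) * fst (v x))"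
 using sq_int_inner[OF W_sq_fst W_sq_fst, of w v] by simp

lemma q_integrable:
 assumes "w \<in> W" "v \<in> W"
 shows "integrable L (%x. snd (w x) \<bullet> snd (v x))" "integrable L (%x. U x * fst (w x) * fst (v x))"
 using sq_int_inner[OF W_sq_snd W_sq_snd, OF assms] sq_int_inner[OF Uf_sq W_sq_fst, OF assms] by simp_all

lemma q_split: "w \<in> W ==> q w w = sqn L (%x. snd (w x)) + (LINT x|L. U x * fst (w x) * fst (w x))"
 unfolding q_def sqn_inner using q_integrable[of w w] by simp

lemma b_sqn: "b w w = sqn L (%x. fst (w x))"
 by (simp add: b_def sqn_inner)

lemma U_term_le: "w \<in> W ==> \<bar>\<integral>x. U x * fst (w x) * fst (w x) \<partial>L\<bar> \<le> CU * b w w"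
proof -
 assume w: "w \<in> W"
 have "norm (LINT x|L. U x * fst (w x) * fst (w x)) \<le> (LINT x|L. CU * (fst (w x) * fst (w x)))"
 proof (rule Bochner_Integration.integral_norm_bound_integral[OF q_integrable(2)[OF w w]])
  show "integrable L (%x. CU * (fst (w x) * fst (w x)))" using b_integrable[OF w w] by simp
  show "norm (U x * fst (w x) * fst (w x)) \<le> CU * (fst (w x) * fst (w x))" if "x \<in> space L" for x
  proof -
   have "\<bar>U x\<bar> * (fst (w x) * fst (w x)) \<le> CU * (fst (w x) * fst (w x))"
    using U_bound[of x] that by (intro mult_right_mono) auto
   then show ?thesis by (simp add: abs_mult mult.assoc)
  qed
 qed
 then show ?thesis by (simp add: b_def)
qed

end

lemma sqn_le_diff:
 assumes "sq_int M f" "sq_int M g"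
 shows "sqn M f \<le> 2 * sqn M (%x. f x - g x) + 2 * sqn M g"
proof -
 have "sq_int M (%x. - g x)" using sq_int_lin[OF assms(2,2), of "-1" 0] by simp
 from sqn_triangle[OF sq_int_diff[OF assms] this] show ?thesis by (simp add: sqn_def)
qed

lemma convergent_sq_sum_cauchy:
 fixes a :: "'c => nat => real"
 assumes "finite C" "!!c. c \<in> C ==> convergent (a c)" "e > 0"
 shows "\<exists>N. \<forall>m\<ge>N. \<forall>n\<ge>N. (\<Sum>c\<in>C. (a c m - a c n)^2) < e"
proof -
 define l where "l c = lim (a c)" for c
 have l: "a c \<longlonglongrightarrow> l c" if "c \<in> C" for c using assms(2)[OF that] by (simp add: l_def convergent_LIMSEQ_iff)
 have "(%n. \<Sum>c\<in>C. (a c n - l c)^2) \<longlonglongrightarrow> (\<Sum>c\<in>C. (l c - l c)^2)"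
  by (intro tendsto_intros l)
 then have "\<forall>\<^sub>F n in sequentially. (\<Sum>c\<in>C. (a c n - l c)^2) < e / 4"
  using assms(3) by (intro order_tendstoD) auto
 then obtain N where N: "!!n. n \<ge> N ==> (\<Sum>c\<in>C. (a c n - l c)^2) < e / 4" by (auto simp: eventually_sequentially)
 have sq: "(x - y)^2 \<le> 2 * (x - z)^2 + 2 * (y - z)^2" for x y z :: real
 proof -
  have "0 \<le> (x + y - 2 * z)^2" by simp
  then show ?thesis by (simp add: power2_eq_square algebra_simps)
 qed
 have "(\<Sum>c\<in>C. (a c m - a c n)^2) < e" if "m \<ge> N" "n \<ge> N" for m n
 proof -
  have "(\<Sum>c\<in>C. (a c m - a c n)^2) \<le> (\<Sum>c\<in>C. 2 * (a c m - l c)^2 + 2 * (a c n - l c)^2)"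
   by (intro sum_mono sq)
  also have "... = 2 * (\<Sum>c\<in>C. (a c m - l c)^2) + 2 * (\<Sum>c\<in>C. (a c n - l c)^2)"
   by (simp add: sum.distrib sum_distrib_left)
  finally show ?thesis using N[OF that(1)] N[OF that(2)] by linarith
 qed
 then show ?thesis by blast
qed

section \<open>Compactness and completeness of the Dirichlet form\<close>

context dirichlet_domain
begin

lemma b_le_sqn: "w \<in> W ==> b w w \<le> sqn L w"
 using sqn_fst_snd[OF W_sq, of w] sqn_nonneg[of L "%x. snd (w x)"] by (simp add: b_sqn)

lemma q_le_sqn: "w \<in> W ==> \<bar>q w w\<bar> \<le> (1 + CU) * sqn L w"
proof -
 assume w: "w \<in> W"
 have "CU * b w w \<le> CU * sqn L w" using b_le_sqn[OF w] CU by (rule mult_left_mono)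
 moreover have "sqn L (%x. snd (w x)) \<le> sqn L w"
  using sqn_fst_snd[OF W_sq[OF w]] sqn_nonneg[of L "%x. fst (w x)"] by simp
 moreover have "0 \<le> sqn L (%x. snd (w x))" by (rule sqn_nonneg)
 moreover have "(1 + CU) * sqn L w = sqn L w + CU * sqn L w" by (simp add: algebra_simps)
 ultimately show ?thesis using U_term_le[OF w] q_split[OF w] by linarith
qed

lemma sqn_le_form: "w \<in> W ==> sqn L w \<le> (1 + CU) * b w w + q w w"
 using sqn_fst_snd[OF W_sq, of w] U_term_le[of w] q_split[of w] by (simp add: b_sqn algebra_simps)

lemma W_diff: "w \<in> W ==> v \<in> W ==> (%x. w x - v x) \<in> W"
 using W_lin[of w v 1 "-1"] by simp

lemma sqn_lborel:
 assumes "test_function D \<phi>"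
 shows "sqn L \<phi> = (LBINT x. (\<phi> x)^2)" "sqn L (grad \<phi>) = (LBINT x. (norm (grad \<phi> x))^2)"
proof -
 interpret f: test_fun D \<phi> R by (rule test_fun[OF assms])
 have m: "(%x. (\<phi> x)^2) \<in> borel_measurable borel" "(%x. (norm (grad \<phi> x))^2) \<in> borel_measurable borel"
  using f.measurable_phi f.measurable_grad by measurable
 show "sqn L \<phi> = (LBINT x. (\<phi> x)^2)"
  unfolding sqn_def using lebesgue_on_lborel(2)[OF open_D m(1)] by (simp add: f.outside_D)
 show "sqn L (grad \<phi>) = (LBINT x. (norm (grad \<phi> x))^2)"
  unfolding sqn_def using lebesgue_on_lborel(2)[OF open_D m(2)] by (simp add: f.outside_D)
qed

text \<open>Rellich compactness: a diagonal subsequence makes the cell integrals converge at all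
  scales \<open>\<rho> j\<close>, and \<open>cell_poincare\<close> at one fine scale turns this into
  the Cauchy property in L2.\<close>

lemma test_sequence_cauchy:
 assumes \<phi>: "!!n. test_function D (\<phi> n)" and E: "!!n. sqn L (\<phi> n) \<le> E" "!!n. sqn L (grad (\<phi> n)) \<le> E"
 shows "\<exists>r::nat => nat. strict_mono r \<and> (\<forall>e>0. \<exists>N. \<forall>m\<ge>N. \<forall>n\<ge>N. sqn L (%x. \<phi> (r m) x - \<phi> (r n) x) < e)"
proof -
 have E0: "E \<ge> 0" using E(1)[of 0] sqn_nonneg[of L "\<phi> 0"] by linarith
 define \<rho> where "\<rho> j = inverse (real (Suc j))" for j
 have \<rho>: "\<rho> j > 0" for j by (simp add: \<rho>_def)
 define I where "I j c n = (LBINT x. (indicator {x. qfloor (\<rho> j) x = c} x * \<phi> n x))" for j and c :: "int ^ 'd" and n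
 have ind_meas: "indicator {x. qfloor (\<rho> j) x = c} \<in> borel_measurable (borel :: (real ^ 'd) measure)" for j c
  by (rule borel_measurable_indicator) (rule sets_qfloor[OF \<rho>])
 have ind_sq: "sq_int L (indicator {x. qfloor (\<rho> j) x = c} :: real ^ 'd => real)" for j c
 proof -
  have one: "sq_int L (%x. 1 :: real)" unfolding sq_int_def using finite_measure.integrable_const[OF finite_L, of "1 :: real"] by simp
  have "sq_int L (%x. indicator {x. qfloor (\<rho> j) x = c} x *\<^sub>R (1 :: real))"
   by (rule sq_int_scaleR_bounded[OF one measurable_lebesgue_on[OF ind_meas], where C = 1]) (simp add: indicator_def)
  then show ?thesis by (simp only: real_scaleR_def mult_1_right)
 qed
 have I_L: "I j c n = (LINT x|L. (\<phi> n x \<bullet> indicator {x. qfloor (\<rho> j) x = c} x))" for j c n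
 proof -
  interpret f: test_fun D "\<phi> n" R by (rule test_fun[OF \<phi>])
  have "(%x. \<phi> n x \<bullet> indicator {x. qfloor (\<rho> j) x = c} x) \<in> borel_measurable borel"
   using f.measurable_phi ind_meas[of j c] by (rule borel_measurable_inner)
  then show ?thesis unfolding I_def
   using lebesgue_on_lborel(2)[OF open_D, of "%x. \<phi> n x \<bullet> indicator {x. qfloor (\<rho> j) x = c} x"] by (simp add: f.outside_D mult.commute)
 qed
 have ind_int: "integrable lborel (%x. indicator {x. qfloor (\<rho> j) x = c} x * \<phi> k x)" for j c k
    proof -
     interpret fk: test_fun D "\<phi> k" R by (rule test_fun[OF \<phi>])
     obtain B where "!!x. \<bar>\<phi> k x\<bar> \<le> B" using fk.bounded_exists by blast
     moreover have "(%x. indicator {x. qfloor (\<rho> j) x = c} x * \<phi> k x) \<in> borel_measurable borel"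
      by (intro borel_measurable_times ind_meas fk.measurable_phi)
     ultimately show ?thesis using fk.outside_D(1) fk.D_bound
      by (intro integrable_bounded_support[where B = "\<bar>B\<bar>" and R = R]) (auto simp: indicator_def intro: order_trans[OF _ abs_ge_self])
    qed
 \<comment> \<open>Pairs of a scale and a cell are enumerated so that one diagonal argument treats
   all of them.\<close>
 define s where "s i n = I (fst (from_nat i :: nat \<times> (int ^ 'd))) (snd (from_nat i :: nat \<times> (int ^ 'd))) n" for i n
 have "\<exists>B. \<forall>n. \<bar>I j c n\<bar> \<le> B" for j c
 proof -
  let ?i = "indicator {x. qfloor (\<rho> j) x = c} :: real ^ 'd => real"
  have "\<bar>I j c n\<bar> \<le> sqrt (E * sqn L ?i)" for n
  proof -
   have "(I j c n)^2 \<le> sqn L (\<phi> n) * sqn L ?i"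
    unfolding I_L by (rule sq_int_cauchy_schwarz[OF test_sq_int(1)[OF \<phi>] ind_sq])
   also have "... \<le> E * sqn L ?i" by (intro mult_right_mono E sqn_nonneg)
   finally have "sqrt ((I j c n)^2) \<le> sqrt (E * sqn L ?i)" by (rule real_sqrt_le_mono)
   then show ?thesis by simp
  qed
  then show ?thesis by blast
 qed
 then have "\<exists>B. \<forall>n. \<bar>s i n\<bar> \<le> B" for i by (simp add: s_def)
 from diagonal_convergent_subseq[of s, OF this] obtain r :: "nat => nat" where r: "strict_mono r"
  and conv: "!!i. convergent (%n. s i (r n))" by blast
 have convI: "convergent (%n. I j c (r n))" for j c
  using conv[of "to_nat (j, c)"] by (simp add: s_def)
 have "\<exists>N. \<forall>m\<ge>N. \<forall>n\<ge>N. sqn L (%x. \<phi> (r m) x - \<phi> (r n) x) < e" if e: "e > 0" for e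
 proof -
  let ?A = "3 ^ CARD('d) * real CARD('d) :: real"
  have "(%j. ?A * (\<rho> j)^2 * (4 * E)) \<longlonglongrightarrow> ?A * 0\<^sup>2 * (4 * E)"
   unfolding \<rho>_def by (intro tendsto_mult tendsto_power tendsto_const LIMSEQ_inverse_real_of_nat)
  \<comment> \<open>Differences of two members have squared gradient norm at most
    \<open>4 * E\<close>. The scale \<open>j\<close> is fixed by this part; afterwards only finitely
    many cells remain.\<close>
  then have "\<forall>\<^sub>F j in sequentially. ?A * (\<rho> j)^2 * (4 * E) < e / 2" using e by (intro order_tendstoD) auto
  then obtain j where j: "?A * (\<rho> j)^2 * (4 * E) < e / 2" by (auto simp: eventually_sequentially)
  define C where "C = {c :: int ^ 'd. \<forall>i. \<bar>\<rho> j * real_of_int (c $ i)\<bar> \<le> R + \<rho> j}"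
  have C: "finite C" unfolding C_def by (rule finite_bounded_lattice[OF \<rho>])
  have rd: "\<rho> j ^ CARD('d) > 0" using \<rho>[of j] by simp
  have "e / 2 * \<rho> j ^ CARD('d) > 0" using e rd by simp
  from convergent_sq_sum_cauchy[of C "%c n. I j c (r n)", OF C convI this]
  obtain N where NN: "\<forall>m\<ge>N. \<forall>n\<ge>N. (\<Sum>c\<in>C. (I j c (r m) - I j c (r n))^2) < e / 2 * \<rho> j ^ CARD('d)" by (elim exE)
  note N = NN[rule_format]
  have "sqn L (%x. \<phi> (r m) x - \<phi> (r n) x) < e" if mn: "m \<ge> N" "n \<ge> N" for m n
  proof -
   let ?f = "\<phi> (r m)" and ?g = "\<phi> (r n)"
   let ?h = "%x. ?f x - ?g x"
   have h: "test_function D ?h" using test_function_lin[OF \<phi> \<phi>, of 1 "r m" "-1" "r n"] by simp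
   interpret f: test_fun D ?f R by (rule test_fun[OF \<phi>])
   interpret g: test_fun D ?g R by (rule test_fun[OF \<phi>])
   interpret h: test_fun D ?h R by (rule test_fun[OF h])
   have gr: "grad ?h x = grad ?f x - grad ?g x" for x
    by (rule grad_eq[OF GDERIV_diff[OF f.gderiv g.gderiv]])
   have Eh: "sqn L (grad ?h) \<le> 4 * E"
   proof -
    have "sqn L (grad ?h) = sqn L (%x. grad ?f x - grad ?g x)" by (simp add: sqn_def gr)
    also have "... \<le> 2 * sqn L (grad ?f) + 2 * sqn L (grad ?g)" by (rule sqn_triangle[OF test_sq_int(2)[OF \<phi>] test_sq_int(2)[OF \<phi>]])
    finally show ?thesis using E(2)[of "r m"] E(2)[of "r n"] by linarith
   qed
   have Ih: "(LBINT x. (indicator {x. qfloor (\<rho> j) x = c} x * ?h x)) = I j c (r m) - I j c (r n)" for c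
   proof -
    have "integrable lborel (%x. indicator {x. qfloor (\<rho> j) x = c} x * \<phi> k x)" for k
     using ind_int .
    then show ?thesis unfolding I_def right_diff_distrib by simp
   qed
   have "sqn L ?h = (LBINT x. (?h x)^2)" by (rule sqn_lborel(1)[OF h])
   also have "... \<le> ?A * (\<rho> j)^2 * (LBINT x. (norm (grad ?h x))^2) + (\<Sum>c\<in>C. (I j c (r m) - I j c (r n))^2 / \<rho> j ^ CARD('d))"
    using h.cell_poincare[OF \<rho>[of j]] unfolding h.near_cells_def C_def[symmetric] Ih .
   also have "(LBINT x. (norm (grad ?h x))^2) = sqn L (grad ?h)" by (rule sqn_lborel(2)[OF h, symmetric])
   also have "?A * (\<rho> j)^2 * sqn L (grad ?h) \<le> ?A * (\<rho> j)^2 * (4 * E)" by (intro mult_left_mono Eh) auto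
   also have "(\<Sum>c\<in>C. (I j c (r m) - I j c (r n))^2 / \<rho> j ^ CARD('d)) < e / 2"
    using N[OF mn] rd by (simp add: sum_divide_distrib[symmetric] field_simps)
   finally show ?thesis using j by simp
  qed
  then show ?thesis by blast
 qed
 then show ?thesis using r by blast
qed

text \<open>Elements of \<open>W\<close> are replaced by test functions at distance tending to zero,
  to which the cell-wise argument applies.\<close>

lemma form_bounded_imp_cauchy:
 assumes w: "!!n::nat. w n \<in> W" and B: "!!n. b (w n) (w n) \<le> B" "!!n. q (w n) (w n) \<le> B"
 shows "\<exists>r::nat => nat. strict_mono r \<and>
    (\<forall>e>0. \<exists>N. \<forall>m\<ge>N. \<forall>n\<ge>N. b (%x. w (r m) x - w (r n) x) (%x. w (r m) x - w (r n) x) < e)"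
proof -
 define E0 where "E0 = (1 + CU) * B + B"
 have wE: "sqn L (w n) \<le> E0" for n
 proof -
  have "(1 + CU) * b (w n) (w n) \<le> (1 + CU) * B" using B(1)[of n] CU by (intro mult_left_mono) auto
  then show ?thesis using sqn_le_form[OF w, of n] B(2)[of n] unfolding E0_def by linarith
 qed
 have "\<forall>n. \<exists>\<phi>. test_function D \<phi> \<and> sqn L (%x. pair \<phi> x - w n x) < inverse (real (Suc n))"
  using W_approx[OF w] by simp
 then obtain \<phi> where \<phi>: "!!n. test_function D (\<phi> n)" "!!n. sqn L (%x. pair (\<phi> n) x - w n x) < inverse (real (Suc n))"
  by metis
 define E where "E = 2 + 2 * E0"
 have pE: "sqn L (pair (\<phi> n)) \<le> E" for n
 proof -
  have "inverse (real (Suc n)) \<le> 1" by (simp add: field_simps)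
  then show ?thesis using sqn_le_diff[OF test_sq_int(4)[OF \<phi>(1)[of n]] W_sq[OF w[of n]]] \<phi>(2)[of n] wE[of n] by (simp add: E_def)
 qed
 have split: "sqn L (pair (\<phi> n)) = sqn L (\<phi> n) + sqn L (grad (\<phi> n))" for n
  using sqn_fst_snd[OF test_sq_int(4)[OF \<phi>(1)[of n]]] by (simp add: pair_def)
 have "sqn L (\<phi> n) \<le> E" "sqn L (grad (\<phi> n)) \<le> E" for n
  using pE[of n] split[of n] sqn_nonneg[of L "\<phi> n"] sqn_nonneg[of L "grad (\<phi> n)"] by linarith+
 from test_sequence_cauchy[of \<phi>, OF \<phi>(1) this] obtain r :: "nat => nat" where
  rr: "strict_mono r \<and> (\<forall>e>0. \<exists>N. \<forall>m\<ge>N. \<forall>n\<ge>N. sqn L (%x. \<phi> (r m) x - \<phi> (r n) x) < e)" by (elim exE)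
 note r = rr[THEN conjunct1] and cau = rr[THEN conjunct2, rule_format]
 have "\<exists>N. \<forall>m\<ge>N. \<forall>n\<ge>N. b (%x. w (r m) x - w (r n) x) (%x. w (r m) x - w (r n) x) < e" if e: "e > 0" for e
 proof -
  obtain N1 where N1: "!!m n. m \<ge> N1 ==> n \<ge> N1 ==> sqn L (%x. \<phi> (r m) x - \<phi> (r n) x) < e / 16" using cau[of "e / 16"] e by auto
  obtain N2 where N2: "inverse (real (Suc N2)) < e / 16" using reals_Archimedean[of "e / 16"] e by auto
  have ap: "sqn L (%x. fst (w (r n) x) - \<phi> (r n) x) < e / 16" if "n \<ge> N2" for n
  proof -
   have "N2 \<le> r n" using strict_mono_imp_increasing[OF r, of n] that by linarith
   then have "inverse (real (Suc (r n))) \<le> inverse (real (Suc N2))" by (simp add: field_simps)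
   then have "sqn L (%x. pair (\<phi> (r n)) x - w (r n) x) < e / 16" using \<phi>(2)[of "r n"] N2 by linarith
   moreover have "sqn L (%x. \<phi> (r n) x - fst (w (r n) x)) \<le> sqn L (%x. pair (\<phi> (r n)) x - w (r n) x)"
    using sqn_fst_snd[OF sq_int_diff[OF test_sq_int(4)[OF \<phi>(1)[of "r n"]] W_sq[OF w[of "r n"]]]]
     sqn_nonneg[of L "%x. snd (pair (\<phi> (r n)) x - w (r n) x)"] by (simp add: pair_def)
   moreover have "sqn L (%x. fst (w (r n) x) - \<phi> (r n) x) = sqn L (%x. \<phi> (r n) x - fst (w (r n) x))"
    by (simp add: sqn_def power2_commute)
   ultimately show ?thesis by linarith
  qed
  have "b (%x. w (r m) x - w (r n) x) (%x. w (r m) x - w (r n) x) < e" if "m \<ge> max N1 N2" "n \<ge> max N1 N2" for m n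
  proof -
   let ?u = "%x. fst (w (r m) x)" and ?v = "%x. fst (w (r n) x)"
   note su = W_sq_fst[OF w[of "r m"]] and sv = W_sq_fst[OF w[of "r n"]]
   note sp = test_sq_int(1)[OF \<phi>(1)[of "r m"]] and sp' = test_sq_int(1)[OF \<phi>(1)[of "r n"]]
   have "sqn L (%x. ?v x - \<phi> (r m) x) \<le> 2 * sqn L (%x. ?v x - \<phi> (r n) x) + 2 * sqn L (%x. \<phi> (r m) x - \<phi> (r n) x)"
    by (rule sqn_triangle3[OF sv sp sp'])
   also have "... < e / 4" using ap[of n] N1[of m n] that by simp
   finally have "sqn L (%x. ?u x - ?v x) < e"
    using sqn_triangle3[OF su sv sp] ap[of m] that e by simp
   then show ?thesis by (simp add: b_sqn)
  qed
  then show ?thesis by blast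
 qed
 then show ?thesis using r by blast
qed

text \<open>By \<open>sqn_le_form\<close> the form controls the square norm of function and gradient
  together, so completeness of square-integrable pairs applies.\<close>

lemma form_complete_W:
 assumes w: "!!n::nat. w n \<in> W"
  and cau: "\<forall>e>0. \<exists>N. \<forall>m\<ge>N. \<forall>n\<ge>N. b (%x. w m x - w n x) (%x. w m x - w n x) < e \<and>
     q (%x. w m x - w n x) (%x. w m x - w n x) < e"
 shows "\<exists>v\<in>W. (%n. b (%x. w n x - v x) (%x. w n x - v x)) \<longlonglongrightarrow> 0 \<and>
    (%n. q (%x. w n x - v x) (%x. w n x - v x)) \<longlonglongrightarrow> 0"
proof -
 have sc: "\<exists>N. \<forall>m\<ge>N. \<forall>n\<ge>N. sqn L (%x. w m x - w n x) < e" if e: "e > 0" for e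
 proof -
  define e' where "e' = e / (2 + CU)"
  have "(1 + CU) * e' + e' = (2 + CU) * e'" by (simp add: algebra_simps)
  moreover have "(2 + CU) * e' = e" using CU by (simp add: e'_def)
  ultimately have e': "e' > 0" "(1 + CU) * e' + e' = e" using e CU by (simp_all add: e'_def)
  obtain N where N: "!!m n. m \<ge> N ==> n \<ge> N ==> b (%x. w m x - w n x) (%x. w m x - w n x) < e' \<and>
     q (%x. w m x - w n x) (%x. w m x - w n x) < e'" using cau e'(1) by blast
  have "sqn L (%x. w m x - w n x) < e" if "m \<ge> N" "n \<ge> N" for m n
  proof -
   let ?d = "%x. w m x - w n x"
   have "sqn L ?d \<le> (1 + CU) * b ?d ?d + q ?d ?d" by (rule sqn_le_form[OF W_diff[OF w w]])
   moreover have "(1 + CU) * b ?d ?d \<le> (1 + CU) * e'" using N[OF that] CU by (intro mult_left_mono) auto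
   ultimately show ?thesis using N[OF that] e'(2) by linarith
  qed
  then show ?thesis by blast
 qed
 obtain v where v: "sq_int L v" "(%n. sqn L (%x. w n x - v x)) \<longlonglongrightarrow> 0"
  using sq_int_complete[OF finite_L W_sq[OF w] sc] by blast
 have vW: "v \<in> W"
 proof (rule W_closed[OF v(1)])
  fix e :: real assume "e > 0"
  then have "\<forall>\<^sub>F n in sequentially. sqn L (%x. w n x - v x) < e" using order_tendstoD(2)[OF v(2)] by blast
  then obtain n where "sqn L (%x. w n x - v x) < e" by (auto simp: eventually_sequentially)
  then show "\<exists>v'\<in>W. sqn L (%x. v' x - v x) < e" using w by blast
 qed
 have "(%n. b (%x. w n x - v x) (%x. w n x - v x)) \<longlonglongrightarrow> 0"
 proof (rule Lim_null_comparison[OF _ v(2)], intro always_eventually allI)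
  fix n show "norm (b (%x. w n x - v x) (%x. w n x - v x)) \<le> sqn L (%x. w n x - v x)"
   using b_le_sqn[OF W_diff[OF w vW]] by (simp add: b_sqn abs_of_nonneg[OF sqn_nonneg])
 qed
 moreover have "(%n. q (%x. w n x - v x) (%x. w n x - v x)) \<longlonglongrightarrow> 0"
 proof (rule Lim_null_comparison)
  show "\<forall>\<^sub>F n in sequentially. norm (q (%x. w n x - v x) (%x. w n x - v x)) \<le> (1 + CU) * sqn L (%x. w n x - v x)"
   using q_le_sqn[OF W_diff[OF w vW]] by simp
  show "(%n. (1 + CU) * sqn L (%x. w n x - v x)) \<longlonglongrightarrow> 0" using tendsto_mult_left[OF v(2), of "1 + CU"] by simp
 qed
 ultimately show ?thesis using vW by blast
qed

lemma zero_in_W: "W ~= {}"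
proof -
 have "Ck n (%x :: real ^ 'd. 0 :: real)" for n by (rule Ck_const)
 then have "test_function D (%x. 0)" unfolding test_function_def by simp
 then show ?thesis using pair_in_W by blast
qed

lemma b_lin:
 assumes "u \<in> W" "v \<in> W" "w \<in> W"
 shows "b (%x. s *\<^sub>R u x + t *\<^sub>R v x) w = s * b u w + t * b v w"
proof -
 have "b (%x. s *\<^sub>R u x + t *\<^sub>R v x) w = (LINT x|L. s * (fst (u x) * fst (w x)) + t * (fst (v x) * fst (w x)))"
  unfolding b_def by (intro Bochner_Integration.integral_cong refl) (simp add: algebra_simps)
 then show ?thesis using b_integrable[OF assms(1,3)] b_integrable[OF assms(2,3)] by (simp add: b_def)
qed

lemma q_lin:
 assumes "u \<in> W" "v \<in> W" "w \<in> W"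
 shows "q (%x. s *\<^sub>R u x + t *\<^sub>R v x) w = s * q u w + t * q v w"
proof -
 have "q (%x. s *\<^sub>R u x + t *\<^sub>R v x) w = (LINT x|L. s * (snd (u x) \<bullet> snd (w x) + U x * fst (u x) * fst (w x))
   + t * (snd (v x) \<bullet> snd (w x) + U x * fst (v x) * fst (w x)))"
  unfolding q_def by (intro Bochner_Integration.integral_cong refl) (simp add: inner_add_left algebra_simps)
 then show ?thesis using q_integrable[OF assms(1,3)] q_integrable[OF assms(2,3)] by (simp add: q_def)
qed

sublocale cf: compact_form W b q CU
proof
 show "W ~= {}" by (rule zero_in_W)
 show "(%x. s *\<^sub>R u x + t *\<^sub>R v x) \<in> W" if "u \<in> W" "v \<in> W" for u v s t using W_lin that by blast
 show "b u v = b v u" for u v by (simp add: b_def mult.commute)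
 show "q u v = q v u" for u v by (simp add: q_def inner_commute mult_ac)
 show "0 \<le> b u u" for u by (simp add: b_sqn sqn_nonneg)
 show "- CU * b u u \<le> q u u" if "u \<in> W" for u
  using U_term_le[OF that] q_split[OF that] sqn_nonneg[of L "%x. snd (u x)"] by linarith
 show "b (%x. s *\<^sub>R u x + t *\<^sub>R v x) w = s * b u w + t * b v w" if "u \<in> W" "v \<in> W" "w \<in> W" for u v w s t
  by (rule b_lin[OF that])
 show "q (%x. s *\<^sub>R u x + t *\<^sub>R v x) w = s * q u w + t * q v w" if "u \<in> W" "v \<in> W" "w \<in> W" for u v w s t
  by (rule q_lin[OF that])
qed (use form_bounded_imp_cauchy form_complete_W in blast)+

lemma eigenspace_eq: "(%u x. fst (u x)) ` cf.eigenspace \<nu> = {u. dirichlet_op D U u (%x. \<nu> * u x)}"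
proof (intro set_eqI iffI)
 fix u assume "u \<in> (%u x. fst (u x)) ` cf.eigenspace \<nu>"
 then obtain w where w: "w \<in> W" "!!v. v \<in> W ==> q w v = \<nu> * b w v" and u: "u = (%x. fst (w x))"
  by (auto simp: cf.eigenspace_def)
 have "L2_on D (%x. \<nu> * u x)"
  using sq_int_lin[OF W_sq_fst W_sq_fst, OF w(1) w(1), of \<nu> 0] by (simp add: L2_on_eq u)
 moreover have "(LINT x|L. snd (w x) \<bullet> V x + U x * u x * v x) = (LINT x|L. \<nu> * u x * v x)" if "H10_grad D v V" for v V
 proof -
  have "(%x. (v x, V x)) \<in> W" using that by (simp add: W_def)
  from w(2)[OF this] show ?thesis by (simp add: q_def b_def u mult.assoc)
 qed
 moreover have "H10_grad D u (%x. snd (w x))" using w(1) by (simp add: W_def u)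
 ultimately show "u \<in> {u. dirichlet_op D U u (%x. \<nu> * u x)}" unfolding dirichlet_op_def by blast
next
 fix u assume "u \<in> {u. dirichlet_op D U u (%x. \<nu> * u x)}"
 then obtain G where G: "H10_grad D u G"
  "!!v V. H10_grad D v V ==> (LINT x|L. G x \<bullet> V x + U x * u x * v x) = (LINT x|L. \<nu> * u x * v x)"
  unfolding dirichlet_op_def by blast
 have "(%x. (u x, G x)) \<in> cf.eigenspace \<nu>"
  unfolding cf.eigenspace_def using G(1) G(2)[of "%x. fst (v x)" "%x. snd (v x)" for v]
  by (auto simp: W_def q_def b_def mult.assoc)
 then show "u \<in> (%u x. fst (u x)) ` cf.eigenspace \<nu>" by (intro image_eqI[of _ _ "%x. (u x, G x)"]) auto
qed

lemma null_iff: "w \<in> W ==> (%x. fst (w x)) \<in> {f. AE x in L. f x = 0} \<longleftrightarrow> b w w = 0"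
 unfolding b_def using integral_nonneg_eq_0_iff_AE[OF b_integrable, of w w] by simp

lemma dirichlet_eigenvalue_eq:
 assumes "cf.eigenbasis k e l" "k \<ge> 1"
 shows "dirichlet_eigenvalue D U k = l (k - 1)"
proof -
 have "linear (fst :: real \<times> (real ^ 'd) => real)" by (rule bounded_linear.linear[OF bounded_linear_fst])
 from cf.kth_eigenvalue_eq[OF assms this null_iff]
 show ?thesis unfolding dirichlet_eigenvalue_def eigenspace_eq .
qed

end

section \<open>The lattice form\<close>

text \<open>Integer squares summing to \<open>1\<close> leave room for a single nonzero coordinate,
  equal to \<open>1\<close> or \<open>-1\<close>.\<close>

lemma unit_lattice_vector:
 fixes z :: "int ^ 'd::finite"
 shows "norm (lattice_point z) = 1 \<longleftrightarrow> (\<exists>i. z = axis i 1 \<or> z = axis i (-1))"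
proof
 assume "norm (lattice_point z) = 1"
 then have "(\<Sum>i\<in>UNIV. (real_of_int (z $ i))^2) = 1"
  by (simp add: norm_vec_def L2_set_def lattice_point_def)
 then have "real_of_int (\<Sum>i\<in>UNIV. (z $ i)^2) = 1" by simp
 then have s: "(\<Sum>i\<in>UNIV. (z $ i)^2) = 1" by linarith
 have "\<exists>i. z $ i ~= 0"
 proof (rule ccontr)
  assume "\<not> ?thesis"
  then show False using s by simp
 qed
 then obtain i where i: "z $ i ~= 0" by blast
 have rest: "(\<Sum>j\<in>UNIV - {i}. (z $ j)^2) = 1 - (z $ i)^2" using s by (simp add: sum.remove[of UNIV i])
 have "(z $ i)^2 \<ge> 1" using i by (simp add: int_one_le_iff_zero_less)
 moreover have "0 \<le> (\<Sum>j\<in>UNIV - {i}. (z $ j)^2)" by (intro sum_nonneg) auto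
 ultimately have z1: "(z $ i)^2 = 1" and "(\<Sum>j\<in>UNIV - {i}. (z $ j)^2) = 0" using rest by auto
 then have z0: "z $ j = 0" if "j ~= i" for j using that by (simp add: sum_nonneg_eq_0_iff)
 define a where "a = z $ i"
 have "z = axis i a" using z0 by (simp add: vec_eq_iff axis_def a_def)
 moreover have "a = 1 \<or> a = -1" using z1 by (simp add: power2_eq_1_iff a_def)
 ultimately show "\<exists>i. z = axis i 1 \<or> z = axis i (-1)" by blast
next
 assume "\<exists>i. z = axis i 1 \<or> z = axis i (-1)"
 then obtain i where "z = axis i 1 \<or> z = axis i (-1)" by blast
 then have "lattice_point z = axis i 1 \<or> lattice_point z = - axis i 1"
  by (auto simp: lattice_point_def vec_eq_iff axis_def)
 then show "norm (lattice_point z) = 1" by auto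
qed

lemma lattice_neighbour_sum:
 fixes x :: "int ^ 'd::finite" and f :: "int ^ 'd => real"
 shows "(\<Sum>y | norm (lattice_point x - lattice_point y) = 1. f y) = (\<Sum>i\<in>UNIV. f (x + axis i 1) + f (x - axis i 1))"
proof -
 have lp: "lattice_point x - lattice_point y = lattice_point (x - y)" for y
  by (simp add: lattice_point_def vec_eq_iff)
 have "{y. norm (lattice_point x - lattice_point y) = 1} = range (%i. x + axis i 1) \<union> range (%i. x - axis i 1)"
 proof (intro set_eqI iffI)
  fix y assume "y \<in> {y. norm (lattice_point x - lattice_point y) = 1}"
  then obtain i where "x - y = axis i 1 \<or> x - y = axis i (-1)" unfolding lp unit_lattice_vector by blast
  moreover have "axis i (-1) = - (axis i 1 :: int ^ 'd)" by (simp add: vec_eq_iff axis_def)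
  ultimately have "y = x - axis i 1 \<or> y = x + axis i 1" by (auto simp: algebra_simps)
  then show "y \<in> range (%i. x + axis i 1) \<union> range (%i. x - axis i 1)" by blast
 next
  fix y assume "y \<in> range (%i. x + axis i 1) \<union> range (%i. x - axis i 1)"
  then obtain i where "y = x + axis i 1 \<or> y = x - axis i 1" by blast
  moreover have "axis i (-1) = - (axis i 1 :: int ^ 'd)" by (simp add: vec_eq_iff axis_def)
  ultimately have "x - y = axis i 1 \<or> x - y = axis i (-1)" by auto
  then show "y \<in> {y. norm (lattice_point x - lattice_point y) = 1}" unfolding mem_Collect_eq lp unit_lattice_vector by blast
 qed
 moreover have "range (%i. x + axis i 1) \<inter> range (%i. x - axis i 1) = {}"
 proof -
  have "x + axis i 1 ~= x - axis j 1" for i j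
  proof
   assume "x + axis i 1 = x - axis j 1"
   then have "(x + axis i 1) $ i = (x - axis j 1) $ i" by simp
   then show False by (simp add: axis_def split: if_splits)
  qed
  then show ?thesis by blast
 qed
 moreover have "inj (%i. x + axis i (1::int))" "inj (%i. x - axis i (1::int))"
  by (auto simp: inj_def axis_eq_axis)
 ultimately show ?thesis
  by (simp add: sum.union_disjoint sum.reindex sum.distrib)
qed

lemma lattice_op_eq:
 fixes f :: "int ^ 'd::finite => real"
 shows "lattice_op eps \<xi> f x = - (1 / eps\<^sup>2) * (\<Sum>i\<in>UNIV. fdiff i f x - fdiff i f (x - axis i 1)) + \<xi> x * f x"
 unfolding lattice_op_def lattice_neighbour_sum by (simp add: fdiff_def)

locale lattice_form =
 fixes S :: "(int ^ 'd::finite) set" and eps :: real and \<xi> :: "int ^ 'd => real"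
 assumes fin_S: "finite S" and eps: "eps > 0"
begin

definition W :: "(int ^ 'd => real) set" where "W = {f. \<forall>x. x \<notin> S --> f x = 0}"

definition b :: "(int ^ 'd => real) => (int ^ 'd => real) => real" where
 "b f g = eps ^ CARD('d) * zsum (%x. f x * g x)"

definition q :: "(int ^ 'd => real) => (int ^ 'd => real) => real" where
 "q f g = eps ^ CARD('d) / eps\<^sup>2 * (\<Sum>i\<in>UNIV. zsum (%x. fdiff i f x * fdiff i g x)) + eps ^ CARD('d) * zsum (%x. \<xi> x * f x * g x)"

text \<open>A crude lower bound that depends on mesh and potential; \<open>compact_form\<close> asks
  only for some constant, and uniformity in the mesh is supplied later by
  \<open>form_close\<close>.\<close>

definition "c0 = (\<Sum>x\<in>S. \<bar>\<xi> x\<bar>)"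

lemma W_fin: "f \<in> W ==> fin_supp f"
 by (rule fin_suppI[OF fin_S]) (auto simp: W_def)

lemma W_zero: "f \<in> W ==> x \<notin> S ==> f x = 0"
 by (auto simp: W_def)

lemma b_eq: "f \<in> W ==> b f g = eps ^ CARD('d) * (\<Sum>x\<in>S. f x * g x)"
 unfolding b_def by (subst zsum_eq[OF fin_S]) (auto simp: W_def)

lemma b_diag: "b f f = mass eps f"
 by (simp add: b_def mass_def power2_eq_square)

lemma q_diag: "q f f = energy eps f + eps ^ CARD('d) * zsum (%x. \<xi> x * (f x)^2)"
 by (simp add: q_def energy_def dirichlet_sum_def power2_eq_square mult.assoc)

lemma fin_fdiff: "f \<in> W ==> fin_supp (fdiff i f)"
 unfolding fdiff_def[abs_def] by (intro fin_supp_diff fin_supp_shift W_fin)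

lemma potential_le: "f \<in> W ==> \<bar>eps ^ CARD('d) * zsum (%x. \<xi> x * (f x)^2)\<bar> \<le> c0 * b f f"
proof -
 assume f: "f \<in> W"
 have "zsum (%x. \<xi> x * (f x)^2) = (\<Sum>x\<in>S. \<xi> x * (f x)^2)" using f by (intro zsum_eq fin_S) (auto simp: W_def)
 also have "\<bar>...\<bar> \<le> (\<Sum>x\<in>S. c0 * (f x)^2)"
 proof (rule order_trans[OF sum_abs sum_mono])
  fix x assume "x \<in> S"
  then have "\<bar>\<xi> x\<bar> \<le> c0" unfolding c0_def using fin_S by (intro member_le_sum) auto
  then show "\<bar>\<xi> x * (f x)^2\<bar> \<le> c0 * (f x)^2" by (simp add: abs_mult mult_right_mono)
 qed
 finally have "\<bar>zsum (%x. \<xi> x * (f x)^2)\<bar> \<le> c0 * (\<Sum>x\<in>S. f x * f x)" by (simp add: sum_distrib_left power2_eq_square)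
 then have "eps ^ CARD('d) * \<bar>zsum (%x. \<xi> x * (f x)^2)\<bar> \<le> eps ^ CARD('d) * (c0 * (\<Sum>x\<in>S. f x * f x))"
  using eps by (intro mult_left_mono) auto
 then show ?thesis using eps by (simp add: b_eq[OF f] abs_mult mult.left_commute)
qed

lemma energy_le: "f \<in> W ==> energy eps f \<le> 4 * real CARD('d) / eps\<^sup>2 * b f f"
proof -
 assume f: "f \<in> W"
 have "zsum (%x. (fdiff i f x)^2) \<le> 4 * zsum (%x. (f x)^2)" for i
 proof -
  have f2: "fin_supp (%x. (f x)^2)" by (rule fin_supp_sq[OF W_fin[OF f]])
  have "zsum (%x. (fdiff i f x)^2) \<le> zsum (%x. 2 * (f (x + axis i 1))^2 + 2 * (f x)^2)"
  proof (intro zsum_mono fin_supp_add)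
   show "fin_supp (%x. (fdiff i f x)^2)" by (rule fin_supp_sq[OF fin_fdiff[OF f]])
   show "fin_supp (%x. 2 * (f (x + axis i 1))^2)" using fin_supp_shift[OF f2, of "axis i 1"] by (rule fin_supp_mult_right)
   show "fin_supp (%x. 2 * (f x)^2)" using f2 by (rule fin_supp_mult_right)
   fix x
   have "0 \<le> (f (x + axis i 1) + f x)^2" by simp
   then show "(fdiff i f x)^2 \<le> 2 * (f (x + axis i 1))^2 + 2 * (f x)^2"
    by (simp add: fdiff_def power2_eq_square algebra_simps)
  qed
  also have "... = 2 * zsum (%x. (f (x + axis i 1))^2) + 2 * zsum (%x. (f x)^2)"
  proof -
   have "fin_supp (%x. 2 * (f (x + axis i 1))^2)" using fin_supp_shift[OF f2, of "axis i 1"] by (rule fin_supp_mult_right)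
   moreover have "fin_supp (%x. 2 * (f x)^2)" using f2 by (rule fin_supp_mult_right)
   ultimately show ?thesis by (simp only: zsum_add zsum_cmult)
  qed
  also have "zsum (%x. (f (x + axis i 1))^2) = zsum (%x. (f x)^2)" by (rule zsum_shift[of "%x. (f x)^2"])
  finally show ?thesis by simp
 qed
 then have "dirichlet_sum f \<le> (\<Sum>i\<in>(UNIV :: 'd set). 4 * zsum (%x. (f x)^2))"
  unfolding dirichlet_sum_def by (rule sum_mono)
 then have "dirichlet_sum f \<le> real CARD('d) * (4 * zsum (%x. (f x)^2))" by simp
 then have "eps ^ CARD('d) / eps\<^sup>2 * dirichlet_sum f \<le> eps ^ CARD('d) / eps\<^sup>2 * (real CARD('d) * (4 * zsum (%x. (f x)^2)))"
  using eps by (intro mult_left_mono) auto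
 then show ?thesis by (simp add: energy_def b_diag mass_def mult_ac)
qed

lemma W_diff: "f \<in> W ==> g \<in> W ==> (%x. f x - g x) \<in> W"
 by (simp add: W_def)

lemma b_tendsto_0:
 assumes "!!n. f n \<in> W" "g \<in> W" "!!x. x \<in> S ==> (%n. f n x) \<longlonglongrightarrow> g x"
 shows "(%n. b (%x. f n x - g x) (%x. f n x - g x)) \<longlonglongrightarrow> 0"
proof -
 have "(%n. eps ^ CARD('d) * (\<Sum>x\<in>S. (f n x - g x) * (f n x - g x))) \<longlonglongrightarrow> eps ^ CARD('d) * (\<Sum>x\<in>S. (g x - g x) * (g x - g x))"
  by (intro tendsto_intros assms(3))
 then show ?thesis using b_eq[OF W_diff[OF assms(1,2)]] by simp
qed

lemma pointwise_le_b:
 assumes "f \<in> W" shows "(f x)^2 \<le> b f f / eps ^ CARD('d)"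
 using zsum_le_sum_sq[OF fin_supp_sq[OF W_fin[OF assms]], of x] eps by (simp add: b_diag mass_def)

sublocale lf: compact_form W b q c0
proof
 show "W ~= {}" by (auto simp: W_def intro: exI[of _ "%_. 0"])
 show "(%x. s *\<^sub>R u x + t *\<^sub>R v x) \<in> W" if "u \<in> W" "v \<in> W" for u v s t using that by (simp add: W_def)
 show "b u v = b v u" for u v by (simp add: b_def mult.commute)
 show "q u v = q v u" for u v by (simp add: q_def mult_ac)
 show "0 \<le> b u u" for u using eps by (simp add: b_diag mass_nonneg)
 show "- c0 * b u u \<le> q u u" if "u \<in> W" for u
  using potential_le[OF that] energy_nonneg[of eps u] eps by (simp add: q_diag)
 show "b (%x. s *\<^sub>R u x + t *\<^sub>R v x) w = s * b u w + t * b v w" if "u \<in> W" "v \<in> W" "w \<in> W" for u v w s t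
 proof -
  have "zsum (%x. (s *\<^sub>R u x + t *\<^sub>R v x) * w x) = zsum (%x. s * (u x * w x) + t * (v x * w x))"
   by (intro arg_cong[where f=zsum] ext) (simp add: algebra_simps)
  also have "... = s * zsum (%x. u x * w x) + t * zsum (%x. v x * w x)"
   using fin_supp_mult_left[OF W_fin[OF that(1)], of w] fin_supp_mult_left[OF W_fin[OF that(2)], of w]
   by (subst zsum_add) (auto intro: fin_supp_mult_right simp: zsum_cmult)
  finally show ?thesis by (simp add: b_def algebra_simps)
 qed
 show "q (%x. s *\<^sub>R u x + t *\<^sub>R v x) w = s * q u w + t * q v w" if "u \<in> W" "v \<in> W" "w \<in> W" for u v w s t
 proof -
  have 1: "zsum (%x. fdiff i (%x. s *\<^sub>R u x + t *\<^sub>R v x) x * fdiff i w x)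
    = s * zsum (%x. fdiff i u x * fdiff i w x) + t * zsum (%x. fdiff i v x * fdiff i w x)" for i
  proof -
   have "zsum (%x. fdiff i (%x. s *\<^sub>R u x + t *\<^sub>R v x) x * fdiff i w x)
    = zsum (%x. s * (fdiff i u x * fdiff i w x) + t * (fdiff i v x * fdiff i w x))"
    by (intro arg_cong[where f=zsum] ext) (simp add: fdiff_def algebra_simps)
   also have "... = s * zsum (%x. fdiff i u x * fdiff i w x) + t * zsum (%x. fdiff i v x * fdiff i w x)"
    using fin_supp_mult_left[OF fin_fdiff[OF that(1), of i], of "fdiff i w"] fin_supp_mult_left[OF fin_fdiff[OF that(2), of i], of "fdiff i w"]
    by (subst zsum_add) (auto intro: fin_supp_mult_right simp: zsum_cmult)
   finally show ?thesis .
  qed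
  have 2: "zsum (%x. \<xi> x * (s *\<^sub>R u x + t *\<^sub>R v x) * w x) = s * zsum (%x. \<xi> x * u x * w x) + t * zsum (%x. \<xi> x * v x * w x)"
  proof -
   have "zsum (%x. \<xi> x * (s *\<^sub>R u x + t *\<^sub>R v x) * w x) = zsum (%x. s * (\<xi> x * u x * w x) + t * (\<xi> x * v x * w x))"
    by (intro arg_cong[where f=zsum] ext) (simp add: algebra_simps)
   also have "... = s * zsum (%x. \<xi> x * u x * w x) + t * zsum (%x. \<xi> x * v x * w x)"
    using fin_supp_mult_left[OF fin_supp_mult_right[OF W_fin[OF that(1)]], of \<xi> w] fin_supp_mult_left[OF fin_supp_mult_right[OF W_fin[OF that(2)]], of \<xi> w]
    by (subst zsum_add) (auto intro: fin_supp_mult_right simp: zsum_cmult)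
   finally show ?thesis .
  qed
  show ?thesis unfolding q_def 1 2 by (simp add: sum.distrib sum_distrib_left[symmetric] algebra_simps)
 qed
 show "\<exists>r::nat => nat. strict_mono r \<and>
    (\<forall>e>0. \<exists>N. \<forall>m\<ge>N. \<forall>n\<ge>N. b (%x. u (r m) x - u (r n) x) (%x. u (r m) x - u (r n) x) < e)"
  if u: "!!n::nat. u n \<in> W" and B: "!!n. b (u n) (u n) \<le> B" for u B
 proof -
  have "\<exists>C. \<forall>n. \<bar>u n (from_nat i)\<bar> \<le> C" for i
  proof -
   have "\<bar>u n (from_nat i)\<bar> \<le> sqrt (B / eps ^ CARD('d))" for n
   proof -
    have "(u n (from_nat i))^2 \<le> b (u n) (u n) / eps ^ CARD('d)" by (rule pointwise_le_b[OF u])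
    also have "... \<le> B / eps ^ CARD('d)" using B eps by (intro divide_right_mono) auto
    finally have "sqrt ((u n (from_nat i))^2) \<le> sqrt (B / eps ^ CARD('d))" by (rule real_sqrt_le_mono)
    then show ?thesis by simp
   qed
   then show ?thesis by blast
  qed
  from diagonal_convergent_subseq[of "%i n. u n (from_nat i)", OF this]
  obtain r :: "nat => nat" where r: "strict_mono r" and conv: "!!i. convergent (%n. u (r n) (from_nat i))" by blast
  define g where "g x = lim (%n. u (r n) x)" for x
  have lim: "(%n. u (r n) x) \<longlonglongrightarrow> g x" for x
   using conv[of "to_nat x"] by (simp add: g_def convergent_LIMSEQ_iff)
  have "\<exists>N. \<forall>m\<ge>N. \<forall>n\<ge>N. b (%x. u (r m) x - u (r n) x) (%x. u (r m) x - u (r n) x) < e" if e: "e > 0" for e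
  proof -
   have ed: "eps ^ CARD('d) > 0" using eps by simp
   have "convergent (%n. u (r n) x)" for x using lim by (rule convergentI)
   then have "\<exists>N. \<forall>m\<ge>N. \<forall>n\<ge>N. (\<Sum>x\<in>S. (u (r m) x - u (r n) x)^2) < e / eps ^ CARD('d)"
    using convergent_sq_sum_cauchy[of S "%x n. u (r n) x" "e / eps ^ CARD('d)"] fin_S e ed by simp
   then obtain N where N: "\<forall>m\<ge>N. \<forall>n\<ge>N. (\<Sum>x\<in>S. (u (r m) x - u (r n) x)^2) < e / eps ^ CARD('d)" by (elim exE)
   have "b (%x. u (r m) x - u (r n) x) (%x. u (r m) x - u (r n) x) < e" if "m \<ge> N" "n \<ge> N" for m n
    using N[rule_format, OF that] ed b_eq[OF W_diff[OF u u], of "r m" "r n"] by (simp add: power2_eq_square field_simps)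
   then show ?thesis by blast
  qed
  then show ?thesis using r by blast
 qed
 show "\<exists>w\<in>W. (%n. b (%x. u n x - w x) (%x. u n x - w x)) \<longlonglongrightarrow> 0 \<and>
    (%n. q (%x. u n x - w x) (%x. u n x - w x)) \<longlonglongrightarrow> 0"
  if u: "!!n::nat. u n \<in> W" and cau: "\<forall>e>0. \<exists>N. \<forall>m\<ge>N. \<forall>n\<ge>N. b (%x. u m x - u n x) (%x. u m x - u n x) < e \<and>
     q (%x. u m x - u n x) (%x. u m x - u n x) < e" for u
 proof -
  have ed: "eps ^ CARD('d) > 0" using eps by simp
  have "Cauchy (%n. u n x)" for x
  proof (rule metric_CauchyI)
   fix e :: real assume e: "e > 0"
   then have "e\<^sup>2 * eps ^ CARD('d) > 0" using ed by simp
   then obtain N where N: "!!m n. m \<ge> N ==> n \<ge> N ==> b (%x. u m x - u n x) (%x. u m x - u n x) < e\<^sup>2 * eps ^ CARD('d)"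
    using cau by blast
   have "dist (u m x) (u n x) < e" if "m \<ge> N" "n \<ge> N" for m n
   proof -
    have "(u m x - u n x)^2 \<le> b (%x. u m x - u n x) (%x. u m x - u n x) / eps ^ CARD('d)"
     by (rule pointwise_le_b[OF W_diff[OF u u]])
    also have "... < e\<^sup>2" using N[OF that] ed by (simp add: field_simps)
    finally have "\<bar>u m x - u n x\<bar>\<^sup>2 < e\<^sup>2" by simp
    then have "\<bar>u m x - u n x\<bar> < e" by (rule power2_less_imp_less) (use e in simp)
    then show ?thesis by (simp add: dist_real_def)
   qed
   then show "\<exists>M. \<forall>m\<ge>M. \<forall>n\<ge>M. dist (u m x) (u n x) < e" by blast
  qed
  then have conv: "convergent (%n. u n x)" for x by (rule Cauchy_convergent)
  define g where "g x = lim (%n. u n x)" for x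
  have lim: "(%n. u n x) \<longlonglongrightarrow> g x" for x
   using conv[of x] by (simp add: g_def convergent_LIMSEQ_iff)
  have g: "g \<in> W" unfolding W_def g_def using u by (simp add: W_def)
  have b0: "(%n. b (%x. u n x - g x) (%x. u n x - g x)) \<longlonglongrightarrow> 0"
   by (rule b_tendsto_0[OF u g lim])
  have q_le: "\<bar>q f f\<bar> \<le> (4 * real CARD('d) / eps\<^sup>2 + c0) * b f f" if "f \<in> W" for f
   using potential_le[OF that] energy_le[OF that] energy_nonneg[of eps f] eps unfolding q_diag distrib_right by linarith
  have "(%n. q (%x. u n x - g x) (%x. u n x - g x)) \<longlonglongrightarrow> 0"
  proof (rule Lim_null_comparison)
   show "\<forall>\<^sub>F n in sequentially. norm (q (%x. u n x - g x) (%x. u n x - g x)) \<le> (4 * real CARD('d) / eps\<^sup>2 + c0) * b (%x. u n x - g x) (%x. u n x - g x)"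
    using q_le[OF W_diff[OF u g]] by simp
   show "(%n. (4 * real CARD('d) / eps\<^sup>2 + c0) * b (%x. u n x - g x) (%x. u n x - g x)) \<longlonglongrightarrow> 0"
    using tendsto_mult_left[OF b0] by simp
  qed
  then show ?thesis using g b0 by blast
 qed
qed

text \<open>Summation by parts; the finite support of \<open>g\<close> leaves no boundary
  terms.\<close>

lemma q_lattice_op:
 assumes f: "f \<in> W" and g: "g \<in> W"
 shows "q f g = eps ^ CARD('d) * zsum (%x. lattice_op eps \<xi> f x * g x)"
proof -
 have gf: "fin_supp g" by (rule W_fin[OF g])
 have 1: "zsum (%x. (fdiff i f x - fdiff i f (x - axis i 1)) * g x) = - zsum (%x. fdiff i f x * fdiff i g x)" for i
 proof -
  have f1: "fin_supp (%x. fdiff i f x * g x)" "fin_supp (%x. fdiff i f (x - axis i 1) * g x)"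
    "fin_supp (%x. fdiff i f x * g (x + axis i 1))"
   using gf by (auto intro: fin_supp_mult_right fin_supp_shift)
  have "zsum (%x. (fdiff i f x - fdiff i f (x - axis i 1)) * g x) = zsum (%x. fdiff i f x * g x) - zsum (%x. fdiff i f (x - axis i 1) * g x)"
   using f1 by (simp add: left_diff_distrib zsum_diff)
  also have "zsum (%x. fdiff i f (x - axis i 1) * g x) = zsum (%x. fdiff i f x * g (x + axis i 1))"
   using zsum_shift[of "%x. fdiff i f (x - axis i 1) * g x" "axis i 1"] by simp
  also have "zsum (%x. fdiff i f x * g x) - ... = zsum (%x. fdiff i f x * g x - fdiff i f x * g (x + axis i 1))"
   using f1 by (simp add: zsum_diff)
  also have "... = zsum (%x. - 1 * (fdiff i f x * fdiff i g x))"
   by (intro arg_cong[where f=zsum] ext) (simp add: fdiff_def algebra_simps)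
  finally show ?thesis unfolding zsum_cmult by simp
 qed
 have "zsum (%x. lattice_op eps \<xi> f x * g x)
  = zsum (%x. (\<Sum>i\<in>UNIV. - (1 / eps\<^sup>2) * ((fdiff i f x - fdiff i f (x - axis i 1)) * g x)) + \<xi> x * f x * g x)"
  unfolding lattice_op_eq by (intro arg_cong[where f=zsum] ext) (simp add: sum_distrib_right sum_distrib_left sum_negf algebra_simps)
 also have "... = (\<Sum>i\<in>UNIV. - (1 / eps\<^sup>2) * zsum (%x. (fdiff i f x - fdiff i f (x - axis i 1)) * g x)) + zsum (%x. \<xi> x * f x * g x)"
 proof -
  have fs: "fin_supp (%x. - (1 / eps\<^sup>2) * ((fdiff i f x - fdiff i f (x - axis i 1)) * g x))" for i
   by (intro fin_supp_mult_right[where g = "%_. - (1 / eps\<^sup>2)"] fin_supp_mult_right[where f = g] gf)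
  have fs2: "fin_supp (%x. \<xi> x * f x * g x)" by (rule fin_supp_mult_right[OF gf])
  have fs3: "fin_supp (%x. \<Sum>i\<in>UNIV. - (1 / eps\<^sup>2) * ((fdiff i f x - fdiff i f (x - axis i 1)) * g x))"
   by (rule fin_supp_sum) (use fs in auto)
  show ?thesis unfolding zsum_add[OF fs3 fs2] by (subst zsum_sum) (use fs in \<open>simp_all only: zsum_cmult finite\<close>)
 qed
 finally show ?thesis unfolding 1 q_def by (simp add: sum_distrib_left distrib_left)
qed

lemma lattice_eigenspace_eq:
 assumes "S = lattice_domain D eps"
 shows "(%u x. id (u x)) ` lf.eigenspace \<nu> = lattice_eigenspace D eps \<xi> \<nu>"
proof -
 have "f \<in> lf.eigenspace \<nu> \<longleftrightarrow> f \<in> lattice_eigenspace D eps \<xi> \<nu>" for f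
 proof
  assume f: "f \<in> lf.eigenspace \<nu>"
  then have fW: "f \<in> W" by (simp add: lf.eigenspace_def)
  have "lattice_op eps \<xi> f x = \<nu> * f x" if x: "x \<in> S" for x
  proof -
   define g where "g y = (if y = x then 1 else 0 :: real)" for y
   have g: "g \<in> W" using x by (auto simp: W_def g_def)
   have z: "zsum (%y. h y * g y) = h x" for h
    using zsum_eq[of "{x}" "%y. h y * g y"] by (simp add: g_def)
   have "q f g = \<nu> * b f g" using f g by (auto simp: lf.eigenspace_def)
   then have "eps ^ CARD('d) * lattice_op eps \<xi> f x = \<nu> * (eps ^ CARD('d) * f x)"
    unfolding q_lattice_op[OF fW g] b_def z .
   then show ?thesis using eps by simp
  qed
  then show "f \<in> lattice_eigenspace D eps \<xi> \<nu>" using W_zero[OF fW]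
   unfolding lattice_eigenspace_def assms[symmetric] by blast
 next
  assume f: "f \<in> lattice_eigenspace D eps \<xi> \<nu>"
  then have fW: "f \<in> W" and ev: "!!x. x \<in> S ==> lattice_op eps \<xi> f x = \<nu> * f x"
   unfolding lattice_eigenspace_def W_def assms[symmetric] by blast+
  have "q f g = \<nu> * b f g" if g: "g \<in> W" for g
  proof -
   have "zsum (%x. lattice_op eps \<xi> f x * g x) = zsum (%x. \<nu> * (f x * g x))"
   proof (intro arg_cong[where f=zsum] ext)
    fix x show "lattice_op eps \<xi> f x * g x = \<nu> * (f x * g x)"
     using ev[of x] W_zero[OF g, of x] by (cases "x \<in> S") auto
   qed
   then show ?thesis unfolding q_lattice_op[OF fW g] b_def zsum_cmult by simp
  qed
  then show "f \<in> lf.eigenspace \<nu>" using fW by (simp add: lf.eigenspace_def)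
 qed
 then show ?thesis by auto
qed

lemma b_null: "u \<in> W ==> b u u = 0 ==> u x = 0"
 using pointwise_le_b[of u x] by simp

lemma lattice_eigenvalue_eq:
 assumes S: "S = lattice_domain D eps" and "lf.eigenbasis k e l" "k \<ge> 1"
 shows "lattice_eigenvalue D eps \<xi> k = l (k - 1)"
proof -
 have "linear (id :: real => real)" by (rule linear_id)
 moreover have "(%x. id (u x)) \<in> {%_. 0} \<longleftrightarrow> b u u = 0" if "u \<in> W" for u
 proof
  assume "(%x. id (u x)) \<in> {%_. 0}"
  then have "u = (%_. 0)" by simp
  then show "b u u = 0" by (simp add: b_def)
 next
  assume "b u u = 0"
  then have "u x = 0" for x by (rule b_null[OF that])
  then show "(%x. id (u x)) \<in> {%_. 0}" by simp
 qed
 ultimately show ?thesis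
  using lf.kth_eigenvalue_eq[OF assms(2,3), of id "{%_. 0}"] unfolding lattice_eigenvalue_def lattice_eigenspace_eq[OF S] by blast
qed

lemma eigenbasis_exists_card:
 assumes "card S \<ge> k"
 shows "\<exists>e l. lf.eigenbasis k e l"
proof -
 obtain y where y: "bij_betw y {..<card S} S"
  using ex_bij_betw_nat_finite[OF fin_S] by (auto simp: atLeast0LessThan)
 define \<phi> where "\<phi> i x = (if x = y i then 1 else 0 :: real)" for i :: nat and x
 have yS: "y i \<in> S" if "i < k" for i using that y assms by (auto simp: bij_betw_def)
 have inj: "y i = y j \<longleftrightarrow> i = j" if "i < k" "j < k" for i j using that y assms by (auto simp: bij_betw_def inj_on_def)
 have W: "\<phi> i \<in> W" if "i < k" for i using yS[OF that] by (auto simp: W_def \<phi>_def)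
 show ?thesis
 proof (rule lf.eigenbasis_exists[of k \<phi> k])
  show "\<phi> i \<in> W" if "i < k" for i by (rule W[OF that])
  fix c assume "b (%x. \<Sum>j<k. c j *\<^sub>R \<phi> j x) (%x. \<Sum>j<k. c j *\<^sub>R \<phi> j x) = 0"
  then have z: "(\<Sum>j<k. c j *\<^sub>R \<phi> j x) = 0" for x by (intro b_null[of "%x. \<Sum>j<k. c j *\<^sub>R \<phi> j x"] lf.sum_in W)
  show "\<forall>j<k. c j = 0"
  proof (intro allI impI)
   fix i assume i: "i < k"
   have "(\<Sum>j<k. c j *\<^sub>R \<phi> j (y i)) = (\<Sum>j<k. if j = i then c j else 0)"
    using inj i by (intro sum.cong) (auto simp: \<phi>_def)
   then show "c i = 0" using z[of "y i"] i by simp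
  qed
 qed simp
qed

end

section \<open>Separated lattice points and existence of eigenbases\<close>

context dirichlet_domain
begin

lemma bounded_D: "bounded D"
proof -
 have "norm x \<le> real CARD('d) * R" if "x \<in> D" for x
 proof -
  have "norm x \<le> (\<Sum>i\<in>UNIV. \<bar>x $ i\<bar>)" by (rule norm_le_l1_cart)
  also have "... \<le> (\<Sum>i\<in>(UNIV :: 'd set). R)" using D_bound[OF that] by (intro sum_mono) auto
  finally show ?thesis by simp
 qed
 then show ?thesis by (auto simp: bounded_iff)
qed

lemma lattice_domain_memI:
 assumes "eps < c" "!!x. (!!i. \<bar>x $ i - eps * real_of_int (y $ i)\<bar> \<le> c) ==> x \<in> D"
 shows "y \<in> lattice_domain D eps"
proof -
 \<comment> \<open>The infimum in \<open>dist_inf\<close> can be bounded below only over a nonempty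
   complement; boundedness of \<open>D\<close> provides a point outside.\<close>
 have "(\<chi> i. R + 1) \<notin> D"
 proof
  assume "(\<chi> i. R + 1) \<in> D"
  from D_bound[OF this] show False by simp
 qed
 then have ne: "- D ~= {}" by blast
 have "c \<le> dist_inf (eps *\<^sub>R lattice_point y) (- D)"
  unfolding dist_inf_def
 proof (rule cINF_greatest[OF ne])
  fix x assume "x \<in> - D"
  then obtain i where i: "\<not> \<bar>x $ i - eps * real_of_int (y $ i)\<bar> \<le> c" using assms(2)[of x] by blast
  have "\<bar>(eps *\<^sub>R lattice_point y - x) $ i\<bar> \<le> infnorm (eps *\<^sub>R lattice_point y - x)"
   by (rule component_le_infnorm_cart)
  then show "c \<le> infnorm (eps *\<^sub>R lattice_point y - x)" using i by (simp add: lattice_point_def abs_minus_commute)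
 qed
 then show ?thesis using assms(1) by (simp add: lattice_domain_def)
qed

text \<open>Indices more than \<open>4\<close> apart in some coordinate have interpolation kernels
  whose product vanishes, since each kernel reaches at most \<open>2 * eps\<close>. The same points
  bound the number of lattice points from below.\<close>

lemma many_points:
 assumes "D ~= {}"
 shows "\<exists>eps0>0. \<forall>eps. 0 < eps --> eps \<le> eps0 --> (\<exists>y :: nat => int ^ 'd. (\<forall>j<k. y j \<in> lattice_domain D eps) \<and>
  (\<forall>i<k. \<forall>j<k. i ~= j --> (\<exists>c. \<bar>y i $ c - y j $ c\<bar> > 4)))"
proof -
 obtain p where p: "p \<in> D" using assms by blast
 obtain r where r: "r > 0" "ball p r \<subseteq> D" using open_D p by (auto simp: open_contains_ball)
 define s where "s = r / (real CARD('d) + 1)"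
 have s: "s > 0" using r by (simp add: s_def add_pos_nonneg)
 have cube: "x \<in> D" if "!!i. \<bar>x $ i - p $ i\<bar> \<le> s" for x
 proof -
  have "norm (p - x) \<le> (\<Sum>i\<in>UNIV. \<bar>(p - x) $ i\<bar>)" by (rule norm_le_l1_cart)
  also have "... \<le> (\<Sum>i\<in>(UNIV :: 'd set). s)" using that by (intro sum_mono) (simp add: abs_minus_commute)
  also have "... = real CARD('d) * s" by simp
  also have "... < (real CARD('d) + 1) * s" using s by (intro mult_strict_right_mono) auto
  also have "... = r" by (simp add: s_def)
  finally show ?thesis using r(2) by (auto simp: dist_norm)
 qed
 \<comment> \<open>This leaves room for \<open>k\<close> points spaced \<open>5\<close> steps apart
   in one direction, plus the rounding of \<open>p\<close> and the cube about each point.\<close>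
 define eps0 where "eps0 = s / (5 * real k + 10)"
 have e0: "eps0 > 0" using s by (simp add: eps0_def add_nonneg_pos)
 have "\<exists>y :: nat => int ^ 'd. (\<forall>j<k. y j \<in> lattice_domain D eps) \<and>
  (\<forall>i<k. \<forall>j<k. i ~= j --> (\<exists>c. \<bar>y i $ c - y j $ c\<bar> > 4))" if eps: "0 < eps" "eps \<le> eps0" for eps
 proof -
  define c0 :: 'd where "c0 = undefined"
  define y where "y j = qfloor eps p + axis c0 (5 * int j)" for j
  have "(5 * real k + 10) * eps \<le> (5 * real k + 10) * eps0" using eps by (intro mult_left_mono) auto
  also have "... = s" by (simp add: eps0_def)
  finally have es: "(5 * real k + 10) * eps \<le> s" .
  have "y j \<in> lattice_domain D eps" if j: "j < k" for j
  proof (rule lattice_domain_memI[of _ "2 * eps"])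
   fix x assume x: "!!i. \<bar>x $ i - eps * real_of_int (y j $ i)\<bar> \<le> 2 * eps"
   show "x \<in> D"
   proof (rule cube)
    fix i
    have "\<bar>eps * real_of_int (qfloor eps p $ i) - p $ i\<bar> \<le> eps" using qfloor_bounds[OF eps(1), of p i] by linarith
    moreover have "\<bar>eps * real_of_int (y j $ i) - eps * real_of_int (qfloor eps p $ i)\<bar> \<le> 5 * real k * eps"
    proof -
     have "eps * real_of_int (y j $ i) - eps * real_of_int (qfloor eps p $ i) = (if i = c0 then 5 * real j * eps else 0)"
      by (simp add: y_def axis_def algebra_simps)
     then show ?thesis using j eps by (simp add: mult_right_mono)
    qed
    ultimately have "\<bar>x $ i - p $ i\<bar> \<le> 2 * eps + eps + 5 * real k * eps" using x[of i] by linarith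
    also have "... \<le> (5 * real k + 10) * eps" using eps by (simp add: algebra_simps)
    finally show "\<bar>x $ i - p $ i\<bar> \<le> s" using es by linarith
   qed
  qed (use eps in simp)
  moreover have "\<exists>c. \<bar>y i $ c - y j $ c\<bar> > 4" if "i ~= j" for i j
   using that by (intro exI[of _ c0]) (auto simp: y_def axis_def)
  ultimately show ?thesis by blast
 qed
 then show ?thesis using e0 by blast
qed

lemma card_lattice_domain_ge:
 assumes "D ~= {}"
 shows "\<exists>eps0>0. \<forall>eps. 0 < eps --> eps \<le> eps0 --> k \<le> card (lattice_domain D eps)"
proof -
 obtain eps0 where eps0: "eps0 > 0" and y: "!!eps. 0 < eps ==> eps \<le> eps0 ==> (\<exists>y :: nat => int ^ 'd. (\<forall>j<k. y j \<in> lattice_domain D eps) \<and>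
  (\<forall>i<k. \<forall>j<k. i ~= j --> (\<exists>c. \<bar>y i $ c - y j $ c\<bar> > 4)))" using many_points[OF assms, of k] by blast
 have "k \<le> card (lattice_domain D eps)" if eps: "0 < eps" "eps \<le> eps0" for eps
 proof -
  obtain y :: "nat => int ^ 'd" where y: "!!j. j < k ==> y j \<in> lattice_domain D eps"
   "!!i j. i < k ==> j < k ==> i ~= j ==> (\<exists>c. \<bar>y i $ c - y j $ c\<bar> > 4)" using y[OF eps] by blast
  have "inj_on y {..<k}"
  proof (rule inj_onI, rule ccontr)
   fix i j assume "i \<in> {..<k}" "j \<in> {..<k}" "y i = y j" "i ~= j"
   then show False using y(2)[of i j] by auto
  qed
  then have "k = card (y ` {..<k})" by (simp add: card_image)
  also have "... \<le> card (lattice_domain D eps)" using y(1) by (intro card_mono finite_lattice_domain[OF bounded_D eps(1)]) auto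
  finally show ?thesis .
 qed
 then show ?thesis using eps0 by blast
qed

lemma b_pair: "b (pair \<phi>) (pair \<psi>) = (LINT x|L. \<phi> x * \<psi> x)"
 by (simp add: b_def pair_def)

text \<open>Interpolation kernels centred at separated lattice points are test functions with
  vanishing mutual products and nonzero mass, hence independent modulo null functions.\<close>

lemma eigenbasis_exists_cont:
 assumes "D ~= {}"
 shows "\<exists>e l. cf.eigenbasis k e l"
proof -
 from many_points[OF assms, of k] obtain eps :: real where eps: "eps > 0" and ex: "\<forall>eps'. 0 < eps' --> eps' \<le> eps --> (\<exists>y :: nat => int ^ 'd. (\<forall>j<k. y j \<in> lattice_domain D eps') \<and>
  (\<forall>i<k. \<forall>j<k. i ~= j --> (\<exists>c. \<bar>y i $ c - y j $ c\<bar> > 4)))" by (elim exE conjE)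
 from ex[rule_format, OF eps order_refl] obtain y :: "nat => int ^ 'd" where y: "!!j. j < k ==> y j \<in> lattice_domain D eps"
   "!!i j. i < k ==> j < k ==> i ~= j ==> (\<exists>c. \<bar>y i $ c - y j $ c\<bar> > 4)" by blast
 obtain w where w: "interpolation_weights D eps w" using interpolation_weights_exist[OF bounded_D eps] by blast
 define \<phi> where "\<phi> j = w (y j)" for j
 have tf: "test_function D (\<phi> j)" if "j < k" for j
 proof -
  define f where "f z = (if z = y j then 1 else 0 :: real)" for z
  have "fin_supp f" by (rule fin_suppI[of "{y j}"]) (auto simp: f_def)
  moreover have "\<forall>z. z \<notin> lattice_domain D eps --> f z = 0" using y(1)[OF that] by (auto simp: f_def)
  ultimately have "test_function D (%x. zsum (%z. f z * w z x))" using w unfolding interpolation_weights_def by blast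
  moreover have "zsum (%z. f z * w z x) = \<phi> j x" for x
   using zsum_eq[of "{y j}" "%z. f z * w z x"] by (simp add: f_def \<phi>_def)
  ultimately show ?thesis by simp
 qed
 have W: "pair (\<phi> j) \<in> W" if "j < k" for j by (rule pair_in_W[OF tf[OF that]])
 have off: "b (pair (\<phi> i)) (pair (\<phi> j)) = 0" if ij: "i < k" "j < k" "i ~= j" for i j
 proof -
  have "\<phi> i x * \<phi> j x = 0" for x
  proof (rule ccontr)
   assume "\<phi> i x * \<phi> j x ~= 0"
   then have nz: "w (y i) x ~= 0" "w (y j) x ~= 0" by (auto simp: \<phi>_def)
   obtain c where c: "\<bar>y i $ c - y j $ c\<bar> > 4" using y(2)[OF ij] by blast
   have "\<bar>x $ c - eps * real_of_int (y i $ c)\<bar> \<le> 2 * eps" "\<bar>x $ c - eps * real_of_int (y j $ c)\<bar> \<le> 2 * eps"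
    using w nz unfolding interpolation_weights_def by blast+
   then have "\<bar>eps * real_of_int (y i $ c) - eps * real_of_int (y j $ c)\<bar> \<le> eps * 4" by linarith
   then have "eps * \<bar>real_of_int (y i $ c - y j $ c)\<bar> \<le> eps * 4" using eps by (simp add: right_diff_distrib[symmetric] abs_mult)
   then have "\<bar>real_of_int (y i $ c - y j $ c)\<bar> \<le> 4" using eps by simp
   then show False using c by linarith
  qed
  then have "(%x. \<phi> i x * \<phi> j x) = (%x. 0)" by blast
  then show ?thesis unfolding b_pair by (simp only: Bochner_Integration.integral_zero)
 qed
 have diag: "b (pair (\<phi> j)) (pair (\<phi> j)) ~= 0" if j: "j < k" for j
 proof
  interpret f: test_fun D "\<phi> j" R by (rule test_fun[OF tf[OF j]])
  assume "b (pair (\<phi> j)) (pair (\<phi> j)) = 0"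
  then have "(LBINT x. \<phi> j x * \<phi> j x) = 0"
   using sqn_lborel(1)[OF tf[OF j]] by (simp add: b_pair sqn_def power2_eq_square)
  moreover have "integrable lborel (%x. \<phi> j x * \<phi> j x)" by (rule test_fun_integrable(1)[OF test_fun[OF tf[OF j]] test_fun[OF tf[OF j]]])
  ultimately have "AE x in lborel. \<phi> j x * \<phi> j x = 0" using integral_nonneg_eq_0_iff_AE[of lborel "%x. \<phi> j x * \<phi> j x"] by simp
  then have "AE x in lborel. w (y j) x = 0" by eventually_elim (simp add: \<phi>_def)
  then have "(LBINT x. w (y j) x) = 0" by (rule integral_eq_zero_AE)
  moreover have "(LBINT x. w (y j) x) = eps ^ CARD('d)" using w unfolding interpolation_weights_def by blast
  ultimately show False using eps by simp
 qed
 show ?thesis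
 proof (rule cf.eigenbasis_exists[of k "%j. pair (\<phi> j)" k])
  show "pair (\<phi> i) \<in> W" if "i < k" for i by (rule W[OF that])
  fix c assume z: "b (%x. \<Sum>j<k. c j *\<^sub>R pair (\<phi> j) x) (%x. \<Sum>j<k. c j *\<^sub>R pair (\<phi> j) x) = 0"
  show "\<forall>j<k. c j = 0"
  proof (intro allI impI)
   fix i assume i: "i < k"
   have vW: "(%x. \<Sum>j<k. c j *\<^sub>R pair (\<phi> j) x) \<in> W" by (rule cf.sum_in) (rule W)
   have "b (%x. \<Sum>j<k. c j *\<^sub>R pair (\<phi> j) x) (pair (\<phi> i)) = 0" by (rule cf.b.null[OF vW W[OF i] z])
   moreover have "b (%x. \<Sum>j<k. c j *\<^sub>R pair (\<phi> j) x) (pair (\<phi> i)) = (\<Sum>j<k. c j * b (pair (\<phi> j)) (pair (\<phi> i)))"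
    by (rule cf.b.sum_left[OF W W[OF i]])
   moreover have "(\<Sum>j<k. c j * b (pair (\<phi> j)) (pair (\<phi> i))) = (\<Sum>j<k. if j = i then c i * b (pair (\<phi> i)) (pair (\<phi> i)) else 0)"
    using off i by (intro sum.cong) auto
   ultimately show "c i = 0" using diag[OF i] i by simp
  qed
 qed simp
qed

end

section \<open>Convergence of eigenvalues for close forms\<close>

text \<open>\<open>\<bar>c i * c j\<bar>\<close> is at most the mean of the two squares, so an
  entrywise error \<open>e\<close> costs \<open>k * e\<close> times the sum of squares.\<close>

lemma quadratic_form_perturbation:
 fixes A A' :: "nat => nat => real"
 assumes "!!i j. i < k ==> j < k ==> \<bar>A' i j - A i j\<bar> \<le> e"
 shows "(\<Sum>i<k. \<Sum>j<k. c i * c j * A i j) - real k * e * (\<Sum>i<k. (c i)^2) \<le> (\<Sum>i<k. \<Sum>j<k. c i * c j * A' i j)"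
proof -
 have "c i * c j * A i j - e * ((c i)^2 + (c j)^2) / 2 \<le> c i * c j * A' i j" if "i < k" "j < k" for i j
 proof -
  have e: "0 \<le> e" using assms[OF that] by linarith
  have "0 \<le> (\<bar>c i\<bar> - \<bar>c j\<bar>)^2" by simp
  then have "\<bar>c i * c j\<bar> \<le> ((c i)^2 + (c j)^2) / 2" by (simp add: power2_diff abs_mult)
  then have "\<bar>c i * c j\<bar> * \<bar>A' i j - A i j\<bar> \<le> ((c i)^2 + (c j)^2) / 2 * e"
   using assms[OF that] by (intro mult_mono) auto
  then have "\<bar>c i * c j * (A' i j - A i j)\<bar> \<le> e * ((c i)^2 + (c j)^2) / 2" by (simp only: abs_mult) (simp add: algebra_simps)
  then show ?thesis unfolding right_diff_distrib by linarith
 qed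
 then have "(\<Sum>i<k. \<Sum>j<k. c i * c j * A i j - e * ((c i)^2 + (c j)^2) / 2) \<le> (\<Sum>i<k. \<Sum>j<k. c i * c j * A' i j)"
  by (intro sum_mono) auto
 moreover have "(\<Sum>i<k. \<Sum>j<k. e * ((c i)^2 + (c j)^2) / 2) = real k * e * (\<Sum>i<k. (c i)^2)"
 proof -
  have "(\<Sum>i<k. \<Sum>j<k. e * ((c i)^2 + (c j)^2) / 2) = (\<Sum>i<k. \<Sum>j<k. e / 2 * (c i)^2 + e / 2 * (c j)^2)"
   by (intro sum.cong refl) (simp add: field_simps)
  also have "... = (\<Sum>i<k. real k * (e / 2) * (c i)^2 + e / 2 * (\<Sum>j<k. (c j)^2))"
   by (simp only: sum.distrib sum_distrib_left[symmetric] sum_constant card_lessThan) simp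
  also have "... = real k * (e / 2) * (\<Sum>i<k. (c i)^2) + real k * (e / 2 * (\<Sum>i<k. (c i)^2))"
   by (simp only: sum.distrib sum_distrib_left[symmetric] sum_constant card_lessThan mult.left_commute)
  also have "... = real k * e * (\<Sum>i<k. (c i)^2)"
   by (simp only: mult.assoc[symmetric] distrib_right[symmetric]) simp
  finally show ?thesis .
 qed
 ultimately show ?thesis by (simp only: sum_subtractf)
qed

lemma sum_sq_pos:
 fixes c :: "nat => real"
 assumes "\<exists>j<k. c j ~= 0" shows "0 < (\<Sum>i<k. (c i)^2)"
proof -
 obtain j where j: "j < k" "c j ~= 0" using assms by blast
 show ?thesis using j by (intro sum_pos2[of _ j]) auto
qed

context psd_form
begin

lemma abs_le_diag: "u \<in> W ==> v \<in> W ==> \<bar>a u v\<bar> \<le> a u u + a v v"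
 using a_pos[OF diff_in, of u v] a_pos[OF add_in, of u v] a_pos[of u] a_pos[of v]
 by (simp add: diff_diff add_add abs_le_iff)

lemma tendsto_both:
 assumes u: "!!n. u n \<in> W" "w \<in> W" and v: "!!n. v n \<in> W" "z \<in> W"
  and lu: "(%n. a (%x. u n x - w x) (%x. u n x - w x)) \<longlonglongrightarrow> 0"
  and lv: "(%n. a (%x. v n x - z x) (%x. v n x - z x)) \<longlonglongrightarrow> 0"
 shows "(%n. a (u n) (v n)) \<longlonglongrightarrow> a w z"
proof -
 have d: "(%x. u n x - w x) \<in> W" "(%x. v n x - z x) \<in> W" for n by (intro diff_in u v)+
 have "(%n. a (%x. u n x - w x) (%x. v n x - z x)) \<longlonglongrightarrow> 0"
 proof (rule Lim_null_comparison)
  show "\<forall>\<^sub>F n in sequentially. norm (a (%x. u n x - w x) (%x. v n x - z x)) \<le> a (%x. u n x - w x) (%x. u n x - w x) + a (%x. v n x - z x) (%x. v n x - z x)"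
   using abs_le_diag[OF d] by simp
  show "(%n. a (%x. u n x - w x) (%x. u n x - w x) + a (%x. v n x - z x) (%x. v n x - z x)) \<longlonglongrightarrow> 0"
   using tendsto_add[OF lu lv] by simp
 qed
 moreover have "(%n. a (u n) z) \<longlonglongrightarrow> a w z" by (rule tendsto_left[OF u v(2) lu])
 moreover have "(%n. a (v n) w) \<longlonglongrightarrow> a z w" by (rule tendsto_left[OF v u(2) lv])
 ultimately have "(%n. a (%x. u n x - w x) (%x. v n x - z x) + a (u n) z + a (v n) w - a w z) \<longlonglongrightarrow> 0 + a w z + a z w - a w z"
  by (intro tendsto_intros)
 moreover have "a (%x. u n x - w x) (%x. v n x - z x) + a (u n) z + a (v n) w - a w z = a (u n) (v n)" for n
  using u v d by (simp add: diff_left diff_right a_sym)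
 ultimately show ?thesis using a_sym[OF u(2) v(2)] by simp
qed

end

context dirichlet_domain
begin

lemma form_tendsto:
 assumes u: "!!n. u n \<in> W" "w \<in> W" and v: "!!n. v n \<in> W" "z \<in> W"
  and lu: "(%n. sqn L (%x. u n x - w x)) \<longlonglongrightarrow> 0"
  and lv: "(%n. sqn L (%x. v n x - z x)) \<longlonglongrightarrow> 0"
 shows "(%n. b (u n) (v n)) \<longlonglongrightarrow> b w z" "(%n. q (u n) (v n)) \<longlonglongrightarrow> q w z"
proof -
 have bl: "(%n. b (%x. u n x - w x) (%x. u n x - w x)) \<longlonglongrightarrow> 0"
  if u: "!!n. u n \<in> W" "w \<in> W" and lu: "(%n. sqn L (%x. u n x - w x)) \<longlonglongrightarrow> 0" for u w
 proof (rule Lim_null_comparison[OF _ lu])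
  show "\<forall>\<^sub>F n in sequentially. norm (b (%x. u n x - w x) (%x. u n x - w x)) \<le> sqn L (%x. u n x - w x)"
   using b_le_sqn[OF W_diff[OF u]] cf.b_pos[OF W_diff[OF u]] by simp
 qed
 have ql: "(%n. q (%x. u n x - w x) (%x. u n x - w x) + CU * b (%x. u n x - w x) (%x. u n x - w x)) \<longlonglongrightarrow> 0"
  if u: "!!n. u n \<in> W" "w \<in> W" and lu: "(%n. sqn L (%x. u n x - w x)) \<longlonglongrightarrow> 0" for u w
 proof -
  have "(%n. q (%x. u n x - w x) (%x. u n x - w x)) \<longlonglongrightarrow> 0"
  proof (rule Lim_null_comparison)
   show "\<forall>\<^sub>F n in sequentially. norm (q (%x. u n x - w x) (%x. u n x - w x)) \<le> (1 + CU) * sqn L (%x. u n x - w x)"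
    using q_le_sqn[OF W_diff[OF u]] by simp
   show "(%n. (1 + CU) * sqn L (%x. u n x - w x)) \<longlonglongrightarrow> 0" using tendsto_mult_left[OF lu, of "1 + CU"] by simp
  qed
  from tendsto_add[OF this tendsto_mult_left[OF bl[OF u lu], of CU]] show ?thesis by simp
 qed
 show 1: "(%n. b (u n) (v n)) \<longlonglongrightarrow> b w z" by (rule cf.b.tendsto_both[OF u v bl[OF u lu] bl[OF v lv]])
 have "(%n. q (u n) (v n) + CU * b (u n) (v n)) \<longlonglongrightarrow> q w z + CU * b w z"
  by (rule cf.Q.tendsto_both[OF u v ql[OF u lu] ql[OF v lv]])
 from tendsto_diff[OF this tendsto_mult_left[OF 1, of CU]] show "(%n. q (u n) (v n)) \<longlonglongrightarrow> q w z" by simp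
qed

section \<open>The locally averaged potential\<close>

definition Uz :: "real ^ 'd => real" where "Uz x = (if x \<in> D then U x else 0)"

lemma Uz_measurable: "Uz \<in> borel_measurable borel"
proof -
 have "(%x. if x \<in> D then U x else 0) \<in> borel_measurable borel"
 proof (rule borel_measurable_continuous_on_if)
  show "D \<in> sets borel" using open_D by simp
 qed (use U_cont in auto)
 then show ?thesis unfolding Uz_def[abs_def] .
qed

lemma Uz_bound: "\<bar>Uz x\<bar> \<le> CU"
 using U_bound CU by (simp add: Uz_def)

definition weight :: "real => int ^ 'd => real ^ 'd => real" where
 "weight eps = (SOME w. interpolation_weights D eps w)"

lemma weight: "eps > 0 ==> interpolation_weights D eps (weight eps)"
 unfolding weight_def using interpolation_weights_exist[OF bounded_D] by (rule someI_ex)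

lemma weight_facts:
 assumes "eps > 0"
 shows "weight eps y \<in> borel_measurable borel" "integrable lborel (weight eps y)" "(LBINT x. weight eps y x) = eps ^ CARD('d)"
  "0 \<le> weight eps y x" "weight eps y x ~= 0 ==> \<bar>x $ i - eps * real_of_int (y $ i)\<bar> \<le> 2 * eps"
 using weight[OF assms] unfolding interpolation_weights_def by blast+

text \<open>Averaging with the weights that interpolate makes the lattice potential term equal to
  the integral of \<open>Uz\<close> against the interpolated squares, so no modulus of continuity of
  \<open>U\<close> enters the lower bound.\<close>

definition Ubar :: "real => int ^ 'd => real" where
 "Ubar eps y = (LBINT x. Uz x * weight eps y x) / eps ^ CARD('d)"

lemma Uz_weight_integrable:
 assumes "eps > 0" shows "integrable lborel (%x. Uz x * weight eps y x)"
proof (rule Bochner_Integration.integrable_bound[of lborel "%x. CU * weight eps y x"])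
 show "integrable lborel (%x. CU * weight eps y x)" using weight_facts(2)[OF assms] by simp
 show "(%x. Uz x * weight eps y x) \<in> borel_measurable lborel"
  using Uz_measurable weight_facts(1)[OF assms, of y] by simp
 show "AE x in lborel. norm (Uz x * weight eps y x) \<le> norm (CU * weight eps y x)"
  using Uz_bound CU by (intro AE_I2) (auto simp: abs_mult intro!: mult_right_mono)
qed

lemma Ubar_near:
 assumes eps: "eps > 0" and near: "!!x. (!!i. \<bar>x $ i - eps * real_of_int (y $ i)\<bar> \<le> 2 * eps) ==> \<bar>Uz x - c\<bar> \<le> e"
 shows "\<bar>Ubar eps y - c\<bar> \<le> e"
proof -
 have ed: "eps ^ CARD('d) > 0" using eps by simp
 note w = weight_facts[OF eps]
 have i1: "integrable lborel (%x. c * weight eps y x)" "integrable lborel (%x. e * weight eps y x)" using w(2) by simp_all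
 have "(LBINT x. Uz x * weight eps y x - c * weight eps y x) = (Ubar eps y - c) * eps ^ CARD('d)"
  unfolding Bochner_Integration.integral_diff[OF Uz_weight_integrable[OF eps] i1(1)] Ubar_def using w(3)[of y] eps by (simp add: left_diff_distrib)
 moreover have "norm (LBINT x. Uz x * weight eps y x - c * weight eps y x) \<le> (LBINT x. e * weight eps y x)"
 proof (rule Bochner_Integration.integral_norm_bound_integral)
  show "integrable lborel (%x. Uz x * weight eps y x - c * weight eps y x)"
   using Uz_weight_integrable[OF eps, of y] i1(1) by (rule Bochner_Integration.integrable_diff)
  show "norm (Uz x * weight eps y x - c * weight eps y x) \<le> e * weight eps y x" for x
  proof (cases "weight eps y x = 0")
   case False
   have "\<bar>Uz x - c\<bar> * weight eps y x \<le> e * weight eps y x" by (intro mult_right_mono near w False)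
   moreover have "norm (Uz x * weight eps y x - c * weight eps y x) = \<bar>Uz x - c\<bar> * weight eps y x"
    using w(4)[of y x] by (simp only: left_diff_distrib[symmetric] real_norm_def abs_mult)
   ultimately show ?thesis by simp
  qed simp
 qed (rule i1(2))
 ultimately have "\<bar>Ubar eps y - c\<bar> * eps ^ CARD('d) \<le> e * eps ^ CARD('d)"
  using w(3)[of y] ed by (simp add: abs_mult)
 then show ?thesis using ed by simp
qed

lemma Ubar_bound: "eps > 0 ==> \<bar>Ubar eps y\<bar> \<le> CU"
 using Ubar_near[of eps y 0 CU] Uz_bound by simp

lemma Ubar_tendsto:
 assumes eps: "!!n. 0 < eps n" "eps \<longlonglongrightarrow> 0" and x: "x \<in> D"
 shows "(%n. Ubar (eps n) (qfloor (eps n) x)) \<longlonglongrightarrow> U x"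
proof (rule metric_LIMSEQ_I)
 fix e :: real assume e: "e > 0"
 have "isCont U x" using U_cont open_D x by (simp add: continuous_on_eq_continuous_at)
 then obtain s where s: "s > 0" "!!x'. dist x' x < s ==> dist (U x') (U x) < e / 2"
  using e unfolding continuous_at_eps_delta by (metis half_gt_zero)
 obtain r where r: "r > 0" "ball x r \<subseteq> D" using open_D x by (auto simp: open_contains_ball)
 \<comment> \<open>In each coordinate a kernel reaches \<open>2 * eps\<close> from its index and
   \<open>x\<close> lies within \<open>eps\<close> of that index; passing to the Euclidean norm
   costs the factor \<open>CARD('d)\<close>.\<close>
 define t where "t = min s r / (3 * real CARD('d))"
 have t: "t > 0" using s r by (simp add: t_def)
 have "\<forall>\<^sub>F n in sequentially. eps n < t" using order_tendstoD(2)[OF eps(2) t] .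
 then obtain N where N: "!!n. n \<ge> N ==> eps n < t" by (auto simp: eventually_sequentially)
 have "dist (Ubar (eps n) (qfloor (eps n) x)) (U x) < e" if n: "n \<ge> N" for n
 proof -
  have "\<bar>Ubar (eps n) (qfloor (eps n) x) - U x\<bar> \<le> e / 2"
  proof (rule Ubar_near[OF eps(1)])
   fix x' assume x': "!!i. \<bar>x' $ i - eps n * real_of_int (qfloor (eps n) x $ i)\<bar> \<le> 2 * eps n"
   have "\<bar>(x' - x) $ i\<bar> \<le> 3 * eps n" for i
    using x'[of i] qfloor_bounds[OF eps(1)[of n], of x i] by simp
   then have "(\<Sum>i\<in>UNIV. \<bar>(x' - x) $ i\<bar>) \<le> (\<Sum>i\<in>(UNIV :: 'd set). 3 * eps n)" by (intro sum_mono)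
   then have "norm (x' - x) \<le> real CARD('d) * (3 * eps n)" using norm_le_l1_cart[of "x' - x"] by simp
   also have "... < real CARD('d) * (3 * t)" using N[OF n] by simp
   also have "... = min s r" by (simp add: t_def)
   finally have d: "dist x' x < min s r" by (simp add: dist_norm)
   then have "x' \<in> D" using r(2) by (auto simp: dist_commute)
   then show "\<bar>Uz x' - U x\<bar> \<le> e / 2" using s(2)[of x'] d by (simp add: Uz_def dist_real_def)
  qed
  then show ?thesis using e by (simp add: dist_real_def)
 qed
 then show "\<exists>N. \<forall>n\<ge>N. dist (Ubar (eps n) (qfloor (eps n) x)) (U x) < e" by blast
qed

text \<open>The support is compact in the open set \<open>D\<close>, so for a small mesh the cube of
  half side \<open>2 * eps\<close> about each of its points stays inside \<open>D\<close>, more than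
  the lattice domain demands.\<close>

lemma sample_in_lattice_domain:
 assumes "test_function D \<phi>"
 shows "\<exists>eps0>0. \<forall>eps. 0 < eps --> eps < eps0 --> (\<forall>y. y \<notin> lattice_domain D eps --> sample eps \<phi> y = 0)"
proof -
 define T where "T = closure {x. \<phi> x ~= 0}"
 have T: "compact T" "T \<subseteq> D" using assms by (auto simp: test_function_def T_def)
 obtain e where e: "e > 0" "!!x. x \<in> T ==> ball x e \<subseteq> D"
  by (rule compact_subset_open_imp_ball_epsilon_subset[OF T(1) open_D T(2)]) blast
 define eps0 where "eps0 = e / (2 * real CARD('d))"
 have "sample eps \<phi> y = 0" if eps: "0 < eps" "eps < eps0" and y: "y \<notin> lattice_domain D eps" for eps y
 proof (rule ccontr)
  define z :: "real ^ 'd" where "z = eps *\<^sub>R lattice_point y"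
  assume "sample eps \<phi> y ~= 0"
  then have "\<phi> z ~= 0" by (simp add: sample_def z_def)
  then have "z \<in> T" unfolding T_def using closure_subset[of "{x. \<phi> x ~= 0}"] by (auto simp del: closure_subset)
  have "y \<in> lattice_domain D eps"
  proof (rule lattice_domain_memI[of _ "2 * eps"])
   fix x assume x: "!!i. \<bar>x $ i - eps * real_of_int (y $ i)\<bar> \<le> 2 * eps"
   have "\<bar>(x - z) $ i\<bar> \<le> 2 * eps" for i using x[of i] by (simp add: z_def lattice_point_def)
   then have "(\<Sum>i\<in>UNIV. \<bar>(x - z) $ i\<bar>) \<le> (\<Sum>i\<in>(UNIV :: 'd set). 2 * eps)" by (intro sum_mono)
   then have "norm (x - z) \<le> real CARD('d) * (2 * eps)" using norm_le_l1_cart[of "x - z"] by simp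
   also have "... < real CARD('d) * (2 * eps0)" using eps by simp
   also have "... = e" by (simp add: eps0_def)
   finally have "x \<in> ball z e" by (simp add: dist_norm norm_minus_commute)
   then show "x \<in> D" using e(2)[OF \<open>z \<in> T\<close>] by blast
  qed (use eps in simp)
  with y show False by blast
 qed
 moreover have "eps0 > 0" using e by (simp add: eps0_def)
 ultimately show ?thesis by blast
qed

lemma pair_integral:
 assumes "test_function D \<phi>" "test_function D \<psi>"
 shows "b (pair \<phi>) (pair \<psi>) = (LBINT x. \<phi> x * \<psi> x)"
  "q (pair \<phi>) (pair \<psi>) = (\<Sum>i\<in>UNIV. \<integral>x. grad \<phi> x $ i * grad \<psi> x $ i \<partial>lborel) + (LBINT x. Uz x * \<phi> x * \<psi> x)"
  "integrable lborel (%x. Uz x * \<phi> x * \<psi> x)"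
proof -
 interpret f: test_fun D \<phi> R by (rule test_fun[OF assms(1)])
 interpret g: test_fun D \<psi> R by (rule test_fun[OF assms(2)])
 note m[measurable] = f.measurable_phi g.measurable_phi f.measurable_grad_nth g.measurable_grad_nth Uz_measurable
 note int = test_fun_integrable[OF f.test_fun_axioms g.test_fun_axioms]
 show "b (pair \<phi>) (pair \<psi>) = (LBINT x. \<phi> x * \<psi> x)"
  unfolding b_pair by (rule lebesgue_on_lborel(2)[OF open_D]) (use m f.outside_D in auto)
 show iU: "integrable lborel (%x. Uz x * \<phi> x * \<psi> x)"
 proof (rule Bochner_Integration.integrable_bound[of lborel "%x. CU * (\<phi> x * \<psi> x)"])
  show "integrable lborel (%x. CU * (\<phi> x * \<psi> x))" using int(1) by simp
  show "(%x. Uz x * \<phi> x * \<psi> x) \<in> borel_measurable lborel" using m by simp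
  show "AE x in lborel. norm (Uz x * \<phi> x * \<psi> x) \<le> norm (CU * (\<phi> x * \<psi> x))"
   using Uz_bound CU by (intro AE_I2) (auto simp: abs_mult mult.assoc intro!: mult_right_mono)
 qed
 have "q (pair \<phi>) (pair \<psi>) = (LINT x|L. (\<Sum>i\<in>UNIV. grad \<phi> x $ i * grad \<psi> x $ i) + Uz x * \<phi> x * \<psi> x)"
  unfolding q_def by (intro Bochner_Integration.integral_cong refl) (simp add: pair_def inner_vec_def Uz_def)
 also have "... = (LBINT x. (\<Sum>i\<in>UNIV. grad \<phi> x $ i * grad \<psi> x $ i) + Uz x * \<phi> x * \<psi> x)"
  by (rule lebesgue_on_lborel(2)[OF open_D]) (use m f.outside_D in auto)
 also have "... = (\<Sum>i\<in>UNIV. \<integral>x. grad \<phi> x $ i * grad \<psi> x $ i \<partial>lborel) + (LBINT x. Uz x * \<phi> x * \<psi> x)"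
  using int(2) iU by simp
 finally show "q (pair \<phi>) (pair \<psi>) = (\<Sum>i\<in>UNIV. \<integral>x. grad \<phi> x $ i * grad \<psi> x $ i \<partial>lborel) + (LBINT x. Uz x * \<phi> x * \<psi> x)" .
qed

lemma potential_sample_tendsto:
 assumes "test_function D \<phi>" "test_function D \<psi>" and eps: "!!n. 0 < eps n" "!!n. eps n \<le> 1" "eps \<longlonglongrightarrow> 0"
 shows "(%n. eps n ^ CARD('d) * zsum (%y. Ubar (eps n) y * sample (eps n) \<phi> y * sample (eps n) \<psi> y)) \<longlonglongrightarrow> (LBINT x. Uz x * \<phi> x * \<psi> x)"
proof -
 interpret f: test_fun D \<phi> R by (rule test_fun[OF assms(1)])
 interpret g: test_fun D \<psi> R by (rule test_fun[OF assms(2)])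
 obtain B where B: "!!x. \<bar>\<phi> x\<bar> \<le> B" using f.bounded_exists by blast
 obtain B' where B': "!!x. \<bar>\<psi> x\<bar> \<le> B'" using g.bounded_exists by blast
 have B0: "0 \<le> B" "0 \<le> B'" using B[of 0] B'[of 0] by linarith+
 show ?thesis
 proof (rule lattice_riemann_sum(2)[where eps = eps and R = R and B = "CU * B * B'"])
  show "(%x. Uz x * \<phi> x * \<psi> x) \<in> borel_measurable borel"
   using Uz_measurable f.measurable_phi g.measurable_phi by simp
  show "\<bar>eps n * real_of_int (y $ i)\<bar> \<le> R" if "Ubar (eps n) y * sample (eps n) \<phi> y * sample (eps n) \<psi> y ~= 0" for n y i
   using that by (intro f.sample_supp) auto
  show "\<bar>Ubar (eps n) y * sample (eps n) \<phi> y * sample (eps n) \<psi> y\<bar> \<le> CU * B * B'" for n y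
   unfolding abs_mult sample_def using Ubar_bound[OF eps(1)] B B' CU B0 by (intro mult_mono) auto
  have "(%n. Ubar (eps n) (qfloor (eps n) x) * sample (eps n) \<phi> (qfloor (eps n) x) * sample (eps n) \<psi> (qfloor (eps n) x)) \<longlonglongrightarrow> Uz x * \<phi> x * \<psi> x" for x
  proof (cases "x \<in> D")
   case True
   then show ?thesis
    using Ubar_tendsto[OF eps(1,3) True] f.sample_tendsto[OF eps(1,3), of x] g.sample_tendsto[OF eps(1,3), of x]
    by (simp add: Uz_def tendsto_mult)
  next
   case False
   \<comment> \<open>Outside \<open>D\<close> the averages \<open>Ubar\<close> need not converge,
     but they are bounded and the samples of \<open>\<phi>\<close> tend to zero.\<close>
   have z: "(%n. CU * B' * \<bar>sample (eps n) \<phi> (qfloor (eps n) x)\<bar>) \<longlonglongrightarrow> 0"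
    using tendsto_mult_left[OF tendsto_rabs[OF f.sample_tendsto[OF eps(1,3), of x]], of "CU * B'"] f.outside_D(1)[OF False] by simp
   have "(%n. Ubar (eps n) (qfloor (eps n) x) * sample (eps n) \<phi> (qfloor (eps n) x) * sample (eps n) \<psi> (qfloor (eps n) x)) \<longlonglongrightarrow> 0"
   proof (rule Lim_null_comparison[OF _ z], rule always_eventually, rule allI)
    fix n
    have "\<bar>Ubar (eps n) (qfloor (eps n) x)\<bar> * \<bar>sample (eps n) \<psi> (qfloor (eps n) x)\<bar> * \<bar>sample (eps n) \<phi> (qfloor (eps n) x)\<bar> \<le> CU * B' * \<bar>sample (eps n) \<phi> (qfloor (eps n) x)\<bar>"
     using Ubar_bound[OF eps(1)] B' CU B0 by (intro mult_right_mono mult_mono) (auto simp: sample_def)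
    then show "norm (Ubar (eps n) (qfloor (eps n) x) * sample (eps n) \<phi> (qfloor (eps n) x) * sample (eps n) \<psi> (qfloor (eps n) x)) \<le> CU * B' * \<bar>sample (eps n) \<phi> (qfloor (eps n) x)\<bar>"
     by (simp add: abs_mult mult_ac)
   qed
   then show ?thesis using f.outside_D(1)[OF False] by simp
  qed
  then show "AE x in lborel. (%n. Ubar (eps n) (qfloor (eps n) x) * sample (eps n) \<phi> (qfloor (eps n) x) * sample (eps n) \<psi> (qfloor (eps n) x)) \<longlonglongrightarrow> Uz x * \<phi> x * \<psi> x"
   by simp
 qed (use eps in auto)
qed

lemma form_sample_tendsto:
 assumes "test_function D \<phi>" "test_function D \<psi>" and eps: "!!n. 0 < eps n" "!!n. eps n \<le> 1" "eps \<longlonglongrightarrow> 0"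
 shows "(%n. lattice_form.b (eps n) (sample (eps n) \<phi>) (sample (eps n) \<psi>)) \<longlonglongrightarrow> b (pair \<phi>) (pair \<psi>)"
  "(%n. lattice_form.q (eps n) (Ubar (eps n)) (sample (eps n) \<phi>) (sample (eps n) \<psi>)) \<longlonglongrightarrow> q (pair \<phi>) (pair \<psi>)"
proof -
 \<comment> \<open>The forms \<open>b\<close> and \<open>q\<close> do not depend on the point set of
   the locale, so the empty set serves to unfold them.\<close>
 have lf: "lattice_form {} (eps n)" for n using eps(1) by unfold_locales auto
 note sl = sample_limits[OF test_fun[OF assms(1)] test_fun[OF assms(2)] eps]
 show "(%n. lattice_form.b (eps n) (sample (eps n) \<phi>) (sample (eps n) \<psi>)) \<longlonglongrightarrow> b (pair \<phi>) (pair \<psi>)"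
  unfolding pair_integral(1)[OF assms(1,2)] lattice_form.b_def[OF lf] by (rule sl(1))
 have "(%n. (\<Sum>i\<in>UNIV. eps n ^ CARD('d) / (eps n)^2 * zsum (%y. fdiff i (sample (eps n) \<phi>) y * fdiff i (sample (eps n) \<psi>) y))
   + eps n ^ CARD('d) * zsum (%y. Ubar (eps n) y * sample (eps n) \<phi> y * sample (eps n) \<psi> y))
   \<longlonglongrightarrow> (\<Sum>i\<in>UNIV. \<integral>x. grad \<phi> x $ i * grad \<psi> x $ i \<partial>lborel) + (LBINT x. Uz x * \<phi> x * \<psi> x)"
  by (intro tendsto_add tendsto_sum sl(2) potential_sample_tendsto assms)
 then show "(%n. lattice_form.q (eps n) (Ubar (eps n)) (sample (eps n) \<phi>) (sample (eps n) \<psi>)) \<longlonglongrightarrow> q (pair \<phi>) (pair \<psi>)"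
  unfolding pair_integral(2)[OF assms(1,2)] lattice_form.q_def[OF lf] by (simp only: sum_distrib_left)
qed

end

section \<open>Comparison of lattice and Dirichlet eigenvalues\<close>

context dirichlet_domain
begin

text \<open>A relative form bound for the difference to the averaged potential. It is the only
  property of the random potential that the spectral comparison uses.\<close>

definition form_close :: "real => real => (int ^ 'd => real) => bool" where
 "form_close \<kappa> eps \<xi> \<longleftrightarrow> (\<forall>f. (\<forall>y. y \<notin> lattice_domain D eps --> f y = 0) -->
   \<bar>eps ^ CARD('d) * zsum (%y. (\<xi> y - Ubar eps y) * (f y)^2)\<bar> \<le> \<kappa> * (energy eps f + mass eps f))"

text \<open>For the eigenfunctions the matrix of \<open>\<mu>\<close> times \<open>b\<close> minus
  \<open>q\<close> is diagonal with entries at least \<open>\<mu> - l (k - 1)\<close>; test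
  functions close to them perturb its entries by an arbitrarily small amount.\<close>

lemma test_matrix_positive:
 assumes el: "cf.eigenbasis k e l" and \<mu>: "\<mu> > l (k - 1)"
 shows "\<exists>\<phi> \<sigma>. (\<forall>i<k. test_function D (\<phi> i)) \<and> \<sigma> > 0 \<and>
  (\<forall>c. \<sigma> * (\<Sum>i<k. (c i)^2) \<le> (\<Sum>i<k. \<Sum>j<k. c i * c j * (\<mu> * b (pair (\<phi> i)) (pair (\<phi> j)) - q (pair (\<phi> i)) (pair (\<phi> j)))))"
proof -
 have eW: "e i \<in> W" if "i < k" for i using el that by (simp add: cf.eigenbasis_def)
 have "\<exists>\<phi>. \<forall>n::nat. test_function D (\<phi> n) \<and> sqn L (%x. pair (\<phi> n) x - e i x) < inverse (real (Suc n))" if "i < k" for i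
 proof (rule choice, rule allI)
  show "\<exists>\<phi>. test_function D \<phi> \<and> sqn L (%x. pair \<phi> x - e i x) < inverse (real (Suc n))" for n :: nat
   by (rule W_approx[OF eW[OF that]]) simp
 qed
 then have "\<forall>i. \<exists>\<phi>. i < k --> (\<forall>n::nat. test_function D (\<phi> n) \<and> sqn L (%x. pair (\<phi> n) x - e i x) < inverse (real (Suc n)))" by blast
 from choice[OF this] obtain \<Phi> :: "nat => nat => real ^ 'd => real" where
  \<Phi>: "!!i n. i < k ==> test_function D (\<Phi> i n)" "!!i n. i < k ==> sqn L (%x. pair (\<Phi> i n) x - e i x) < inverse (real (Suc n))" by blast
 have lim: "(%n. sqn L (%x. pair (\<Phi> i n) x - e i x)) \<longlonglongrightarrow> 0" if "i < k" for i
  by (rule sqn_null_comparison[OF less_imp_le[OF \<Phi>(2)[OF that]] LIMSEQ_inverse_real_of_nat])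
 define A where "A i j = \<mu> * b (e i) (e j) - q (e i) (e j)" for i j
 define A' where "A' n i j = \<mu> * b (pair (\<Phi> i n)) (pair (\<Phi> j n)) - q (pair (\<Phi> i n)) (pair (\<Phi> j n))" for n i j
 define \<sigma> where "\<sigma> = \<mu> - l (k - 1)"
 \<comment> \<open>An entrywise error \<open>\<eta>\<close> costs at most half of
   \<open>\<sigma>\<close> in the quadratic form.\<close>
 define \<eta> where "\<eta> = \<sigma> / (2 * (real k + 1))"
 have \<sigma>: "\<sigma> > 0" "\<eta> > 0" using \<mu> by (auto simp: \<sigma>_def \<eta>_def)
 have conv: "(%n. A' n i j) \<longlonglongrightarrow> A i j" if "i < k" "j < k" for i j
  unfolding A_def A'_def using that \<Phi>(1) eW lim by (intro tendsto_intros form_tendsto pair_in_W) auto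
 have "\<forall>\<^sub>F n in sequentially. \<forall>i\<in>{..<k}. \<forall>j\<in>{..<k}. \<bar>A' n i j - A i j\<bar> \<le> \<eta>"
 proof (intro eventually_ball_finite ballI finite_lessThan)
  fix i j assume "i \<in> {..<k}" "j \<in> {..<k}"
  then have "(%n. A' n i j) \<longlonglongrightarrow> A i j" by (intro conv) auto
  from tendstoD[OF this \<sigma>(2)] show "\<forall>\<^sub>F n in sequentially. \<bar>A' n i j - A i j\<bar> \<le> \<eta>"
   by (rule eventually_mono) (simp add: dist_real_def)
 qed
 then obtain n where n: "!!i j. i < k ==> j < k ==> \<bar>A' n i j - A i j\<bar> \<le> \<eta>"
  unfolding eventually_sequentially by blast
 have "\<sigma> / 2 * (\<Sum>i<k. (c i)^2) \<le> (\<Sum>i<k. \<Sum>j<k. c i * c j * A' n i j)" for c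
 proof -
  have Aeq: "A i j = (if i = j then \<mu> - l i else 0)" if "i < k" "j < k" for i j
   using el that eW unfolding A_def cf.eigenbasis_def by auto
  have "(\<Sum>i<k. \<Sum>j<k. c i * c j * A i j) = (\<Sum>i<k. (c i)^2 * (\<mu> - l i))"
   by (intro sum.cong refl) (simp add: Aeq if_distrib power2_eq_square cong: if_cong)
  also have "... \<ge> (\<Sum>i<k. \<sigma> * (c i)^2)"
  proof (rule sum_mono)
   fix i assume i: "i \<in> {..<k}"
   then have "l i \<le> l (k - 1)" by (intro cf.eigenbasis_mono[OF el]) auto
   then have "\<sigma> * (c i)^2 \<le> (\<mu> - l i) * (c i)^2" unfolding \<sigma>_def by (intro mult_right_mono) auto
   then show "\<sigma> * (c i)^2 \<le> (c i)^2 * (\<mu> - l i)" by (simp add: mult.commute)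
  qed
  finally have 1: "\<sigma> * (\<Sum>i<k. (c i)^2) \<le> (\<Sum>i<k. \<Sum>j<k. c i * c j * A i j)" by (simp add: sum_distrib_left)
  have "real k * \<eta> \<le> \<sigma> / 2" using \<sigma> by (simp add: \<eta>_def field_simps)
  then have "real k * \<eta> * (\<Sum>i<k. (c i)^2) \<le> \<sigma> / 2 * (\<Sum>i<k. (c i)^2)" by (intro mult_right_mono sum_nonneg) auto
  then show ?thesis using quadratic_form_perturbation[of k "A' n" A \<eta> c, OF n] 1 by linarith
 qed
 then show ?thesis using \<Phi>(1) \<sigma> unfolding A'_def
  by (intro exI[of _ "%i. \<Phi> i n"] exI[of _ "\<sigma> / 2"]) auto
qed

lemma form_le_Ubar_form:
 assumes eps: "eps > 0" and f: "\<forall>y. y \<notin> lattice_domain D eps --> f y = 0" and cl: "form_close \<kappa> eps \<xi>"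
 defines "u \<equiv> eps ^ CARD('d) * zsum (%y. Ubar eps y * (f y)^2)"
  and "v \<equiv> eps ^ CARD('d) * zsum (%y. \<xi> y * (f y)^2)"
 shows "\<bar>v - u\<bar> \<le> \<kappa> * (energy eps f + mass eps f)" "\<bar>u\<bar> \<le> CU * mass eps f"
proof -
 have ff: "fin_supp f" using f by (intro fin_suppI[OF finite_lattice_domain[OF bounded_D eps]]) auto
 then have f2: "fin_supp (%y. (f y)^2)" by (rule fin_supp_sq)
 have fs: "fin_supp (%y. \<zeta> y * (f y)^2)" for \<zeta> by (rule fin_supp_mult_right[OF f2])
 have "v - u = eps ^ CARD('d) * zsum (%y. (\<xi> y - Ubar eps y) * (f y)^2)"
  unfolding u_def v_def left_diff_distrib zsum_diff[OF fs fs] by (simp add: algebra_simps)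
 then show "\<bar>v - u\<bar> \<le> \<kappa> * (energy eps f + mass eps f)" using cl f unfolding form_close_def by simp
 have "\<bar>zsum (%y. Ubar eps y * (f y)^2)\<bar> \<le> zsum (%y. \<bar>Ubar eps y * (f y)^2\<bar>)" by (rule zsum_abs[OF fs])
 also have "... \<le> zsum (%y. CU * (f y)^2)"
 proof (rule zsum_mono)
  show "fin_supp (%y. \<bar>Ubar eps y * (f y)^2\<bar>)" by (rule fin_supp_comp0[OF fs]) simp
  show "fin_supp (%y. CU * (f y)^2)" by (rule fs)
  show "\<bar>Ubar eps y * (f y)^2\<bar> \<le> CU * (f y)^2" for y using Ubar_bound[OF eps, of y] by (simp add: abs_mult mult_right_mono)
 qed
 finally have "eps ^ CARD('d) * \<bar>zsum (%y. Ubar eps y * (f y)^2)\<bar> \<le> eps ^ CARD('d) * (CU * zsum (%y. (f y)^2))"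
  unfolding zsum_cmult using eps by (intro mult_left_mono) auto
 then show "\<bar>u\<bar> \<le> CU * mass eps f" using eps by (simp add: u_def mass_def abs_mult mult_ac)
qed

text \<open>Sampled test functions form the trial family. Since the energy is at most the averaged
  form plus \<open>CU\<close> times the mass, closeness bounds the form of \<open>\<xi> n\<close> by
  \<open>1 + \<kappa> n\<close> times the averaged form plus \<open>\<kappa> n * (1 + CU)\<close>
  times the mass; the matrix \<open>A'\<close> encodes this comparison and converges to
  \<open>A\<close>.\<close>

lemma eigenvalue_upper:
 assumes ne: "D ~= {}" and k: "k \<ge> 1" and eps: "!!n. 0 < eps n" "!!n. eps n \<le> 1" "eps \<longlonglongrightarrow> 0"
  and \<kappa>: "\<kappa> \<longlonglongrightarrow> 0" "!!n. 0 \<le> \<kappa> n" and cl: "!!n. form_close (\<kappa> n) (eps n) (\<xi> n)" and \<mu>: "\<mu> > dirichlet_eigenvalue D U k"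
 shows "\<forall>\<^sub>F n in sequentially. lattice_eigenvalue D (eps n) (\<xi> n) k < \<mu>"
proof -
 obtain e l where el: "cf.eigenbasis k e l" using eigenbasis_exists_cont[OF ne] by blast
 have "\<mu> > l (k - 1)" using \<mu> unfolding dirichlet_eigenvalue_eq[OF el k] .
 from test_matrix_positive[OF el this] obtain \<phi> \<sigma> where \<phi>: "!!i. i < k ==> test_function D (\<phi> i)" and \<sigma>: "\<sigma> > 0" and
  pos: "!!c. \<sigma> * (\<Sum>i<k. (c i)^2) \<le> (\<Sum>i<k. \<Sum>j<k. c i * c j * (\<mu> * b (pair (\<phi> i)) (pair (\<phi> j)) - q (pair (\<phi> i)) (pair (\<phi> j))))"
  by blast
 define A where "A i j = \<mu> * b (pair (\<phi> i)) (pair (\<phi> j)) - q (pair (\<phi> i)) (pair (\<phi> j))" for i j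
 define s where "s n i = sample (eps n) (\<phi> i)" for n i
 define A' where "A' n i j = (\<mu> - \<kappa> n * (1 + CU)) * lattice_form.b (eps n) (s n i) (s n j) - (1 + \<kappa> n) * lattice_form.q (eps n) (Ubar (eps n)) (s n i) (s n j)" for n i j
 define \<eta> where "\<eta> = \<sigma> / (2 * (real k + 1))"
 have \<eta>: "\<eta> > 0" using \<sigma> by (auto simp: \<eta>_def)
 have conv: "(%n. A' n i j) \<longlonglongrightarrow> A i j" if "i < k" "j < k" for i j
 proof -
  have "(%n. A' n i j) \<longlonglongrightarrow> (\<mu> - 0 * (1 + CU)) * b (pair (\<phi> i)) (pair (\<phi> j)) - (1 + 0) * q (pair (\<phi> i)) (pair (\<phi> j))"
   unfolding A'_def s_def by (intro tendsto_intros \<kappa> form_sample_tendsto \<phi> eps that)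
  then show ?thesis by (simp add: A_def)
 qed
 have ev1: "\<forall>\<^sub>F n in sequentially. \<forall>i\<in>{..<k}. \<forall>j\<in>{..<k}. \<bar>A' n i j - A i j\<bar> \<le> \<eta>"
 proof (intro eventually_ball_finite ballI finite_lessThan)
  fix i j assume "i \<in> {..<k}" "j \<in> {..<k}"
  then have "(%n. A' n i j) \<longlonglongrightarrow> A i j" by (intro conv) auto
  from tendstoD[OF this \<eta>] show "\<forall>\<^sub>F n in sequentially. \<bar>A' n i j - A i j\<bar> \<le> \<eta>"
   by (rule eventually_mono) (simp add: dist_real_def)
 qed
 have ev2: "\<forall>\<^sub>F n in sequentially. \<forall>i\<in>{..<k}. \<forall>y. y \<notin> lattice_domain D (eps n) --> s n i y = 0"
 proof (intro eventually_ball_finite ballI finite_lessThan)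
  fix i assume "i \<in> {..<k}"
  then have "test_function D (\<phi> i)" by (intro \<phi>) auto
  from sample_in_lattice_domain[OF this] obtain eps0 where "eps0 > 0" and
   *: "!!eps. 0 < eps ==> eps < eps0 ==> (\<forall>y. y \<notin> lattice_domain D eps --> sample eps (\<phi> i) y = 0)" by blast
  have "\<forall>\<^sub>F n in sequentially. eps n < eps0" using order_tendstoD(2)[OF eps(3) \<open>eps0 > 0\<close>] .
  then show "\<forall>\<^sub>F n in sequentially. \<forall>y. y \<notin> lattice_domain D (eps n) --> s n i y = 0"
   unfolding s_def by (rule eventually_mono) (rule *[OF eps(1)])
 qed
 obtain eps1 where "eps1 > 0" and card: "!!eps. 0 < eps ==> eps \<le> eps1 ==> k \<le> card (lattice_domain D eps)"
  using card_lattice_domain_ge[OF ne, of k] by blast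
 have ev3: "\<forall>\<^sub>F n in sequentially. eps n < eps1" using order_tendstoD(2)[OF eps(3) \<open>eps1 > 0\<close>] .
 show ?thesis using ev1 ev2 ev3
 proof eventually_elim
  case (elim n)
  define S where "S = lattice_domain D (eps n)"
  have finS: "finite S" unfolding S_def by (rule finite_lattice_domain[OF bounded_D eps(1)])
  interpret X: lattice_form S "eps n" "\<xi> n" using finS eps(1) by unfold_locales auto
  interpret Z: lattice_form S "eps n" "Ubar (eps n)" using finS eps(1) by unfold_locales auto
  obtain e' l' where el': "X.lf.eigenbasis k e' l'" using X.eigenbasis_exists_card card[of "eps n"] eps(1)[of n] elim(3) unfolding S_def by force
  have sW: "s n i \<in> X.W" if "i < k" for i unfolding X.W_def using elim(2) that by (simp add: S_def)
  have "l' (k - 1) < \<mu>"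
  proof (rule X.lf.kth_le_test[OF el' k sW])
   fix c :: "nat => real" assume c: "\<exists>j<k. c j ~= 0"
   define f where "f = (%x. \<Sum>j<k. c j *\<^sub>R s n j x)"
   have f: "f \<in> X.W" unfolding f_def by (rule X.lf.sum_in[OF sW])
   then have f0: "\<forall>y. y \<notin> lattice_domain D (eps n) --> f y = 0" unfolding X.W_def by (simp add: S_def)
   note cmp = form_le_Ubar_form[OF eps(1) f0 cl]
   have "X.q f f \<le> Z.q f f + \<kappa> n * (energy (eps n) f + mass (eps n) f)"
    unfolding X.q_diag Z.q_diag using cmp(1) by linarith
   moreover have "energy (eps n) f \<le> Z.q f f + CU * mass (eps n) f" unfolding Z.q_diag using cmp(2) by linarith
   then have "\<kappa> n * (energy (eps n) f + mass (eps n) f) \<le> \<kappa> n * (Z.q f f + CU * mass (eps n) f + mass (eps n) f)"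
    using \<kappa>(2) by (intro mult_left_mono) auto
   ultimately have "X.q f f \<le> (1 + \<kappa> n) * Z.q f f + \<kappa> n * (1 + CU) * X.b f f"
    unfolding X.b_diag by (simp add: algebra_simps)
   moreover have "(\<mu> - \<kappa> n * (1 + CU)) * X.b f f - (1 + \<kappa> n) * Z.q f f = (\<Sum>i<k. \<Sum>j<k. c i * c j * A' n i j)"
   proof -
    have b: "X.b f f = (\<Sum>i<k. \<Sum>j<k. c i * c j * X.b (s n i) (s n j))" unfolding f_def by (rule X.lf.b.sum_sum[OF sW])
    have q: "Z.q f f = (\<Sum>i<k. \<Sum>j<k. c i * c j * Z.q (s n i) (s n j))" unfolding f_def by (rule Z.lf.q.sum_sum[OF sW])
    show ?thesis unfolding b q A'_def sum_distrib_left sum_subtractf[symmetric]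
     by (intro sum.cong refl) (simp add: algebra_simps)
   qed
   moreover have "0 < (\<Sum>i<k. \<Sum>j<k. c i * c j * A' n i j)"
   proof -
    have c2: "0 < (\<Sum>i<k. (c i)^2)" by (rule sum_sq_pos[OF c])
    have "real k * \<eta> < \<sigma>" using \<sigma> by (simp add: \<eta>_def field_simps add_nonneg_pos)
    then have "real k * \<eta> * (\<Sum>i<k. (c i)^2) < \<sigma> * (\<Sum>i<k. (c i)^2)" using c2 by (rule mult_strict_right_mono)
    then show ?thesis using quadratic_form_perturbation[of k "A' n" A \<eta> c] elim(1) pos[of c] unfolding A_def[symmetric] by fastforce
   qed
   ultimately have "X.q f f < \<mu> * X.b f f" by (simp add: algebra_simps)
   then show "X.q (%x. \<Sum>j<k. c j *\<^sub>R s n j x) (%x. \<Sum>j<k. c j *\<^sub>R s n j x) < \<mu> * X.b (%x. \<Sum>j<k. c j *\<^sub>R s n j x) (%x. \<Sum>j<k. c j *\<^sub>R s n j x)"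
    unfolding f_def .
  qed
  then show ?case unfolding X.lattice_eigenvalue_eq[OF S_def el' k] .
 qed
qed

text \<open>\<open>I\<close> is the variance error of the interpolation. It enters the mass once and
  the potential with the factor \<open>CU\<close>, while the gradient part carries no error.\<close>

lemma interpolate:
 assumes eps: "eps > 0" and f: "\<forall>y. y \<notin> lattice_domain D eps --> f y = 0"
 defines "P \<equiv> (%x. zsum (%y. f y * weight eps y x))" and "I \<equiv> interp_const TYPE('d) * eps\<^sup>2 * energy eps f"
 shows "test_function D P" "\<bar>mass eps f - b (pair P) (pair P)\<bar> \<le> I"
  "q (pair P) (pair P) \<le> energy eps f + eps ^ CARD('d) * zsum (%y. Ubar eps y * (f y)^2) + CU * I"
proof -
 have ff: "fin_supp f" using f by (intro fin_suppI[OF finite_lattice_domain[OF bounded_D eps]]) auto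
 note w = weight[OF eps, unfolded interpolation_weights_def]
 show P: "test_function D P" unfolding P_def using w ff f by blast
 interpret p: test_fun D P R by (rule test_fun[OF P])
 have ed: "eps ^ CARD('d) > 0" using eps by simp
 have E: "(LBINT x. (norm (grad P x))^2) \<le> energy eps f" unfolding P_def using w ff by blast
 have pot: "\<bar>zsum (%y. (f y)^2 * (LBINT x. u x * weight eps y x)) - (LBINT x. u x * (P x)^2)\<bar>
    \<le> C * interp_const TYPE('d) * eps\<^sup>2 * energy eps f" if "u \<in> borel_measurable borel" "\<forall>x. \<bar>u x\<bar> \<le> C" for u C
  unfolding P_def using w ff that by blast
 have "mass eps f = zsum (%y. (f y)^2 * (LBINT x. 1 * weight eps y x))"
  unfolding mass_def mult_1 weight_facts(3)[OF eps] zsum_mult_right by (rule mult.commute)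
 then show "\<bar>mass eps f - b (pair P) (pair P)\<bar> \<le> I"
  using pot[of "%_. 1" 1] unfolding pair_integral(1)[OF P P] I_def by (simp add: power2_eq_square)
 have "eps ^ CARD('d) * zsum (%y. Ubar eps y * (f y)^2) = zsum (%y. (f y)^2 * (LBINT x. Uz x * weight eps y x))"
  unfolding zsum_cmult[symmetric] Ubar_def using eps by (intro arg_cong[where f=zsum] ext) simp
 then have "(LBINT x. Uz x * (P x)^2) \<le> eps ^ CARD('d) * zsum (%y. Ubar eps y * (f y)^2) + CU * I"
  using pot[of Uz CU] Uz_measurable Uz_bound unfolding I_def by (simp add: mult.assoc)
 moreover have "q (pair P) (pair P) = (LBINT x. (norm (grad P x))^2) + (LBINT x. Uz x * (P x)^2)"
 proof -
  have "(\<Sum>i\<in>UNIV. \<integral>x. grad P x $ i * grad P x $ i \<partial>lborel) = (LBINT x. (\<Sum>i\<in>UNIV. grad P x $ i * grad P x $ i))"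
   using test_fun_integrable(2)[OF p.test_fun_axioms p.test_fun_axioms] by simp
  also have "... = (LBINT x. (norm (grad P x))^2)"
   by (intro Bochner_Integration.integral_cong refl) (simp add: power2_norm_eq_inner inner_vec_def)
  finally show ?thesis unfolding pair_integral(2)[OF P P] by (simp add: power2_eq_square mult.assoc)
 qed
 ultimately show "q (pair P) (pair P) \<le> energy eps f + eps ^ CARD('d) * zsum (%y. Ubar eps y * (f y)^2) + CU * I"
  using E by linarith
qed

text \<open>Interpolation is linear, so combinations of interpolated eigenvectors are interpolants
  of lattice combinations, to which the bounds of \<open>interpolate\<close> apply.\<close>

lemma pair_interpolate_sum:
 fixes k :: nat
 assumes eps: "eps > 0" and e: "!!i. i < k ==> \<forall>y. y \<notin> lattice_domain D eps --> e i y = 0"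
 shows "pair (%x. zsum (%y. (\<Sum>i<k. c i *\<^sub>R e i y) * weight eps y x))
  = (%x. \<Sum>i<k. c i *\<^sub>R pair (%x. zsum (%y. e i y * weight eps y x)) x)"
proof -
 define P where "P i x = zsum (%y. e i y * weight eps y x)" for i x
 have fe: "fin_supp (e i)" if "i < k" for i using e[OF that] by (intro fin_suppI[OF finite_lattice_domain[OF bounded_D eps]]) auto
 have eq: "zsum (%y. (\<Sum>i<k. c i *\<^sub>R e i y) * weight eps y x) = (\<Sum>i<k. c i * P i x)" for x
 proof -
  have fs: "fin_supp (%y. c i * (e i y * weight eps y x))" if "i < k" for i
   by (rule fin_supp_mult_right[OF fin_supp_mult_left[OF fe[OF that]]])
  have "zsum (%y. (\<Sum>i<k. c i *\<^sub>R e i y) * weight eps y x) = zsum (%y. \<Sum>i<k. c i * (e i y * weight eps y x))"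
   by (intro arg_cong[where f=zsum] ext) (simp add: sum_distrib_right mult.assoc)
  also have "... = (\<Sum>i<k. zsum (%y. c i * (e i y * weight eps y x)))" by (rule zsum_sum[where f = "%i y. c i * (e i y * weight eps y x)"]) (use fs in auto)
  finally show ?thesis unfolding zsum_cmult P_def .
 qed
 have gd: "GDERIV (P i) x :> grad (P i) x" if "i < k" for i x
 proof -
  interpret p: test_fun D "P i" R unfolding P_def using test_fun[OF interpolate(1)[OF eps e[OF that]]] .
  show ?thesis by (rule p.gderiv)
 qed
 have "grad (%x. \<Sum>i<k. c i * P i x) x = (\<Sum>i<k. c i *\<^sub>R grad (P i) x)" for x
  by (rule grad_eq) (intro GDERIV_sum GDERIV_cmult gd, auto)
 then show ?thesis unfolding eq P_def[symmetric] pair_def[abs_def]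
  by (simp add: fun_eq_iff sum_prod prod_eq_iff fst_sum snd_sum)
qed

text \<open>The first \<open>k\<close> lattice eigenvectors are interpolated and used as trial
  family. The errors are proportional to the energy, so the energy must first be bounded by a
  multiple of the mass; this follows from the upper bound already proved for the lattice
  eigenvalue.\<close>

lemma eigenvalue_lower:
 assumes ne: "D ~= {}" and k: "k \<ge> 1" and eps: "!!n. 0 < eps n" "!!n. eps n \<le> 1" "eps \<longlonglongrightarrow> 0"
  and \<kappa>: "\<kappa> \<longlonglongrightarrow> 0" "!!n. 0 \<le> \<kappa> n" and cl: "!!n. form_close (\<kappa> n) (eps n) (\<xi> n)" and \<delta>: "\<delta> > 0"
 shows "\<forall>\<^sub>F n in sequentially. dirichlet_eigenvalue D U k < lattice_eigenvalue D (eps n) (\<xi> n) k + \<delta>"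
proof -
 obtain e l where el: "cf.eigenbasis k e l" using eigenbasis_exists_cont[OF ne] by blast
 define lam where "lam = dirichlet_eigenvalue D U k"
 have lam: "lam = l (k - 1)" unfolding lam_def by (rule dirichlet_eigenvalue_eq[OF el k])
 \<comment> \<open>\<open>C\<close> bounds energy by mass for combinations of the lattice
   eigenvectors: once \<open>\<kappa> n < 1 / 2\<close>, half of the energy is absorbed, which
   doubles the remaining constants. \<open>G\<close> will bound
   \<open>\<bar>\<nu> + \<delta>\<bar>\<close>.\<close>
 define C where "C = 2 * (\<bar>lam\<bar> + CU + 2)"
 define H where "H = interp_const TYPE('d) * C"
 define G where "G = \<bar>lam\<bar> + CU + 2 + \<delta>"
 have pos: "C \<ge> 0" "G \<ge> 0" "interp_const TYPE('d) \<ge> 0" using CU \<delta> by (auto simp: C_def G_def interp_const_def)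
 then have H: "H \<ge> 0" by (simp add: H_def)
 have "(%n. \<kappa> n * (C + 1) + (CU + G) * (H * (eps n)^2)) \<longlonglongrightarrow> 0 * (C + 1) + (CU + G) * (H * 0\<^sup>2)"
  by (intro tendsto_intros \<kappa> eps)
 then have ev1: "\<forall>\<^sub>F n in sequentially. \<kappa> n * (C + 1) + (CU + G) * (H * (eps n)^2) < \<delta>"
  using \<delta> by (intro order_tendstoD(2)[where y = "0 * (C + 1) + (CU + G) * (H * 0\<^sup>2)"]) auto
 have ev2: "\<forall>\<^sub>F n in sequentially. \<kappa> n < 1 / 2" by (rule order_tendstoD(2)[OF \<kappa>(1)]) simp
 have ev3: "\<forall>\<^sub>F n in sequentially. lattice_eigenvalue D (eps n) (\<xi> n) k < lam + 1"
  by (rule eigenvalue_upper[OF ne k eps \<kappa> cl]) (simp add: lam_def)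
 obtain eps1 where "eps1 > 0" and card: "!!eps. 0 < eps ==> eps \<le> eps1 ==> k \<le> card (lattice_domain D eps)"
  using card_lattice_domain_ge[OF ne, of k] by blast
 have ev4: "\<forall>\<^sub>F n in sequentially. eps n < eps1" using order_tendstoD(2)[OF eps(3) \<open>eps1 > 0\<close>] .
 show ?thesis using ev1 ev2 ev3 ev4
 proof eventually_elim
  case (elim n)
  define S where "S = lattice_domain D (eps n)"
  have finS: "finite S" unfolding S_def by (rule finite_lattice_domain[OF bounded_D eps(1)])
  interpret X: lattice_form S "eps n" "\<xi> n" using finS eps(1) by unfold_locales auto
  obtain e' l' where el': "X.lf.eigenbasis k e' l'" using X.eigenbasis_exists_card card[of "eps n"] eps(1)[of n] elim(4) unfolding S_def by force
  define \<nu> where "\<nu> = l' (k - 1)"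
  have \<nu>: "lattice_eigenvalue D (eps n) (\<xi> n) k = \<nu>" unfolding \<nu>_def by (rule X.lattice_eigenvalue_eq[OF S_def el' k])
  have eW: "e' i \<in> X.W" if "i < k" for i using el' that by (simp add: X.lf.eigenbasis_def)
  have e0: "\<forall>y. y \<notin> lattice_domain D (eps n) --> e' i y = 0" if "i < k" for i using eW[OF that] unfolding X.W_def by (simp add: S_def)
  have \<nu>u: "\<nu> \<le> \<bar>lam\<bar> + 1" using elim(3) unfolding \<nu> by linarith
  \<comment> \<open>A lower bound independent of the mesh: the energy of the eigenvector absorbs the
    part of the potential error that is proportional to it.\<close>
  have \<nu>l: "\<nu> \<ge> - (CU + 1)"
  proof -
   have kk: "k - 1 < k" using k by simp
   have b1: "mass (eps n) (e' (k - 1)) = 1" using el' kk unfolding X.b_diag[symmetric] by (simp add: X.lf.eigenbasis_def)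
   have q1: "X.q (e' (k - 1)) (e' (k - 1)) = \<nu>" using el' kk eW[OF kk] by (simp add: X.lf.eigenbasis_def \<nu>_def)
   define E where "E = energy (eps n) (e' (k - 1))"
   have E: "E \<ge> 0" unfolding E_def using eps(1)[of n] by (intro energy_nonneg) auto
   have "\<kappa> n * E \<le> 1 * E" using elim(2) E by (intro mult_right_mono) auto
   then show ?thesis using form_le_Ubar_form[OF eps(1) e0[OF kk] cl] q1 elim(2) unfolding X.q_diag b1 E_def[symmetric] distrib_left by linarith
  qed
  define P where "P i = (%x. zsum (%y. e' i y * weight (eps n) y x))" for i
  have PW: "pair (P i) \<in> W" if "i < k" for i unfolding P_def by (rule pair_in_W[OF interpolate(1)[OF eps(1) e0[OF that]]])
  have "l (k - 1) < \<nu> + \<delta>"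
  proof (rule cf.kth_le_test[OF el k PW])
   fix c :: "nat => real" assume c: "\<exists>j<k. c j ~= 0"
   define f where "f = (%y. \<Sum>i<k. c i *\<^sub>R e' i y)"
   have fW: "f \<in> X.W" unfolding f_def by (rule X.lf.sum_in[OF eW])
   have f0: "\<forall>y. y \<notin> lattice_domain D (eps n) --> f y = 0" using fW unfolding X.W_def by (simp add: S_def)
   define F where "F = (%x. zsum (%y. f y * weight (eps n) y x))"
   have Feq: "(%x. \<Sum>i<k. c i *\<^sub>R pair (P i) x) = pair F"
    unfolding F_def f_def P_def by (rule pair_interpolate_sum[OF eps(1) e0, symmetric])
   define m where "m = mass (eps n) f"
   define E where "E = energy (eps n) f"
   define I where "I = interp_const TYPE('d) * (eps n)^2 * E"
   have E: "E \<ge> 0" unfolding E_def using eps(1)[of n] by (intro energy_nonneg) auto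
   have m: "m = (\<Sum>i<k. (c i)^2)"
    unfolding m_def X.b_diag[symmetric] f_def by (rule X.lf.eigenbasis_b_sum[OF el'])
   have mpos: "m > 0" unfolding m by (rule sum_sq_pos[OF c])
   have qle: "X.q f f \<le> \<nu> * m" unfolding f_def m \<nu>_def by (rule X.lf.eigenbasis_q_sum_le[OF el'])
   define u where "u = (eps n) ^ CARD('d) * zsum (%y. Ubar (eps n) y * (f y)^2)"
   define v where "v = (eps n) ^ CARD('d) * zsum (%y. \<xi> n y * (f y)^2)"
   note cmp = form_le_Ubar_form[OF eps(1) f0 cl, folded u_def v_def E_def m_def]
   note ip = interpolate[OF eps(1) f0, folded F_def u_def E_def m_def, folded I_def]
   have qv: "E + v \<le> \<nu> * m" using qle unfolding X.q_diag E_def v_def .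
   have EC: "E \<le> C * m"
   proof -
    have "\<kappa> n * E \<le> 1 / 2 * E" "\<kappa> n * m \<le> 1 / 2 * m" using elim(2) E mpos by (intro mult_right_mono, simp, simp)+
    moreover have "\<nu> * m \<le> (\<bar>lam\<bar> + 1) * m" using \<nu>u mpos by (intro mult_right_mono) auto
    ultimately have "E - 1 / 2 * E \<le> (\<bar>lam\<bar> + 1) * m + CU * m + 1 / 2 * m" using cmp qv unfolding distrib_left by linarith
    also have "... \<le> C / 2 * m" using mpos by (simp add: C_def distrib_right)
    finally show ?thesis by simp
   qed
   have IH: "I \<le> H * (eps n)^2 * m"
   proof -
    have "I \<le> interp_const TYPE('d) * (eps n)^2 * (C * m)" unfolding I_def using EC pos by (intro mult_left_mono) auto
    then show ?thesis by (simp add: H_def mult_ac)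
   qed
   have I0: "I \<ge> 0" unfolding I_def using pos E by simp
   have "\<kappa> n * (E + m) \<le> \<kappa> n * ((C + 1) * m)" using EC \<kappa>(2) by (intro mult_left_mono) (auto simp: distrib_right)
   moreover have "CU * I \<le> CU * (H * (eps n)^2 * m)" using IH CU by (rule mult_left_mono)
   ultimately have q1: "q (pair F) (pair F) \<le> \<nu> * m + \<kappa> n * ((C + 1) * m) + CU * (H * (eps n)^2 * m)"
    using ip(3) cmp(1) qv by linarith
   have "\<bar>\<nu> + \<delta>\<bar> \<le> G" using \<nu>u \<nu>l \<delta> CU by (simp add: G_def abs_le_iff)
   then have "\<bar>\<nu> + \<delta>\<bar> * \<bar>m - b (pair F) (pair F)\<bar> \<le> G * (H * (eps n)^2 * m)"
    using ip(2) IH I0 pos by (intro mult_mono) auto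
   then have "(\<nu> + \<delta>) * (m - b (pair F) (pair F)) \<le> G * (H * (eps n)^2 * m)" unfolding abs_mult[symmetric] by linarith
   moreover have "(\<kappa> n * (C + 1) + (CU + G) * (H * (eps n)^2)) * m < \<delta> * m" using elim(1) mpos by (rule mult_strict_right_mono)
   ultimately have "q (pair F) (pair F) < (\<nu> + \<delta>) * b (pair F) (pair F)"
    using q1 by (simp add: algebra_simps)
   then show "q (%x. \<Sum>j<k. c j *\<^sub>R pair (P j) x) (%x. \<Sum>j<k. c j *\<^sub>R pair (P j) x) < (\<nu> + \<delta>) * b (%x. \<Sum>j<k. c j *\<^sub>R pair (P j) x) (%x. \<Sum>j<k. c j *\<^sub>R pair (P j) x)"
    unfolding Feq .
  qed
  then show ?case unfolding \<nu> lam[symmetric] lam_def .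
 qed
qed

text \<open>The contradiction turns the sequential bounds into one deterministic threshold: failure
  for every \<open>\<kappa>\<close> yields meshes and potentials with mesh and closeness tending to
  zero. What remains for probability is the single event \<open>form_close\<close>.\<close>

theorem form_close_imp_eigenvalue_close:
 assumes ne: "D ~= {}" and k: "k \<ge> 1" and \<delta>: "\<delta> > 0"
 shows "\<exists>\<kappa>>0. \<forall>eps \<xi>. 0 < eps --> eps < \<kappa> --> form_close \<kappa> eps \<xi> -->
  \<bar>lattice_eigenvalue D eps \<xi> k - dirichlet_eigenvalue D U k\<bar> < \<delta>"
proof (rule ccontr)
 assume neg: "\<not> ?thesis"
 define \<kappa> where "\<kappa> n = inverse (real (Suc n))" for n
 have \<kappa>0: "\<kappa> n > 0" for n by (simp add: \<kappa>_def)
 have "\<exists>p. 0 < fst p \<and> fst p < \<kappa> n \<and> form_close (\<kappa> n) (fst p) (snd p) \<and>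
   \<not> \<bar>lattice_eigenvalue D (fst p) (snd p) k - dirichlet_eigenvalue D U k\<bar> < \<delta>" for n
  using neg \<kappa>0[of n] by (metis fst_conv snd_conv)
 then have "\<exists>p. \<forall>n. 0 < fst (p n) \<and> fst (p n) < \<kappa> n \<and> form_close (\<kappa> n) (fst (p n)) (snd (p n)) \<and>
   \<not> \<bar>lattice_eigenvalue D (fst (p n)) (snd (p n)) k - dirichlet_eigenvalue D U k\<bar> < \<delta>" by (intro choice allI)
 then obtain p where p: "\<forall>n. 0 < fst (p n) \<and> fst (p n) < \<kappa> n \<and> form_close (\<kappa> n) (fst (p n)) (snd (p n)) \<and>
   \<not> \<bar>lattice_eigenvalue D (fst (p n)) (snd (p n)) k - dirichlet_eigenvalue D U k\<bar> < \<delta>" by (elim exE)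
 define eps where "eps n = fst (p n)" for n
 define \<xi> where "\<xi> n = snd (p n)" for n
 have eps: "0 < eps n" "eps n < \<kappa> n" "form_close (\<kappa> n) (eps n) (\<xi> n)"
  "\<not> \<bar>lattice_eigenvalue D (eps n) (\<xi> n) k - dirichlet_eigenvalue D U k\<bar> < \<delta>" for n
  using p unfolding eps_def \<xi>_def by simp_all
 have \<kappa>lim: "\<kappa> \<longlonglongrightarrow> 0" unfolding \<kappa>_def[abs_def] by (rule LIMSEQ_inverse_real_of_nat)
 have eps1: "eps n \<le> 1" for n
 proof -
  have "\<kappa> n \<le> 1" by (simp add: \<kappa>_def field_simps)
  then show ?thesis using eps(2)[of n] by linarith
 qed
 have epslim: "eps \<longlonglongrightarrow> 0"
  by (rule tendsto_sandwich[OF always_eventually always_eventually tendsto_const \<kappa>lim]) (use eps(1,2) in \<open>auto intro: less_imp_le\<close>)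
 have "\<forall>\<^sub>F n in sequentially. lattice_eigenvalue D (eps n) (\<xi> n) k < dirichlet_eigenvalue D U k + \<delta>"
  by (rule eigenvalue_upper[OF ne k eps(1) eps1 epslim \<kappa>lim less_imp_le[OF \<kappa>0] eps(3)]) (use \<delta> in simp)
 moreover have "\<forall>\<^sub>F n in sequentially. dirichlet_eigenvalue D U k < lattice_eigenvalue D (eps n) (\<xi> n) k + \<delta>"
  by (rule eigenvalue_lower[OF ne k eps(1) eps1 epslim \<kappa>lim less_imp_le[OF \<kappa>0] eps(3) \<delta>])
 ultimately have "\<forall>\<^sub>F n in sequentially. False"
 proof eventually_elim
  case (elim n)
  then have "\<bar>lattice_eigenvalue D (eps n) (\<xi> n) k - dirichlet_eigenvalue D U k\<bar> < \<delta>" by linarith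
  with eps(4)[of n] show ?case by blast
 qed
 then show False by simp
qed

end

section \<open>Probabilistic estimates\<close>

lemma (in prob_space) markov_abs:
 fixes X :: "'a => real"
 assumes "integrable M X" "c > 0"
 shows "prob {\<omega> \<in> space M. \<bar>X \<omega>\<bar> \<ge> c} \<le> expectation (%\<omega>. \<bar>X \<omega>\<bar>) / c"
 by (rule integral_Markov_inequality_measure[where A = "{}"]) (use assms in auto)

lemma (in prob_space) second_moment_indep_sum:
 fixes Z :: "'i => 'a => real"
 assumes fin: "finite A" and ind: "indep_vars (%_. borel) Z A"
  and bd: "!!x \<omega>. x \<in> A ==> \<bar>Z x \<omega>\<bar> \<le> B" and zero: "!!x. x \<in> A ==> expectation (Z x) = 0"
 shows "integrable M (%\<omega>. (\<Sum>x\<in>A. Z x \<omega>)^2)" "expectation (%\<omega>. (\<Sum>x\<in>A. Z x \<omega>)^2) \<le> real (card A) * B\<^sup>2"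
proof -
 have m: "Z x \<in> borel_measurable M" if "x \<in> A" for x using ind that unfolding indep_vars_def by auto
 have int: "integrable M (%\<omega>. Z x \<omega> * Z y \<omega>)" if xy: "x \<in> A" "y \<in> A" for x y
 proof (rule integrable_const_bound[of _ "B * B"])
  show "(%\<omega>. Z x \<omega> * Z y \<omega>) \<in> borel_measurable M" using m[OF xy(1)] m[OF xy(2)] by simp
  have "\<bar>Z x \<omega>\<bar> * \<bar>Z y \<omega>\<bar> \<le> B * B" for \<omega>
   using bd[OF xy(1), of \<omega>] bd[OF xy(2), of \<omega>] by (intro mult_mono) auto
  then show "AE \<omega> in M. norm (Z x \<omega> * Z y \<omega>) \<le> B * B" by (simp add: abs_mult)
 qed
 have off: "expectation (%\<omega>. Z x \<omega> * Z y \<omega>) = 0" if xy: "x \<in> A" "y \<in> A" "x ~= y" for x y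
 proof -
  have "indep_vars (%_. borel) Z {x, y}" using xy by (intro indep_vars_subset[OF ind]) auto
  moreover have "integrable M (Z i)" if "i \<in> {x, y}" for i
   using m[of i] bd[of i] that xy by (intro integrable_const_bound[of _ B]) auto
  ultimately have "expectation (%\<omega>. \<Prod>i\<in>{x, y}. Z i \<omega>) = (\<Prod>i\<in>{x, y}. expectation (Z i))"
   by (intro indep_vars_lebesgue_integral) auto
  then show ?thesis using xy zero by simp
 qed
 have diag: "expectation (%\<omega>. Z x \<omega> * Z x \<omega>) \<le> B\<^sup>2" if x: "x \<in> A" for x
 proof -
  have "expectation (%\<omega>. Z x \<omega> * Z x \<omega>) \<le> expectation (%\<omega>. B\<^sup>2)"
  proof (rule integral_mono[OF int[OF x x]])
   show "Z x \<omega> * Z x \<omega> \<le> B\<^sup>2" for \<omega>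
    using power_mono[OF bd[OF x, of \<omega>], of 2] by (simp add: power2_eq_square)
  qed simp
  then show ?thesis by (simp add: prob_space)
 qed
 have eq: "(%\<omega>. (\<Sum>x\<in>A. Z x \<omega>)^2) = (%\<omega>. \<Sum>x\<in>A. \<Sum>y\<in>A. Z x \<omega> * Z y \<omega>)"
  by (simp add: power2_eq_square sum_product)
 show "integrable M (%\<omega>. (\<Sum>x\<in>A. Z x \<omega>)^2)" unfolding eq by (intro Bochner_Integration.integrable_sum int)
 have "expectation (%\<omega>. (\<Sum>x\<in>A. Z x \<omega>)^2) = (\<Sum>x\<in>A. \<Sum>y\<in>A. expectation (%\<omega>. Z x \<omega> * Z y \<omega>))"
  unfolding eq using int by simp
 also have "... = (\<Sum>x\<in>A. \<Sum>y\<in>A. if x = y then expectation (%\<omega>. Z x \<omega> * Z x \<omega>) else 0)"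
  using off by (intro sum.cong refl) auto
 also have "... = (\<Sum>x\<in>A. expectation (%\<omega>. Z x \<omega> * Z x \<omega>))" using fin by simp
 also have "... \<le> (\<Sum>x\<in>A. B\<^sup>2)" by (intro sum_mono diag)
 finally show "expectation (%\<omega>. (\<Sum>x\<in>A. Z x \<omega>)^2) \<le> real (card A) * B\<^sup>2" by simp
qed

text \<open>The truncation at level \<open>T\<close> has bounded second moment, the remainder small first moment.\<close>

lemma (in prob_space) weak_law_truncated:
 fixes X :: "'i => 'a => real"
 assumes fin: "finite A" and ind: "indep_vars (%_. borel) X A" and K: "K > 1" and T: "T > 0"
  and int: "!!x. x \<in> A ==> integrable M (X x)" "!!x. x \<in> A ==> integrable M (%\<omega>. \<bar>X x \<omega>\<bar> powr K)"
  and C: "!!x. x \<in> A ==> expectation (%\<omega>. \<bar>X x \<omega>\<bar> powr K) \<le> C"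
  and C0: "C \<ge> 0" and w: "w \<ge> 0" "w * real (card A) \<le> V" and a: "a > 0"
 shows "prob {\<omega> \<in> space M. \<bar>w * (\<Sum>x\<in>A. X x \<omega> - expectation (X x))\<bar> > 2 * a}
  \<le> w * V * (2 * T)^2 / a\<^sup>2 + 2 * V * C * T powr (1 - K) / a"
proof -
 define Y where "Y x \<omega> = (if \<bar>X x \<omega>\<bar> \<le> T then X x \<omega> else 0)" for x \<omega>
 define Y' where "Y' x \<omega> = Y x \<omega> - expectation (Y x)" for x \<omega>
 define N where "N x \<omega> = X x \<omega> - Y x \<omega>" for x \<omega>
 have mX: "X x \<in> borel_measurable M" if "x \<in> A" for x using int(1)[OF that] by simp
 have mY: "Y x \<in> borel_measurable M" if "x \<in> A" for x
  using mX[OF that] unfolding Y_def[abs_def] by measurable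
 have Yb: "\<bar>Y x \<omega>\<bar> \<le> T" for x \<omega> using T by (simp add: Y_def)
 have iY: "integrable M (Y x)" if "x \<in> A" for x
  using mY[OF that] Yb by (intro integrable_const_bound[of _ T]) auto
 have EY: "\<bar>expectation (Y x)\<bar> \<le> T" if "x \<in> A" for x
 proof -
  have "\<bar>expectation (Y x)\<bar> \<le> expectation (%\<omega>. \<bar>Y x \<omega>\<bar>)" using integral_norm_bound[of M "Y x"] by simp
  also have "... \<le> expectation (%_. T)" using iY[OF that] Yb by (intro integral_mono) auto
  finally show ?thesis by (simp add: prob_space)
 qed
 have ind': "indep_vars (%_. borel) Y' A"
 proof -
  have "indep_vars (%_. borel) (%x \<omega>. (%t. (if \<bar>t\<bar> \<le> T then t else 0) - expectation (Y x)) (X x \<omega>)) A"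
   by (rule indep_vars_compose2[OF ind]) measurable
  then show ?thesis by (simp add: Y'_def[abs_def] Y_def[abs_def])
 qed
 have Y'b: "\<bar>Y' x \<omega>\<bar> \<le> 2 * T" if "x \<in> A" for x \<omega> using Yb[of x \<omega>] EY[OF that] unfolding Y'_def by linarith
 have EY': "expectation (Y' x) = 0" if "x \<in> A" for x using iY[OF that] by (simp add: Y'_def[abs_def] prob_space)
 note sm = second_moment_indep_sum[OF fin ind' Y'b EY']
 have mS: "(%\<omega>. w * (\<Sum>x\<in>A. Y' x \<omega>)) \<in> borel_measurable M" using mY unfolding Y'_def by simp
 have 1: "prob {\<omega> \<in> space M. \<bar>w * (\<Sum>x\<in>A. Y' x \<omega>)\<bar> \<ge> a} \<le> w * V * (2 * T)^2 / a\<^sup>2"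
 proof -
  have "prob {\<omega> \<in> space M. \<bar>w * (\<Sum>x\<in>A. Y' x \<omega>)\<bar> \<ge> a} \<le> expectation (%\<omega>. (w * (\<Sum>x\<in>A. Y' x \<omega>))^2) / a\<^sup>2"
   using mS sm(1) a by (intro second_moment_method) (auto simp: power_mult_distrib)
  also have "expectation (%\<omega>. (w * (\<Sum>x\<in>A. Y' x \<omega>))^2) = w\<^sup>2 * expectation (%\<omega>. (\<Sum>x\<in>A. Y' x \<omega>)^2)"
   by (simp add: power_mult_distrib)
  also have "... \<le> w\<^sup>2 * (real (card A) * (2 * T)^2)" using sm(2) by (intro mult_left_mono) auto
  also have "... = w * (w * real (card A)) * (2 * T)^2" by (simp add: power2_eq_square)
  also have "... \<le> w * V * (2 * T)^2" using w by (intro mult_right_mono mult_left_mono) auto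
  finally show ?thesis by (simp add: divide_right_mono)
 qed
 have iN: "integrable M (N x)" if "x \<in> A" for x unfolding N_def using int(1)[OF that] iY[OF that] by simp
 have EN: "expectation (%\<omega>. \<bar>N x \<omega>\<bar>) \<le> C * T powr (1 - K)" if x: "x \<in> A" for x
 proof -
  have "expectation (%\<omega>. \<bar>N x \<omega>\<bar>) \<le> expectation (%\<omega>. T powr (1 - K) * \<bar>X x \<omega>\<bar> powr K)"
  proof (rule integral_mono)
   show "\<bar>N x \<omega>\<bar> \<le> T powr (1 - K) * \<bar>X x \<omega>\<bar> powr K" for \<omega>
   proof (cases "\<bar>X x \<omega>\<bar> \<le> T")
    case False
    then have pos: "\<bar>X x \<omega>\<bar> > 0" using T by linarith
    \<comment> \<open>Beyond the level \<open>T\<close> the factor in parentheses is at least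
      \<open>1\<close>, as \<open>K > 1\<close>.\<close>
    have "1 * \<bar>X x \<omega>\<bar> \<le> (T powr (1 - K) * \<bar>X x \<omega>\<bar> powr (K - 1)) * \<bar>X x \<omega>\<bar>"
    proof (rule mult_right_mono)
     have "T powr (1 - K) * T powr (K - 1) \<le> T powr (1 - K) * \<bar>X x \<omega>\<bar> powr (K - 1)"
      using False T K by (intro mult_left_mono powr_mono2) auto
     then show "1 \<le> T powr (1 - K) * \<bar>X x \<omega>\<bar> powr (K - 1)" using T by (simp add: powr_add[symmetric])
    qed simp
    also have "... = T powr (1 - K) * (\<bar>X x \<omega>\<bar> powr (K - 1) * \<bar>X x \<omega>\<bar> powr 1)" using pos by simp
    also have "... = T powr (1 - K) * \<bar>X x \<omega>\<bar> powr K" unfolding powr_add[symmetric] by simp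
    finally show ?thesis using False by (simp add: N_def Y_def)
   qed (simp add: N_def Y_def)
  qed (use iN[OF x] int(2)[OF x] in auto)
  also have "... = T powr (1 - K) * expectation (%\<omega>. \<bar>X x \<omega>\<bar> powr K)" by simp
  also have "... \<le> T powr (1 - K) * C" using C[OF x] by (intro mult_left_mono) auto
  finally show ?thesis by (simp add: mult.commute)
 qed
 have EN': "expectation (%\<omega>. \<bar>N x \<omega> - expectation (N x)\<bar>) \<le> 2 * (C * T powr (1 - K))" if x: "x \<in> A" for x
 proof -
  have "expectation (%\<omega>. \<bar>N x \<omega> - expectation (N x)\<bar>) \<le> expectation (%\<omega>. \<bar>N x \<omega>\<bar> + \<bar>expectation (N x)\<bar>)"
   using iN[OF x] by (intro integral_mono) auto
  also have "... = expectation (%\<omega>. \<bar>N x \<omega>\<bar>) + \<bar>expectation (N x)\<bar>" using iN[OF x] by (simp add: prob_space)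
  also have "\<bar>expectation (N x)\<bar> \<le> expectation (%\<omega>. \<bar>N x \<omega>\<bar>)" using integral_norm_bound[of M "N x"] by simp
  finally show ?thesis using EN[OF x] by linarith
 qed
 have iS: "integrable M (%\<omega>. w * (\<Sum>x\<in>A. N x \<omega> - expectation (N x)))" using iN by simp
 have 2: "prob {\<omega> \<in> space M. \<bar>w * (\<Sum>x\<in>A. N x \<omega> - expectation (N x))\<bar> \<ge> a} \<le> 2 * V * C * T powr (1 - K) / a"
 proof -
  have "prob {\<omega> \<in> space M. \<bar>w * (\<Sum>x\<in>A. N x \<omega> - expectation (N x))\<bar> \<ge> a}
   \<le> expectation (%\<omega>. \<bar>w * (\<Sum>x\<in>A. N x \<omega> - expectation (N x))\<bar>) / a" by (rule markov_abs[OF iS a])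
  also have "expectation (%\<omega>. \<bar>w * (\<Sum>x\<in>A. N x \<omega> - expectation (N x))\<bar>) \<le> expectation (%\<omega>. w * (\<Sum>x\<in>A. \<bar>N x \<omega> - expectation (N x)\<bar>))"
  proof (rule integral_mono)
   show "\<bar>w * (\<Sum>x\<in>A. N x \<omega> - expectation (N x))\<bar> \<le> w * (\<Sum>x\<in>A. \<bar>N x \<omega> - expectation (N x)\<bar>)" for \<omega>
    using w sum_abs[of "%x. N x \<omega> - expectation (N x)" A] by (simp add: abs_mult mult_left_mono)
  qed (use iS iN in auto)
  also have "... = w * (\<Sum>x\<in>A. expectation (%\<omega>. \<bar>N x \<omega> - expectation (N x)\<bar>))" using iN by simp
  also have "... \<le> w * (\<Sum>x\<in>A. 2 * (C * T powr (1 - K)))" using w by (intro mult_left_mono sum_mono EN') auto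
  also have "... = (w * real (card A)) * (2 * (C * T powr (1 - K)))" by simp
  also have "... \<le> V * (2 * (C * T powr (1 - K)))" using w C0 by (intro mult_right_mono) auto
  finally show ?thesis using a by (simp add: divide_right_mono mult_ac)
 qed
 have sub: "{\<omega> \<in> space M. \<bar>w * (\<Sum>x\<in>A. X x \<omega> - expectation (X x))\<bar> > 2 * a} \<subseteq>
   {\<omega> \<in> space M. \<bar>w * (\<Sum>x\<in>A. Y' x \<omega>)\<bar> \<ge> a} \<union> {\<omega> \<in> space M. \<bar>w * (\<Sum>x\<in>A. N x \<omega> - expectation (N x))\<bar> \<ge> a}"
 proof -
  have "w * (\<Sum>x\<in>A. X x \<omega> - expectation (X x)) = w * (\<Sum>x\<in>A. Y' x \<omega>) + w * (\<Sum>x\<in>A. N x \<omega> - expectation (N x))" for \<omega>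
  proof -
   have "X x \<omega> - expectation (X x) = Y' x \<omega> + (N x \<omega> - expectation (N x))" if "x \<in> A" for x
    using int(1)[OF that] iY[OF that] by (simp add: N_def[abs_def] Y'_def)
   then show ?thesis by (simp add: sum.distrib[symmetric] distrib_left[symmetric])
  qed
  then show ?thesis by auto
 qed
 have ev: "{\<omega> \<in> space M. \<bar>g \<omega>\<bar> \<ge> a} \<in> events" if [measurable]: "g \<in> borel_measurable M" for g :: "'a => real"
  by measurable
 have "prob {\<omega> \<in> space M. \<bar>w * (\<Sum>x\<in>A. X x \<omega> - expectation (X x))\<bar> > 2 * a}
  \<le> prob ({\<omega> \<in> space M. \<bar>w * (\<Sum>x\<in>A. Y' x \<omega>)\<bar> \<ge> a} \<union> {\<omega> \<in> space M. \<bar>w * (\<Sum>x\<in>A. N x \<omega> - expectation (N x))\<bar> \<ge> a})"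
  by (intro finite_measure_mono[OF sub] sets.Un ev mS borel_measurable_integrable[OF iS])
 also have "... \<le> prob {\<omega> \<in> space M. \<bar>w * (\<Sum>x\<in>A. Y' x \<omega>)\<bar> \<ge> a} + prob {\<omega> \<in> space M. \<bar>w * (\<Sum>x\<in>A. N x \<omega> - expectation (N x))\<bar> \<ge> a}"
  by (intro measure_Un_le ev mS borel_measurable_integrable[OF iS])
 finally show ?thesis using 1 2 by linarith
qed

section \<open>Monotonicity and measurability of lattice eigenvalues\<close>

text \<open>The eigenvectors for \<open>\<zeta>\<close> serve as trial family for
  \<open>\<xi>\<close>; an auxiliary \<open>s > 0\<close> supplies the strict inequality of
  \<open>kth_le_test\<close> and is removed at the end.\<close>

lemma lattice_eigenvalue_le:
 fixes D :: "(real ^ 'd::finite) set"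
 assumes fin: "finite (lattice_domain D eps)" and eps: "eps > 0" and k: "k \<ge> 1" "k \<le> card (lattice_domain D eps)"
  and le: "!!x. x \<in> lattice_domain D eps ==> \<xi> x \<le> \<zeta> x + t"
 shows "lattice_eigenvalue D eps \<xi> k \<le> lattice_eigenvalue D eps \<zeta> k + t"
proof -
 define S where "S = lattice_domain D eps"
 interpret X: lattice_form S eps \<xi> using fin eps by unfold_locales (auto simp: S_def)
 interpret Z: lattice_form S eps \<zeta> using fin eps by unfold_locales (auto simp: S_def)
 obtain e l where el: "X.lf.eigenbasis k e l" using X.eigenbasis_exists_card k(2) unfolding S_def by blast
 obtain e' l' where el': "Z.lf.eigenbasis k e' l'" using Z.eigenbasis_exists_card k(2) unfolding S_def by blast
 have eW: "e' i \<in> X.W" if "i < k" for i using el' that by (simp add: Z.lf.eigenbasis_def)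
 have "l (k - 1) \<le> l' (k - 1) + t + s" if s: "s > 0" for s
 proof (rule less_imp_le, rule X.lf.kth_le_test[OF el k(1) eW])
  fix c :: "nat => real" assume c: "\<exists>j<k. c j ~= 0"
  define f where "f = (%y. \<Sum>i<k. c i *\<^sub>R e' i y)"
  have fW: "f \<in> X.W" unfolding f_def by (rule X.lf.sum_in[OF eW])
  have ff: "fin_supp (%x. (f x)^2)" by (rule fin_supp_sq[OF X.W_fin[OF fW]])
  have b: "X.b f f = (\<Sum>i<k. (c i)^2)" unfolding f_def by (rule Z.lf.eigenbasis_b_sum[OF el'])
  have 1: "Z.q f f \<le> l' (k - 1) * X.b f f" unfolding b unfolding f_def by (rule Z.lf.eigenbasis_q_sum_le[OF el'])
  have "zsum (%x. \<xi> x * (f x)^2) \<le> zsum (%x. \<zeta> x * (f x)^2 + t * (f x)^2)"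
  proof (rule zsum_mono)
   fix x
   show "\<xi> x * (f x)^2 \<le> \<zeta> x * (f x)^2 + t * (f x)^2"
    using mult_right_mono[OF le[of x], of "(f x)^2"] X.W_zero[OF fW, of x] unfolding S_def by (cases "x \<in> lattice_domain D eps") (auto simp: distrib_right)
  qed (intro fin_supp_add fin_supp_mult_right[OF ff])+
  also have "... = zsum (%x. \<zeta> x * (f x)^2) + t * zsum (%x. (f x)^2)"
   using fin_supp_mult_right[OF ff] by (subst zsum_add) (auto simp: zsum_cmult)
  finally have "eps ^ CARD('d) * zsum (%x. \<xi> x * (f x)^2) \<le> eps ^ CARD('d) * (zsum (%x. \<zeta> x * (f x)^2) + t * zsum (%x. (f x)^2))"
   using eps by (intro mult_left_mono) auto
  then have "X.q f f \<le> Z.q f f + t * X.b f f" unfolding X.q_diag Z.q_diag X.b_diag mass_def by (simp add: algebra_simps)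
  moreover have "0 < s * X.b f f" using s sum_sq_pos[OF c] unfolding b by simp
  ultimately have "X.q f f < (l' (k - 1) + t + s) * X.b f f" using 1 by (simp add: distrib_right)
  then show "X.q (%x. \<Sum>j<k. c j *\<^sub>R e' j x) (%x. \<Sum>j<k. c j *\<^sub>R e' j x) < (l' (k - 1) + t + s) * X.b (%x. \<Sum>j<k. c j *\<^sub>R e' j x) (%x. \<Sum>j<k. c j *\<^sub>R e' j x)"
   unfolding f_def .
 qed
 then have "l (k - 1) \<le> l' (k - 1) + t" by (rule field_le_epsilon)
 then show ?thesis unfolding X.lattice_eigenvalue_eq[OF S_def el k(1)] Z.lattice_eigenvalue_eq[OF S_def el' k(1)] .
qed

text \<open>By monotonicity the eigenvalue is less than \<open>a\<close> iff that of some larger rational potential is.\<close>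

lemma lattice_eigenvalue_measurable:
 fixes D :: "(real ^ 'd::finite) set" and \<xi> :: "int ^ 'd => 'w => real"
 assumes fin: "finite (lattice_domain D eps)" and eps: "eps > 0" and k: "k \<ge> 1" "k \<le> card (lattice_domain D eps)"
  and m: "!!x. x \<in> lattice_domain D eps ==> \<xi> x \<in> borel_measurable M"
 shows "(%\<omega>. lattice_eigenvalue D eps (%x. \<xi> x \<omega>) k) \<in> borel_measurable M"
proof (rule borel_measurableI_less)
 fix a :: real
 define S where "S = lattice_domain D eps"
 define F where "F r = lattice_eigenvalue D eps r k" for r
 define Q where "Q = {r \<in> PiE S (%_. \<rat>). F r < a}"
 have cQ: "countable Q" unfolding Q_def
  by (rule countable_subset[OF _ countable_PiE[of S "%_. \<rat>"]]) (use fin countable_rat in \<open>auto simp: S_def\<close>)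
 have "{\<omega> \<in> space M. F (%x. \<xi> x \<omega>) < a} = (\<Union>r\<in>Q. {\<omega> \<in> space M. \<forall>x\<in>S. \<xi> x \<omega> \<le> r x})"
 proof (intro set_eqI iffI)
  fix \<omega> assume "\<omega> \<in> {\<omega> \<in> space M. F (%x. \<xi> x \<omega>) < a}"
  then have w: "\<omega> \<in> space M" "F (%x. \<xi> x \<omega>) < a" by auto
  define t where "t = (a - F (%x. \<xi> x \<omega>)) / 2"
  have t: "t > 0" using w by (simp add: t_def)
  have "\<forall>x. \<exists>q\<in>\<rat>. \<xi> x \<omega> < q \<and> q < \<xi> x \<omega> + t" using t by (intro allI Rats_dense_in_real) simp
  then obtain r where r: "!!x. r x \<in> \<rat>" "!!x. \<xi> x \<omega> < r x" "!!x. r x < \<xi> x \<omega> + t" by metis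
  have "F (restrict r S) \<le> F (%x. \<xi> x \<omega>) + t" unfolding F_def
   by (rule lattice_eigenvalue_le[OF fin eps k]) (use r(3) in \<open>simp add: S_def less_imp_le\<close>)
  also have "... < a" using t by (simp add: t_def field_simps)
  finally have "restrict r S \<in> Q" using r(1) by (simp add: Q_def)
  moreover have "\<forall>x\<in>S. \<xi> x \<omega> \<le> restrict r S x" using r(2) by (simp add: less_imp_le)
  ultimately show "\<omega> \<in> (\<Union>r\<in>Q. {\<omega> \<in> space M. \<forall>x\<in>S. \<xi> x \<omega> \<le> r x})" using w(1) by blast
 next
  fix \<omega> assume "\<omega> \<in> (\<Union>r\<in>Q. {\<omega> \<in> space M. \<forall>x\<in>S. \<xi> x \<omega> \<le> r x})"
  then obtain r where r: "F r < a" "\<omega> \<in> space M" "!!x. x \<in> S ==> \<xi> x \<omega> \<le> r x" unfolding Q_def by blast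
  have "F (%x. \<xi> x \<omega>) \<le> F r + 0" unfolding F_def
   by (rule lattice_eigenvalue_le[OF fin eps k]) (use r(3) in \<open>simp add: S_def\<close>)
  then show "\<omega> \<in> {\<omega> \<in> space M. F (%x. \<xi> x \<omega>) < a}" using r by simp
 qed
 moreover have "{\<omega> \<in> space M. \<forall>x\<in>S. \<xi> x \<omega> \<le> r x} \<in> sets M" for r
 proof (rule sets.sets_Collect_finite_All)
  show "{\<omega> \<in> space M. \<xi> x \<omega> \<le> r x} \<in> sets M" if "x \<in> S" for x
   using m[of x] that unfolding S_def by measurable
 qed (use fin in \<open>simp add: S_def\<close>)
 ultimately show "{\<omega> \<in> space M. lattice_eigenvalue D eps (%x. \<xi> x \<omega>) k < a} \<in> sets M"
  unfolding F_def using cQ by auto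
qed

section \<open>From moments and cell sums to closeness of forms\<close>

context dirichlet_domain
begin

text \<open>\<open>U\<close> is continuous only inside \<open>D\<close>, so the difference tends to
  zero pointwise but not necessarily uniformly up to the boundary; boundedness and dominated
  convergence still control the lattice average.\<close>

lemma centre_error_tendsto:
 "((%eps. eps ^ CARD('d) * (\<Sum>x\<in>lattice_domain D eps. \<bar>U (eps *\<^sub>R lattice_point x) - Ubar eps x\<bar>)) \<longlongrightarrow> 0) (at_right 0)"
proof (rule tendsto_at_right_0_iff_seq)
 fix X :: "nat => real"
 assume X: "!!n. 0 < X n" "!!n. X n \<le> 1" "X \<longlonglongrightarrow> 0"
 define g where "g n y = (if y \<in> lattice_domain D (X n) then \<bar>U (X n *\<^sub>R lattice_point y) - Ubar (X n) y\<bar> else 0)" for n y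
 have inD: "X n *\<^sub>R lattice_point y \<in> D" if "y \<in> lattice_domain D (X n)" for n y
  by (rule lattice_domain_bounded(1)[OF D_bound X(1) that])
 have "(%n. X n ^ CARD('d) * zsum (g n)) \<longlonglongrightarrow> (\<integral>x. 0 \<partial>(lborel :: (real ^ 'd) measure))"
 proof (rule lattice_riemann_sum(2)[where eps = X and R = R and B = "CU + CU" and G = "%_. 0"])
  show "\<bar>X n * real_of_int (y $ i)\<bar> \<le> R" if "g n y ~= 0" for n y i
  proof -
   have y: "y \<in> lattice_domain D (X n)" using that by (simp add: g_def split: if_splits)
   show ?thesis by (rule lattice_domain_bounded(2)[OF D_bound X(1) y])
  qed
  show "\<bar>g n y\<bar> \<le> CU + CU" for n y
   using U_bound[OF inD, of y n] Ubar_bound[OF X(1), of n y] CU by (auto simp: g_def)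
  have "(%n. g n (qfloor (X n) x)) \<longlonglongrightarrow> 0" for x
  proof (cases "x \<in> D")
   case True
   have q: "(%n. X n *\<^sub>R lattice_point (qfloor (X n) x)) \<longlonglongrightarrow> x" using qfloor_tendsto[OF X(1,3), where z = 0 and x = x] by simp
   have "isCont U x" using U_cont open_D True by (simp add: continuous_on_eq_continuous_at)
   from isCont_tendsto_compose[OF this q] have "(%n. U (X n *\<^sub>R lattice_point (qfloor (X n) x))) \<longlonglongrightarrow> U x" .
   from tendsto_rabs[OF tendsto_diff[OF this Ubar_tendsto[OF X(1,3) True]]]
   have lim: "(%n. \<bar>U (X n *\<^sub>R lattice_point (qfloor (X n) x)) - Ubar (X n) (qfloor (X n) x)\<bar>) \<longlonglongrightarrow> 0" by simp
   show ?thesis by (rule Lim_null_comparison[OF _ lim]) (simp add: g_def)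
  next
   case False
   \<comment> \<open>A point is within one mesh of its lattice index in every coordinate, so an
     index in the lattice domain would force the point into \<open>D\<close>.\<close>
   have "qfloor (X n) x \<notin> lattice_domain D (X n)" for n
   proof
    assume "qfloor (X n) x \<in> lattice_domain D (X n)"
    then have "dist_inf (X n *\<^sub>R lattice_point (qfloor (X n) x)) (- D) > X n" by (simp add: lattice_domain_def)
    then have "x \<in> D"
    proof (rule dist_inf_cube)
     fix i show "\<bar>x $ i - (X n *\<^sub>R lattice_point (qfloor (X n) x)) $ i\<bar> \<le> X n"
      using qfloor_bounds[OF X(1)[of n], of x i] by (simp add: lattice_point_def)
    qed
    with False show False by blast
   qed
   then show ?thesis by (simp add: g_def)
  qed
  then show "AE x in lborel. (%n. g n (qfloor (X n) x)) \<longlonglongrightarrow> 0" by simp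
 qed (use X in auto)
 moreover have "zsum (g n) = (\<Sum>x\<in>lattice_domain D (X n). \<bar>U (X n *\<^sub>R lattice_point x) - Ubar (X n) x\<bar>)" for n
  by (subst zsum_eq[OF finite_lattice_domain[OF bounded_D X(1)[of n]]]) (auto simp: g_def)
 ultimately show "(%n. X n ^ CARD('d) * (\<Sum>x\<in>lattice_domain D (X n). \<bar>U (X n *\<^sub>R lattice_point x) - Ubar (X n) x\<bar>)) \<longlonglongrightarrow> 0" by simp
qed

lemma lattice_volume_bounded:
 "\<exists>V\<ge>0. \<forall>eps. 0 < eps --> eps \<le> 1 --> eps ^ CARD('d) * real (card (lattice_domain D eps)) \<le> V"
proof -
 define B :: "(real ^ 'd) set" where "B = cbox (\<chi> i. - (R + 1)) (\<chi> i. R + 1)"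
 have "eps ^ CARD('d) * real (card (lattice_domain D eps)) \<le> measure lborel B" if eps: "0 < eps" "eps \<le> 1" for eps
 proof -
  define c where "c y = (if y \<in> lattice_domain D eps then 1 else 0 :: real)" for y
  have fin: "finite (lattice_domain D eps)" by (rule finite_lattice_domain[OF bounded_D eps(1)])
  then have fc: "fin_supp c" by (intro fin_suppI[OF fin]) (auto simp: c_def)
  have "zsum c = (\<Sum>y\<in>lattice_domain D eps. c y)" by (rule zsum_eq[OF fin]) (auto simp: c_def)
  also have "... = real (card (lattice_domain D eps))" by (simp add: c_def)
  finally have "eps ^ CARD('d) * real (card (lattice_domain D eps)) = (LBINT x. c (qfloor eps x))"
   using integral_step[OF fc eps(1)] by simp
  also have "... \<le> (LBINT x. indicator B x)"
  proof (rule integral_mono[OF integrable_step[OF fc eps(1)]])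
   show "integrable lborel (indicator B :: real ^ 'd => real)" unfolding B_def
    by (intro integrable_real_indicator emeasure_lborel_cbox_finite) simp
   show "c (qfloor eps x) \<le> indicator B x" for x
   proof (cases "qfloor eps x \<in> lattice_domain D eps")
    case True
    have "- (R + 1) \<le> x $ i \<and> x $ i \<le> R + 1" for i
     using lattice_domain_bounded(2)[OF D_bound eps(1) True, of i] qfloor_bounds[OF eps(1), of x i] eps(2) by linarith
    then have "x \<in> B" by (simp add: B_def mem_box_cart)
    then show ?thesis by (simp add: c_def)
   qed (simp add: c_def)
  qed
  also have "... = measure lborel B" by simp
  finally show ?thesis .
 qed
 then show ?thesis by (intro exI[of _ "measure lborel B"]) auto
qed

text \<open>Reduces the conditions to the cells near the domain, and the first moment to the
  \<open>K\<close>-th by \<open>t \<le> 1 + t powr K\<close>, which explains the bound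
  \<open>M0 + V\<close>. The first premise is what \<open>potential_form_small\<close> provides at
  one mesh.\<close>

lemma form_close_if_cells_small:
 assumes pfs: "!!(\<eta> :: int ^ 'd => real) f. fin_supp \<eta> ==>
   (\<forall>x i. \<eta> x ~= 0 --> \<bar>eps * real_of_int (x $ i)\<bar> \<le> R) ==>
   eps ^ CARD('d) * zsum (%x. \<bar>\<eta> x\<bar> powr K) \<le> M0 + V ==> eps ^ CARD('d) * zsum (%x. \<bar>\<eta> x\<bar>) \<le> M0 + V ==>
   (\<forall>c. \<bar>eps ^ CARD('d) * zsum (%x. if cell \<rho> eps x = c then \<eta> x else 0)\<bar> \<le> \<delta>1) ==> fin_supp f ==>
   \<bar>eps ^ CARD('d) * zsum (%x. \<eta> x * (f x)^2)\<bar> \<le> \<kappa> * (energy eps f + mass eps f)"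
  and eps: "eps > 0" and \<rho>: "\<rho> > 0" and K: "K > 1" and \<delta>1: "\<delta>1 > 0"
  and vol: "eps ^ CARD('d) * real (card (lattice_domain D eps)) \<le> V" "V \<ge> 0"
  and mom: "eps ^ CARD('d) * (\<Sum>x\<in>lattice_domain D eps. \<bar>\<xi> x - Ubar eps x\<bar> powr K) \<le> M0"
  and cells: "!!c. (!!i. \<bar>\<rho> * real_of_int (c $ i)\<bar> \<le> R + \<rho>) ==>
   \<bar>eps ^ CARD('d) * (\<Sum>x | x \<in> lattice_domain D eps \<and> cell \<rho> eps x = c. \<xi> x - Ubar eps x)\<bar> \<le> \<delta>1"
 shows "form_close \<kappa> eps \<xi>"
 unfolding form_close_def
proof (intro allI impI)
 fix f :: "int ^ 'd => real" assume f: "\<forall>y. y \<notin> lattice_domain D eps --> f y = 0"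
 define S where "S = lattice_domain D eps"
 have fin: "finite S" unfolding S_def by (rule finite_lattice_domain[OF bounded_D eps])
 have SR: "\<bar>eps * real_of_int (x $ i)\<bar> \<le> R" if "x \<in> S" for x i
  by (rule lattice_domain_bounded(2)[OF D_bound eps that[unfolded S_def]])
 define \<eta> where "\<eta> x = (if x \<in> S then \<xi> x - Ubar eps x else 0)" for x
 have ed: "eps ^ CARD('d) > 0" using eps by simp
 have zK: "zsum (%x. \<bar>\<eta> x\<bar> powr K) = (\<Sum>x\<in>S. \<bar>\<xi> x - Ubar eps x\<bar> powr K)"
  by (subst zsum_eq[OF fin]) (auto simp: \<eta>_def)
 have z1: "zsum (%x. \<bar>\<eta> x\<bar>) = (\<Sum>x\<in>S. \<bar>\<xi> x - Ubar eps x\<bar>)"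
  by (subst zsum_eq[OF fin]) (auto simp: \<eta>_def)
 have "\<bar>eps ^ CARD('d) * zsum (%x. \<eta> x * (f x)^2)\<bar> \<le> \<kappa> * (energy eps f + mass eps f)"
 proof (rule pfs)
  show "fin_supp \<eta>" by (rule fin_suppI[OF fin]) (simp add: \<eta>_def)
  show "fin_supp f" by (rule fin_suppI[OF fin]) (use f in \<open>simp add: S_def\<close>)
  show "\<forall>x i. \<eta> x ~= 0 --> \<bar>eps * real_of_int (x $ i)\<bar> \<le> R" using SR by (simp add: \<eta>_def)
  show "eps ^ CARD('d) * zsum (%x. \<bar>\<eta> x\<bar> powr K) \<le> M0 + V" unfolding zK using mom vol(2) unfolding S_def by linarith
  have "(\<Sum>x\<in>S. \<bar>\<xi> x - Ubar eps x\<bar>) \<le> (\<Sum>x\<in>S. 1 + \<bar>\<xi> x - Ubar eps x\<bar> powr K)"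
  proof (rule sum_mono)
   fix x
   show "\<bar>\<xi> x - Ubar eps x\<bar> \<le> 1 + \<bar>\<xi> x - Ubar eps x\<bar> powr K"
   proof (cases "\<bar>\<xi> x - Ubar eps x\<bar> \<le> 1")
    case False
    then have "\<bar>\<xi> x - Ubar eps x\<bar> powr 1 \<le> \<bar>\<xi> x - Ubar eps x\<bar> powr K" using K by (intro powr_mono) auto
    then show ?thesis using False by simp
   next
    case True
    then show ?thesis using powr_ge_zero[of "\<bar>\<xi> x - Ubar eps x\<bar>" K] by linarith
   qed
  qed
  then have "eps ^ CARD('d) * (\<Sum>x\<in>S. \<bar>\<xi> x - Ubar eps x\<bar>) \<le> eps ^ CARD('d) * (\<Sum>x\<in>S. 1 + \<bar>\<xi> x - Ubar eps x\<bar> powr K)"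
   using ed by (intro mult_left_mono) auto
  also have "... \<le> M0 + V" using mom vol(1) unfolding S_def sum.distrib distrib_left by simp
  finally show "eps ^ CARD('d) * zsum (%x. \<bar>\<eta> x\<bar>) \<le> M0 + V" unfolding z1 .
  show "\<forall>c. \<bar>eps ^ CARD('d) * zsum (%x. if cell \<rho> eps x = c then \<eta> x else 0)\<bar> \<le> \<delta>1"
  proof
   fix c
   have "zsum (%x. if cell \<rho> eps x = c then \<eta> x else 0) = (\<Sum>x | x \<in> S \<and> cell \<rho> eps x = c. if cell \<rho> eps x = c then \<eta> x else 0)"
    by (rule zsum_eq) (use fin in \<open>auto simp: \<eta>_def\<close>)
   also have "... = (\<Sum>x | x \<in> S \<and> cell \<rho> eps x = c. \<xi> x - Ubar eps x)"
    by (intro sum.cong refl) (auto simp: \<eta>_def)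
   finally have z: "zsum (%x. if cell \<rho> eps x = c then \<eta> x else 0) = (\<Sum>x | x \<in> S \<and> cell \<rho> eps x = c. \<xi> x - Ubar eps x)" .
   show "\<bar>eps ^ CARD('d) * zsum (%x. if cell \<rho> eps x = c then \<eta> x else 0)\<bar> \<le> \<delta>1"
   proof (cases "{x. x \<in> S \<and> cell \<rho> eps x = c} = {}")
    case True
    show ?thesis unfolding z True using \<delta>1 by simp
   next
    case False
    then obtain x where x: "x \<in> S" "cell \<rho> eps x = c" by blast
    have "\<bar>\<rho> * real_of_int (c $ i)\<bar> \<le> R + \<rho>" for i
    proof -
     define t where "t = eps * real_of_int (x $ i)"
     have c: "c $ i = \<lfloor>t / \<rho>\<rfloor>" using x(2) by (auto simp: cell_def t_def)
     have "real_of_int (c $ i) \<le> t / \<rho>" "t / \<rho> < real_of_int (c $ i) + 1" unfolding c by linarith+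
     then have "\<rho> * real_of_int (c $ i) \<le> t" "t < \<rho> * real_of_int (c $ i) + \<rho>" using \<rho> by (simp_all add: field_simps)
     then show ?thesis using SR[OF x(1), of i] unfolding t_def[symmetric] by linarith
    qed
    then show ?thesis unfolding z S_def by (rule cells)
   qed
  qed
 qed
 moreover have "(%y. (\<xi> y - Ubar eps y) * (f y)^2) = (%x. \<eta> x * (f x)^2)" using f by (auto simp: \<eta>_def S_def)
 ultimately show "\<bar>eps ^ CARD('d) * zsum (%y. (\<xi> y - Ubar eps y) * (f y)^2)\<bar> \<le> \<kappa> * (energy eps f + mass eps f)" by simp
qed

end

lemma abs_diff_powr_le:
 fixes a u K :: real
 assumes "K \<ge> 0" "\<bar>u\<bar> \<le> c"
 shows "\<bar>a - u\<bar> powr K \<le> 2 powr K * (\<bar>a\<bar> powr K + c powr K)"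
proof -
 have "\<bar>a - u\<bar> powr K \<le> (2 * max \<bar>a\<bar> c) powr K" using assms by (intro powr_mono2) auto
 also have "... = 2 powr K * max \<bar>a\<bar> c powr K" by (rule powr_mult)
 also have "max \<bar>a\<bar> c powr K \<le> \<bar>a\<bar> powr K + c powr K" by (simp add: max_def)
 finally show ?thesis by simp
qed

lemma integrable_if_integrable_powr:
 fixes X :: "'a => real"
 assumes "finite_measure M" "X \<in> borel_measurable M" "integrable M (%\<omega>. \<bar>X \<omega>\<bar> powr K)" "K \<ge> 1"
 shows "integrable M X"
proof (rule Bochner_Integration.integrable_bound)
 show "integrable M (%\<omega>. 1 + \<bar>X \<omega>\<bar> powr K)"
  using finite_measure.integrable_const[OF assms(1), of "1 :: real"] assms(3) by (rule Bochner_Integration.integrable_add)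
 have "\<bar>t\<bar> \<le> 1 + \<bar>t\<bar> powr K" for t :: real
 proof (cases "\<bar>t\<bar> \<le> 1")
  case False
  then have "\<bar>t\<bar> powr 1 \<le> \<bar>t\<bar> powr K" using assms(4) by (intro powr_mono) auto
  then show ?thesis using False by simp
 qed (use powr_ge_zero[of "\<bar>t\<bar>" K] in linarith)
 then show "AE \<omega> in M. norm (X \<omega>) \<le> norm (1 + \<bar>X \<omega>\<bar> powr K)" by (intro AE_I2) (simp add: order_trans[OF _ abs_ge_self])
qed (rule assms(2))

context dirichlet_domain
begin

text \<open>Outside two kinds of bad events, a large \<open>K\<close>-th moment sum and a large
  fluctuation in one of finitely many cells, the potential is close in form. Markov's inequality and
  the truncated weak law make their total probability small.\<close>

lemma converges_in_probability:
 fixes M :: "'w measure" and \<xi> :: "real => int ^ 'd => 'w => real"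
 assumes ne: "D ~= {}" and k: "k \<ge> 1" and M: "prob_space M"
  and ind: "!!eps. eps \<in> {0<..<1} ==> prob_space.indep_vars M (%_. borel) (\<xi> eps) (lattice_domain D eps)"
  and K: "K > 1" "2 * K > real CARD('d)"
  and int: "!!eps x. eps \<in> {0<..<1} ==> x \<in> lattice_domain D eps ==> integrable M (%\<omega>. \<bar>\<xi> eps x \<omega>\<bar> powr K)"
  and C: "!!eps x. eps \<in> {0<..<1} ==> x \<in> lattice_domain D eps ==> (\<integral>\<omega>. \<bar>\<xi> eps x \<omega>\<bar> powr K \<partial>M) \<le> C" "C \<ge> 0"
  and mean: "!!eps x. eps \<in> {0<..<1} ==> x \<in> lattice_domain D eps ==> (\<integral>\<omega>. \<xi> eps x \<omega> \<partial>M) = U (eps *\<^sub>R lattice_point x)"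
 shows "tendsto_in_prob M (%eps \<omega>. lattice_eigenvalue D eps (%x. \<xi> eps x \<omega>) k) (dirichlet_eigenvalue D U k) (at_right 0)"
proof -
 let ?F = "%eps \<omega>. lattice_eigenvalue D eps (%x. \<xi> eps x \<omega>) k" and ?l = "dirichlet_eigenvalue D U k"
 interpret prob_space M by (rule M)
 have R: "R \<ge> 0"
 proof -
  obtain x where "x \<in> D" using ne by blast
  from D_bound[OF this, of undefined] show ?thesis by linarith
 qed
 obtain epsc where epsc: "epsc > 0" and card: "!!eps. 0 < eps ==> eps \<le> epsc ==> k \<le> card (lattice_domain D eps)"
  using card_lattice_domain_ge[OF ne, of k] by blast
 obtain V where V: "V \<ge> 0" and vol: "!!eps. 0 < eps ==> eps \<le> 1 ==> eps ^ CARD('d) * real (card (lattice_domain D eps)) \<le> V"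
  using lattice_volume_bounded by blast
 have small: "\<forall>\<^sub>F eps in at_right 0. 0 < eps \<and> eps < s" if "s > 0" for s :: real
  using that by (auto simp: eventually_at_right_field)
 have fin: "finite (lattice_domain D eps)" if "eps > 0" for eps by (rule finite_lattice_domain[OF bounded_D that])
 have meas: "\<xi> eps x \<in> borel_measurable M" if "eps \<in> {0<..<1}" "x \<in> lattice_domain D eps" for eps x
  using ind[OF that(1)] that(2) unfolding indep_vars_def by auto
 have int1: "integrable M (\<xi> eps x)" if "eps \<in> {0<..<1}" "x \<in> lattice_domain D eps" for eps x
  by (rule integrable_if_integrable_powr[OF finite_measure_axioms meas[OF that] int[OF that]]) (use K in simp)
 have ev_meas: "\<forall>\<^sub>F eps in at_right 0. (%\<omega>. ?F eps \<omega>) \<in> borel_measurable M"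
 proof (rule eventually_mono[OF small[of "min 1 epsc"]])
  fix eps assume "0 < eps \<and> eps < min 1 epsc"
  then have eps: "0 < eps" "eps \<le> epsc" "eps \<in> {0<..<1}" by auto
  show "(%\<omega>. ?F eps \<omega>) \<in> borel_measurable M"
   by (rule lattice_eigenvalue_measurable[OF fin[OF eps(1)] eps(1) k card[OF eps(1,2)] meas[OF eps(3)]])
 qed (use epsc in simp)
 have "((%eps. prob {\<omega> \<in> space M. \<bar>?F eps \<omega> - ?l\<bar> > \<delta>}) \<longlongrightarrow> 0) (at_right 0)"
  if \<delta>: "\<delta> > 0" for \<delta>
 proof (rule tendstoI)
  fix \<tau> :: real assume \<tau>: "\<tau> > 0"
  obtain \<kappa> where \<kappa>: "\<kappa> > 0" and det: "!!eps \<xi>. 0 < eps ==> eps < \<kappa> ==> form_close \<kappa> eps \<xi> ==>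
    \<bar>lattice_eigenvalue D eps \<xi> k - ?l\<bar> < \<delta>"
   using form_close_imp_eigenvalue_close[OF ne k \<delta>] by blast
  \<comment> \<open>\<open>B\<close> bounds the expected moment sum; \<open>M0\<close> is then large
    enough for Markov's inequality to give at most \<open>\<tau> / 4\<close>.\<close>
  define B where "B = V * (2 powr K * (C + CU powr K))"
  have B: "B \<ge> 0" unfolding B_def using V C(2) by (intro mult_nonneg_nonneg add_nonneg_nonneg) auto
  define M0 where "M0 = 4 * (B + 1) / \<tau>"
  have M0: "M0 > 0" using B \<tau> by (simp add: M0_def)
  have MV: "M0 + V > 0" using M0 V by simp
  from potential_form_small[OF K \<kappa> R MV] obtain \<rho> \<delta>1 eps0 where \<rho>: "\<rho> > 0" and \<delta>1: "\<delta>1 > 0" and eps0: "eps0 > 0"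
   and pfs: "\<forall>eps (\<eta> :: int ^ 'd => real) f. 0 < eps --> eps < eps0 --> fin_supp \<eta> -->
   (\<forall>x i. \<eta> x ~= 0 --> \<bar>eps * real_of_int (x $ i)\<bar> \<le> R) -->
   eps ^ CARD('d) * zsum (%x. \<bar>\<eta> x\<bar> powr K) \<le> M0 + V --> eps ^ CARD('d) * zsum (%x. \<bar>\<eta> x\<bar>) \<le> M0 + V -->
   (\<forall>c. \<bar>eps ^ CARD('d) * zsum (%x. if cell \<rho> eps x = c then \<eta> x else 0)\<bar> \<le> \<delta>1) --> fin_supp f -->
   \<bar>eps ^ CARD('d) * zsum (%x. \<eta> x * (f x)^2)\<bar> \<le> \<kappa> * (energy eps f + mass eps f)"
   by (elim exE conjE)
  define Cs where "Cs = {c :: int ^ 'd. \<forall>i. \<bar>\<rho> * real_of_int (c $ i)\<bar> \<le> R + \<rho>}"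
  have Cs: "finite Cs" unfolding Cs_def by (rule finite_bounded_lattice[OF \<rho>])
  \<comment> \<open>The threshold \<open>2 * a\<close> is half of \<open>\<delta>1\<close>; the
    other half covers the deviation of \<open>Ubar\<close> from \<open>U\<close> at the lattice
    points.\<close>
  define a where "a = \<delta>1 / 4"
  have a: "a > 0" using \<delta>1 by (simp add: a_def)
  \<comment> \<open>Each cell contributes a probability of at most \<open>2 * \<sigma>\<close>, in
    total at most \<open>\<tau> / 2\<close>.\<close>
  define \<sigma> where "\<sigma> = \<tau> / (4 * (real (card Cs) + 1))"
  have \<sigma>: "\<sigma> > 0" using \<tau> by (simp add: \<sigma>_def)
  define s where "s = \<sigma> * a / (2 * V * C + 1)"
  have s: "s > 0" unfolding s_def using \<sigma> a V C(2) by (intro divide_pos_pos mult_pos_pos add_nonneg_pos) auto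
  \<comment> \<open>The truncation level solves \<open>T powr (1 - K) = s\<close>. It bounds the
    remainder by \<open>\<sigma>\<close> before the mesh is sent to zero, and at fixed
    \<open>T\<close> the variance term then vanishes in the limit.\<close>
  define T where "T = s powr (1 / (1 - K))"
  have T: "T > 0" using s by (simp add: T_def)
  have TK: "T powr (1 - K) = s" using K(1) s unfolding T_def powr_powr by simp
  have trunc: "2 * V * C * T powr (1 - K) / a \<le> \<sigma>"
  proof -
   have "2 * V * C * s \<le> (2 * V * C + 1) * s" using s by (intro mult_right_mono) auto
   also have "... = \<sigma> * a" using V C(2) by (simp add: s_def add_nonneg_eq_0_iff)
   finally show ?thesis unfolding TK using a by (simp add: field_simps)
  qed
  have "((%eps::real. eps ^ CARD('d) * V * (2 * T)^2 / a\<^sup>2) \<longlongrightarrow> 0 ^ CARD('d) * V * (2 * T)^2 / a\<^sup>2) (at_right 0)"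
   using a by (intro tendsto_intros) auto
  then have ev1: "\<forall>\<^sub>F eps in at_right 0. eps ^ CARD('d) * V * (2 * T)^2 / a\<^sup>2 < \<sigma>"
   using \<sigma> by (intro order_tendstoD(2)[where y = "0 ^ CARD('d) * V * (2 * T)^2 / a\<^sup>2"]) (auto simp: zero_power)
  have ev2: "\<forall>\<^sub>F eps in at_right 0. eps ^ CARD('d) * (\<Sum>x\<in>lattice_domain D eps. \<bar>U (eps *\<^sub>R lattice_point x) - Ubar eps x\<bar>) < \<delta>1 / 2"
   using \<delta>1 by (intro order_tendstoD(2)[OF centre_error_tendsto]) simp
  have ev3: "\<forall>\<^sub>F eps in at_right 0. 0 < eps \<and> eps < min 1 (min \<kappa> eps0)" by (rule small) (use \<kappa> eps0 in simp)
  show "\<forall>\<^sub>F eps in at_right 0. dist (prob {\<omega> \<in> space M. \<bar>?F eps \<omega> - ?l\<bar> > \<delta>}) 0 < \<tau>"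
   using ev1 ev2 ev3
  proof eventually_elim
   case (elim eps)
   then have eps: "0 < eps" "eps < 1" "eps < \<kappa>" "eps < eps0" "eps \<in> {0<..<1}" by auto
   define S where "S = lattice_domain D eps"
   define w where "w = eps ^ CARD('d)"
   have w: "w > 0" "w * real (card S) \<le> V" using eps vol[of eps] by (auto simp: w_def S_def)
   have finS: "finite S" unfolding S_def by (rule fin[OF eps(1)])
   define Z where "Z \<omega> = w * (\<Sum>x\<in>S. \<bar>\<xi> eps x \<omega> - Ubar eps x\<bar> powr K)" for \<omega>
   define A where "A = {\<omega> \<in> space M. \<bar>Z \<omega>\<bar> \<ge> M0}"
   define Sc where "Sc c = {x. x \<in> S \<and> cell \<rho> eps x = c}" for c
   define Bc where "Bc c = {\<omega> \<in> space M. \<bar>w * (\<Sum>x\<in>Sc c. \<xi> eps x \<omega> - expectation (\<xi> eps x))\<bar> > 2 * a}" for c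
   have ScS: "Sc c \<subseteq> S" "finite (Sc c)" for c using finS by (auto simp: Sc_def)
   have mS: "\<xi> eps x \<in> borel_measurable M" if "x \<in> S" for x using meas[OF eps(5)] that by (simp add: S_def)
   have iZ: "integrable M (%\<omega>. \<bar>\<xi> eps x \<omega> - Ubar eps x\<bar> powr K)"
    and EZ: "expectation (%\<omega>. \<bar>\<xi> eps x \<omega> - Ubar eps x\<bar> powr K) \<le> 2 powr K * (C + CU powr K)" if x: "x \<in> S" for x
   proof -
    have le: "\<bar>\<xi> eps x \<omega> - Ubar eps x\<bar> powr K \<le> 2 powr K * (\<bar>\<xi> eps x \<omega>\<bar> powr K + CU powr K)" for \<omega>
     by (rule abs_diff_powr_le) (use K Ubar_bound[OF eps(1)] in auto)
    have i: "integrable M (%\<omega>. 2 powr K * (\<bar>\<xi> eps x \<omega>\<bar> powr K + CU powr K))"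
     using int[OF eps(5)] x by (simp add: S_def)
    show iZ: "integrable M (%\<omega>. \<bar>\<xi> eps x \<omega> - Ubar eps x\<bar> powr K)"
    proof (rule Bochner_Integration.integrable_bound[OF i])
     show "(%\<omega>. \<bar>\<xi> eps x \<omega> - Ubar eps x\<bar> powr K) \<in> borel_measurable M" using mS[OF x] by measurable
     show "AE \<omega> in M. norm (\<bar>\<xi> eps x \<omega> - Ubar eps x\<bar> powr K) \<le> norm (2 powr K * (\<bar>\<xi> eps x \<omega>\<bar> powr K + CU powr K))"
     proof (rule AE_I2)
      fix \<omega> show "norm (\<bar>\<xi> eps x \<omega> - Ubar eps x\<bar> powr K) \<le> norm (2 powr K * (\<bar>\<xi> eps x \<omega>\<bar> powr K + CU powr K))"
       using le[of \<omega>] by simp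
     qed
    qed
    have "expectation (%\<omega>. \<bar>\<xi> eps x \<omega> - Ubar eps x\<bar> powr K) \<le> expectation (%\<omega>. 2 powr K * (\<bar>\<xi> eps x \<omega>\<bar> powr K + CU powr K))"
     by (rule integral_mono[OF iZ i le])
    also have "... = 2 powr K * (expectation (%\<omega>. \<bar>\<xi> eps x \<omega>\<bar> powr K) + CU powr K)"
     using int[OF eps(5)] x by (simp add: S_def prob_space)
    also have "... \<le> 2 powr K * (C + CU powr K)" using C(1)[OF eps(5)] x by (simp add: S_def)
    finally show "expectation (%\<omega>. \<bar>\<xi> eps x \<omega> - Ubar eps x\<bar> powr K) \<le> 2 powr K * (C + CU powr K)" .
   qed
   have intZ: "integrable M Z" unfolding Z_def[abs_def] using iZ by simp
   have Z0: "Z \<omega> \<ge> 0" for \<omega> unfolding Z_def using w by (intro mult_nonneg_nonneg sum_nonneg) auto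
   have PA: "prob A \<le> \<tau> / 4"
   proof -
    have "prob A \<le> expectation (%\<omega>. \<bar>Z \<omega>\<bar>) / M0" unfolding A_def by (rule markov_abs[OF intZ M0])
    also have "expectation (%\<omega>. \<bar>Z \<omega>\<bar>) = w * (\<Sum>x\<in>S. expectation (%\<omega>. \<bar>\<xi> eps x \<omega> - Ubar eps x\<bar> powr K))"
     using Z0 iZ by (simp add: Z_def[abs_def])
    also have "... \<le> w * (\<Sum>x\<in>S. 2 powr K * (C + CU powr K))" using w EZ by (intro mult_left_mono sum_mono) auto
    also have "... = (w * real (card S)) * (2 powr K * (C + CU powr K))" by simp
    also have "... \<le> B" unfolding B_def using w C(2) by (intro mult_right_mono) auto
    finally have "prob A \<le> B / M0" using M0 by (simp add: divide_right_mono)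
    also have "... \<le> \<tau> / 4" using B \<tau> unfolding M0_def by (simp add: field_simps)
    finally show ?thesis .
   qed
   have PB: "prob (Bc c) \<le> 2 * \<sigma>" for c
   proof -
    have vc: "w * real (card (Sc c)) \<le> V"
     using w card_mono[OF finS ScS(1)[of c]] by (intro order_trans[OF _ w(2)] mult_left_mono) auto
    have "prob (Bc c) \<le> w * V * (2 * T)^2 / a\<^sup>2 + 2 * V * C * T powr (1 - K) / a" unfolding Bc_def
    proof (rule weak_law_truncated[OF ScS(2) _ K(1) T _ _ _ C(2) _ vc a])
     show "indep_vars (%_. borel) (\<xi> eps) (Sc c)"
      by (rule indep_vars_subset[OF ind[OF eps(5)]]) (use ScS(1) in \<open>simp add: S_def\<close>)
    qed (use ScS(1)[of c] int1[OF eps(5)] int[OF eps(5)] C(1)[OF eps(5)] w(1) in \<open>auto simp: S_def\<close>)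
    then show ?thesis using trunc elim(1) unfolding w_def by linarith
   qed
   have evA: "A \<in> events"
   proof -
    have [measurable]: "Z \<in> borel_measurable M" using intZ by simp
    show ?thesis unfolding A_def by measurable
   qed
   have evB: "Bc c \<in> events" for c
   proof -
    have [measurable]: "(%\<omega>. w * (\<Sum>x\<in>Sc c. \<xi> eps x \<omega> - expectation (\<xi> eps x))) \<in> borel_measurable M"
     using mS ScS(1)[of c] by (intro borel_measurable_times borel_measurable_sum borel_measurable_diff) auto
    show ?thesis unfolding Bc_def by measurable
   qed
   have sub: "{\<omega> \<in> space M. \<bar>?F eps \<omega> - ?l\<bar> > \<delta>} \<subseteq> A \<union> (\<Union>c\<in>Cs. Bc c)"
   proof (rule subsetI, rule ccontr)
    fix \<omega> assume \<omega>: "\<omega> \<in> {\<omega> \<in> space M. \<bar>?F eps \<omega> - ?l\<bar> > \<delta>}"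
     and n: "\<omega> \<notin> A \<union> (\<Union>c\<in>Cs. Bc c)"
    have "form_close \<kappa> eps (%x. \<xi> eps x \<omega>)"
    proof (rule form_close_if_cells_small[OF pfs[rule_format] eps(1) \<rho> K(1) \<delta>1 _ V])
     show "eps ^ CARD('d) * real (card (lattice_domain D eps)) \<le> V" using w(2) by (simp add: w_def S_def)
     show "eps ^ CARD('d) * (\<Sum>x\<in>lattice_domain D eps. \<bar>\<xi> eps x \<omega> - Ubar eps x\<bar> powr K) \<le> M0"
      using n \<omega> Z0[of \<omega>] unfolding A_def Z_def w_def S_def by auto
     fix c :: "int ^ 'd" assume "!!i. \<bar>\<rho> * real_of_int (c $ i)\<bar> \<le> R + \<rho>"
     then have "c \<in> Cs" by (simp add: Cs_def)
     then have nB: "\<bar>w * (\<Sum>x\<in>Sc c. \<xi> eps x \<omega> - expectation (\<xi> eps x))\<bar> \<le> 2 * a" using n \<omega> unfolding Bc_def by auto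
     have "\<bar>\<Sum>x\<in>Sc c. U (eps *\<^sub>R lattice_point x) - Ubar eps x\<bar> \<le> (\<Sum>x\<in>Sc c. \<bar>U (eps *\<^sub>R lattice_point x) - Ubar eps x\<bar>)" by (rule sum_abs)
     also have "... \<le> (\<Sum>x\<in>S. \<bar>U (eps *\<^sub>R lattice_point x) - Ubar eps x\<bar>)" by (rule sum_mono2[OF finS ScS(1)]) auto
     finally have "\<bar>w * (\<Sum>x\<in>Sc c. U (eps *\<^sub>R lattice_point x) - Ubar eps x)\<bar> \<le> w * (\<Sum>x\<in>S. \<bar>U (eps *\<^sub>R lattice_point x) - Ubar eps x\<bar>)"
      using w(1) by (simp add: abs_mult)
     also have "... \<le> \<delta>1 / 2" using elim(2) by (simp add: w_def S_def)
     finally have c2: "\<bar>w * (\<Sum>x\<in>Sc c. U (eps *\<^sub>R lattice_point x) - Ubar eps x)\<bar> \<le> \<delta>1 / 2" .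
     have "(\<Sum>x\<in>Sc c. \<xi> eps x \<omega> - Ubar eps x) = (\<Sum>x\<in>Sc c. (\<xi> eps x \<omega> - expectation (\<xi> eps x)) + (U (eps *\<^sub>R lattice_point x) - Ubar eps x))"
      using mean[OF eps(5)] by (intro sum.cong refl) (auto simp: Sc_def S_def)
     then have "w * (\<Sum>x\<in>Sc c. \<xi> eps x \<omega> - Ubar eps x) = w * (\<Sum>x\<in>Sc c. \<xi> eps x \<omega> - expectation (\<xi> eps x)) + w * (\<Sum>x\<in>Sc c. U (eps *\<^sub>R lattice_point x) - Ubar eps x)"
      by (simp only: sum.distrib distrib_left)
     then have "\<bar>w * (\<Sum>x\<in>Sc c. \<xi> eps x \<omega> - Ubar eps x)\<bar> \<le> \<delta>1" using nB c2 unfolding a_def by linarith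
     then show "\<bar>eps ^ CARD('d) * (\<Sum>x | x \<in> lattice_domain D eps \<and> cell \<rho> eps x = c. \<xi> eps x \<omega> - Ubar eps x)\<bar> \<le> \<delta>1"
      unfolding w_def Sc_def S_def .
    qed (use eps in auto)
    from det[OF eps(1,3) this] show False using \<omega> by simp
   qed
   have "prob {\<omega> \<in> space M. \<bar>?F eps \<omega> - ?l\<bar> > \<delta>} \<le> prob (A \<union> (\<Union>c\<in>Cs. Bc c))"
    by (intro finite_measure_mono[OF sub] sets.Un evA sets.finite_UN Cs evB)
   also have "... \<le> prob A + prob (\<Union>c\<in>Cs. Bc c)"
    by (intro measure_Un_le evA sets.finite_UN Cs evB)
   also have "prob (\<Union>c\<in>Cs. Bc c) \<le> (\<Sum>c\<in>Cs. prob (Bc c))" by (intro measure_UNION_le Cs evB)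
   also have "... \<le> (\<Sum>c\<in>Cs. 2 * \<sigma>)" by (intro sum_mono PB)
   also have "... = real (card Cs) * (2 * \<sigma>)" by simp
   also have "... \<le> \<tau> / 2" using \<tau> by (simp add: \<sigma>_def field_simps)
   finally have "prob {\<omega> \<in> space M. \<bar>?F eps \<omega> - ?l\<bar> > \<delta>} \<le> prob A + \<tau> / 2" by simp
   then show ?case using PA \<tau> by (simp add: dist_real_def)
  qed
 qed
 then show ?thesis unfolding tendsto_in_prob_def using ev_meas by blast
qed

end

theorem theorem1p3:
  fixes D :: "(real ^ 'd::finite) set"
    and M :: "'w measure"
    and \<xi> :: "real \<Rightarrow> int ^ 'd \<Rightarrow> 'w \<Rightarrow> real"
    and U :: "real ^ 'd \<Rightarrow> real"
    and \<alpha> K :: real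
    and k :: nat
  assumes "D \<noteq> {}" "bounded D" "open D"
    and "\<alpha> > 0" "C1_Holder_boundary \<alpha> D"
    and "prob_space M"
    and "\<And>\<epsilon>. \<epsilon> \<in> {0<..<1} \<Longrightarrow>
           prob_space.indep_vars M (\<lambda>_. borel) (\<xi> \<epsilon>) (lattice_domain D \<epsilon>)"
    and "K > max 1 (real CARD('d) / 2)"
    and "(SUP \<epsilon>\<in>{0<..<1}. SUP x\<in>lattice_domain D \<epsilon>.
            \<integral>\<^sup>+\<omega>. ennreal (\<bar>\<xi> \<epsilon> x \<omega>\<bar> powr K) \<partial>M) < \<infinity>"
    and "continuous_on D U" "bounded (U ` D)"
    and "\<And>\<epsilon> x. \<epsilon> \<in> {0<..<1} \<Longrightarrow> x \<in> lattice_domain D \<epsilon> \<Longrightarrow>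
           prob_space.expectation M (\<xi> \<epsilon> x) = U (\<epsilon> *\<^sub>R lattice_point x)"
    and "k \<ge> 1"
  shows "tendsto_in_prob M
           (\<lambda>\<epsilon> \<omega>. lattice_eigenvalue D \<epsilon> (\<lambda>x. \<xi> \<epsilon> x \<omega>) k)
           (dirichlet_eigenvalue D U k) (at_right 0)"
proof -
 interpret prob_space M by fact
 obtain R where R: "!!x. x \<in> D ==> norm x \<le> R" using assms(2) unfolding bounded_iff by blast
 obtain B where B: "!!x. x \<in> D ==> \<bar>U x\<bar> \<le> B" using assms(11) unfolding bounded_iff by auto
 interpret dirichlet_domain D U R "max 0 B"
 proof
  show "\<bar>x $ i\<bar> \<le> R" if "x \<in> D" for x i using component_le_norm_cart[of x i] R[OF that] by linarith
  show "\<bar>U x\<bar> \<le> max 0 B" if "x \<in> D" for x using B[OF that] by linarith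
 qed (use assms in auto)
 define C where "C = (SUP eps\<in>{0<..<1}. SUP x\<in>lattice_domain D eps. \<integral>\<^sup>+\<omega>. ennreal (\<bar>\<xi> eps x \<omega>\<bar> powr K) \<partial>M)"
 have C: "C < \<infinity>" using assms(9) by (simp add: C_def)
 have le: "(\<integral>\<^sup>+\<omega>. ennreal (\<bar>\<xi> eps x \<omega>\<bar> powr K) \<partial>M) \<le> C" if "eps \<in> {0<..<1}" "x \<in> lattice_domain D eps" for eps x
  unfolding C_def by (intro SUP_upper2[OF that(1)] SUP_upper2[OF that(2)] order_refl)
 have m: "(%\<omega>. \<bar>\<xi> eps x \<omega>\<bar> powr K) \<in> borel_measurable M" if "eps \<in> {0<..<1}" "x \<in> lattice_domain D eps" for eps x
 proof -
  have [measurable]: "\<xi> eps x \<in> borel_measurable M" using assms(7)[OF that(1)] that(2) unfolding indep_vars_def by auto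
  show ?thesis by measurable
 qed
 show ?thesis
 \<comment> \<open>A finite supremum in \<open>ennreal\<close> yields both integrability of the
   \<open>K\<close>-th powers and the common real bound \<open>enn2real C\<close>.\<close>
 proof (rule converges_in_probability[where K = K and C = "enn2real C"])
  fix eps x assume x: "eps \<in> {0<..<1}" "x \<in> lattice_domain D eps"
  show "integrable M (%\<omega>. \<bar>\<xi> eps x \<omega>\<bar> powr K)"
   by (rule integrableI_bounded[OF m[OF x]]) (use le[OF x] C in \<open>simp add: le_less_trans\<close>)
  have "expectation (%\<omega>. \<bar>\<xi> eps x \<omega>\<bar> powr K) = enn2real (\<integral>\<^sup>+\<omega>. ennreal (\<bar>\<xi> eps x \<omega>\<bar> powr K) \<partial>M)"
   by (rule integral_eq_nn_integral[OF m[OF x]]) simp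
  also have "... \<le> enn2real C" using le[OF x] C by (intro enn2real_mono) auto
  finally show "expectation (%\<omega>. \<bar>\<xi> eps x \<omega>\<bar> powr K) \<le> enn2real C" .
 qed (use assms in auto)
qed

end
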